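(* Let $p$ be a prime, $k$ an algebraically closed field of characteristic $p$, and $K=k((t))$. Let $n\ge 2$ and $m\ge 1$ be integers with $p\nmid m$, let $G$ be a semi-direct product of the form $\mathbb{Z}/p^n\rtimes\mathbb{Z}/m$, and let $H_{n-1}$ be the unique subgroup of $G$ of order $p$ (so that $G/H_{n-1}$ is a semi-direct product of the form $\mathbb{Z}/p^{n-1}\rtimes\mathbb{Z}/m$). Suppose $L_{n-1}/K$ is a $G/H_{n-1}$-Galois extension with upper jumps $u_1 \leq \cdots \leq u_{n-1}$. Let $u_n \in \frac{1}{m}\mathbb{N}$ be such that either $u_n = p u_{n-1}$, or both $u_n > pu_{n-1}$ and $p \nmid mu_n$. Suppose also that $mu_n \equiv mu_1 \bmod m$. Then there exists a $G$-Galois extension $L_n/K$ with upper jumps $u_1 \leq \cdots \leq u_n$ that dominates $L_{n-1}/K$.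
   Context: A $G$-Galois extension of $K$ is a separable Galois field extension $L/K$ together with a fixed identification of $\mathrm{Aut}(L/K)$ with $G$. Its upper jumps are the positive breaks of its ramification filtration in the upper numbering (Serre, "Local Fields", Ch. IV). The $G$-Galois extension $L_n/K$ dominates the $G/H_{n-1}$-Galois extension $L_{n-1}/K$ if the fixed field $L_n^{H_{n-1}}$, with its induced $G/H_{n-1}$-action, is isomorphic to $L_{n-1}$ as a $G/H_{n-1}$-Galois extension of $K$. *)

theory Defs
  imports
    "HOL-Analysis.Analysis"
    "HOL-Algebra.Algebra"
    "HOL-Algebra.Algebraic_Closure_Type"
    "HOL-Computational_Algebra.Formal_Laurent_Series"
    "HOL-Library.Real_Mod"
begin

section \<open>Groups of the form \<open>\<int>/a \<rtimes> \<int>/b\<close>\<close>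

definition semidirect_cyclic :: "('g, 'z) monoid_scheme \<Rightarrow> nat \<Rightarrow> nat \<Rightarrow> bool" where
  "semidirect_cyclic G a b \<longleftrightarrow> group G \<and>
     (\<exists>N Q. N \<lhd> G \<and> subgroup Q G \<and> N \<inter> Q = {\<one>\<^bsub>G\<^esub>} \<and> N <#>\<^bsub>G\<^esub> Q = carrier G \<and>
        G\<lparr>carrier := N\<rparr> \<cong> integer_mod_group a \<and> G\<lparr>carrier := Q\<rparr> \<cong> integer_mod_group b)"


section \<open>Galois extensions with a given group\<close>

text \<open>The three conditions are: algebraic; normal (minimal polynomials split); separable (minimal
  polynomials have only simple roots, which may be tested in \<open>L\<close> as they split there).\<close>

definition galois_extension :: "('a, 'z) ring_scheme \<Rightarrow> 'a set \<Rightarrow> bool" where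
  "galois_extension L F \<longleftrightarrow> field L \<and> subfield F L \<and>
     (\<forall>x\<in>carrier L. (ring.algebraic L over F) x) \<and>
     (\<forall>x\<in>carrier L. ring.splitted L (ring.Irr L F x)) \<and>
     (\<forall>x\<in>carrier L. \<forall>a. count (ring.roots L (ring.Irr L F x)) a \<le> 1)"

definition galois_group :: "('a, 'z) ring_scheme \<Rightarrow> 'a set \<Rightarrow> ('a \<Rightarrow> 'a) monoid" where
  "galois_group L F = BijGroup (carrier L)
     \<lparr>carrier := {\<sigma> \<in> ring_hom L L \<inter> Bij (carrier L). \<forall>x\<in>F. \<sigma> x = x}\<rparr>"

text \<open>The base field is a type \<open>'b\<close>; a field extension of it is a field \<open>L\<close> together with a
  homomorphism \<open>\<iota>\<close>. The identification of \<open>G\<close> with the automorphism group is the isomorphism \<open>\<phi>\<close>.\<close>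

definition galois_extension_with_group ::
  "('g, 'y) monoid_scheme \<Rightarrow> ('a, 'z) ring_scheme \<Rightarrow> ('b::field \<Rightarrow> 'a) \<Rightarrow> ('g \<Rightarrow> 'a \<Rightarrow> 'a) \<Rightarrow> bool" where
  "galois_extension_with_group G L \<iota> \<phi> \<longleftrightarrow>
     \<iota> \<in> ring_hom ring_of_type_algebra L \<and> galois_extension L (range \<iota>) \<and>
     \<phi> \<in> iso G (galois_group L (range \<iota>))"

definition fixed_field :: "('a, 'z) ring_scheme \<Rightarrow> ('g \<Rightarrow> 'a \<Rightarrow> 'a) \<Rightarrow> 'g set \<Rightarrow> 'a set" where
  "fixed_field L \<phi> H = {x \<in> carrier L. \<forall>h\<in>H. \<phi> h x = x}"

text \<open>\<open>(L, \<iota>, \<phi>)\<close> is a \<open>G\<close>-Galois extension and \<open>(L', \<iota>', \<phi>')\<close> a \<open>G/H\<close>-Galois extension of the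
  same base; the coset of \<open>g\<close> acts on the fixed field of \<open>H\<close> as \<open>g\<close> does.\<close>

definition dominates ::
  "('g, 'y) monoid_scheme \<Rightarrow> 'g set \<Rightarrow>
   ('a, 'z) ring_scheme \<Rightarrow> ('b::field \<Rightarrow> 'a) \<Rightarrow> ('g \<Rightarrow> 'a \<Rightarrow> 'a) \<Rightarrow>
   ('c, 'w) ring_scheme \<Rightarrow> ('b \<Rightarrow> 'c) \<Rightarrow> ('g set \<Rightarrow> 'c \<Rightarrow> 'c) \<Rightarrow> bool" where
  "dominates G H L \<iota> \<phi> L' \<iota>' \<phi>' \<longleftrightarrow>
     (\<exists>\<theta> \<in> ring_iso (L\<lparr>carrier := fixed_field L \<phi> H\<rparr>) L'.
        (\<forall>a. \<theta> (\<iota> a) = \<iota>' a) \<and>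
        (\<forall>g\<in>carrier G. \<forall>x\<in>fixed_field L \<phi> H. \<theta> (\<phi> g x) = \<phi>' (H #>\<^bsub>G\<^esub> g) (\<theta> x)))"


section \<open>Ramification filtration of extensions of \<open>k((t))\<close>\<close>

definition integral_closure :: "('a, 'z) ring_scheme \<Rightarrow> 'a set \<Rightarrow> 'a set" where
  "integral_closure L A =
     {x \<in> carrier L. \<exists>f\<in>carrier (A[X]\<^bsub>L\<^esub>). f \<noteq> [] \<and> hd f = \<one>\<^bsub>L\<^esub> \<and> ring.eval L f x = \<zero>\<^bsub>L\<^esub>}"

text \<open>The valuation ring of a finite extension \<open>L\<close> of \<open>k((t))\<close>: the integral closure of \<open>k[[t]]\<close>.
  It is local, so that its maximal ideal consists of the non-units.\<close>

definition valuation_ring :: "('a, 'z) ring_scheme \<Rightarrow> ('k::field fls \<Rightarrow> 'a) \<Rightarrow> ('a, 'z) ring_scheme" where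
  "valuation_ring L \<iota> = L\<lparr>carrier := integral_closure L (\<iota> ` range fps_to_fls)\<rparr>"

definition valuation_ideal :: "('a, 'z) ring_scheme \<Rightarrow> ('k::field fls \<Rightarrow> 'a) \<Rightarrow> 'a set" where
  "valuation_ideal L \<iota> = carrier (valuation_ring L \<iota>) - Units (valuation_ring L \<iota>)"

text \<open>Lower numbering, for \<open>i \<ge> -1\<close>: the automorphisms acting trivially modulo the power \<open>i + 1\<close> of
  the maximal ideal. For real \<open>t \<ge> -1\<close> the group of index \<open>t\<close> is the one of index \<open>\<lceil>t\<rceil>\<close>.\<close>

definition lower_ramification_group ::
  "('a, 'z) ring_scheme \<Rightarrow> ('k::field fls \<Rightarrow> 'a) \<Rightarrow> int \<Rightarrow> ('a \<Rightarrow> 'a) set" where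
  "lower_ramification_group L \<iota> i =
     {\<sigma> \<in> carrier (galois_group L (range \<iota>)). \<forall>b\<in>carrier (valuation_ring L \<iota>).
        \<sigma> b \<ominus>\<^bsub>L\<^esub> b \<in> valuation_ideal L \<iota> [^]\<^bsub>ideals_set (valuation_ring L \<iota>)\<^esub> nat (i + 1)}"

text \<open>The Herbrand function \<open>t \<mapsto> \<integral>\<^sub>0\<^sup>t ds / (G\<^sub>0 : G\<^sub>s)\<close>, which is the identity on \<open>[-1, 0]\<close>.\<close>

definition herbrand_phi :: "('a, 'z) ring_scheme \<Rightarrow> ('k::field fls \<Rightarrow> 'a) \<Rightarrow> real \<Rightarrow> real" where
  "herbrand_phi L \<iota> t =
     (if t < 0 then t
      else integral {0..t} (\<lambda>s. real (card (lower_ramification_group L \<iota> \<lceil>s\<rceil>)) /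
                                real (card (lower_ramification_group L \<iota> 0))))"

definition herbrand_psi :: "('a, 'z) ring_scheme \<Rightarrow> ('k::field fls \<Rightarrow> 'a) \<Rightarrow> real \<Rightarrow> real" where
  "herbrand_psi L \<iota> = the_inv_into {-1..} (herbrand_phi L \<iota>)"

definition upper_ramification_group ::
  "('a, 'z) ring_scheme \<Rightarrow> ('k::field fls \<Rightarrow> 'a) \<Rightarrow> real \<Rightarrow> ('a \<Rightarrow> 'a) set" where
  "upper_ramification_group L \<iota> v = lower_ramification_group L \<iota> \<lceil>herbrand_psi L \<iota> v\<rceil>"

definition upper_breaks :: "('a, 'z) ring_scheme \<Rightarrow> ('k::field fls \<Rightarrow> 'a) \<Rightarrow> real set" where
  "upper_breaks L \<iota> = {v. v > 0 \<and>
     (\<forall>\<epsilon>>0. upper_ramification_group L \<iota> (v + \<epsilon>) \<noteq> upper_ramification_group L \<iota> v)}"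

text \<open>The values \<open>u 1 \<le> \<dots> \<le> u r\<close> enumerate the positive breaks. For the groups \<open>\<int>/p^r \<rtimes> \<int>/m\<close> with
  \<open>p \<nmid> m\<close> over \<open>k((t))\<close>, \<open>k\<close> algebraically closed of characteristic \<open>p\<close>, there are exactly \<open>r\<close>
  positive breaks, so that there is no question of multiplicities.\<close>

definition has_upper_jumps ::
  "('a, 'z) ring_scheme \<Rightarrow> ('k::field fls \<Rightarrow> 'a) \<Rightarrow> nat \<Rightarrow> (nat \<Rightarrow> real) \<Rightarrow> bool" where
  "has_upper_jumps L \<iota> r u \<longleftrightarrow> mono_on {1..r} u \<and> u ` {1..r} = upper_breaks L \<iota>"

end

theory Submission
  imports Defs
begin

text \<open>
  By the tame theory the fixed field of the cyclic part of a \<open>\<int>/p\<^sup>R \<rtimes> \<int>/m\<close>-extension \<open>L\<close> of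
  \<open>k((t))\<close>, where \<open>R = n - 1\<close>, is \<open>k((\<tau>))\<close> with \<open>\<tau>\<^sup>m = t\<close>. Over it, a cyclic extension of degree \<open>p\<^sup>R\<close> is encoded
  by a single power series \<open>Y\<close> over \<open>L\<close> with \<open>g(Y) = (1 + X) Y\<close> modulo \<open>X^(p\<^sup>R)\<close> (Hilbert 90). The
  group of power series with constant term 1 thus plays the role of the Witt vectors: the Lang equation
  \<open>Y W = F(Y)\<close> has a datum \<open>W\<close> over \<open>k((\<tau>))\<close> which can be brought into the normal form
  \<open>\<Prod>\<^sub>i (1 - f\<^sub>i X^i)\<close> with all exponents of \<open>f\<^sub>i\<close> reduced, and taking logarithmic derivatives (which kills
  Frobenius) yields the upper jumps from the pole orders of the \<open>f\<^sub>i\<close>: only the \<open>f(p\<^sup>r)\<close> matter, by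
  \<open>\<rho>\<^sub>r = max (p \<rho>\<^sub>r\<^sub>-\<^sub>1) (pole (f(p\<^sup>r)))\<close>.

  The coefficient at \<open>p\<^sup>R\<close> is still free. It gives the Artin--Schreier equation of the extension
  \<open>L\<^sub>n/L\<^sub>n\<^sub>-\<^sub>1\<close>; with \<open>f(p\<^sup>R) = 0\<close> or \<open>\<tau>\<^sup>-\<^sup>a\<close> its jump is the prescribed one. The class is averaged into an
  eigenspace of the tame generator, so that the extension becomes Galois with group \<open>G\<close>; the congruence
  between the first and the last jump says that the averaging does not destroy the leading term.
\<close>

unbundle no vec_syntax and fps_syntax
hide_const (open) Divisibility.prime UnivPoly.coeff UnivPoly.monom

text \<open>Why power series: 1 + X has order p^r modulo X^(p^r), but order p^(r+1) once the
  coefficient at p^r is kept. So one more coefficient of \<open>Y\<close> is one more step of the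
  tower, and the coefficient at p^R has room for the last step. The obstacle: a jump is the pole
  order of an Artin-Schreier class after removal of p-th powers, measured in the uniformizer of the
  level below, where the datum is no longer reduced. A derivative ignores p-th powers and shows this
  order at once, provided that the poles it hides are less than p times as large. This requires a
  bound for all f_i, also for i not a power of p, which never enter \<open>rho\<close>. They are
  bounded because the Lang equation is solvable in a field whose different is already known. What
  closes the estimate is p * \<open>diff_exp\<close> < (p - 1) * \<open>jump\<close>, with p = 2 as
  the tightest case. Each level is presented as k((X)), and the levels are glued by field
  homomorphisms into one algebraic closure. All valuations are computed in Laurent coordinates, and
  topology is replaced by the fact that automorphisms preserve the valuation.\<close>

abbreviation val :: "'a::zero fls \<Rightarrow> int" where "val \<equiv> fls_subdegree"

abbreviation (input) type_ring where "type_ring \<equiv> ring_of_type_algebra"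

section \<open>Field homomorphisms as functions between types\<close>

definition fhom :: "('a::field \<Rightarrow> 'b::field) \<Rightarrow> bool" where
 "fhom f \<longleftrightarrow> f 1 = 1 \<and> (\<forall>x y. f (x + y) = f x + f y) \<and> (\<forall>x y. f (x * y) = f x * f y)"

lemma fhom_1: "fhom f \<Longrightarrow> f 1 = 1"
 and fhom_add: "fhom f \<Longrightarrow> f (x + y) = f x + f y"
 and fhom_mult: "fhom f \<Longrightarrow> f (x * y) = f x * f y"
 by (simp_all add: fhom_def)

lemma fhom_0: assumes "fhom f" shows "f 0 = 0"
proof -
 have "f 0 + f 0 = f 0 + 0" using fhom_add[OF assms, of 0 0] by simp
 thus ?thesis by (rule add_left_imp_eq)
qed

lemma fhom_uminus: assumes "fhom f" shows "f (- x) = - f x"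
proof -
 have "f (x + - x) = f x + f (- x)" by (rule fhom_add[OF assms])
 thus ?thesis using fhom_0[OF assms] by (simp add: eq_neg_iff_add_eq_0 add.commute)
qed

lemma fhom_diff: assumes "fhom f" shows "f (x - y) = f x - f y"
 using fhom_add[OF assms, of x "- y"] fhom_uminus[OF assms] by simp

lemma fhom_power: assumes "fhom f" shows "f (x ^ n) = f x ^ n"
 by (induction n) (simp_all add: fhom_1[OF assms] fhom_mult[OF assms])

lemma fhom_eq_0: assumes "fhom f" shows "f x = 0 \<longleftrightarrow> x = 0"
proof
 assume z: "f x = 0"
 show "x = 0"
 proof (rule ccontr)
  assume "x \<noteq> 0"
  hence "f (x * inverse x) = 1" using fhom_1[OF assms] by simp
  thus False using z by (simp add: fhom_mult[OF assms])
 qed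
qed (simp add: fhom_0[OF assms])

lemma fhom_inj: assumes "fhom f" shows "inj f"
 by (rule injI) (metis assms eq_iff_diff_eq_0 fhom_diff fhom_eq_0)

lemma fhom_eq_iff: assumes "fhom f" shows "f x = f y \<longleftrightarrow> x = y"
 using fhom_inj[OF assms] by (auto dest: injD)

lemma fhom_inverse: assumes "fhom f" shows "f (inverse x) = inverse (f x)"
proof (cases "x = 0")
 case False
 hence "x * inverse x = 1" by (rule right_inverse)
 hence "f x * f (inverse x) = 1"
  by (simp only: fhom_mult[OF assms, symmetric] fhom_1[OF assms])
 hence "inverse (f x) = f (inverse x)" by (rule inverse_unique)
 thus ?thesis by (rule sym)
qed (simp add: fhom_0[OF assms])

lemma fhom_divide: assumes "fhom f" shows "f (x / y) = f x / f y"
 by (simp add: divide_inverse fhom_mult[OF assms] fhom_inverse[OF assms])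

lemma fhom_of_nat: assumes "fhom f" shows "f (of_nat n) = of_nat n"
 by (induction n) (simp_all add: fhom_0[OF assms] fhom_1[OF assms] fhom_add[OF assms])

lemma fhom_powi: assumes "fhom f" shows "f (x powi n) = f x powi n"
 by (simp add: power_int_def fhom_power[OF assms] fhom_inverse[OF assms])

lemma fhom_sum: assumes "fhom f" shows "f (\<Sum>i\<in>A. g i) = (\<Sum>i\<in>A. f (g i))"
 by (induction A rule: infinite_finite_induct) (simp_all add: fhom_0[OF assms] fhom_add[OF assms])

lemmas fhom_simps = fhom_0 fhom_1 fhom_add fhom_mult fhom_diff fhom_uminus fhom_power fhom_of_nat

lemma fhom_comp: "fhom f \<Longrightarrow> fhom g \<Longrightarrow> fhom (\<lambda>x. f (g x))"
 by (simp add: fhom_def)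

lemma fhom_id: "fhom (\<lambda>x. x)"
 by (simp add: fhom_def)

lemma fhom_funpow:
 fixes f :: "'a::field \<Rightarrow> 'a"
 assumes "fhom f" shows "fhom (f ^^ n)"
proof (induction n)
 case 0
 thus ?case by (simp add: fhom_def)
next
 case (Suc n)
 thus ?case using assms by (simp add: fhom_def)
qed

lemma fhom_poly: assumes "fhom f" shows "f (poly P x) = poly (map_poly f P) (f x)"
 by (induction P) (simp_all add: fhom_simps[OF assms] map_poly_pCons)

subsection \<open>Artin--Schreier theory of Laurent series\<close>

definition wp :: "nat \<Rightarrow> 'a::comm_ring_1 \<Rightarrow> 'a" where
 "wp p x = x ^ p - x"

lemma char_power_add:
 fixes x y :: "'a::comm_semiring_1"
 assumes "prime p" "CHAR('a) = p"
 shows "(x + y) ^ p = x ^ p + y ^ p"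
 by (rule freshmans_dream) (simp_all add: assms)

lemma char_power_uminus:
 fixes x :: "'a::comm_ring_1"
 assumes "prime p" "CHAR('a) = p"
 shows "(- x) ^ p = - (x ^ p)"
proof -
 have "(x + - x) ^ p = x ^ p + (- x) ^ p" by (rule char_power_add[OF assms])
 moreover have "p > 0" using assms(1) prime_gt_0_nat by blast
 ultimately have "x ^ p + (- x) ^ p = 0" by (simp add: zero_power)
 thus ?thesis by (metis add_eq_0_iff)
qed

lemma char_power_diff:
 fixes x y :: "'a::comm_ring_1"
 assumes "prime p" "CHAR('a) = p"
 shows "(x - y) ^ p = x ^ p - y ^ p"
 using char_power_add[OF assms, of x "- y"] char_power_uminus[OF assms, of y] by simp

lemma of_nat_power_char:
 assumes "prime p" "CHAR('a::comm_ring_1) = p"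
 shows "(of_nat n :: 'a) ^ p = of_nat n"
proof (induction n)
 case 0
 have "p > 0" using assms(1) by (rule prime_gt_0_nat)
 thus ?case by (simp add: zero_power)
next
 case (Suc n)
 have "(of_nat (Suc n) :: 'a) ^ p = 1 ^ p + of_nat n ^ p"
  unfolding of_nat_Suc by (rule char_power_add[OF assms])
 thus ?case by (simp only: Suc power_one of_nat_Suc)
qed

lemma wp_add:
 fixes x y :: "'a::comm_ring_1"
 assumes "prime p" "CHAR('a) = p"
 shows "wp p (x + y) = wp p x + wp p y"
 by (simp add: wp_def char_power_add[OF assms])

lemma wp_diff:
 fixes x y :: "'a::comm_ring_1"
 assumes "prime p" "CHAR('a) = p"
 shows "wp p (x - y) = wp p x - wp p y"
 by (simp add: wp_def char_power_diff[OF assms])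

lemma wp_fhom: "fhom f \<Longrightarrow> f (wp p x) = wp p (f x)"
 by (simp add: wp_def fhom_simps)

lemma alg_closed_power_root:
 fixes c :: "'k::alg_closed_field"
 assumes "n > 0"
 shows "\<exists>x. x ^ n = c"
proof -
 let ?P = "monom 1 n + [:- c:]"
 have "Polynomial.degree ?P = Polynomial.degree (monom (1::'k) n)"
  by (rule degree_add_eq_left) (simp add: assms degree_monom_eq)
 hence "Polynomial.degree ?P > 0" using assms by (simp add: degree_monom_eq)
 then obtain x where "poly ?P x = 0" using alg_closed_imp_poly_has_root by blast
 thus ?thesis by (intro exI[of _ x]) (simp add: poly_monom)
qed

lemma alg_closed_wp:
 fixes c :: "'k::alg_closed_field"
 assumes "n > 1"
 shows "\<exists>x. wp n x = c"
proof -
 let ?P = "monom 1 n + [:- c, - 1:]"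
 have "Polynomial.degree ?P = Polynomial.degree (monom (1::'k) n)"
  by (rule degree_add_eq_left) (use assms in \<open>simp add: degree_monom_eq\<close>)
 hence "Polynomial.degree ?P > 0" using assms by (simp add: degree_monom_eq)
 then obtain x where "poly ?P x = 0" using alg_closed_imp_poly_has_root by blast
 hence "x ^ n + (- c - x) = 0" by (simp add: poly_monom)
 hence "x ^ n - x = c" by (simp add: algebra_simps)
 thus ?thesis by (intro exI[of _ x]) (simp add: wp_def)
qed

text \<open>A series without constant term and with nonzero linear coefficient has a compositional
  inverse, and substituting z there solves f(y) = z. This does the work of Hensel's lemma for y^p -
  y and for (1 + y)^n - 1.\<close>

lemma fps_inverse_image:
 fixes f z :: "'k::field fps"
 assumes "f $ 0 = 0" "f $ 1 \<noteq> 0" "z $ 0 = 0"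
 shows "f oo (fps_inv f oo z) = z"
proof -
 have "f oo (fps_inv f oo z) = (f oo fps_inv f) oo z"
  by (rule fps_compose_assoc) (use assms in \<open>simp_all add: fps_inv_def\<close>)
 also have "f oo fps_inv f = fps_X"
  by (rule fps_inv_right) (use assms in auto)
 finally show ?thesis using assms by simp
qed

lemma fps_wp_exists:
 fixes z :: "'k::field fps"
 assumes "p > 1" "z $ 0 = 0"
 shows "\<exists>y. y $ 0 = 0 \<and> wp p y = z"
proof -
 let ?f = "fps_X ^ p - fps_X :: 'k fps"
 let ?y = "fps_inv ?f oo z"
 have f: "?f $ 0 = 0" "?f $ 1 \<noteq> 0" using assms by (auto simp: fps_X_power_nth)
 have "?f oo ?y = ?y ^ p - ?y"
  by (simp add: fps_compose_sub_distrib fps_compose_power[symmetric] fps_inv_def)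
 hence "wp p ?y = z" using fps_inverse_image[OF f assms(2)] by (simp add: wp_def)
 moreover have "?y $ 0 = 0" by (simp add: fps_inv_def)
 ultimately show ?thesis by blast
qed

lemma fps_root_exists:
 fixes z :: "'k::field fps"
 assumes "of_nat n \<noteq> (0::'k)" "z $ 0 = 0"
 shows "\<exists>y. y $ 0 = 1 \<and> y ^ n = 1 + z"
proof -
 let ?f = "(1 + fps_X) ^ n - 1 :: 'k fps"
 let ?y = "fps_inv ?f oo z"
 have f: "?f $ 0 = 0" by (simp add: fps_power_zeroth)
 have "(1 + fps_X :: 'k fps) ^ n $ 1 = of_nat n"
  by (induction n) (simp_all add: fps_mult_nth_1 fps_power_zeroth)
 hence f1: "?f $ 1 \<noteq> 0" using assms by simp
 have "?f oo ?y = (1 + ?y) ^ n - 1"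
  by (simp add: fps_compose_sub_distrib fps_compose_power[symmetric] fps_compose_add_distrib fps_inv_def)
 hence "(1 + ?y) ^ n = 1 + z" using fps_inverse_image[OF f f1 assms(2)] by (simp add: algebra_simps)
 moreover have "(1 + ?y) $ 0 = 1" by (simp add: fps_inv_def)
 ultimately show ?thesis by blast
qed

section \<open>Lower bounds for the order of a Laurent series\<close>

definition vge :: "'k::zero fls \<Rightarrow> real \<Rightarrow> bool" where
 "vge f r \<longleftrightarrow> (\<forall>i::int. of_int i < r \<longrightarrow> f $$ i = 0)"

text \<open>The bound r is real because slopes are fractional. The zero series satisfies every
  bound, whereas its \<open>val\<close> is 0 by convention; the disjunction accounts for
  this.\<close>

lemma vge_iff: "vge f r \<longleftrightarrow> f = 0 \<or> r \<le> of_int (val f)"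
proof (cases "f = 0")
 case False
 show ?thesis
 proof
  assume "vge f r"
  thus "f = 0 \<or> r \<le> real_of_int (val f)"
   using False nth_fls_subdegree_nonzero[of f] unfolding vge_def by (meson not_le)
 next
  assume "f = 0 \<or> r \<le> real_of_int (val f)"
  thus "vge f r" unfolding vge_def using False by auto
 qed
qed (simp add: vge_def)

lemma vge_0 [simp]: "vge 0 r" by (simp add: vge_def)

lemma vge_mono: "vge f r \<Longrightarrow> s \<le> r \<Longrightarrow> vge f s"
 by (auto simp: vge_def)

lemma vge_add: "vge f r \<Longrightarrow> vge g r \<Longrightarrow> vge (f + g) r"
 for f g :: "'k::group_add fls"
 by (simp add: vge_def)

lemma vge_diff: "vge f r \<Longrightarrow> vge g r \<Longrightarrow> vge (f - g) r"
 for f g :: "'k::group_add fls"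
 by (simp add: vge_def)

lemma vge_uminus: "vge f r \<Longrightarrow> vge (- f) r"
 for f :: "'k::group_add fls"
 by (simp add: vge_def)

lemma vge_mult: "vge f r \<Longrightarrow> vge g s \<Longrightarrow> vge (f * g) (r + s)"
 for f g :: "'k::field fls"
 by (cases "f = 0"; cases "g = 0") (simp_all add: vge_iff)

lemma vge_sum: "(\<And>i. i \<in> A \<Longrightarrow> vge (f i) r) \<Longrightarrow> vge (\<Sum>i\<in>A. f i) r"
 for f :: "'i \<Rightarrow> 'k::field fls"
 by (induction A rule: infinite_finite_induct) (simp_all add: vge_add)

lemma vge_1: "r \<le> 0 \<Longrightarrow> vge (1 :: 'k::field fls) r"
 by (simp add: vge_iff)

lemma vge_const: "r \<le> 0 \<Longrightarrow> vge (fls_const c :: 'k::field fls) r"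
 by (simp add: vge_iff)

lemma vge_power: "vge f r \<Longrightarrow> vge (f ^ n) (real n * r)"
 for f :: "'k::field fls"
proof (induction n)
 case (Suc n)
 have "vge (f * f ^ n) (r + real n * r)" using Suc by (intro vge_mult) auto
 thus ?case by (simp add: algebra_simps)
qed (simp add: vge_1)

lemma vge_deriv: "vge f r \<Longrightarrow> vge (fls_deriv f) (r - 1)"
 for f :: "'k::field fls"
 by (auto simp: vge_def)

lemma vge_eq_0: "(\<And>n::nat. vge f (real n + r)) \<Longrightarrow> f = 0"
proof (rule ccontr)
 assume a: "\<And>n::nat. vge f (real n + r)" and "f \<noteq> 0"
 hence "real n + r \<le> real_of_int (val f)" for n :: nat by (simp add: vge_iff)
 thus False by (metis add_le_cancel_right diff_add_cancel not_le reals_Archimedean2)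
qed

text \<open>The strict ultrametric inequality, in the form in which every dominant term below is
  isolated; it also yields that the sum is nonzero.\<close>

lemma subdegree_add_vge:
 fixes f g :: "'k::field fls"
 assumes "f \<noteq> 0" "vge g r" "real_of_int (val f) < r"
 shows "f + g \<noteq> 0 \<and> val (f + g) = val f"
proof -
 have g: "g $$ i = 0" if "i \<le> val f" for i
  using assms(2,3) that unfolding vge_def by (meson le_less_trans of_int_le_iff)
 have 1: "(f + g) $$ val f \<noteq> 0" using assms(1) g by simp
 have "val (f + g) = val f"
  by (rule fls_subdegree_eqI[OF 1]) (use g in simp)
 with fls_nonzeroI[OF 1] show ?thesis by blast
qed

subsection \<open>Embeddings of Laurent series fields\<close>

text \<open>A k-embedding of k((t)) into k((X)), totally ramified of index d. The residue field is k
  on both sides, so d is also the degree; d = 1 is the case of automorphisms.\<close>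

definition good :: "('k::field fls \<Rightarrow> 'k fls) \<Rightarrow> nat \<Rightarrow> bool" where
 "good K d \<longleftrightarrow> fhom K \<and> d > 0 \<and> (\<forall>c. K (fls_const c) = fls_const c) \<and>
   (\<forall>f. val (K f) = int d * val f)"

lemma good_fhom: "good K d \<Longrightarrow> fhom K"
 and good_pos: "good K d \<Longrightarrow> d > 0"
 and good_const: "good K d \<Longrightarrow> K (fls_const c) = fls_const c"
 and good_subdegree: "good K d \<Longrightarrow> val (K f) = int d * val f"
 by (simp_all add: good_def)

lemma good_comp: "good K d \<Longrightarrow> good K' d' \<Longrightarrow> good (\<lambda>x. K (K' x)) (d * d')"
 by (auto simp: good_def intro: fhom_comp)

lemma good_id: "good (\<lambda>x. x) 1"
 by (simp add: good_def fhom_id)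

lemma good_vge:
 assumes "good K d" "vge f r"
 shows "vge (K f) (real d * r)"
 using assms good_pos[OF assms(1)]
 by (auto simp: vge_iff good_subdegree fhom_0[OF good_fhom[OF assms(1)]])

lemma good_compose:
 fixes T :: "'k::field fps"
 assumes "T \<noteq> 0" "T $ 0 = 0"
 shows "good (\<lambda>f. fls_compose_fps f T) (subdegree T)"
 using assms
 by (auto simp: good_def fhom_def fls_compose_fps_add fls_compose_fps_mult subdegree_pos_iff mult.commute)

text \<open>The defect of the chain rule is a derivation that vanishes on \<open>k[t]\<close>; it raises the valuation by
 an arbitrary amount, hence vanishes.\<close>

lemma good_deriv:
 fixes K :: "'k::field fls \<Rightarrow> 'k fls"
 assumes "good K d"
 shows "fls_deriv (K f) = K (fls_deriv f) * fls_deriv (K fls_X)"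
proof -
 note h = good_fhom[OF assms]
 define D where "D = fls_deriv (K fls_X)"
 define \<Delta> where "\<Delta> f = fls_deriv (K f) - K (fls_deriv f) * D" for f
 have add: "\<Delta> (f + g) = \<Delta> f + \<Delta> g" for f g
  by (simp add: \<Delta>_def fhom_add[OF h] algebra_simps)
 have mult: "\<Delta> (f * g) = \<Delta> f * K g + K f * \<Delta> g" for f g
  by (simp add: \<Delta>_def fhom_add[OF h] fhom_mult[OF h] algebra_simps)
 have c: "\<Delta> (fls_const a) = 0" for a
  by (simp add: \<Delta>_def good_const[OF assms] fhom_0[OF h])
 have X: "\<Delta> fls_X = 0" by (simp add: \<Delta>_def D_def fhom_1[OF h])
 have vX: "vge (K fls_X) 1"
  using good_subdegree[OF assms, of fls_X] good_pos[OF assms] by (simp add: vge_iff)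
 have vD: "vge D 0" unfolding D_def using vge_deriv[OF vX] by simp
 have v\<Delta>: "vge (\<Delta> g) (- 1)" if "vge g 0" for g
 proof -
  have "vge (fls_deriv g) 0"
  proof -
   have "fls_deriv g $$ i = 0" if "i < 0" for i
    using \<open>vge g 0\<close> that by (cases "i = - 1") (auto simp: vge_def)
   thus ?thesis by (simp add: vge_def)
  qed
  hence "vge (K (fls_deriv g)) 0" using good_vge[OF assms, of _ 0] by simp
  hence "vge (K (fls_deriv g) * D) 0" using vge_mult[OF _ vD, of _ 0] by simp
  moreover have "vge (fls_deriv (K g)) (- 1)"
   using vge_deriv[OF good_vge[OF assms that]] by simp
  ultimately show ?thesis unfolding \<Delta>_def by (intro vge_diff) (auto intro: vge_mono)
 qed
 have step: "\<exists>h. vge h 0 \<and> \<Delta> g = K fls_X ^ n * \<Delta> h" if "vge g 0" for g and n :: nat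
  using that
 proof (induction n)
  case (Suc n)
  then obtain h where h: "vge h 0" "\<Delta> g = K fls_X ^ n * \<Delta> h" by blast
  define e where "e = fls_shift 1 (h - fls_const (h $$ 0))"
  have "h = fls_const (h $$ 0) + fls_X * e"
   by (simp add: e_def fls_X_times_conv_shift)
  hence "\<Delta> h = K fls_X * \<Delta> e" by (metis add c X mult add_0 mult_zero_left)
  moreover have "vge e 0" unfolding vge_def
  proof (intro allI impI)
   fix i :: int assume "real_of_int i < 0"
   thus "e $$ i = 0" using h(1) by (cases "i = - 1") (auto simp: e_def vge_def)
  qed
  ultimately show ?case using h(2) by (intro exI[of _ e]) (simp add: mult_ac)
 qed auto
 have z: "\<Delta> g = 0" if g: "vge g 0" for g
 proof (rule vge_eq_0[of _ "- 1"])
  fix n :: nat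
  obtain h where h: "vge h 0" "\<Delta> g = K fls_X ^ n * \<Delta> h" using step[OF g] by blast
  have "vge (K fls_X ^ n * \<Delta> h) (real n * 1 + - 1)"
   by (intro vge_mult vge_power vX v\<Delta> h)
  thus "vge (\<Delta> g) (real n + - 1)" using h by simp
 qed
 have "\<Delta> f = 0"
 proof -
  define n where "n = nat (- val f)"
  have Xn: "\<Delta> (fls_X ^ n) = 0" by (induction n) (use c[of 1] in \<open>simp_all add: mult X\<close>)
  have "vge (fls_X ^ n * f) 0" by (cases "f = 0") (simp_all add: vge_iff n_def)
  hence "\<Delta> (fls_X ^ n * f) = 0" by (rule z)
  hence "K (fls_X ^ n) * \<Delta> f = 0" by (simp add: mult Xn)
  moreover have "K (fls_X ^ n) \<noteq> 0" using fhom_eq_0[OF h] by simp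
  ultimately show ?thesis by simp
 qed
 thus ?thesis by (simp add: \<Delta>_def D_def)
qed

lemma fps_to_fls_regpart: "vge f 0 \<Longrightarrow> fps_to_fls (fls_regpart f) = f"
 by (rule fls_eqI) (auto simp: vge_def not_less)

lemma vge_fps_to_fls: "vge (fps_to_fls F) 0"
 by (auto simp: vge_def)

lemma vge_0_iff_range: "vge f 0 \<longleftrightarrow> f \<in> range fps_to_fls"
 using fps_to_fls_regpart[of f] vge_fps_to_fls by (metis rangeE rangeI)

lemma vge_Suc: 
 assumes "vge f (of_int n)" "f $$ n = 0" shows "vge f (of_int n + 1)"
 using assms unfolding vge_def
 by (metis linorder_not_less of_int_1 of_int_add of_int_less_iff order_less_le zless_add1_eq)

lemma fls_root_exists:
 fixes z :: "'k::field fls"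
 assumes "of_nat n \<noteq> (0::'k)" "vge z 1"
 shows "\<exists>y. y ^ n = 1 + z"
proof -
 have z: "fps_to_fls (fls_regpart z) = z" by (rule fps_to_fls_regpart) (use assms(2) vge_mono in force)
 have "fls_regpart z $ 0 = 0" using assms(2) by (simp add: vge_def)
 from fps_root_exists[OF assms(1) this] obtain y where "y ^ n = 1 + fls_regpart z" by blast
 hence "fps_to_fls (y ^ n) = fps_to_fls (1 + fls_regpart z)" by simp
 hence "fps_to_fls y ^ n = 1 + z" using z by (simp add: fps_to_fls_power)
 thus ?thesis by blast
qed

lemma fhom_inv:
 assumes "fhom \<sigma>" "bij \<sigma>"
 shows "fhom (inv_into UNIV \<sigma>)"
proof -
 let ?\<tau> = "inv_into UNIV \<sigma>"
 have 1: "\<sigma> (?\<tau> x) = x" for x using assms(2) by (simp add: bij_is_surj surj_f_inv_f)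
 have 2: "?\<tau> (\<sigma> x) = x" for x using assms(2) by (simp add: bij_is_inj)
 have "?\<tau> x + ?\<tau> y = ?\<tau> (x + y)" for x y
  using 2[of "?\<tau> x + ?\<tau> y"] by (simp add: fhom_add[OF assms(1)] 1)
 moreover have "?\<tau> x * ?\<tau> y = ?\<tau> (x * y)" for x y
  using 2[of "?\<tau> x * ?\<tau> y"] by (simp add: fhom_mult[OF assms(1)] 1)
 moreover have "?\<tau> 1 = 1" using 2[of 1] by (simp add: fhom_1[OF assms(1)])
 ultimately show ?thesis unfolding fhom_def by metis
qed

text \<open>Bijective field homomorphisms preserve the valuation without any continuity assumption, since the
 \<open>1 + x\<close> with \<open>x\<close> in the maximal ideal have roots of all orders prime to the characteristic.\<close>

lemma fhom_bij_vge_aux: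
 fixes \<sigma> :: "'k::field fls \<Rightarrow> 'k fls"
 assumes p: "prime p" "CHAR('k) = p"
  and h: "fhom \<sigma>" and x: "vge x 1"
 shows "vge (\<sigma> x) 0"
proof (rule ccontr)
 assume "\<not> vge (\<sigma> x) 0"
 hence nz: "\<sigma> x \<noteq> 0" and neg: "val (\<sigma> x) < 0" by (auto simp: vge_iff)
 \<comment> \<open>n is prime to p, so 1 + x has an n-th root, and n exceeds the pole order of
   \<sigma> x, which it would have to divide.\<close>
 define n where "n = p * nat (- val (\<sigma> x)) + 1"
 have p1: "p > 1" using p(1) prime_gt_1_nat by blast
 have "\<not> p dvd n"
 proof
  assume "p dvd n"
  hence "p dvd 1" unfolding n_def using dvd_add_right_iff[of p "p * nat (- val (\<sigma> x))" 1] by simp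
  thus False using p1 by simp
 qed
 hence "of_nat n \<noteq> (0::'k)" using p(2) of_nat_eq_0_iff_char_dvd by blast
 then obtain y where "y ^ n = 1 + x" using fls_root_exists x by blast
 hence y: "\<sigma> y ^ n = \<sigma> x + 1" by (metis add.commute fhom_1 fhom_add fhom_power h)
 have "val (\<sigma> x + 1) = val (\<sigma> x)"
  using subdegree_add_vge[OF nz vge_1[of 0]] neg by simp
 hence "int n * val (\<sigma> y) = val (\<sigma> x)" using y by (metis fls_subdegree_pow)
 hence "int n dvd val (\<sigma> x)" by (metis dvd_triv_left)
 hence "int n \<le> - val (\<sigma> x)" using neg by (metis dvd_minus_iff neg_0_less_iff_less zdvd_imp_le)
 moreover have "int n > - val (\<sigma> x)"
 proof -
  have "nat (- val (\<sigma> x)) \<le> p * nat (- val (\<sigma> x))" using p1 by simp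
  thus ?thesis unfolding n_def using neg by linarith
 qed
 ultimately show False by simp
qed

text \<open>So far only the maximal ideal is controlled. If \<sigma> z had a pole, then for large n
  so would the image of X z^n, although X z^n lies in the maximal ideal.\<close>

lemma fhom_vge_0:
 fixes \<sigma> :: "'k::field fls \<Rightarrow> 'k fls"
 assumes p: "prime p" "CHAR('k) = p"
  and h: "fhom \<sigma>" and z: "vge z 0"
 shows "vge (\<sigma> z) 0"
proof (rule ccontr)
 assume "\<not> vge (\<sigma> z) 0"
 hence nz: "\<sigma> z \<noteq> 0" and neg: "val (\<sigma> z) \<le> - 1" by (auto simp: vge_iff)
 have X: "\<sigma> fls_X \<noteq> 0" using fhom_eq_0[OF h] by simp
 define n where "n = nat (val (\<sigma> fls_X)) + 1"
 have "vge (fls_X * z ^ n) (1 + real n * 0)"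
  by (intro vge_mult vge_power z) (simp add: vge_iff)
 hence "vge (\<sigma> (fls_X * z ^ n)) 0" using fhom_bij_vge_aux[OF p h] by simp
 hence "0 \<le> val (\<sigma> fls_X) + int n * val (\<sigma> z)"
 proof -
  have e: "\<sigma> (fls_X * z ^ n) = \<sigma> fls_X * \<sigma> z ^ n" by (simp only: fhom_mult[OF h] fhom_power[OF h])
  have "\<sigma> fls_X * \<sigma> z ^ n \<noteq> 0" using nz X by simp
  hence "0 \<le> val (\<sigma> fls_X * \<sigma> z ^ n)"
   using \<open>vge (\<sigma> (fls_X * z ^ n)) 0\<close> unfolding e vge_iff of_int_0_le_iff by blast
  thus ?thesis using nz X by (simp add: fls_subdegree_pow)
 qed
 moreover have "int n * val (\<sigma> z) \<le> int n * (- 1)"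
  by (rule mult_left_mono) (use neg in simp_all)
 moreover have "int n = val (\<sigma> fls_X) + 1"
  using fhom_bij_vge_aux[OF p h, of fls_X] X by (simp add: n_def vge_iff)
 ultimately show False by linarith
qed

text \<open>Both \<sigma> and its inverse preserve integrality, hence units. Therefore \<sigma>
  multiplies valuations by the constant \<open>val (\<sigma> fls_X)\<close>, and the preimage of X
  shows that this constant divides 1.\<close>

lemma fhom_bij_subdegree:
 fixes \<sigma> :: "'k::field fls \<Rightarrow> 'k fls"
 assumes p: "prime p" "CHAR('k) = p"
  and h: "fhom \<sigma>" and b: "bij \<sigma>"
 shows "val (\<sigma> x) = val x"
proof -
 define \<tau> where "\<tau> = inv_into UNIV \<sigma>"
 have \<sigma>\<tau>: "\<sigma> (\<tau> x) = x" for x using b unfolding \<tau>_def by (simp add: bij_is_surj surj_f_inv_f)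
 have \<tau>\<sigma>: "\<tau> (\<sigma> x) = x" for x using b unfolding \<tau>_def by (simp add: bij_is_inj)
 have h': "fhom \<tau>" unfolding \<tau>_def by (rule fhom_inv[OF h b])
 have iff: "vge (\<sigma> x) 0 \<longleftrightarrow> vge x 0" for x
  using fhom_vge_0[OF p h, of x] fhom_vge_0[OF p h', of "\<sigma> x"] \<tau>\<sigma> by metis
 have unit: "val (\<sigma> u) = 0" if "val u = 0" for u
 proof (cases "u = 0")
  case False
  have "vge (\<sigma> u) 0" "vge (\<sigma> (inverse u)) 0" using iff that by (simp_all add: vge_iff)
  thus ?thesis using False by (auto simp: vge_iff fhom_inverse[OF h] fhom_eq_0[OF h])
 qed (simp add: fhom_0[OF h])
 have unit': "val (\<tau> u) = 0" if "val u = 0" for u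
 proof (cases "u = 0")
  case False
  have "vge (\<tau> u) 0" "vge (\<tau> (inverse u)) 0" using iff[of "\<tau> u"] iff[of "\<tau> (inverse u)"] that
   by (simp_all add: vge_iff \<sigma>\<tau>)
  thus ?thesis using False by (auto simp: vge_iff fhom_inverse[OF h'] fhom_eq_0[OF h'])
 qed (simp add: fhom_0[OF h'])
 have pw: "val (\<sigma> y) = val y * val (\<sigma> fls_X)" for y
 proof (cases "y = 0")
  case False
  define e where "e = val y"
  define Z where "Z = (fls_X :: 'k fls) powi e"
  have Z: "Z \<noteq> 0" "val Z = e" unfolding Z_def by simp_all
  have \<sigma>Z: "\<sigma> Z = \<sigma> fls_X powi e" unfolding Z_def by (rule fhom_powi[OF h])
  have nz: "\<sigma> fls_X \<noteq> 0" "\<sigma> y \<noteq> 0" using False fhom_eq_0[OF h] by simp_all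
  have "val (y / Z) = 0"
   using fls_divide_subdegree[OF False Z(1)] Z(2) e_def by simp
  hence "val (\<sigma> (y / Z)) = 0" by (rule unit)
  hence "val (\<sigma> y / (\<sigma> fls_X powi e)) = 0" by (simp only: fhom_divide[OF h] \<sigma>Z)
  moreover have "\<sigma> fls_X powi e \<noteq> 0" using nz by simp
  ultimately have "val (\<sigma> y) - val (\<sigma> fls_X powi e) = 0"
   using fls_divide_subdegree[OF nz(2)] by metis
  thus ?thesis by (simp add: e_def)
 qed (simp add: fhom_0[OF h])
 have "val (\<sigma> fls_X) \<ge> 0" using iff[of fls_X] fhom_eq_0[OF h] by (simp add: vge_iff)
 moreover have "1 = val (\<tau> fls_X) * val (\<sigma> fls_X)"
  using pw[of "\<tau> fls_X"] by (simp add: \<sigma>\<tau>)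
 moreover from this have "val (\<sigma> fls_X) dvd 1" by (metis dvd_triv_right)
 ultimately have "val (\<sigma> fls_X) = 1" by simp
 thus ?thesis using pw[of x] by simp
qed

subsection \<open>Artin--Schreier classes of Laurent series\<close>

text \<open>The constant term is solved for in the algebraically closed field k, the remainder by a
  power series without constant term.\<close>

lemma wp_vge_0:
 fixes f :: "'k::alg_closed_field fls"
 assumes p: "prime p" "CHAR('k) = p" and f: "vge f 0"
 shows "\<exists>h. f = wp p h"
proof -
 have p1: "p > 1" using p(1) prime_gt_1_nat by blast
 obtain c where c: "wp p c = f $$ 0" using alg_closed_wp[OF p1] by metis
 define g where "g = fls_regpart f - fps_const (f $$ 0)"
 have "g $ 0 = 0" by (simp add: g_def)
 then obtain y where y: "wp p y = g" using fps_wp_exists[OF p1] by blast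
 have "f = fps_to_fls (g + fps_const (f $$ 0))" using fps_to_fls_regpart[OF f] by (simp add: g_def)
 also have "\<dots> = wp p (fps_to_fls y) + wp p (fls_const c)"
  by (simp flip: y c add: wp_def fps_to_fls_power fls_const_power fls_minus_const[symmetric])
 also have "\<dots> = wp p (fps_to_fls y + fls_const c)" by (rule wp_add[symmetric]) (use p in simp_all)
 finally show ?thesis by blast
qed

text \<open>The leading coefficient has a p-th root in k, so a monomial u satisfies u^p = leading
  term. The pole of u itself is smaller than that of f, so passing from u^p to \<open>wp p u\<close>
  does not disturb the cancellation.\<close>

lemma leading_power_term:
 fixes f :: "'k::alg_closed_field fls"
 assumes p: "prime p" "CHAR('k) = p" and f: "f \<noteq> 0" "int p dvd val f"
  and n: "val f < 0"
 obtains u where "u \<noteq> 0" "int p * val u = val f"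
  "vge (f - wp p u) (val f + 1)"
proof -
 have p1: "p > 1" using p(1) prime_gt_1_nat by blast
 obtain i where i: "val f = int p * i" using f(2) by blast
 obtain c where c: "c ^ p = f $$ val f" using alg_closed_power_root p1 by (metis less_trans zero_less_one)
 have c0: "c \<noteq> 0" using c f(1) p1 by (auto simp: zero_power)
 define u where "u = fls_const c * fls_X_intpow i"
 have u: "u \<noteq> 0" "val u = i" using c0 by (simp_all add: u_def fls_subdegree_mult)
 have up: "u ^ p = fls_const (c ^ p) * fls_X_intpow (int p * i)"
  by (simp add: u_def power_mult_distrib fls_const_power fls_X_intpow_power mult.commute)
 have i0: "i < 0" using n i p1 by (simp add: mult_less_0_iff)
 have "vge (f - wp p u) (of_int (val f) + 1)"
 proof (rule vge_Suc)
  have "real p * real_of_int i \<le> 1 * real_of_int i"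
   using i0 p1 by (intro mult_right_mono_neg) auto
  hence 1: "real_of_int (val f) \<le> real_of_int (val u)" by (simp add: u i)
  have "vge u (of_int (val f))" using 1 by (simp add: vge_iff)
  moreover have "vge (u ^ p) (of_int (val f))" using u by (simp add: vge_iff i fls_subdegree_pow)
  ultimately show "vge (f - wp p u) (of_int (val f))"
   unfolding wp_def by (intro vge_diff) (simp_all add: vge_iff)
  have "int p * i < i" using i0 p1 by (simp add: mult_less_cancel_right2)
  hence "u $$ val f = 0" using u i by simp
  thus "(f - wp p u) $$ val f = 0" using up c i by (simp add: wp_def)
 qed
 thus ?thesis using that u i by simp
qed

text \<open>Cancelling leading terms whose order is divisible by p lowers the pole order. The
  process stops at a pole order prime to p or at a regular series, whose class is trivial.\<close>

lemma wp_reduce: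
 fixes f :: "'k::alg_closed_field fls"
 assumes p: "prime p" "CHAR('k) = p"
 shows "\<exists>h g. f = wp p h + g \<and> (g = 0 \<or> val g < 0 \<and> \<not> int p dvd val g)"
proof (induction "nat (- val f)" arbitrary: f rule: less_induct)
 case less
 have p1: "p > 1" using p(1) prime_gt_1_nat by blast
 consider "vge f 0" | "f \<noteq> 0" "val f < 0" "\<not> int p dvd val f"
  | "f \<noteq> 0" "val f < 0" "int p dvd val f"
  by (cases "vge f 0") (auto simp: vge_iff not_le)
 thus ?case
 proof cases
  case 1
  thus ?thesis using wp_vge_0[OF p] by (metis add.right_neutral)
 next
  case 2
  have "wp p (0::'k fls) = 0" using p1 by (simp add: wp_def)
  thus ?thesis using 2 by (intro exI[of _ 0] exI[of _ f]) simp
 next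
  case 3
  obtain u where u: "vge (f - wp p u) (val f + 1)"
   using leading_power_term[OF p 3(1,3,2)] by blast
  have "\<exists>h g. f - wp p u = wp p h + g \<and> (g = 0 \<or> val g < 0 \<and> \<not> int p dvd val g)"
  proof (cases "f - wp p u = 0")
   case True
   have "f - wp p u = wp p 0 + 0" using True p1 by (simp add: wp_def)
   thus ?thesis by blast
  next
   case False
   hence "val f < val (f - wp p u)" using u by (simp add: vge_iff)
   thus ?thesis using 3 by (intro less) simp
  qed
  then obtain h g where hg: "f - wp p u = wp p h + g" "g = 0 \<or> val g < 0 \<and> \<not> int p dvd val g"
   by blast
  have "wp p (u + h) = wp p u + wp p h" by (rule wp_add) (use p in simp_all)
  hence "f = wp p (u + h) + g" using hg(1) by (simp add: algebra_simps)
  thus ?thesis using hg(2) by blast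
 qed
qed

lemma fls_deriv_char_power:
 fixes f :: "'k::field fls"
 assumes "CHAR('k) = p"
 shows "fls_deriv (f ^ p) = 0"
proof -
 have "of_nat p = (0 :: 'k fls)" using assms by (metis of_nat_CHAR semiring_char_fls)
 thus ?thesis by (simp add: fls_deriv_power)
qed

text \<open>If x has a pole of order n > j, the derivative shows no term there, so p divides n and
  the leading term can be removed by some \<open>wp p u\<close>. This adds u' to the derivative.
  Since n \<le> B < p j, the pole of u has order n/p < j, so the leading term of the derivative
  survives and the reduction stops exactly at j.\<close>

lemma wp_reduce_deriv:
 fixes x :: "'k::alg_closed_field fls"
 assumes p: "prime p" "CHAR('k) = p"
  and x: "vge x (- B)" and d: "fls_deriv x \<noteq> 0" "val (fls_deriv x) = - j - 1"
  and j: "j > 0" "B < real p * real_of_int j"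
 shows "\<exists>b. x - wp p b \<noteq> 0 \<and> val (x - wp p b) = - j \<and> \<not> int p dvd j"
 using x d
proof (induction "nat (- val x - j)" arbitrary: x rule: less_induct)
 case less
 have p1: "p > 1" using p(1) prime_gt_1_nat by blast
 have "fls_deriv x $$ (- j - 1) \<noteq> 0" using less.prems(2,3) by (metis nth_fls_subdegree_nonzero)
 hence nz: "of_int (- j) * x $$ (- j) \<noteq> 0" by simp
 hence x0: "x \<noteq> 0" and xj: "x $$ (- j) \<noteq> 0" by auto
 have "of_int (- j) \<noteq> (0::'k)" using nz by auto
 hence pj: "\<not> int p dvd j" using p(2) of_int_eq_0_iff_char_dvd[where 'a='k, of "- j"] by simp
 have le: "val x \<le> - j" using xj by (rule fls_subdegree_leI)
 show ?case
 proof (cases "val x = - j")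
  case True
  have "x - wp p 0 = x" using p1 by (simp add: wp_def)
  thus ?thesis using True x0 pj by metis
 next
  case False
  define n where "n = - val x"
  have n: "n > j" using False le by (simp add: n_def)
  have "fls_deriv x $$ (- n - 1) = 0" by (rule fls_eq0_below_subdegree) (use n less.prems(3) in simp)
  hence "of_int (- n) * x $$ (- n) = 0" by simp
  moreover have "x $$ (- n) \<noteq> 0" using x0 by (simp add: n_def)
  ultimately have "of_int (- n) = (0::'k)" by simp
  hence pn: "int p dvd val x" using p(2) of_int_eq_0_iff_char_dvd[where 'a='k, of "- n"] by (simp add: n_def)
  have neg: "val x < 0" using n j(1) by (simp add: n_def)
  obtain u where u: "u \<noteq> 0" "int p * val u = val x"
   "vge (x - wp p u) (val x + 1)"
   using leading_power_term[OF p x0 pn neg] by blast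
  have "real_of_int n \<le> B" using less.prems(1) x0 by (simp add: vge_iff n_def)
  hence "real_of_int (int p * - val u) < real_of_int (int p * j)" using u(2) j(2) by (simp add: n_def)
  hence uj: "- val u < j" 
   using mult_less_cancel_left_pos[of "int p" "- val u" j] p1 unfolding of_int_less_iff by simp
  have vu: "vge u (of_int (- j + 1))" using uj by (simp add: vge_iff)
  have du: "fls_deriv (x - wp p u) = fls_deriv x + fls_deriv u"
   using fls_deriv_char_power[OF p(2), of u] by (simp add: wp_def)
  have vdu: "vge (fls_deriv u) (of_int (- j))" using vge_deriv[OF vu] by simp
  have d1: "fls_deriv x + fls_deriv u \<noteq> 0 \<and> val (fls_deriv x + fls_deriv u) = - j - 1"
   using subdegree_add_vge[OF less.prems(2) vdu] less.prems(3) by simp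
  let ?x = "x - wp p u"
  have dx: "fls_deriv ?x \<noteq> 0" "val (fls_deriv ?x) = - j - 1" unfolding du using d1 by blast+
  have x1: "?x \<noteq> 0" using dx(1) by auto
  have lt: "val x < val ?x" using u(3) x1 by (simp add: vge_iff)
  have v1: "vge ?x (- B)" using lt less.prems(1) x0 by (auto simp: vge_iff)
  obtain b where b: "?x - wp p b \<noteq> 0" "val (?x - wp p b) = - j"
   using less.hyps[OF _ v1 dx] lt n by (auto simp: n_def)
  have "wp p (u + b) = wp p u + wp p b" by (rule wp_add) (use p in simp_all)
  hence "?x - wp p b = x - wp p (u + b)" by (simp add: algebra_simps)
  thus ?thesis using b pj by metis
 qed
qed

text \<open>The derivative of \<open>wp p z\<close> is -z', so z has a pole of order at least j and
  \<open>wp p z\<close> one of order at least p j, beyond the bound B.\<close>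

lemma not_wp_deriv:
 fixes z :: "'k::field fls"
 assumes p: "prime p" "CHAR('k) = p"
  and x: "vge (wp p z) (- B)" and d: "val (fls_deriv (wp p z)) = - j - 1"
  and j: "j > 0" "B < real p * real_of_int j"
 shows False
proof -
 have p1: "p > 1" using p(1) prime_gt_1_nat by blast
 have dz: "fls_deriv (wp p z) = - fls_deriv z"
  using fls_deriv_char_power[OF p(2), of z] by (simp add: wp_def)
 have z0: "z \<noteq> 0" using d j(1) p1 by (auto simp: wp_def zero_power)
 have dz0: "fls_deriv z \<noteq> 0" using d j(1) dz by auto
 have "vge (fls_deriv z) (of_int (val z) - 1)" by (rule vge_deriv) (simp add: vge_iff)
 hence sz: "val z \<le> - j" using dz0 d dz by (simp add: vge_iff)
 have lt: "int p * val z < val z"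
  using sz j(1) p1 by (simp add: mult_less_cancel_right2)
 have "vge (- z) (of_int (val z))" by (simp add: vge_iff)
 hence "z ^ p + - z \<noteq> 0 \<and> val (z ^ p + - z) = int p * val z"
  using subdegree_add_vge[of "z ^ p" "- z" "real_of_int (val z)"] z0 lt
  unfolding of_int_less_iff fls_subdegree_pow by simp
 hence "wp p z \<noteq> 0" "val (wp p z) = int p * val z"
  by (simp_all add: wp_def)
 hence "- B \<le> real p * real_of_int (val z)" using x by (simp add: vge_iff)
 also have "\<dots> \<le> real p * real_of_int (- j)" using sz by (intro mult_left_mono) simp_all
 finally show False using j(2) by simp
qed

subsection \<open>Bases of totally ramified extensions\<close>

lemma vge_int: "vge f (of_int r) \<longleftrightarrow> f = 0 \<or> r \<le> val f"
 by (simp add: vge_iff)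

text \<open>The coordinates are found digit by digit.\<close>

lemma good_basis:
 fixes K :: "'k::field fls \<Rightarrow> 'k fls" and b :: "nat \<Rightarrow> 'k fls"
 assumes g: "good K d" and b0: "\<And>i. i < d \<Longrightarrow> b i \<noteq> 0"
  and inj: "inj_on (\<lambda>i. val (b i) mod int d) {..<d}"
 shows "\<exists>a. f = (\<Sum>i<d. K (a i) * b i)"
proof -
 note h = good_fhom[OF g]
 have d0: "d > 0" by (rule good_pos[OF g])
 define s where "s i = val (b i)" for i
 have surj: "(\<lambda>i. s i mod int d) ` {..<d} = {0..<int d}"
 proof (rule card_subset_eq)
  show "(\<lambda>i. s i mod int d) ` {..<d} \<subseteq> {0..<int d}" using d0 by auto
  show "card ((\<lambda>i. s i mod int d) ` {..<d}) = card {0..<int d}"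
   using card_image[OF inj] by (simp add: s_def)
 qed simp
 have ex: "\<exists>ie. fst ie < d \<and> n = int d * snd ie + s (fst ie)" for n
 proof -
  have "n mod int d \<in> (\<lambda>i. s i mod int d) ` {..<d}" unfolding surj using d0 by simp
  then obtain i where i: "i < d" "n mod int d = s i mod int d" by auto
  hence "int d dvd n - s i" by (simp add: mod_eq_dvd_iff)
  then obtain e where "n - s i = int d * e" by blast
  thus ?thesis using i by (intro exI[of _ "(i, e)"]) simp
 qed
 \<comment> \<open>Each integer n is d e + s i for a unique pair (i, e). With this pair,
   \<open>\<mu> n\<close> = K(t^e) b_i has valuation exactly n and serves as the digit of position
   n.\<close>
 define ie where "ie n = (SOME ie. fst ie < d \<and> n = int d * snd ie + s (fst ie))" for n
 have ie: "fst (ie n) < d" "n = int d * snd (ie n) + s (fst (ie n))" for n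
  using someI_ex[OF ex[of n]] unfolding ie_def by blast+
 have uniq: "fst (ie n) = i \<and> snd (ie n) = e" if "n = int d * e + s i" "i < d" for n i e
 proof -
  have "s (fst (ie n)) mod int d = s i mod int d"
   using ie(2)[of n] that(1) by (metis mod_mult_self4)
  hence 1: "fst (ie n) = i" using inj ie(1)[of n] that(2) by (auto simp: inj_on_def s_def)
  have "n = int d * snd (ie n) + s i" using ie(2)[of n] unfolding 1 .
  hence "int d * snd (ie n) = int d * e" using that(1) by linarith
  thus ?thesis using 1 d0 by simp
 qed
 define \<mu> where "\<mu> n = K (fls_X_intpow (snd (ie n))) * b (fst (ie n))" for n
 have X0: "K (fls_X_intpow e) \<noteq> 0" for e using fhom_eq_0[OF h] by simp
 have \<mu>0: "\<mu> n \<noteq> 0" for n unfolding \<mu>_def using X0 b0[OF ie(1)] by simp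
 have \<mu>s: "val (\<mu> n) = n" for n
  unfolding \<mu>_def using X0 b0[OF ie(1)] ie(2)[of n] by (simp add: good_subdegree[OF g] s_def)
 define N where "N = val f"
 define c where "c r k = (r $$ (N + int k)) / (\<mu> (N + int k) $$ (N + int k))" for r and k :: nat
 define R where "R = rec_nat f (\<lambda>k r. r - fls_const (c r k) * \<mu> (N + int k))"
 have R0: "R 0 = f" and RS: "R (Suc k) = R k - fls_const (c (R k) k) * \<mu> (N + int k)" for k
  by (simp_all add: R_def)
 have vR: "vge (R k) (of_int (N + int k))" for k
 proof (induction k)
  case 0
  thus ?case by (simp add: R0 vge_iff N_def)
 next
  case (Suc k)
  have "vge (R (Suc k)) (of_int (N + int k) + 1)"
  proof (rule vge_Suc)
   have "vge (\<mu> (N + int k)) (of_int (N + int k))" unfolding vge_int \<mu>s by simp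
   hence "vge (fls_const (c (R k) k) * \<mu> (N + int k)) (0 + of_int (N + int k))"
    by (intro vge_mult vge_const) simp_all
   thus "vge (R (Suc k)) (of_int (N + int k))" unfolding RS
    by (intro vge_diff Suc) simp
   have "\<mu> (N + int k) $$ (N + int k) \<noteq> 0" using \<mu>0 \<mu>s by (metis nth_fls_subdegree_nonzero)
   thus "R (Suc k) $$ (N + int k) = 0" by (simp add: RS c_def)
  qed
  thus ?case by (simp add: algebra_simps)
 qed
 \<comment> \<open>The digit of position N + l belongs to exactly one coordinate.
   \<open>A k i\<close> is the k-th partial sum of coordinate i, and \<open>a i\<close> below is its
   limit, written down coefficient by coefficient.\<close>
 define t where "t i l = (if fst (ie (N + int l)) = i
  then fls_const (c (R l) l) * fls_X_intpow (snd (ie (N + int l))) else 0)" for i and l :: nat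
 define A where "A k i = (\<Sum>l<k. t i l)" for k i
 have fR: "f - R k = (\<Sum>i<d. K (A k i) * b i)" for k
 proof (induction k)
  case 0
  thus ?case by (simp add: R0 A_def fhom_0[OF h])
 next
  case (Suc k)
  have "(\<Sum>i<d. K (t i k) * b i) = (\<Sum>i<d. if i = fst (ie (N + int k)) then fls_const (c (R k) k) * \<mu> (N + int k) else 0)"
   by (intro sum.cong refl)
    (auto simp: t_def \<mu>_def fhom_0[OF h] fhom_mult[OF h] good_const[OF g])
  also have "\<dots> = fls_const (c (R k) k) * \<mu> (N + int k)" using ie(1) by simp
  finally have "(\<Sum>i<d. K (t i k) * b i) = fls_const (c (R k) k) * \<mu> (N + int k)" .
  hence "(\<Sum>i<d. K (A (Suc k) i) * b i) = (f - R k) + fls_const (c (R k) k) * \<mu> (N + int k)"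
   by (simp add: A_def fhom_add[OF h] sum.distrib algebra_simps Suc[unfolded A_def])
  thus ?case by (simp add: RS)
 qed
 define C where "C n = (if n \<ge> N then c (R (nat (n - N))) (nat (n - N)) else 0)" for n
 define a where "a i = Abs_fls (\<lambda>e. C (int d * e + s i))" for i
 have a: "a i $$ e = C (int d * e + s i)" for i e
  unfolding a_def
 proof (rule nth_Abs_fls_lower_bound[of "min 0 (N - s i)"], intro allI impI)
  fix e assume "e < min 0 (N - s i)"
  hence "e < 0" "e < N - s i" by auto
  hence "int d * e \<le> 1 * e" using d0 by (intro mult_right_mono_neg) auto
  thus "C (int d * e + s i) = 0" using \<open>e < N - s i\<close> by (simp add: C_def)
 qed
 have close: "vge (A k i - a i) ((of_int (N + int k) - of_int (s i)) / real d)" if "i < d" for k i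
  unfolding vge_def
 proof (intro allI impI)
  fix e :: int
  assume "real_of_int e < (real_of_int (N + int k) - real_of_int (s i)) / real d"
  hence "real_of_int (int d * e + s i) < real_of_int (N + int k)" using d0 by (simp add: field_simps)
  hence lt: "int d * e + s i < N + int k" by (simp only: of_int_less_iff)
  have "A k i $$ e = (\<Sum>l<k. if int l = int d * e + s i - N then c (R l) l else 0)"
   unfolding A_def fls_nth_sum
  proof (intro sum.cong refl)
   fix l
   show "t i l $$ e = (if int l = int d * e + s i - N then c (R l) l else 0)"
   proof (cases "int l = int d * e + s i - N")
    case True
    hence "fst (ie (N + int l)) = i \<and> snd (ie (N + int l)) = e"
     using that by (intro uniq) auto
    thus ?thesis using True by (simp add: t_def)
   next
    case False
    have "\<not> (fst (ie (N + int l)) = i \<and> snd (ie (N + int l)) = e)"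
     using False ie(2)[of "N + int l"] by auto
    thus ?thesis using False by (auto simp: t_def)
   qed
  qed
  also have "\<dots> = C (int d * e + s i)"
  proof (cases "int d * e + s i \<ge> N")
   case True
   have "(\<Sum>l<k. if int l = int d * e + s i - N then c (R l) l else 0) =
    (\<Sum>l<k. if l = nat (int d * e + s i - N) then c (R l) l else 0)"
    using True by (intro sum.cong) auto
   also have "\<dots> = C (int d * e + s i)" using True lt by (auto simp: C_def)
   finally show ?thesis .
  qed (auto simp: C_def intro!: sum.neutral)
  finally show "(A k i - a i) $$ e = 0" by (simp add: a)
 qed
 have "f - (\<Sum>i<d. K (a i) * b i) = 0"
 proof (rule vge_eq_0[of _ "real_of_int N"])
  fix k :: nat
  have "f - (\<Sum>i<d. K (a i) * b i) = R k + (\<Sum>i<d. K (A k i - a i) * b i)"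
   using fR[of k] by (simp add: fhom_diff[OF h] sum_subtractf algebra_simps)
  moreover have "vge (\<Sum>i<d. K (A k i - a i) * b i) (of_int (N + int k))"
  proof (rule vge_sum)
   fix i assume i: "i \<in> {..<d}"
   have "vge (K (A k i - a i)) (real d * ((of_int (N + int k) - of_int (s i)) / real d))"
    by (rule good_vge[OF g close]) (use i in simp)
   moreover have "vge (b i) (of_int (s i))" by (simp add: vge_int s_def)
   ultimately have "vge (K (A k i - a i) * b i)
    (real d * ((of_int (N + int k) - of_int (s i)) / real d) + of_int (s i))"
    by (rule vge_mult)
   thus "vge (K (A k i - a i) * b i) (of_int (N + int k))" using d0 by simp
  qed
  ultimately have "vge (f - (\<Sum>i<d. K (a i) * b i)) (of_int (N + int k))"
   by (simp only: vge_add[OF vR])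
  thus "vge (f - (\<Sum>i<d. K (a i) * b i)) (real k + of_int N)" by (simp add: add.commute)
 qed
 thus ?thesis by (intro exI[of _ a]) simp
qed

text \<open>The nonzero terms have valuations that differ modulo d, so the one of least valuation
  cannot cancel.\<close>

lemma good_basis_indep:
 fixes K :: "'k::field fls \<Rightarrow> 'k fls" and b :: "nat \<Rightarrow> 'k fls"
 assumes g: "good K d" and b0: "\<And>i. i < d \<Longrightarrow> b i \<noteq> 0"
  and inj: "inj_on (\<lambda>i. val (b i) mod int d) {..<d}"
  and z: "(\<Sum>i<d. K (a i) * b i) = 0" and i: "i < d"
 shows "a i = 0"
proof (rule ccontr)
 assume nz: "a i \<noteq> 0"
 note h = good_fhom[OF g]
 define J where "J = {i. i < d \<and> a i \<noteq> 0}"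
 define v where "v i = val (K (a i) * b i)" for i
 have J: "finite J" "J \<noteq> {}" using nz i by (auto simp: J_def)
 have nz': "K (a i) * b i \<noteq> 0" if "i \<in> J" for i
  using that b0 fhom_eq_0[OF h] by (simp add: J_def)
 have v: "v i = int d * val (a i) + val (b i)" if "i \<in> J" for i
  using nz'[OF that] by (auto simp: v_def good_subdegree[OF g])
 have vinj: "i = i'" if "i \<in> J" "i' \<in> J" "v i = v i'" for i i'
 proof -
  have "val (b i) mod int d = val (b i') mod int d"
   using that v by (metis mod_mult_self4)
  thus ?thesis using inj that by (auto simp: inj_on_def J_def)
 qed
 define i0 where "i0 = arg_min_on v J"
 have i0: "i0 \<in> J" "\<And>i. i \<in> J \<Longrightarrow> v i0 \<le> v i"
  using J arg_min_if_finite[OF J, of v] by (auto simp: i0_def not_less)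
 have "(\<Sum>i<d. K (a i) * b i) $$ v i0 = (\<Sum>i<d. if i = i0 then (K (a i) * b i) $$ v i0 else 0)"
  unfolding fls_nth_sum
 proof (intro sum.cong refl)
  fix i assume "i \<in> {..<d}"
  show "(K (a i) * b i) $$ v i0 = (if i = i0 then (K (a i) * b i) $$ v i0 else 0)"
  proof (cases "i = i0 \<or> a i = 0")
   case False
   hence "i \<in> J" using \<open>i \<in> {..<d}\<close> by (simp add: J_def)
   hence "v i0 < v i" using i0 vinj[of i i0] False by (metis le_less)
   thus ?thesis using False by (simp add: v_def)
  qed (auto simp: fhom_0[OF h])
 qed
 also have "\<dots> = (K (a i0) * b i0) $$ v i0" using i0(1) by (simp add: J_def)
 finally have "(K (a i0) * b i0) $$ v i0 = 0" using z by simp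
 thus False using nz'[OF i0(1)] unfolding v_def by (simp only: nth_fls_subdegree_zero_iff)
qed

lemma fhom_map_poly_add: "fhom f \<Longrightarrow> map_poly f (P + Q) = map_poly f P + map_poly f Q"
 by (rule poly_eqI) (simp add: coeff_map_poly fhom_simps)

lemma fhom_map_poly_mult: "fhom f \<Longrightarrow> map_poly f (P * Q) = map_poly f P * map_poly f Q"
 by (rule poly_eqI) (simp add: coeff_map_poly fhom_simps coeff_mult fhom_sum)

lemma fhom_degree_map_poly: assumes "fhom f" shows "Polynomial.degree (map_poly f P) \<le> Polynomial.degree P"
 by (rule degree_le) (simp add: coeff_map_poly fhom_0[OF assms] coeff_eq_0)

lemma poly_eq_sum_lessThan:
 fixes P :: "'a::comm_semiring_1 poly"
 assumes "Polynomial.degree P < d"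
 shows "poly P x = (\<Sum>i<d. Polynomial.coeff P i * x ^ i)"
proof -
 have "poly P x = (\<Sum>i\<le>Polynomial.degree P. Polynomial.coeff P i * x ^ i)" by (rule poly_altdef)
 also have "\<dots> = (\<Sum>i<d. Polynomial.coeff P i * x ^ i)"
  by (rule sum.mono_neutral_left) (use assms in \<open>auto simp: coeff_eq_0\<close>)
 finally show ?thesis .
qed

text \<open>Valuations show that the powers of z below d form a basis. Hence every element is a
  polynomial in z, and a polynomial vanishing at z leaves remainder 0 modulo M. Evaluation at Y
  therefore factors through evaluation at z.\<close>

lemma simple_extension_hom:
 fixes K :: "'k::field fls \<Rightarrow> 'k fls" and \<psi> :: "'k fls \<Rightarrow> 'w::field" and M :: "'k fls poly"
 assumes g: "good K d" and z0: "z \<noteq> 0"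
  and inj: "inj_on (\<lambda>i. val (z ^ i) mod int d) {..<d}"
  and M: "Polynomial.degree M = d"
  and Mz: "poly (map_poly K M) z = 0" and MY: "poly (map_poly \<psi> M) Y = 0" and \<psi>: "fhom \<psi>"
 shows "\<exists>\<psi>'. fhom \<psi>' \<and> (\<forall>a. \<psi>' (K a) = \<psi> a) \<and> \<psi>' z = Y"
proof -
 note h = good_fhom[OF g]
 define ev1 where "ev1 P = poly (map_poly K P) z" for P
 define ev2 where "ev2 P = poly (map_poly \<psi> P) Y" for P
 have ev1: "ev1 (P + Q) = ev1 P + ev1 Q" "ev1 (P * Q) = ev1 P * ev1 Q" "ev1 [:c:] = K c" for P Q c
  by (simp_all add: ev1_def fhom_map_poly_add[OF h] fhom_map_poly_mult[OF h] map_poly_pCons fhom_0[OF h])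
 have ev2: "ev2 (P + Q) = ev2 P + ev2 Q" "ev2 (P * Q) = ev2 P * ev2 Q" "ev2 [:c:] = \<psi> c" for P Q c
  by (simp_all add: ev2_def fhom_map_poly_add[OF \<psi>] fhom_map_poly_mult[OF \<psi>] map_poly_pCons fhom_0[OF \<psi>])
 have X: "ev1 [:0, 1:] = z" "ev2 [:0, 1:] = Y"
  by (simp_all add: ev1_def ev2_def map_poly_pCons fhom_simps[OF h] fhom_simps[OF \<psi>])
 have d0: "d > 0" by (rule good_pos[OF g])
 have ev1_sum: "ev1 P = (\<Sum>i<d. K (Polynomial.coeff P i) * z ^ i)" if "Polynomial.degree P < d" for P
  using poly_eq_sum_lessThan[of "map_poly K P" d z] fhom_degree_map_poly[OF h, of P] that
  by (simp add: ev1_def coeff_map_poly fhom_0[OF h])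
 have surj: "\<exists>P. ev1 P = f" for f
 proof -
  obtain a where a: "f = (\<Sum>i<d. K (a i) * z ^ i)"
   using good_basis[OF g _ inj, of f] z0 by auto
  define P where "P = (\<Sum>i<d. monom (a i) i)"
  have cP: "Polynomial.coeff P i = (if i < d then a i else 0)" for i
   by (auto simp: P_def coeff_sum coeff_monom)
  have "Polynomial.degree P \<le> d - 1" by (rule degree_le) (use cP in auto)
  thus ?thesis using a ev1_sum[of P] d0 by (intro exI[of _ P]) (simp add: cP)
 qed
 have ker: "ev2 P = 0" if "ev1 P = 0" for P
 proof -
  define R where "R = P mod M"
  have M0: "M \<noteq> 0" using M d0 by auto
  have PR: "P = P div M * M + R" by (simp add: R_def)
  have "ev1 P = ev1 (P div M) * ev1 M + ev1 R" by (subst PR) (simp only: ev1)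
  hence R0: "ev1 R = 0" using that Mz by (simp add: ev1_def)
  have dR: "Polynomial.degree R < d"
  proof (cases "R = 0")
   case False
   thus ?thesis using degree_mod_less'[OF M0, of P] M by (simp add: R_def)
  qed (simp add: d0)
  have "(\<Sum>i<d. K (Polynomial.coeff R i) * z ^ i) = 0" using R0 ev1_sum[OF dR] by simp
  hence "Polynomial.coeff R i = 0" if "i < d" for i
   using good_basis_indep[OF g _ inj _ that, of "Polynomial.coeff R"] z0 by simp
  hence "R = 0" using dR by (metis leading_coeff_0_iff)
  hence "ev2 P = ev2 (P div M) * ev2 M" using PR ev2(2) by (metis add.right_neutral)
  thus ?thesis using MY by (simp add: ev2_def)
 qed
 define \<psi>' where "\<psi>' f = ev2 (SOME P. ev1 P = f)" for f
 have \<psi>': "\<psi>' (ev1 P) = ev2 P" for P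
 proof -
  define Q where "Q = (SOME Q. ev1 Q = ev1 P)"
  have "ev1 Q = ev1 P" unfolding Q_def by (rule someI) (rule refl)
  moreover have "ev1 (Q + [:- 1:] * P) = ev1 Q + K (- 1) * ev1 P" by (simp only: ev1)
  ultimately have "ev1 (Q + [:- 1:] * P) = 0" by (simp add: fhom_simps[OF h])
  hence "ev2 (Q + [:- 1:] * P) = 0" by (rule ker)
  hence "ev2 Q + \<psi> (- 1) * ev2 P = 0" by (simp only: ev2)
  thus ?thesis by (simp add: \<psi>'_def Q_def[symmetric] fhom_simps[OF \<psi>])
 qed
 have "fhom \<psi>'"
  unfolding fhom_def
 proof (intro conjI allI)
  show "\<psi>' 1 = 1" using \<psi>'[of "[:1:]"] by (simp add: ev1 ev2 fhom_1[OF h] fhom_1[OF \<psi>])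
  fix x y
  obtain P Q where PQ: "ev1 P = x" "ev1 Q = y" using surj by metis
  show "\<psi>' (x + y) = \<psi>' x + \<psi>' y" using \<psi>'[of "P + Q"] \<psi>'[of P] \<psi>'[of Q] PQ by (simp add: ev1 ev2)
  show "\<psi>' (x * y) = \<psi>' x * \<psi>' y" using \<psi>'[of "P * Q"] \<psi>'[of P] \<psi>'[of Q] PQ by (simp add: ev1 ev2)
 qed
 moreover have "\<psi>' (K a) = \<psi> a" for a using \<psi>'[of "[:a:]"] by (simp add: ev1 ev2)
 moreover have "\<psi>' z = Y" using \<psi>'[of "[:0, 1:]"] by (simp add: X)
 ultimately show ?thesis by blast
qed

subsection \<open>Artin--Schreier extensions\<close>

text \<open>\<open>K\<close> embeds the base k((t)) into the extension k((X)), generated by z. The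
  pole order j of z in X is also that of x in t: K multiplies valuations by p, and z^p dominates
  z.\<close>

definition artin_schreier ::
 "nat \<Rightarrow> 'k::field fls \<Rightarrow> int \<Rightarrow> ('k fls \<Rightarrow> 'k fls) \<Rightarrow> 'k fls \<Rightarrow> bool" where
 "artin_schreier p x j K z \<longleftrightarrow> good K p \<and> wp p z = K x \<and> z \<noteq> 0 \<and> val z = - j \<and>
   j > 0 \<and> \<not> int p dvd j"

lemma inj_on_mult_mod:
 assumes "prime p" "\<not> int p dvd s"
 shows "inj_on (\<lambda>i::nat. (int i * s) mod int p) {..<p}"
proof (rule inj_onI)
 fix i i' assume i: "i \<in> {..<p}" "i' \<in> {..<p}" "(int i * s) mod int p = (int i' * s) mod int p"
 hence "int p dvd (int i - int i') * s" by (simp add: mod_eq_dvd_iff algebra_simps)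
 moreover have "prime (int p)" using assms(1) by simp
 ultimately have "int p dvd int i - int i'" using assms(2) prime_dvd_multD by blast
 hence "int i mod int p = int i' mod int p" by (simp add: mod_eq_dvd_iff)
 thus "i = i'" using i by simp
qed

lemma artin_schreier_inj:
 assumes p: "prime p" and AS: "artin_schreier p x j K z"
 shows "inj_on (\<lambda>i. val (z ^ i) mod int p) {..<p}"
proof -
 have "\<not> int p dvd - j" using AS by (simp add: artin_schreier_def)
 from inj_on_mult_mod[OF p this] show ?thesis
  using AS by (simp add: artin_schreier_def fls_subdegree_pow)
qed

lemma artin_schreier_basis:
 assumes "prime p" "artin_schreier p x j K z"
 shows "\<exists>a. f = (\<Sum>i<p. K (a i) * z ^ i)"
 using good_basis[OF _ _ artin_schreier_inj[OF assms]] assms(2) by (simp add: artin_schreier_def)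

lemma artin_schreier_hom:
 fixes x :: "'k::field fls" and \<psi> :: "'k fls \<Rightarrow> 'w::field"
 assumes p: "prime p" and AS: "artin_schreier p x j K z"
  and \<psi>: "fhom \<psi>" and Y: "wp p Y = \<psi> x"
 shows "\<exists>\<psi>'. fhom \<psi>' \<and> (\<forall>a. \<psi>' (K a) = \<psi> a) \<and> \<psi>' z = Y"
proof (rule simple_extension_hom[OF _ _ artin_schreier_inj[OF p AS]])
 let ?M = "monom 1 p + [:- x, - 1:]"
 have p1: "p > 1" using p prime_gt_1_nat by blast
 have "Polynomial.degree ?M = Polynomial.degree (monom (1 :: 'k fls) p)"
  by (rule degree_add_eq_left) (use p1 in \<open>simp add: degree_monom_eq\<close>)
 thus "Polynomial.degree ?M = p" by (simp add: degree_monom_eq)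
 have ev: "poly (map_poly f ?M) y = y ^ p - y - f x" if "fhom f" for f :: "'k fls \<Rightarrow> 'c::field" and y
  by (simp add: fhom_map_poly_add[OF that] map_poly_pCons fhom_simps[OF that] map_poly_monom poly_monom)
 show "poly (map_poly K ?M) z = 0" "poly (map_poly \<psi> ?M) Y = 0"
  using ev[OF \<psi>] ev[OF good_fhom[of K p]] AS Y by (simp_all add: artin_schreier_def wp_def)
qed (use AS \<psi> in \<open>simp_all add: artin_schreier_def\<close>)

text \<open>The derivative of K t generates the different. Differentiating
  \<open>wp p z = K x\<close> gives - z' = K(x') (K t)', and comparing orders yields the classical
  exponent (p - 1)(j + 1).\<close>

lemma artin_schreier_different:
 fixes x :: "'k::field fls"
 assumes p: "prime p" "CHAR('k) = p" and AS: "artin_schreier p x j K z"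
  and dx: "fls_deriv x \<noteq> 0" "val (fls_deriv x) = - j - 1"
 shows "fls_deriv (K fls_X) \<noteq> 0 \<and> val (fls_deriv (K fls_X)) = (int p - 1) * (j + 1)"
proof -
 have AS': "good K p" "wp p z = K x" "z \<noteq> 0" "val z = - j" "j > 0" "\<not> int p dvd j"
  using AS by (simp_all add: artin_schreier_def)
 have "- fls_deriv z = fls_deriv (wp p z)" using fls_deriv_char_power[OF p(2), of z] by (simp add: wp_def)
 also have "\<dots> = K (fls_deriv x) * fls_deriv (K fls_X)" unfolding AS'(2) by (rule good_deriv[OF AS'(1)])
 finally have e: "- fls_deriv z = K (fls_deriv x) * fls_deriv (K fls_X)" .
 have "of_int (- j) \<noteq> (0::'k)" using AS'(6) p(2) of_int_eq_0_iff_char_dvd[where 'a='k, of "- j"] by simp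
 hence zn: "fls_deriv z $$ (- j - 1) \<noteq> 0" using AS'(3,4) by (metis fls_deriv_nth diff_add_cancel nth_fls_subdegree_nonzero mult_eq_0_iff)
 have "val (fls_deriv z) = - j - 1"
  by (rule fls_subdegree_eqI[OF zn]) (use AS'(4) in simp)
 moreover have "fls_deriv z \<noteq> 0" using fls_nonzeroI[OF zn] .
 ultimately have "val (- fls_deriv z) = - j - 1" "- fls_deriv z \<noteq> 0" by simp_all
 hence "K (fls_deriv x) * fls_deriv (K fls_X) \<noteq> 0"
  "val (K (fls_deriv x) * fls_deriv (K fls_X)) = - j - 1"
  unfolding e by blast+
 hence "fls_deriv (K fls_X) \<noteq> 0" "- j - 1 = int p * (- j - 1) + val (fls_deriv (K fls_X))"
  using dx by (simp_all add: good_subdegree[OF AS'(1)])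
 thus ?thesis by (simp add: algebra_simps)
qed

text \<open>After a change of parameter the equation is \<open>y^p - y = s^(- j)\<close>. With \<open>y = X^(- j)\<close> it reads
 \<open>s^j (1 - X^(j (p - 1))) = X^(p j)\<close>, which is solved by extracting a \<open>j\<close>-th root.\<close>

lemma artin_schreier_exists:
 fixes x :: "'k::alg_closed_field fls"
 assumes p: "prime p" "CHAR('k) = p"
  and x: "x \<noteq> 0" "val x = - j" and j: "j > 0" "\<not> int p dvd j"
 shows "\<exists>K z. artin_schreier p x j K z"
proof -
 have p1: "p > 1" using p(1) prime_gt_1_nat by blast
 define J where "J = nat j"
 have J: "J > 0" "j = int J" using j(1) by (simp_all add: J_def)
 have J0: "of_nat J \<noteq> (0::'k)" using j(2) p(2) of_nat_eq_0_iff_char_dvd[where 'a='k, of J] by (simp add: J)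
 define U where "U = fls_regpart (fls_X_intpow j * x)"
 have sU: "val (fls_X_intpow j * x) = 0" using x by simp
 hence "fps_to_fls U = fls_X_intpow j * x" unfolding U_def by (intro fps_to_fls_regpart) (simp add: vge_iff)
 hence U: "fps_to_fls U = fls_X ^ J * x" by (simp add: J(2) fls_X_power_conv_shift_1)
 have "(fls_X_intpow j * x) $$ 0 \<noteq> 0" using sU x(1) by (metis fls_X_intpow_nonzero mult_eq_0_iff nth_fls_subdegree_nonzero)
 hence U0: "U $ 0 \<noteq> 0" by (simp add: U_def)
 obtain c where c: "c ^ J = U $ 0" using alg_closed_power_root[OF J(1)] by blast
 have c0: "c \<noteq> 0" using c U0 J(1) by (auto simp: zero_power)
 have "(U * fps_const (inverse (U $ 0)) - 1) $ 0 = 0" using U0 by simp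
 from fps_root_exists[OF J0 this] obtain r where r: "r $ 0 = 1" "r ^ J = U * fps_const (inverse (U $ 0))" by auto
 define V where "V = fps_const c * r"
 have V: "V ^ J = U" using U0 by (simp add: V_def power_mult_distrib r(2) c fps_const_power mult_ac)
 have V0: "V $ 0 \<noteq> 0" using c0 r(1) by (simp add: V_def)
 \<comment> \<open>This is the parameter of the base in which x = s^(-J).\<close>
 define s where "s = fps_X * inverse V"
 have s0: "s $ 0 = 0" and s1: "s $ 1 \<noteq> 0" using V0 by (simp_all add: s_def)
 have Vi: "inverse V * V = 1" by (rule inverse_mult_eq_1[OF V0])
 have sJ: "s ^ J * U = fps_X ^ J"
 proof -
  have "s ^ J * U = fps_X ^ J * (inverse V * V) ^ J" by (simp add: s_def power_mult_distrib V mult_ac)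
  thus ?thesis by (simp add: Vi)
 qed
 have xs: "x * fps_to_fls s ^ J = 1"
 proof -
  have "fls_X ^ J * (x * fps_to_fls s ^ J) = fps_to_fls (s ^ J * U)"
   by (simp add: fls_times_fps_to_fls fps_to_fls_power U mult_ac)
  also have "\<dots> = fls_X ^ J * 1" by (simp add: sJ fps_to_fls_power)
  finally show ?thesis by (subst (asm) mult_cancel_left) simp
 qed
 have "(- (fps_X ^ (J * (p - 1))) :: 'k fps) $ 0 = 0" using J(1) p1 by simp
 from fps_root_exists[OF J0 this] obtain w :: "'k fps" where w: "w $ 0 = 1" "w ^ J = 1 - fps_X ^ (J * (p - 1))" by auto
 have w0: "w $ 0 \<noteq> 0" using w(1) by simp
 \<comment> \<open>S is to become the image of s: S^(-J) = X^(-pJ) - X^(-J), which is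
   \<open>wp p\<close> of X^(-J).\<close>
 define S where "S = fps_X ^ p * inverse w"
 have wi: "inverse w * w = 1" by (rule inverse_mult_eq_1[OF w0])
 have SJ: "S ^ J * (1 - fps_X ^ (J * (p - 1))) = fps_X ^ (p * J)"
 proof -
  have "(fps_X ^ (p * J) :: 'k fps) = (fps_X ^ p) ^ J" by (rule power_mult)
  hence "S ^ J * w ^ J = fps_X ^ (p * J) * (inverse w * w) ^ J"
   by (simp only: S_def power_mult_distrib mult_ac)
  thus ?thesis by (simp only: wi w(2) power_one mult_1_right)
 qed
 have S0: "S $ 0 = 0" using p1 by (simp add: S_def)
 have Sn: "S \<noteq> 0" using w0 unfolding S_def by (auto simp: fps_inverse_eq_0_iff)
 have sS: "subdegree S = p"
 proof -
  have "inverse w \<noteq> 0" using w0 by (auto simp: fps_inverse_eq_0_iff)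
  moreover have "subdegree (inverse w) = 0" by (rule subdegree_eq_0) (simp add: w0)
  ultimately show ?thesis by (simp add: S_def subdegree_mult)
 qed
 \<comment> \<open>T is the image of t, found by solving s(T) = S.\<close>
 define T where "T = fps_inv s oo S"
 have sT: "s oo T = S" unfolding T_def by (rule fps_inverse_image[OF s0 s1 S0])
 have T0: "T $ 0 = 0" by (simp add: T_def fps_inv_def)
 have Tn: "T \<noteq> 0" using sT Sn s0 by auto
 define K where "K f = fls_compose_fps f T" for f
 have g: "good K (subdegree T)" unfolding K_def by (rule good_compose[OF Tn T0])
 note h = good_fhom[OF g]
 have Ks: "K (fps_to_fls s) = fps_to_fls S" by (simp add: K_def Tn T0 sT)
 have "subdegree s = 1" using s0 s1 by (intro subdegreeI) auto
 hence "subdegree T = p" using good_subdegree[OF g, of "fps_to_fls s"] sS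
  by (simp add: Ks fls_subdegree_fls_to_fps)
 with g have g: "good K p" by simp
 define z where "z = (fls_X_intpow (- j) :: 'k fls)"
 have "K x * fps_to_fls S ^ J = 1" using xs by (metis Ks fhom_1[OF h] fhom_mult[OF h] fhom_power[OF h])
 moreover have "wp p z * fps_to_fls S ^ J = 1"
 proof -
  have zX: "z * fls_X ^ J = 1" by (simp add: z_def J(2) fls_X_power_conv_shift_1 fls_shifted_times_simps)
  have "fps_to_fls S ^ J * (1 - fls_X ^ (J * (p - 1))) = fls_X ^ (p * J)"
  proof -
   have "fps_to_fls (S ^ J * (1 - fps_X ^ (J * (p - 1)))) = fps_to_fls (fps_X ^ (p * J))" by (simp only: SJ)
   thus ?thesis by (simp add: fls_times_fps_to_fls fps_to_fls_power)
  qed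
  hence "z ^ p * (fps_to_fls S ^ J * (1 - fls_X ^ (J * (p - 1)))) = (z * fls_X ^ J) ^ p"
   by (simp add: power_mult_distrib power_mult[symmetric] mult.commute)
  hence e: "fps_to_fls S ^ J * (z ^ p - z ^ p * fls_X ^ (J * (p - 1))) = 1"
   by (simp add: zX algebra_simps)
  have "z ^ p = z ^ (p - 1) * z" by (rule power_minus_mult[symmetric]) (use p1 in simp)
  hence "z ^ p * fls_X ^ (J * (p - 1)) = z * (z * fls_X ^ J) ^ (p - 1)"
   by (simp only: power_mult_distrib power_mult mult_ac)
  hence "z ^ p * fls_X ^ (J * (p - 1)) = z" by (simp add: zX)
  thus ?thesis using e by (simp add: wp_def mult.commute)
 qed
 moreover have "fps_to_fls S ^ J \<noteq> 0" using Sn by simp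
 ultimately have "wp p z = K x" by (metis mult_right_cancel)
 moreover have "z \<noteq> 0" by (simp add: z_def fls_shift_eq0_iff)
 ultimately have "artin_schreier p x j K z" using g j by (simp add: artin_schreier_def z_def)
 thus ?thesis by blast
qed

subsection \<open>Power series over Laurent series fields\<close>

definition fmap :: "('a \<Rightarrow> 'b) \<Rightarrow> 'a fps \<Rightarrow> 'b fps" where
 "fmap f A = Abs_fps (\<lambda>n. f (A $ n))"

lemma fmap_nth [simp]: "fmap f A $ n = f (A $ n)"
 by (simp add: fmap_def)

lemma fmap_mult: "fhom f \<Longrightarrow> fmap f (A * B) = fmap f A * fmap f B"
 by (rule fps_ext) (simp add: fps_mult_nth fhom_sum fhom_mult)

lemma fmap_1: "fhom f \<Longrightarrow> fmap f 1 = 1"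
 by (rule fps_ext) (simp add: fhom_simps)

lemma fmap_power: "fhom f \<Longrightarrow> fmap f (A ^ n) = fmap f A ^ n"
 by (induction n) (simp_all add: fmap_1 fmap_mult)

lemma fmap_prod: "fhom f \<Longrightarrow> fmap f (\<Prod>i\<in>I. A i) = (\<Prod>i\<in>I. fmap f (A i))"
 by (induction I rule: infinite_finite_induct) (simp_all add: fmap_1 fmap_mult)

lemma fmap_const: "fhom f \<Longrightarrow> fmap f (fps_const c) = fps_const (f c)"
 by (rule fps_ext) (simp add: fhom_simps)

lemma fhom_frob:
 assumes "prime p" "CHAR('a::field) = p"
 shows "fhom (\<lambda>x::'a. x ^ p)"
 by (simp add: fhom_def power_mult_distrib char_power_add[OF assms])

lemma fmap_deriv_mult:
 fixes A B :: "'k::field fls fps"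
 shows "fmap fls_deriv (A * B) = fmap fls_deriv A * B + A * fmap fls_deriv B"
 by (rule fps_ext) (simp add: fps_mult_nth fls_deriv_sum sum.distrib)

definition elem_factor :: "nat \<Rightarrow> 'a::field \<Rightarrow> 'a fps" where
 "elem_factor i f = 1 - fps_const f * fps_X ^ i"

lemma elem_factor_nth: "elem_factor i f $ n = (if n = 0 then 1 else 0) - (if n = i then f else 0)"
 by (simp add: elem_factor_def fps_X_power_nth)

lemma elem_factor_nth_0: "i > 0 \<Longrightarrow> elem_factor i f $ 0 = 1"
 by (simp add: elem_factor_nth)

lemma fmap_elem_factor: "fhom K \<Longrightarrow> fmap K (elem_factor i f) = elem_factor i (K f)"
 by (rule fps_ext) (simp add: elem_factor_nth fhom_simps)

definition normal_form :: "(nat \<Rightarrow> 'a::field) \<Rightarrow> nat \<Rightarrow> 'a fps" where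
 "normal_form f N = (\<Prod>i\<in>{1..<N}. elem_factor i (f i))"

lemma fmap_normal_form: "fhom K \<Longrightarrow> fmap K (normal_form f N) = normal_form (\<lambda>i. K (f i)) N"
 by (simp add: normal_form_def fmap_prod fmap_elem_factor)

lemma prod_nth_0: "(\<And>i. i \<in> I \<Longrightarrow> A i $ 0 = 1) \<Longrightarrow> (\<Prod>i\<in>I. A i) $ 0 = (1::'a::comm_ring_1)"
 by (induction I rule: infinite_finite_induct) simp_all

lemma normal_form_nth_0: "normal_form f N $ 0 = 1"
 unfolding normal_form_def by (rule prod_nth_0) (simp add: elem_factor_nth_0)

text \<open>\<mu> is a slope of Newton polygon type: a linear bound on the pole orders passes to
  products, and to inverses of series with constant term 1.\<close>

definition pole_bound :: "real \<Rightarrow> 'k::field fls fps \<Rightarrow> bool" where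
 "pole_bound \<mu> A \<longleftrightarrow> (\<forall>n. vge (A $ n) (- \<mu> * real n))"

lemma pole_bound_mult:
 assumes "pole_bound \<mu> A" "pole_bound \<mu> B"
 shows "pole_bound \<mu> (A * B)"
 unfolding pole_bound_def fps_mult_nth
proof (intro allI vge_sum)
 fix n i :: nat assume i: "i \<in> {0..n}"
 have "vge (A $ i * B $ (n - i)) (- \<mu> * real i + - \<mu> * real (n - i))"
  using assms unfolding pole_bound_def by (intro vge_mult) auto
 moreover have "- \<mu> * real i + - \<mu> * real (n - i) = - \<mu> * real n" using i by (simp add: algebra_simps of_nat_diff)
 ultimately show "vge (A $ i * B $ (n - i)) (- \<mu> * real n)" by simp
qed

lemma pole_bound_1: "pole_bound \<mu> 1"
 by (auto simp: pole_bound_def intro!: vge_1)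

lemma pole_bound_prod: "(\<And>i. i \<in> I \<Longrightarrow> pole_bound \<mu> (A i)) \<Longrightarrow> pole_bound \<mu> (\<Prod>i\<in>I. A i)"
 by (induction I rule: infinite_finite_induct) (simp_all add: pole_bound_1 pole_bound_mult)

lemma pole_bound_inverse:
 assumes A: "pole_bound \<mu> A" "A $ 0 = 1"
 shows "pole_bound \<mu> (inverse A)"
 unfolding pole_bound_def
proof
 fix n show "vge (inverse A $ n) (- \<mu> * real n)"
 proof (induction n rule: less_induct)
  case (less n)
  show ?case
  proof (cases "n = 0")
   case False
   have "(A * inverse A) $ n = 0" using inverse_mult_eq_1'[of A] A(2) False by simp
   hence "inverse A $ n + (\<Sum>i=1..n. A $ i * inverse A $ (n - i)) = 0"
    using A(2) unfolding fps_mult_nth by (simp add: sum.atLeast_Suc_atMost)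
   hence "inverse A $ n = - (\<Sum>i=1..n. A $ i * inverse A $ (n - i))" by (simp add: eq_neg_iff_add_eq_0)
   moreover have "vge (\<Sum>i=1..n. A $ i * inverse A $ (n - i)) (- \<mu> * real n)"
   proof (rule vge_sum)
    fix i assume i: "i \<in> {1..n}"
    have "vge (A $ i * inverse A $ (n - i)) (- \<mu> * real i + - \<mu> * real (n - i))"
     using A(1) less[of "n - i"] i False unfolding pole_bound_def by (intro vge_mult) auto
    moreover have "- \<mu> * real i + - \<mu> * real (n - i) = - \<mu> * real n"
     using i by (simp add: algebra_simps of_nat_diff)
    ultimately show "vge (A $ i * inverse A $ (n - i)) (- \<mu> * real n)" by simp
   qed
   ultimately show ?thesis by (simp add: vge_uminus)
  qed (use A(2) in \<open>simp add: vge_1\<close>)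
 qed
qed

text \<open>If y has a pole then y^p dominates y. The resulting division by p is the gain in slope
  that makes Y negligible against W in the Lang equation.\<close>

lemma wp_vge:
 fixes y :: "'k::field fls"
 assumes "p > 1" "vge (wp p y) (- c)" "c \<ge> 0"
 shows "vge y (- c / real p)"
proof (cases "vge y 0")
 case True
 thus ?thesis using assms(1,3) by (elim vge_mono) simp
next
 case False
 hence y: "y \<noteq> 0" "val y < 0" by (auto simp: vge_iff)
 have "real p * real_of_int (val y) < 1 * real_of_int (val y)"
  using y(2) assms(1) by (intro mult_strict_right_mono_neg) auto
 hence lt: "real_of_int (val (y ^ p)) < real_of_int (val y)" by (simp add: fls_subdegree_pow)
 have "y ^ p \<noteq> 0" using y(1) by simp
 from subdegree_add_vge[OF this _ lt, of "- y"]
 have "y ^ p + - y \<noteq> 0" "val (y ^ p + - y) = val (y ^ p)"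
  by (simp_all add: vge_uminus vge_iff)
 hence "- c \<le> real p * real_of_int (val y)"
  using assms(2) by (simp add: wp_def vge_iff fls_subdegree_pow)
 thus ?thesis using assms(1) by (simp add: vge_iff field_simps)
qed

subsection \<open>Logarithmic derivatives\<close>

text \<open>Differentiation is coefficientwise in the Laurent variable; the indeterminate of the
  power series counts as a constant, so that 1 + X has logarithmic derivative 0.\<close>

definition dlog :: "'k::field fls fps \<Rightarrow> 'k fls fps" where
 "dlog A = fmap fls_deriv A * inverse A"

lemma dlog_mult:
 assumes "A $ 0 = 1" "B $ 0 = 1"
 shows "dlog (A * B) = dlog A + dlog B"
proof -
 have 1: "A * inverse A = 1" "B * inverse B = 1" using assms by (simp_all add: inverse_mult_eq_1')
 have "dlog (A * B) = fmap fls_deriv A * inverse A * (B * inverse B) + fmap fls_deriv B * inverse B * (A * inverse A)"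
  unfolding dlog_def fmap_deriv_mult fps_inverse_mult by (simp add: algebra_simps)
 thus ?thesis by (simp add: 1 dlog_def)
qed

lemma dlog_1: "dlog 1 = 0"
proof -
 have "fmap fls_deriv (1 :: 'a fls fps) = 0" by (rule fps_ext) simp
 thus ?thesis by (simp add: dlog_def)
qed

lemma dlog_prod: "(\<And>i. i \<in> I \<Longrightarrow> A i $ 0 = 1) \<Longrightarrow> dlog (\<Prod>i\<in>I. A i) = (\<Sum>i\<in>I. dlog (A i))"
 by (induction I rule: infinite_finite_induct) (simp_all add: dlog_1 dlog_mult prod_nth_0)

lemma inverse_elem_factor:
 assumes "i > 0"
 shows "inverse (elem_factor i f) = Abs_fps (\<lambda>n. if i dvd n then f ^ (n div i) else 0)" (is "_ = ?G")
proof -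
 have "elem_factor i f * ?G = 1"
 proof (rule fps_ext)
  fix n
  have "(elem_factor i f * ?G) $ n = ?G $ n - f * (fps_X ^ i * ?G) $ n"
   unfolding elem_factor_def by (simp add: algebra_simps)
  also have "\<dots> = (1 :: 'a fps) $ n"
  proof (cases "i dvd n \<and> n \<noteq> 0")
   case True
   then obtain k where k: "n = i * Suc k" by (metis dvdE mult_0_right not0_implies_Suc)
   hence "n - i = i * k" by simp
   thus ?thesis using k assms by (simp add: fps_X_power_mult_nth)
  next
   case False
   thus ?thesis using assms by (auto simp: fps_X_power_mult_nth dvd_minus_self not_less)
  qed
  finally show "(elem_factor i f * ?G) $ n = (1 :: 'a fps) $ n" .
 qed
 thus ?thesis by (rule fps_inverse_unique)
qed

lemma dlog_elem_factor_nth: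
 assumes "i > 0"
 shows "dlog (elem_factor i f) $ n = (if i dvd n \<and> n > 0 then - (f ^ (n div i - 1) * fls_deriv f) else 0)"
proof -
 have "fmap fls_deriv (elem_factor i f) = - (fps_const (fls_deriv f) * fps_X ^ i)"
  by (rule fps_ext) (auto simp: elem_factor_nth fps_X_power_nth)
 hence "dlog (elem_factor i f) $ n = - (fls_deriv f * (fps_X ^ i * inverse (elem_factor i f)) $ n)"
  by (simp add: dlog_def mult.assoc)
 also have "\<dots> = (if i dvd n \<and> n > 0 then - (f ^ (n div i - 1) * fls_deriv f) else 0)"
 proof (cases "i dvd n \<and> n > 0")
  case True
  then obtain k where k: "n = i * Suc k" by (metis dvdE mult_0_right not0_implies_Suc less_nat_zero_code)
  hence "n - i = i * k" by simp
  thus ?thesis using k assms by (simp add: fps_X_power_mult_nth inverse_elem_factor)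
 next
  case False
  thus ?thesis using assms by (auto simp: fps_X_power_mult_nth inverse_elem_factor dvd_minus_self not_less)
 qed
 finally show ?thesis .
qed

lemma dlog_normal_form_nth:
 assumes "n > 0"
 shows "dlog (normal_form f N) $ n = - (\<Sum>i\<in>{i\<in>{1..<N}. i dvd n}. f i ^ (n div i - 1) * fls_deriv (f i))"
proof -
 have "dlog (normal_form f N) $ n = (\<Sum>i\<in>{1..<N}. dlog (elem_factor i (f i)) $ n)"
  unfolding normal_form_def by (subst dlog_prod) (simp_all add: elem_factor_nth_0 fps_sum_nth)
 also have "\<dots> = (\<Sum>i\<in>{1..<N}. if i dvd n then - (f i ^ (n div i - 1) * fls_deriv (f i)) else 0)"
  using assms by (intro sum.cong) (simp_all add: dlog_elem_factor_nth)
 also have "\<dots> = (\<Sum>i\<in>{i\<in>{1..<N}. i dvd n}. - (f i ^ (n div i - 1) * fls_deriv (f i)))"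
  by (rule sum.inter_filter[symmetric]) simp
 finally show ?thesis by (simp only: sum_negf)
qed

text \<open>The coefficients of \<open>dlog\<close> behave like differential forms: by the chain
  rule, passing to a larger field multiplies them by a generator of the different.\<close>

lemma dlog_fmap_nth:
 assumes g: "good K d" and A: "A $ 0 = 1"
 shows "dlog (fmap K A) $ n = K (dlog A $ n) * fls_deriv (K fls_X)"
proof -
 note h = good_fhom[OF g]
 have 1: "fmap fls_deriv (fmap K A) = fmap K (fmap fls_deriv A) * fps_const (fls_deriv (K fls_X))"
  by (rule fps_ext) (simp, rule good_deriv[OF g])
 have "fmap K A * fmap K (inverse A) = fmap K (A * inverse A)" by (simp add: fmap_mult[OF h])
 also have "\<dots> = 1" using A by (simp add: inverse_mult_eq_1' fmap_1[OF h])
 finally have "inverse (fmap K A) = fmap K (inverse A)" by (rule fps_inverse_unique)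
 hence "dlog (fmap K A) = fmap K (dlog A) * fps_const (fls_deriv (K fls_X))"
  by (simp add: dlog_def 1 fmap_mult[OF h] mult_ac)
 thus ?thesis by simp
qed

lemma dlog_pole_bound:
 assumes "pole_bound \<mu> A" "A $ 0 = 1"
 shows "vge (dlog A $ n) (- \<mu> * real n - 1)"
 unfolding dlog_def fps_mult_nth
proof (rule vge_sum)
 fix i assume i: "i \<in> {0..n}"
 have "vge (fls_deriv (A $ i) * inverse A $ (n - i)) ((- \<mu> * real i - 1) + - \<mu> * real (n - i))"
  using assms pole_bound_inverse[OF assms] unfolding pole_bound_def by (intro vge_mult vge_deriv) auto
 moreover have "(- \<mu> * real i - 1) + - \<mu> * real (n - i) = - \<mu> * real n - 1" using i by (simp add: algebra_simps of_nat_diff)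
 ultimately show "vge (fmap fls_deriv A $ i * inverse A $ (n - i)) (- \<mu> * real n - 1)" by (simp only: fmap_nth)
qed

text \<open>The Frobenius kills the logarithmic derivative, so that the Lang equation \<open>F(Y) = Y W\<close> becomes
 \<open>dlog Y = - dlog W\<close>.\<close>

lemma dlog_lang:
 fixes Y W :: "'k::field fls fps"
 assumes p: "prime p" "CHAR('k) = p"
  and Y: "Y $ 0 = 1" and W: "W $ 0 = 1"
  and rel: "\<And>i. i < n \<Longrightarrow> (Y * W) $ i = (Y $ i) ^ p"
 shows "fls_deriv ((Y * W) $ n - (Y $ n) ^ p) = dlog Y $ n + dlog W $ n"
proof -
 define Q where "Q = Y * W - fmap (\<lambda>x. x ^ p) Y"
 have YW: "(Y * W) $ 0 = 1" using Y W by simp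
 have "fmap fls_deriv Q = fmap fls_deriv (Y * W)"
  by (rule fps_ext) (simp add: Q_def fls_deriv_char_power[OF p(2)])
 hence e: "fmap fls_deriv Q * inverse (Y * W) = dlog Y + dlog W"
  using dlog_mult[OF Y W] by (simp add: dlog_def)
 have "(fmap fls_deriv Q * inverse (Y * W)) $ n = (\<Sum>i=0..n. if i = n then fls_deriv (Q $ n) else 0)"
  unfolding fps_mult_nth
 proof (intro sum.cong refl)
  fix i assume "i \<in> {0..n}"
  thus "fmap fls_deriv Q $ i * inverse (Y * W) $ (n - i) = (if i = n then fls_deriv (Q $ n) else 0)"
   using YW rel[of i] by (cases "i = n") (simp_all add: Q_def)
 qed
 thus ?thesis using e by (simp add: Q_def)
qed

subsection \<open>Pole orders along a cyclic tower\<close>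

definition pole :: "'k::zero fls \<Rightarrow> nat" where
 "pole f = nat (- val f)"

definition reduced :: "nat \<Rightarrow> 'k::zero fls \<Rightarrow> bool" where
 "reduced p f \<longleftrightarrow> f = 0 \<or> val f < 0 \<and> \<not> int p dvd val f"

lemma pole_0 [simp]: "pole 0 = 0"
 by (simp add: pole_def)

lemma reduced_pole:
 assumes "reduced p f" "f \<noteq> 0"
 shows "val f = - int (pole f)" "pole f > 0" "\<not> p dvd pole f"
proof -
 show 1: "val f = - int (pole f)" and "pole f > 0"
  using assms by (auto simp: reduced_def pole_def)
 have "\<not> int p dvd - int (pole f)" using assms 1 unfolding reduced_def by metis
 thus "\<not> p dvd pole f" by simp
qed

lemma reduced_vge: "reduced p f \<Longrightarrow> vge f (- real (pole f))"
 using reduced_pole(1)[of p f] by (cases "f = 0") (simp_all add: vge_iff)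

lemma subdegree_deriv:
 fixes f :: "'k::field fls"
 assumes "CHAR('k) = p" "f \<noteq> 0" "\<not> int p dvd val f"
 shows "fls_deriv f \<noteq> 0" "val (fls_deriv f) = val f - 1"
proof -
 have "of_int (val f) \<noteq> (0::'k)"
  using assms(1,3) of_int_eq_0_iff_char_dvd[where 'a='k, of "val f"] by simp
 hence n: "fls_deriv f $$ (val f - 1) \<noteq> 0" using assms(2) by simp
 show "fls_deriv f \<noteq> 0" using fls_nonzeroI[OF n] .
 show "val (fls_deriv f) = val f - 1"
  by (rule fls_subdegree_eqI[OF n]) simp
qed

lemma dlog_term:
 fixes f :: "'k::field fls"
 assumes "CHAR('k) = p" "reduced p f" "f \<noteq> 0" "k > 0"
 shows "f ^ (k - 1) * fls_deriv f \<noteq> 0"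
  "val (f ^ (k - 1) * fls_deriv f) = - int (k * pole f) - 1"
proof -
 note r = reduced_pole[OF assms(2,3)]
 have nd: "\<not> int p dvd val f" using assms(2,3) by (simp add: reduced_def)
 note d = subdegree_deriv[OF assms(1,3) nd]
 show nz: "f ^ (k - 1) * fls_deriv f \<noteq> 0" using d assms(3) by simp
 obtain l where k: "k = Suc l" using assms(4) gr0_implies_Suc by blast
 show "val (f ^ (k - 1) * fls_deriv f) = - int (k * pole f) - 1"
  using d assms(3) r(1) by (simp add: k fls_subdegree_pow algebra_simps)
qed

primrec rho :: "nat \<Rightarrow> (nat \<Rightarrow> 'k::zero fls) \<Rightarrow> nat \<Rightarrow> nat" where
 "rho p f 0 = pole (f 1)"
| "rho p f (Suc r) = max (p * rho p f r) (pole (f (p ^ Suc r)))"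

lemma rho_ge: "a \<le> r \<Longrightarrow> p ^ (r - a) * pole (f (p ^ a)) \<le> rho p f r"
proof (induction r)
 case (Suc r)
 show ?case
 proof (cases "a = Suc r")
  case False
  hence "p ^ (r - a) * pole (f (p ^ a)) \<le> rho p f r" using Suc by simp
  hence "p * (p ^ (r - a) * pole (f (p ^ a))) \<le> p * rho p f r" by simp
  moreover have "p ^ (Suc r - a) = p * p ^ (r - a)" using False Suc.prems by (simp add: Suc_diff_le)
  ultimately show ?thesis by (simp add: le_max_iff_disj mult.assoc)
 qed simp
qed simp

text \<open>With \<open>rho_ge\<close>, this unfolds the recursion into the maximum of p^(r - a) *
  \<open>pole (f (p ^ a))\<close> over a \<le> r. These numbers, increased by 1, are the pole orders
  of the terms of the logarithmic derivative at index p^r.\<close>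

lemma rho_attained: "\<exists>a\<le>r. rho p f r = p ^ (r - a) * pole (f (p ^ a))"
proof (induction r)
 case (Suc r)
 then obtain a where a: "a \<le> r" "rho p f r = p ^ (r - a) * pole (f (p ^ a))" by blast
 show ?case
 proof (cases "p * rho p f r \<le> pole (f (p ^ Suc r))")
  case True
  thus ?thesis by (intro exI[of _ "Suc r"]) (simp add: max_def)
 next
  case False
  thus ?thesis using a by (intro exI[of _ a]) (simp add: max_def Suc_diff_le)
 qed
qed simp

lemma rho_pos:
 assumes "p > 0" "pole (f 1) > 0"
 shows "rho p f r > 0"
 by (induction r) (use assms in \<open>auto simp: less_max_iff_disj\<close>)

text \<open>Since \<open>rho\<close> grows at least by the factor p, p^i rho_i is at most p^(2i - r)
  rho_r, and the sum of the p^(2i) is the geometric series (p^(2r) - 1)/(p^2 - 1).\<close>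

lemma rho_sum_bound:
 assumes "p > 1"
 shows "real p ^ r * (\<Sum>i<r. real p ^ i * real (rho p f i)) * (real p ^ 2 - 1) \<le> real (rho p f r) * (real p ^ (2 * r) - 1)"
proof (induction r)
 case (Suc r)
 let ?p = "real p" and ?R = "real (rho p f r)"
 define S where "S = (\<Sum>i<r. real p ^ i * real (rho p f i))"
 have p: "?p > 1" using assms by simp
 have e: "?p ^ (2 * r) = ?p ^ r * ?p ^ r" "?p ^ (2 * Suc r) = ?p * ?p * (?p ^ r * ?p ^ r)"
  by (simp_all add: mult_2 power_add)
 have pp: "?p ^ (2 * Suc r) \<ge> 1" using p by (intro one_le_power) simp
 have "?p ^ Suc r * (S + ?p ^ r * ?R) * (?p ^ 2 - 1) =
   ?p * (?p ^ r * S * (?p ^ 2 - 1)) + ?p * ?R * (?p ^ (2 * r) * (?p ^ 2 - 1))"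
  unfolding e by (simp add: algebra_simps power2_eq_square)
 also have "\<dots> \<le> ?p * (?R * (?p ^ (2 * r) - 1)) + ?p * ?R * (?p ^ (2 * r) * (?p ^ 2 - 1))"
  using Suc p by (intro add_right_mono mult_left_mono) (simp_all add: S_def)
 also have "\<dots> = (?p * ?R) * (?p ^ (2 * Suc r) - 1)"
  unfolding e by (simp add: algebra_simps power2_eq_square)
 also have "\<dots> \<le> real (rho p f (Suc r)) * (?p ^ (2 * Suc r) - 1)"
 proof (rule mult_right_mono)
  show "?p * ?R \<le> real (rho p f (Suc r))" by (simp flip: of_nat_mult)
 qed (use pp in simp)
 finally show ?case by (simp add: S_def)
qed simp

lemma normal_form_pole_bound:
 fixes f :: "nat \<Rightarrow> 'k::field fls"
 assumes g: "good K d" and f: "\<And>i. 1 \<le> i \<Longrightarrow> i < N \<Longrightarrow> reduced p (f i) \<and> real (pole (f i)) \<le> sl * real i"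
  and l: "sl \<ge> 0"
 shows "pole_bound (real d * sl) (fmap K (normal_form f N))"
 unfolding fmap_normal_form[OF good_fhom[OF g]] unfolding normal_form_def
proof (rule pole_bound_prod)
 fix i assume i: "i \<in> {1..<N}"
 have "vge (f i) (- sl * real i)"
  using f[of i] i reduced_vge[of p "f i"] by (auto elim: vge_mono)
 from good_vge[OF g this] have v: "vge (K (f i)) (- (real d * sl) * real i)" by (simp add: algebra_simps)
 show "pole_bound (real d * sl) (elem_factor i (K (f i)))"
  unfolding pole_bound_def elem_factor_nth
 proof (intro allI vge_diff)
  fix n show "vge (if n = 0 then 1 else (0 :: 'k fls)) (- (real d * sl) * real n)" using l by (simp add: vge_1)
  show "vge (if n = i then K (f i) else 0) (- (real d * sl) * real n)" using v by auto
 qed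
qed

text \<open>The equation reads wp(Y_n) = sum of Y_i V_(n-i) over i < n. Inductively the right side
  has pole order at most \<mu> n, and \<open>wp_vge\<close> divides it by p.\<close>

lemma lang_pole_bound:
 fixes Y V :: "'k::field fls fps"
 assumes p: "p > 1" and V: "pole_bound \<mu> V" "V $ 0 = 1" and \<mu>: "\<mu> \<ge> 0"
  and Y: "Y $ 0 = 1" "\<And>n. n \<ge> N \<Longrightarrow> Y $ n = 0"
  and rel: "\<And>n. n < N \<Longrightarrow> (Y * V) $ n = (Y $ n) ^ p"
 shows "pole_bound (\<mu> / real p) Y"
 unfolding pole_bound_def
proof
 fix n show "vge (Y $ n) (- (\<mu> / real p) * real n)"
 proof (induction n rule: less_induct)
  case (less n)
  show ?case
  proof (cases "n = 0 \<or> n \<ge> N")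
   case True
   thus ?thesis using Y by (auto intro: vge_1)
  next
   case False
   hence n: "0 < n" "n < N" by auto
   have "(Y * V) $ n = (\<Sum>i<n. Y $ i * V $ (n - i)) + Y $ n * V $ 0"
    unfolding fps_mult_nth by (simp add: atLeast0AtMost lessThan_Suc_atMost[symmetric])
   hence wpy: "wp p (Y $ n) = (\<Sum>i<n. Y $ i * V $ (n - i))"
    using rel[OF n(2)] V(2) by (simp add: wp_def algebra_simps)
   have "vge (wp p (Y $ n)) (- (\<mu> * real n))"
    unfolding wpy
   proof (rule vge_sum)
    fix i assume i: "i \<in> {..<n}"
    have "vge (Y $ i * V $ (n - i)) (- (\<mu> / real p) * real i + - \<mu> * real (n - i))"
    proof (rule vge_mult)
     show "vge (Y $ i) (- (\<mu> / real p) * real i)" by (rule less) (use i in simp)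
     show "vge (V $ (n - i)) (- \<mu> * real (n - i))" using V(1) unfolding pole_bound_def by blast
    qed
    moreover have "- (\<mu> * real n) \<le> - (\<mu> / real p) * real i + - \<mu> * real (n - i)"
    proof -
     have "\<mu> / real p \<le> \<mu>" using \<mu> p mult_left_mono[of 1 "real p" \<mu>] by (simp add: field_simps)
     hence "(\<mu> / real p) * real i \<le> \<mu> * real i" by (intro mult_right_mono) auto
     thus ?thesis using i by (simp add: algebra_simps of_nat_diff)
    qed
    ultimately show "vge (Y $ i * V $ (n - i)) (- (\<mu> * real n))" by (rule vge_mono)
   qed
   from wp_vge[OF p this] show ?thesis using \<mu> by simp
  qed
 qed
qed

text \<open>At indices \<open>I = i\<^sub>1 p^k\<close>, where \<open>i\<^sub>1\<close> is minimal among the indices of maximal slope, a single term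
 of \<open>dlog W\<close> dominates: all indices of maximal slope have the same \<open>p\<close>-adic valuation.\<close>

lemma dlog_normal_form_dominant:
 fixes f :: "nat \<Rightarrow> 'k::field fls" and k :: nat
 assumes p: "prime p" "CHAR('k) = p"
  and f: "\<And>i. 1 \<le> i \<Longrightarrow> i < N \<Longrightarrow> reduced p (f i)"
  and i1: "1 \<le> i1" "i1 < N" "f i1 \<noteq> 0"
  and max: "\<And>i. 1 \<le> i \<Longrightarrow> i < N \<Longrightarrow> pole (f i) * i1 \<le> pole (f i1) * i"
  and min: "\<And>i. 1 \<le> i \<Longrightarrow> i < i1 \<Longrightarrow> pole (f i) * i1 < pole (f i1) * i"
 defines "I \<equiv> i1 * p ^ k"
 shows "dlog (normal_form f N) $ I \<noteq> 0 \<and>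
  val (dlog (normal_form f N) $ I) = - int (p ^ k * pole (f i1)) - 1"
proof -
 have p1: "p > 1" using p(1) prime_gt_1_nat by blast
 have I0: "I > 0" using i1 p1 by (simp add: I_def)
 let ?J = "{i\<in>{1..<N}. i dvd I}"
 let ?t = "\<lambda>i. f i ^ (I div i - 1) * fls_deriv (f i)"
 note r1 = f[OF i1(1,2)]
 note P1 = reduced_pole[OF r1 i1(3)]
 have Id: "I div i1 = p ^ k" using i1 by (simp add: I_def)
 have J: "finite ?J" "i1 \<in> ?J" using i1 by (auto simp: I_def)
 have t1: "?t i1 \<noteq> 0" "val (?t i1) = - int (p ^ k * pole (f i1)) - 1"
  using dlog_term[OF p(2) r1 i1(3), of "p ^ k"] p1 by (simp_all add: Id)
 have t: "vge (?t i) (of_int (- int (p ^ k * pole (f i1)) - 1 + 1))" if i: "i \<in> ?J - {i1}" for i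
 proof (cases "f i = 0")
  case False
  have i': "1 \<le> i" "i < N" "i dvd I" "i \<noteq> i1" using i by auto
  note P = reduced_pole[OF f[OF i'(1,2)] False]
  define e where "e = I div i"
  have e: "I = i * e" "e > 0" using i' I0 by (auto simp: e_def dvd_div_eq_0_iff)
  \<comment> \<open>Otherwise i has maximal slope too. Minimality of i1 excludes i < i1. Pole orders
    are prime to p, so i and i1 have the same p-part; then i dividing i1 p^k forces i to divide i1,
    which excludes i > i1.\<close>
  have "pole (f i) * i1 \<noteq> pole (f i1) * i"
  proof
   assume eq: "pole (f i) * i1 = pole (f i1) * i"
   have "\<not> i < i1" using min[of i] i' eq by auto
   hence gt: "i > i1" using i' by simp
   have c: "coprime (p ^ l) (pole (f i))" for l using P(3) p(1) by (simp add: prime_imp_coprime)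
   have c1: "coprime (p ^ l) (pole (f i1))" for l using P1(3) p(1) by (simp add: prime_imp_coprime)
   define v where "v = multiplicity p i1"
   obtain i1' where i1': "i1 = p ^ v * i1'" "\<not> p dvd i1'"
    using multiplicity_decompose'[of i1 p] i1 p1 unfolding v_def by (metis One_nat_def nat_neq_iff not_le zero_less_Suc prime_elem_not_unit p(1) prime_imp_prime_elem)
   obtain w i2 where i2: "i = p ^ w * i2" "\<not> p dvd i2"
    using multiplicity_decompose'[of i p] i' p1 by (metis One_nat_def nat_neq_iff not_le zero_less_Suc prime_elem_not_unit p(1) prime_imp_prime_elem)
   have "p ^ v dvd pole (f i1) * i" using eq by (metis dvd_mult dvd_triv_left i1'(1))
   hence "p ^ v dvd i" using c1 coprime_dvd_mult_right_iff by blast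
   hence "p ^ v dvd p ^ w" unfolding i2(1)
    using i2(2) p(1) by (metis coprime_dvd_mult_left_iff coprime_power_left_iff prime_imp_coprime)
   moreover have "p ^ w dvd pole (f i) * i1" using eq by (metis dvd_mult dvd_triv_left i2(1))
   hence "p ^ w dvd i1" using c coprime_dvd_mult_right_iff by blast
   hence "p ^ w dvd p ^ v" unfolding i1'(1)
    using i1'(2) p(1) by (metis coprime_dvd_mult_left_iff coprime_power_left_iff prime_imp_coprime)
   ultimately have vw: "p ^ v = p ^ w" by (rule dvd_antisym)
   have "i2 dvd p ^ k * i1" using i'(3) unfolding I_def i2(1) by (metis dvd_mult_right mult.commute)
   hence "i2 dvd i1" using i2(2) p(1) by (metis coprime_commute coprime_dvd_mult_right_iff coprime_power_left_iff prime_imp_coprime)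
   hence "i2 dvd i1'" unfolding i1'(1) using i2(2) p(1) by (metis coprime_commute coprime_dvd_mult_right_iff coprime_power_left_iff prime_imp_coprime)
   hence "i dvd i1" unfolding i2(1) i1'(1) vw by simp
   hence "i \<le> i1" using i1 by (simp add: dvd_imp_le)
   thus False using gt by simp
  qed
  hence "pole (f i) * i1 < pole (f i1) * i" using max[OF i'(1,2)] by simp
  hence "(pole (f i) * i1) * e < (pole (f i1) * i) * e" using e(2) by simp
  hence "i1 * (e * pole (f i)) < pole (f i1) * (i * e)" by (simp add: mult_ac)
  hence "i1 * (e * pole (f i)) < i1 * (p ^ k * pole (f i1))"
   unfolding e(1)[symmetric] I_def by (simp add: mult_ac)
  hence "e * pole (f i) < p ^ k * pole (f i1)" by simp
  thus ?thesis unfolding vge_int using dlog_term(2)[OF p(2) f[OF i'(1,2)] False e(2)]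
   by (simp add: e_def flip: of_nat_mult of_nat_power)
 qed simp
 have "vge (\<Sum>i\<in>?J - {i1}. ?t i) (of_int (- int (p ^ k * pole (f i1)) - 1 + 1))" by (rule vge_sum[OF t])
 note vs = this
 have lt: "real_of_int (val (?t i1)) < real_of_int (- int (p ^ k * pole (f i1)) - 1 + 1)"
  unfolding t1(2) of_int_less_iff by simp
 have s: "?t i1 + (\<Sum>i\<in>?J - {i1}. ?t i) \<noteq> 0"
  "val (?t i1 + (\<Sum>i\<in>?J - {i1}. ?t i)) = - int (p ^ k * pole (f i1)) - 1"
  using subdegree_add_vge[OF t1(1) vs lt] unfolding t1(2) by blast+
 have "dlog (normal_form f N) $ I = - (?t i1 + (\<Sum>i\<in>?J - {i1}. ?t i))"
  unfolding dlog_normal_form_nth[OF I0] by (subst sum.remove[OF J]) (rule refl)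
 thus ?thesis using s
  by (simp only: neg_equal_0_iff_equal fls_uminus_subdegree simp_thms not_False_eq_True)
qed

text \<open>Bounds the f_i of arbitrary index. At a suitable I \<ge> N/p, the logarithmic derivative
  of K(W) has pole order N sl I - E + 1 by dominance. It is the negative of that of Y, whose pole
  order is at most N sl I/p + 1. Comparison gives N sl I (1 - 1/p) \<le> E.\<close>

lemma lang_slope_bound:
 fixes Y :: "'k::field fls fps" and f :: "nat \<Rightarrow> 'k fls"
 assumes p: "prime p" "CHAR('k) = p"
  and g: "good K N" and D: "fls_deriv (K fls_X) \<noteq> 0"
  and f: "\<And>i. 1 \<le> i \<Longrightarrow> i < N \<Longrightarrow> reduced p (f i)"
  and Y: "Y $ 0 = 1" "\<And>n. n \<ge> N \<Longrightarrow> Y $ n = 0"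
  and rel: "\<And>n. n < N \<Longrightarrow> (Y * fmap K (normal_form f N)) $ n = (Y $ n) ^ p"
  and E: "E = real_of_int (val (fls_deriv (K fls_X))) - real N + 1" "E \<ge> 0"
 shows "\<exists>sl\<ge>0. (\<forall>i. 1 \<le> i \<longrightarrow> i < N \<longrightarrow> real (pole (f i)) \<le> sl * real i) \<and>
  real N * sl * real N * (real p - 1) \<le> real p * (real p * E)"
proof (cases "\<forall>i. 1 \<le> i \<longrightarrow> i < N \<longrightarrow> f i = 0")
 case True
 thus ?thesis using E(2) by (intro exI[of _ 0]) simp
next
 case False
 have p1: "p > 1" using p(1) prime_gt_1_nat by blast
 let ?s = "\<lambda>i. real (pole (f i)) / real i"
 let ?J = "{1..<N}"
 have J: "finite ?J" "?J \<noteq> {}" using False by auto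
 define sl where "sl = Max (?s ` ?J)"
 have le: "?s i \<le> sl" if "i \<in> ?J" for i using that J by (simp add: sl_def)
 have "sl \<in> ?s ` ?J" unfolding sl_def using J by (intro Max_in) auto
 then obtain i0 where i0: "i0 \<in> ?J" "?s i0 = sl" by auto
 define i1 where "i1 = (LEAST i. i \<in> ?J \<and> ?s i = sl)"
 have i1: "i1 \<in> ?J" "?s i1 = sl" using LeastI[of "\<lambda>i. i \<in> ?J \<and> ?s i = sl" i0] i0 by (auto simp: i1_def)
 have least: "\<not> (i \<in> ?J \<and> ?s i = sl)" if "i < i1" for i using that unfolding i1_def by (rule not_less_Least)
 have i1': "1 \<le> i1" "i1 < N" using i1 by auto
 obtain i2 where i2: "i2 \<in> ?J" "f i2 \<noteq> 0" using False by auto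
 have "pole (f i2) > 0" using reduced_pole(2)[OF f i2(2)] i2(1) by simp
 hence "0 < ?s i2" using i2(1) by simp
 hence sl0: "sl > 0" using le[OF i2(1)] by linarith
 hence fi1: "f i1 \<noteq> 0" using i1(2) by auto
 have mx: "pole (f i) * i1 \<le> pole (f i1) * i" if "1 \<le> i" "i < N" for i
 proof -
  have "?s i \<le> ?s i1" using le[of i] that i1(2) by simp
  hence "real (pole (f i)) * real i1 \<le> real (pole (f i1)) * real i"
   using that i1' by (simp add: field_simps)
  thus ?thesis by (metis of_nat_le_iff of_nat_mult)
 qed
 have mn: "pole (f i) * i1 < pole (f i1) * i" if "1 \<le> i" "i < i1" for i
 proof -
  have "?s i \<noteq> ?s i1" using least[OF that(2)] that i1(2) i1' by auto
  hence "real (pole (f i)) * real i1 \<noteq> real (pole (f i1)) * real i"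
   using that i1' by (auto simp: field_simps)
  hence "pole (f i) * i1 \<noteq> pole (f i1) * i" by (metis of_nat_mult)
  thus ?thesis using mx[of i] that i1' by simp
 qed
 \<comment> \<open>The largest k with i1 p^k < N is wanted: the Lang relation is available only
   below N, while I \<ge> N/p keeps the loss in the final bound down to one factor p.\<close>
 have "\<exists>k. N \<le> i1 * p ^ Suc k"
 proof
  have "N < 2 ^ N" by (rule less_exp)
  also have "\<dots> \<le> p ^ N" using p1 by (intro power_mono) auto
  also have "\<dots> \<le> 1 * p ^ Suc N" using p1 by simp
  also have "\<dots> \<le> i1 * p ^ Suc N" using i1'(1) by (intro mult_right_mono) auto
  finally show "N \<le> i1 * p ^ Suc N" by simp
 qed
 define k where "k = (LEAST k. N \<le> i1 * p ^ Suc k)"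
 have k1: "N \<le> i1 * p ^ Suc k" unfolding k_def by (rule LeastI_ex) fact
 have k2: "i1 * p ^ k < N"
 proof (cases k)
  case (Suc l)
  hence "\<not> N \<le> i1 * p ^ Suc l" using not_less_Least[of l "\<lambda>k. N \<le> i1 * p ^ Suc k"] by (simp add: k_def)
  thus ?thesis using Suc by simp
 qed (use i1' in simp)
 define I where "I = i1 * p ^ k"
 define W where "W = normal_form f N"
 have dom: "dlog W $ I \<noteq> 0" "val (dlog W $ I) = - int (p ^ k * pole (f i1)) - 1"
  using dlog_normal_form_dominant[OF p f i1' fi1 mx mn] unfolding I_def W_def by blast+
 have slI: "real (p ^ k * pole (f i1)) = sl * real I"
  using i1(2) i1' by (simp add: I_def field_simps)
 have fb: "reduced p (f i) \<and> real (pole (f i)) \<le> sl * real i" if "1 \<le> i" "i < N" for i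
  using le[of i] f[OF that] that by (simp add: field_simps)
 let ?V = "fmap K W"
 have W0: "W $ 0 = 1" by (simp add: W_def normal_form_nth_0)
 have V0: "?V $ 0 = 1" by (simp add: W0 fhom_1[OF good_fhom[OF g]])
 have Vb: "pole_bound (real N * sl) ?V"
  unfolding W_def using sl0 by (intro normal_form_pole_bound[OF g fb]) auto
 have Yb: "pole_bound (real N * sl / real p) Y"
  by (rule lang_pole_bound[OF p1 Vb V0 _ Y rel[folded W_def]]) (use sl0 in simp)
 have "fls_deriv ((Y * ?V) $ I - (Y $ I) ^ p) = dlog Y $ I + dlog ?V $ I"
  by (rule dlog_lang[OF p Y(1) V0]) (use rel[folded W_def] k2 in \<open>simp add: I_def\<close>)
 hence "dlog ?V $ I = - (dlog Y $ I)"
  using rel[of I, folded W_def] k2 by (simp add: I_def eq_neg_iff_add_eq_0 add.commute)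
 moreover have "vge (- (dlog Y $ I)) (- (real N * sl / real p) * real I - 1)"
  by (rule vge_uminus[OF dlog_pole_bound[OF Yb Y(1)]])
 ultimately have v: "vge (dlog ?V $ I) (- (real N * sl / real p) * real I - 1)" by simp
 have e: "dlog ?V $ I = K (dlog W $ I) * fls_deriv (K fls_X)" by (rule dlog_fmap_nth[OF g W0])
 have nz: "K (dlog W $ I) \<noteq> 0" using dom(1) fhom_eq_0[OF good_fhom[OF g]] by simp
 have "real_of_int (val (dlog ?V $ I)) = - real N * (sl * real I + 1) + (E + real N - 1)"
  unfolding e using nz D by (simp add: good_subdegree[OF g] dom(2) E(1) algebra_simps flip: slI)
 moreover have "dlog ?V $ I \<noteq> 0" unfolding e using nz D by simp
 ultimately have "- (real N * sl / real p) * real I - 1 \<le> - real N * (sl * real I + 1) + (E + real N - 1)"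
  using v by (simp add: vge_iff)
 hence "real N * sl * real I - (real N * sl * real I) / real p \<le> E" by (simp add: algebra_simps)
 hence b: "real N * sl * real I * (real p - 1) \<le> real p * E" using p1 by (simp add: field_simps)
 have "real N \<le> real p * real I"
 proof -
  have "N \<le> p * I" using k1 by (simp add: I_def mult_ac)
  thus ?thesis by (metis of_nat_le_iff of_nat_mult)
 qed
 hence "real N * sl * real N * (real p - 1) \<le> real N * sl * (real p * real I) * (real p - 1)"
  using sl0 p1 by (intro mult_right_mono mult_left_mono) auto
 also have "\<dots> = real p * (real N * sl * real I * (real p - 1))" by simp
 also have "\<dots> \<le> real p * (real p * E)" using b p1 by (intro mult_left_mono) auto
 finally show ?thesis using sl0 fb by (intro exI[of _ sl]) auto
qed

text \<open>In a tower with normal form \<open>f\<close>, the upper jumps are the \<open>rho p f r / m\<close>, the lower jumps the \<open>jump p f r\<close>,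
 and \<open>diff_exp\<close> determines the different.\<close>

definition diff_exp :: "nat \<Rightarrow> (nat \<Rightarrow> 'k::zero fls) \<Rightarrow> nat \<Rightarrow> nat" where
 "diff_exp p f r = (p - 1) * (\<Sum>i<r. p ^ i * rho p f i)"

definition jump :: "nat \<Rightarrow> (nat \<Rightarrow> 'k::zero fls) \<Rightarrow> nat \<Rightarrow> int" where
 "jump p f r = int (p ^ r * rho p f r) - int (diff_exp p f r)"

lemma diff_exp_Suc: "diff_exp p f (Suc r) = diff_exp p f r + (p - 1) * (p ^ r * rho p f r)"
 by (simp add: diff_exp_def algebra_simps)

text \<open>Passage from upper to lower numbering: between these upper jumps the inverse Herbrand
  function has slope m p^(r+1), and the factor m is absorbed by measuring upper jumps as
  \<open>rho\<close> / m.\<close>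

lemma jump_Suc:
 assumes "p > 0"
 shows "jump p f (Suc r) = jump p f r + int (p ^ Suc r) * (int (rho p f (Suc r)) - int (rho p f r))"
proof -
 obtain l where p: "p = Suc l" using assms gr0_implies_Suc by blast
 have "int (p ^ Suc r) = int (p ^ r) + int (l * p ^ r)" by (simp add: p)
 thus ?thesis unfolding jump_def diff_exp_Suc by (simp add: p algebra_simps del: rho.simps)
qed

lemma jump_strict_mono:
 assumes "p > 1" "pole (f 1) > 0"
 shows "jump p f r < jump p f (Suc r)"
proof -
 have "rho p f r > 0" by (rule rho_pos) (use assms in auto)
 hence "1 * rho p f r < p * rho p f r" using assms(1) by simp
 hence "rho p f r < rho p f (Suc r)" by (simp add: less_max_iff_disj)
 hence "int (p ^ Suc r) * (int (rho p f (Suc r)) - int (rho p f r)) > 0"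
  using assms(1) by (intro mult_pos_pos) auto
 thus ?thesis using jump_Suc[of p f r] assms(1) by simp
qed

lemma rho_cong: "(\<And>i. i \<le> r \<Longrightarrow> f (p ^ i) = h (p ^ i)) \<Longrightarrow> rho p f r = rho p h r"
proof (induction r)
 case 0
 from 0[of 0] show ?case by simp
next
 case (Suc r)
 have "rho p f r = rho p h r" by (rule Suc.IH) (rule Suc.prems, simp)
 thus ?case using Suc.prems[of "Suc r"] by simp
qed

lemma jump_less:
 assumes "p > 1" "pole (f 1) > 0" "i < r"
 shows "jump p f i < jump p f r"
 using assms(3) by (induction rule: less_Suc_induct) (use jump_strict_mono[of p f, OF assms(1,2)] in auto)

lemma jump_gt_0:
 assumes "p > 1" "pole (f 1) > 0"
 shows "0 < jump p f i"
proof -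
 have "0 < jump p f 0" using assms(2) by (simp add: jump_def diff_exp_def)
 thus ?thesis using jump_less[of p f 0 i, OF assms] by (cases "i = 0") auto
qed

lemma diff_exp_cong:
 assumes "\<And>i. i < r \<Longrightarrow> f (p ^ i) = h (p ^ i)"
 shows "diff_exp p f r = diff_exp p h r"
proof -
 have "rho p f i = rho p h i" if "i < r" for i by (rule rho_cong) (use assms that in auto)
 thus ?thesis by (simp add: diff_exp_def)
qed

lemma jump_cong: "(\<And>i. i \<le> r \<Longrightarrow> f (p ^ i) = h (p ^ i)) \<Longrightarrow> jump p f r = jump p h r"
 unfolding jump_def using rho_cong[of r f p h] diff_exp_cong[of r f p h] by simp

lemma wild_multiplicity:
 assumes "p ^ r dvd (i :: nat)" "\<not> p ^ Suc r dvd i"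
 shows "multiplicity p i = r"
 using assms by (intro multiplicity_eqI)

lemma wild_multiplicity_less:
 assumes "\<not> p ^ r dvd (i :: nat)"
 shows "multiplicity p i < r"
proof (rule ccontr)
 assume "\<not> multiplicity p i < r"
 hence "p ^ r dvd p ^ multiplicity p i" by (simp add: le_imp_power_dvd)
 thus False using assms multiplicity_dvd dvd_trans by blast
qed

text \<open>In terms of S, the sum of the p^i rho_i over i < r, the claim is (2p - 1) S < p^r rho_r.
  It follows from \<open>rho_sum_bound\<close> because 2p - 1 \<le> p^2 - 1, with equality for p =
  2.\<close>

lemma jump_dominates:
 assumes p: "p > 1" and r: "rho p f r > 0"
 shows "real p * real (diff_exp p f r) < (real p - 1) * real_of_int (jump p f r)"
proof -
 let ?p = "real p" and ?R = "real (rho p f r)" and ?N = "real p ^ r"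
 define S where "S = (\<Sum>i<r. ?p ^ i * real (rho p f i))"
 have p2: "?p \<ge> 2" using p by simp
 have S0: "S \<ge> 0" unfolding S_def by (intro sum_nonneg) simp
 have N: "?N > 0" using p by simp
 have E: "real (diff_exp p f r) = (?p - 1) * S"
  using p by (simp add: diff_exp_def S_def of_nat_diff)
 have j: "real_of_int (jump p f r) = ?N * ?R - (?p - 1) * S"
  unfolding jump_def using E by simp
 have "2 * ?p - 1 \<le> ?p ^ 2 - 1" using p2 by (simp add: power2_eq_square)
 hence "?N * S * (2 * ?p - 1) \<le> ?N * S * (?p ^ 2 - 1)"
  using N S0 by (intro mult_left_mono) auto
 also have "\<dots> \<le> ?R * (?p ^ (2 * r) - 1)" using rho_sum_bound[OF p, of r f] by (simp add: S_def)
 also have "\<dots> < ?R * (?N * ?N)" using r by (simp add: mult_2 power_add)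
 finally have "?N * (S * (2 * ?p - 1)) < ?N * (?R * ?N)" by (simp add: mult_ac)
 hence "S * (2 * ?p - 1) < ?R * ?N" using N by simp
 hence "(?p - 1) * (S * (2 * ?p - 1)) < (?p - 1) * (?R * ?N)" using p2 by (intro mult_strict_left_mono) auto
 thus ?thesis unfolding E j by (simp add: algebra_simps)
qed

text \<open>Only indices p^b divide p^r. Their terms have pole orders p^(r-b)
  \<open>pole (f (p ^ b))\<close> + 1, and the poles being prime to p, the factors p^(r-b) make
  these orders distinct. So a single term of order \<open>rho p f r\<close> + 1 dominates.\<close>

lemma dlog_normal_form_top:
 fixes f :: "nat \<Rightarrow> 'k::field fls"
 assumes p: "prime p" "CHAR('k) = p"
  and f: "\<And>i. 1 \<le> i \<Longrightarrow> i \<le> p ^ r \<Longrightarrow> reduced p (f i)" and r: "rho p f r > 0"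
 shows "dlog (normal_form f (Suc (p ^ r))) $ (p ^ r) \<noteq> 0 \<and>
  val (dlog (normal_form f (Suc (p ^ r))) $ (p ^ r)) = - int (rho p f r) - 1"
proof -
 have p1: "p > 1" using p(1) prime_gt_1_nat by blast
 have N0: "p ^ r > 0" using p1 by simp
 let ?J = "{i\<in>{1..<Suc (p ^ r)}. i dvd p ^ r}"
 let ?t = "\<lambda>i. f i ^ (p ^ r div i - 1) * fls_deriv (f i)"
 obtain a where a: "a \<le> r" "rho p f r = p ^ (r - a) * pole (f (p ^ a))" using rho_attained by blast
 have dv: "p ^ r div p ^ b = p ^ (r - b)" if "b \<le> r" for b using that p1 by (simp add: power_diff)
 have le: "1 \<le> p ^ b" "p ^ b \<le> p ^ r" if "b \<le> r" for b using that p1 by (auto intro: power_increasing)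
 have fa: "f (p ^ a) \<noteq> 0" using r a(2) by (auto)
 have J: "finite ?J" "p ^ a \<in> ?J" using le[OF a(1)] a(1) by (auto simp: le_imp_power_dvd)
 have pa: "p ^ (r - a) > 0" using p1 by simp
 have t1: "?t (p ^ a) \<noteq> 0" "val (?t (p ^ a)) = - int (rho p f r) - 1"
  using dlog_term[OF p(2) f[OF le[OF a(1)]] fa pa] unfolding dv[OF a(1)] a(2)
  by blast+
 have t: "vge (?t i) (of_int (- int (rho p f r) - 1 + 1))" if i: "i \<in> ?J - {p ^ a}" for i
 proof (cases "f i = 0")
  case False
  obtain b where b: "b \<le> r" "i = p ^ b" using i p(1) divides_primepow_nat by (metis (mono_tags, lifting) DiffD1 mem_Collect_eq)
  have ab: "a \<noteq> b" using i b by auto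
  have fb: "f (p ^ b) \<noteq> 0" using False b by simp
  note Pb = reduced_pole(3)[OF f[OF le[OF b(1)]] fb] and Pa = reduced_pole(3)[OF f[OF le[OF a(1)]] fa]
  have "p ^ (r - b) * pole (f (p ^ b)) \<noteq> rho p f r"
  proof
   assume eq: "p ^ (r - b) * pole (f (p ^ b)) = rho p f r"
   show False
   proof (cases "a < b")
    case True
    hence "r - a = r - b + Suc (b - a - 1)" using b(1) by simp
    hence "p ^ (r - a) = p ^ (r - b) * (p * p ^ (b - a - 1))"
     by (simp only: power_add power_Suc)
    hence "p ^ (r - b) * pole (f (p ^ b)) = p ^ (r - b) * (p * (p ^ (b - a - 1) * pole (f (p ^ a))))"
     using eq a(2) by (simp add: mult_ac)
    hence "pole (f (p ^ b)) = p * (p ^ (b - a - 1) * pole (f (p ^ a)))" using p1 by simp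
    thus False using Pb by simp
   next
    case False
    hence "r - b = r - a + Suc (a - b - 1)" using a(1) ab by simp
    hence "p ^ (r - b) = p ^ (r - a) * (p * p ^ (a - b - 1))"
     by (simp only: power_add power_Suc)
    hence "p ^ (r - b) * pole (f (p ^ b)) = p ^ (r - a) * (p * (p ^ (a - b - 1) * pole (f (p ^ b))))"
     by (simp only: mult.assoc)
    hence "p ^ (r - a) * pole (f (p ^ a)) = p ^ (r - a) * (p * (p ^ (a - b - 1) * pole (f (p ^ b))))"
     using eq a(2) by (simp only: )
    hence "pole (f (p ^ a)) = p * (p ^ (a - b - 1) * pole (f (p ^ b)))" using p1 by simp
    thus False using Pa by simp
   qed
  qed
  hence "p ^ (r - b) * pole (f (p ^ b)) < rho p f r" using rho_ge[OF b(1), of p f] by simp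
  hence "int (p ^ (r - b) * pole (f (p ^ b))) < int (rho p f r)" by (simp only: of_nat_less_iff)
  moreover have "val (?t i) = - int (p ^ (r - b) * pole (f (p ^ b))) - 1"
   using dlog_term(2)[OF p(2) f[OF le[OF b(1)]] fb, of "p ^ (r - b)"] p1 unfolding b(2) dv[OF b(1)] by simp
  ultimately show ?thesis unfolding vge_int by linarith
 qed simp
 have vs: "vge (\<Sum>i\<in>?J - {p ^ a}. ?t i) (of_int (- int (rho p f r) - 1 + 1))" by (rule vge_sum[OF t])
 have lt: "real_of_int (val (?t (p ^ a))) < real_of_int (- int (rho p f r) - 1 + 1)"
  unfolding t1(2) of_int_less_iff by simp
 have s: "?t (p ^ a) + (\<Sum>i\<in>?J - {p ^ a}. ?t i) \<noteq> 0"
  "val (?t (p ^ a) + (\<Sum>i\<in>?J - {p ^ a}. ?t i)) = - int (rho p f r) - 1"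
  using subdegree_add_vge[OF t1(1) vs lt] unfolding t1(2) by blast+
 have "dlog (normal_form f (Suc (p ^ r))) $ (p ^ r) = - (?t (p ^ a) + (\<Sum>i\<in>?J - {p ^ a}. ?t i))"
  unfolding dlog_normal_form_nth[OF N0] by (subst sum.remove[OF J]) (rule refl)
 thus ?thesis using s
  by (simp only: neg_equal_0_iff_equal fls_uminus_subdegree simp_thms not_False_eq_True)
qed

text \<open>Supplies what \<open>wp_reduce_deriv\<close> needs for the next Artin-Schreier equation.
  The main term K \<omega> D of x' has order - jump - 1, since D has order \<open>diff_exp\<close> +
  p^r - 1; the remainder \<eta> is the logarithmic derivative of Y, and B bounds the poles that
  differentiation hides.\<close>

lemma level_estimate:
 fixes Y :: "'k::field fls fps" and f :: "nat \<Rightarrow> 'k fls"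
 assumes p: "prime p" "CHAR('k) = p"
  and g: "good K (p ^ r)" and D: "fls_deriv (K fls_X) \<noteq> 0"
  and f: "\<And>i. 1 \<le> i \<Longrightarrow> i \<le> p ^ r \<Longrightarrow> reduced p (f i)"
  and Y: "Y $ 0 = 1" "\<And>n. n \<ge> p ^ r \<Longrightarrow> Y $ n = 0"
  and rel: "\<And>n. n < p ^ r \<Longrightarrow> (Y * fmap K (normal_form f (p ^ r))) $ n = (Y $ n) ^ p"
  and E: "val (fls_deriv (K fls_X)) = int (diff_exp p f r) + int (p ^ r) - 1"
  and r: "rho p f r > 0"
 defines "x \<equiv> (Y * fmap K (normal_form f (p ^ r))) $ (p ^ r) - K (f (p ^ r))"
 shows "\<exists>\<omega> \<eta> B. fls_deriv x = K \<omega> * fls_deriv (K fls_X) + \<eta> \<and> \<omega> \<noteq> 0 \<and>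
  val \<omega> = - int (rho p f r) - 1 \<and> vge \<eta> (of_int (- jump p f r)) \<and>
  vge x (- B) \<and> B < real p * of_int (jump p f r) \<and> jump p f r > 0"
proof -
 have p1: "p > 1" using p(1) prime_gt_1_nat by blast
 define N where "N = p ^ r"
 define j where "j = real_of_int (jump p f r)"
 define e where "e = real (diff_exp p f r)"
 note h = good_fhom[OF g]
 have N0: "N > 0" using p1 by (simp add: N_def)
 have f': "reduced p (f i)" if "1 \<le> i" "i < N" for i using f that by (simp add: N_def)
 have dom: "real p * e < (real p - 1) * j" unfolding e_def j_def by (rule jump_dominates[OF p1 r])
 have e0: "e \<ge> 0" by (simp add: e_def)
 have "0 < (real p - 1) * j"
 proof -
  have "0 \<le> real p * e" using e0 by simp
  with dom show ?thesis by linarith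
 qed
 hence j0: "j > 0" using p1 by (simp add: zero_less_mult_iff)
 have ee: "e = real_of_int (val (fls_deriv (K fls_X))) - real N + 1"
  using E by (simp add: e_def N_def)
 obtain sl where sl: "sl \<ge> 0" "\<And>i. 1 \<le> i \<Longrightarrow> i < N \<Longrightarrow> real (pole (f i)) \<le> sl * real i"
  "real N * sl * real N * (real p - 1) \<le> real p * (real p * e)"
  using lang_slope_bound[OF p g[folded N_def] D f' Y(1) Y(2)[folded N_def] rel[folded N_def] ee e0] by blast
 define W where "W = normal_form f N"
 have W0: "W $ 0 = 1" by (simp add: W_def normal_form_nth_0)
 let ?V = "fmap K W"
 have V0: "?V $ 0 = 1" by (simp add: W0 fhom_1[OF h])
 have Vb: "pole_bound (real N * sl) ?V"
  unfolding W_def using sl f' by (intro normal_form_pole_bound[OF g[folded N_def]]) auto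
 have Yb: "pole_bound (real N * sl / real p) Y"
  by (rule lang_pole_bound[OF p1 Vb V0 _ Y[folded N_def] rel[folded N_def W_def]]) (use sl(1) in simp)
 define x0 where "x0 = (Y * ?V) $ N"
 have x: "x = x0 - K (f N)" by (simp add: x_def x0_def W_def N_def)
 have YN: "Y $ N = 0" using Y(2) by (simp add: N_def)
 have "fls_deriv ((Y * ?V) $ N - (Y $ N) ^ p) = dlog Y $ N + dlog ?V $ N"
  by (rule dlog_lang[OF p Y(1) V0]) (use rel[folded N_def W_def] in blast)
 hence dx0: "fls_deriv x0 = dlog Y $ N + dlog ?V $ N" using YN p1 by (simp add: x0_def zero_power)
 \<comment> \<open>The factor of index N is included: the term K(f_N) subtracted in x contributes
   exactly its share of the derivative.\<close>
 define \<omega> where "\<omega> = dlog (normal_form f (Suc N)) $ N"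
 have nf: "normal_form f (Suc N) = W * elem_factor N (f N)"
  unfolding normal_form_def W_def using N0 by (simp add: prod.atLeastLessThan_Suc)
 have "\<omega> = dlog W $ N - fls_deriv (f N)"
  unfolding \<omega>_def nf using dlog_mult[OF W0 elem_factor_nth_0[OF N0, of "f N"]] N0
  by (simp add: dlog_elem_factor_nth)
 hence dW: "dlog W $ N = \<omega> + fls_deriv (f N)" by simp
 have "fls_deriv x = dlog Y $ N + K (dlog W $ N) * fls_deriv (K fls_X) - fls_deriv (K (f N))"
  unfolding x fls_deriv_sub dx0 dlog_fmap_nth[OF g W0] ..
 also have "fls_deriv (K (f N)) = K (fls_deriv (f N)) * fls_deriv (K fls_X)" by (rule good_deriv[OF g])
 finally have dx: "fls_deriv x = K \<omega> * fls_deriv (K fls_X) + dlog Y $ N"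
  unfolding dW fhom_add[OF h] by (simp add: algebra_simps)
 have \<omega>: "\<omega> \<noteq> 0" "val \<omega> = - int (rho p f r) - 1"
  using dlog_normal_form_top[OF p f r] unfolding \<omega>_def N_def by blast+
 \<comment> \<open>The slope bound and p * \<open>diff_exp\<close> < (p - 1) * \<open>jump\<close>
   meet here. The inequality serves twice: for \<eta>, after division by p, and for the pole bound
   B.\<close>
 have nl: "real N * sl * real N < real p * j"
 proof -
  have "real N * sl * real N * (real p - 1) < real p * ((real p - 1) * j)"
   using sl(3) dom p1 by (smt (verit) mult_strict_left_mono of_nat_1 of_nat_less_iff)
  hence "(real N * sl * real N) * (real p - 1) < (real p * j) * (real p - 1)" by (simp add: mult_ac)
  thus ?thesis using p1 by (simp add: mult_less_cancel_right)
 qed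
 have "vge (dlog Y $ N) (- (real N * sl / real p) * real N - 1)" by (rule dlog_pole_bound[OF Yb Y(1)])
 hence \<eta>: "vge (dlog Y $ N) (of_int (- jump p f r))"
 proof -
  assume v: "vge (dlog Y $ N) (- (real N * sl / real p) * real N - 1)"
  show ?thesis
  proof (cases "dlog Y $ N = 0")
   case False
   have "- (real N * sl / real p) * real N - 1 > - j - 1" using nl p1 by (simp add: field_simps)
   hence "real_of_int (- jump p f r - 1) < real_of_int (val (dlog Y $ N))"
    using v False by (simp add: vge_iff j_def)
   hence "- jump p f r - 1 < val (dlog Y $ N)" by (simp only: of_int_less_iff)
   thus ?thesis unfolding vge_int by linarith
  qed simp
 qed
 \<comment> \<open>The two entries bound the poles of the two parts of x, the coefficient of Y V at
   N and K(f_N).\<close>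
 define B where "B = max (real N * sl * real N) (real N * real (rho p f r))"
 have Nr: "real N * real (rho p f r) = j + e" by (simp add: j_def e_def jump_def N_def)
 have "vge x (- B)"
 proof -
  have "vge x0 (- (real N * sl) * real N)"
   using pole_bound_mult[of "real N * sl" Y ?V] Vb Yb unfolding x0_def
  proof -
   have "real N * sl / real p \<le> real N * sl"
    using sl(1) p1 mult_left_mono[of 1 "real p" "real N * sl"] by (simp add: field_simps)
   hence "pole_bound (real N * sl) Y"
    unfolding pole_bound_def
   proof (intro allI)
    fix n
    have "real N * sl / real p * real n \<le> real N * sl * real n"
     using \<open>real N * sl / real p \<le> real N * sl\<close> by (rule mult_right_mono) simp
    hence le: "- (real N * sl) * real n \<le> - (real N * sl / real p) * real n" by simp
    have "vge (Y $ n) (- (real N * sl / real p) * real n)" using Yb unfolding pole_bound_def by blast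
    thus "vge (Y $ n) (- (real N * sl) * real n)" using le by (rule vge_mono)
   qed
   thus "vge ((Y * ?V) $ N) (- (real N * sl) * real N)"
    using pole_bound_mult[of "real N * sl" Y ?V] Vb unfolding pole_bound_def by blast
  qed
  hence 1: "vge x0 (- B)" by (rule vge_mono) (simp add: B_def)
  have rN: "reduced p (f N)" using f[of N] N0 by (simp add: N_def)
  have "vge (K (f N)) (real N * (- real (pole (f N))))"
   using good_vge[OF g reduced_vge[OF rN]] by (simp add: N_def)
  moreover have "real (pole (f N)) \<le> real (rho p f r)" using rho_ge[of r r p f] by (simp add: N_def)
  hence "real N * real (pole (f N)) \<le> real N * real (rho p f r)" by (intro mult_left_mono) auto
  ultimately have "vge (K (f N)) (- B)" by (elim vge_mono) (simp add: B_def)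
  thus ?thesis unfolding x using 1 by (rule vge_diff[rotated])
 qed
 moreover have "B < real p * j"
 proof -
  have "(real p - 1) * (j + e) < (real p - 1) * (real p * j)"
  proof -
   have "(real p - 1) * e \<le> real p * e" using e0 by (intro mult_right_mono) auto
   hence "(real p - 1) * (j + e) < (real p - 1) * j + (real p - 1) * j" using dom by (simp add: algebra_simps)
   also have "\<dots> = (real p - 1) * (2 * j)" by simp
   also have "\<dots> \<le> (real p - 1) * (real p * j)" using p1 j0 by (intro mult_left_mono mult_right_mono) auto
   finally show ?thesis .
  qed
  hence "j + e < real p * j" using p1 by (simp add: mult_less_cancel_left)
  thus ?thesis unfolding B_def Nr using nl by simp
 qed
 ultimately show ?thesis using dx \<omega> \<eta> j0 unfolding j_def
  by (intro exI[of _ \<omega>] exI[of _ "dlog Y $ N"] exI[of _ B]) auto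
qed

subsection \<open>Ramification numbers of automorphisms\<close>

text \<open>The lower ramification number of \<sigma>, read off at the uniformizer: \<sigma> lies in
  the group of index i but not in that of index i + 1. No i satisfies this for the identity.\<close>

definition ram :: "('k::field fls \<Rightarrow> 'k fls) \<Rightarrow> int \<Rightarrow> bool" where
 "ram \<sigma> i \<longleftrightarrow> \<sigma> fls_X - fls_X \<noteq> 0 \<and> val (\<sigma> fls_X - fls_X) = i + 1"

lemma good_subdegree_1: "good \<sigma> 1 \<Longrightarrow> val (\<sigma> f) = val f"
 by (simp add: good_subdegree)

lemma good_vge_1: "good \<sigma> 1 \<Longrightarrow> vge f r \<Longrightarrow> vge (\<sigma> f) r"
 using good_vge[of \<sigma> 1 f r] by simp

lemma ram_vge_unit:
 fixes \<sigma> :: "'k::field fls \<Rightarrow> 'k fls" and b :: nat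
 assumes g: "good \<sigma> 1" and i: "vge (\<sigma> fls_X - fls_X) (real b)" and f: "vge f 0"
 shows "vge (\<sigma> f - f) (real b)"
proof -
 note h = good_fhom[OF g]
 have "vge (\<sigma> f - f) (real c)" if "c \<le> b" for c :: nat
  using that f
 proof (induction c arbitrary: f)
  case 0
  thus ?case by (intro vge_diff good_vge_1[OF g]) auto
 next
  case (Suc c)
  define e where "e = fls_shift 1 (f - fls_const (f $$ 0))"
  have e: "f = fls_const (f $$ 0) + fls_X * e"
   by (simp add: e_def fls_X_times_conv_shift)
  have ve: "vge e 0" unfolding vge_def
  proof (intro allI impI)
   fix i :: int assume "real_of_int i < 0"
   thus "e $$ i = 0" using Suc.prems(2) by (cases "i = - 1") (auto simp: e_def vge_def)
  qed
  have "\<sigma> f = fls_const (f $$ 0) + \<sigma> fls_X * \<sigma> e"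
   by (subst e) (simp add: fhom_add[OF h] fhom_mult[OF h] good_const[OF g])
  hence "\<sigma> f - f = (\<sigma> fls_X - fls_X) * \<sigma> e + fls_X * (\<sigma> e - e)"
   by (subst (2) e) (simp add: algebra_simps)
  moreover have "vge ((\<sigma> fls_X - fls_X) * \<sigma> e) (real b + 0)"
   by (intro vge_mult i good_vge_1[OF g] ve)
  moreover have "vge (fls_X * (\<sigma> e - e)) (1 + real c)"
   by (intro vge_mult Suc.IH ve) (use Suc.prems in \<open>simp_all add: vge_iff\<close>)
  ultimately show ?case using Suc.prems by (auto intro!: vge_add elim!: vge_mono)
 qed
 thus ?thesis by simp
qed

text \<open>Preservation of the valuation acts as continuity: modulo any power of X an integral
  series is a polynomial in X, which \<sigma> fixes.\<close>

lemma good_eq_id: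
 fixes \<sigma> :: "'k::field fls \<Rightarrow> 'k fls"
 assumes g: "good \<sigma> 1" and X: "\<sigma> fls_X = fls_X"
 shows "\<sigma> f = f"
proof -
 note h = good_fhom[OF g]
 have z: "\<sigma> f = f" if "vge f 0" for f
 proof -
  have "vge (\<sigma> f - f) (real n)" for n by (rule ram_vge_unit[OF g _ that]) (simp add: X)
  hence "\<sigma> f - f = 0" using vge_eq_0[of "\<sigma> f - f" 0] by simp
  thus ?thesis by simp
 qed
 show ?thesis
 proof (cases "vge f 0")
  case False
  hence "vge (inverse f) 0" by (auto simp: vge_iff)
  hence "\<sigma> (inverse f) = inverse f" by (rule z)
  hence "inverse (\<sigma> f) = inverse f" by (simp only: fhom_inverse[OF h])
  thus ?thesis by simp
 qed (rule z)
qed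

text \<open>Write f = X^n u with a unit u and \<sigma> X = X (1 + \<epsilon>). Then (1 +
  \<epsilon>)^n - 1 is \<epsilon> times a unit because p does not divide n, while u moves only by
  order i + 1 or more.\<close>

lemma ram_wild_pos:
 fixes \<sigma> :: "'k::field fls \<Rightarrow> 'k fls"
 assumes p: "CHAR('k) = p" and g: "good \<sigma> 1" and r: "ram \<sigma> i" and i: "i \<ge> 1"
  and f: "f \<noteq> 0" "val f > 0" "\<not> int p dvd val f"
 shows "\<sigma> f - f \<noteq> 0 \<and> val (\<sigma> f - f) = val f + i"
proof -
 note h = good_fhom[OF g]
 define n where "n = nat (val f)"
 define Z where "Z = (fls_X :: 'k fls) ^ n"
 have Z: "Z \<noteq> 0" "val Z = int n" by (simp_all add: Z_def)
 have n: "int n = val f" using f(2) by (simp add: n_def)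
 have n0: "of_nat n \<noteq> (0::'k)" using f(3) p of_nat_eq_0_iff_char_dvd[where 'a='k, of n] by (simp flip: n)
 define \<epsilon> where "\<epsilon> = (\<sigma> fls_X - fls_X) / fls_X"
 have d: "\<sigma> fls_X - fls_X \<noteq> 0" "val (\<sigma> fls_X - fls_X) = i + 1" using r by (simp_all add: ram_def)
 have \<epsilon>: "\<epsilon> \<noteq> 0" "val \<epsilon> = i" 
  using d(1) fls_divide_subdegree[OF d(1), of fls_X] unfolding \<epsilon>_def divide_eq_0_iff d(2) by simp_all
 have "fls_X * \<epsilon> = \<sigma> fls_X - fls_X"
  unfolding \<epsilon>_def times_divide_eq_right by (rule nonzero_mult_div_cancel_left) simp
 hence \<sigma>X: "\<sigma> fls_X = fls_X * (1 + \<epsilon>)" unfolding distrib_left by simp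
 define S where "S = (\<Sum>l<n. (1 + \<epsilon>) ^ l)"
 have v\<epsilon>: "vge \<epsilon> 1" using \<epsilon> i by (simp add: vge_iff)
 have one: "vge ((1 + \<epsilon>) ^ l - 1) 1" for l
 proof (induction l)
  case (Suc l)
  have "(1 + \<epsilon>) ^ Suc l - 1 = ((1 + \<epsilon>) ^ l - 1) * (1 + \<epsilon>) + \<epsilon>" by (simp add: algebra_simps)
  moreover have "vge (((1 + \<epsilon>) ^ l - 1) * (1 + \<epsilon>)) (1 + 0)"
   by (intro vge_mult Suc vge_add vge_1 vge_mono[OF v\<epsilon>]) simp_all
  ultimately show ?case using v\<epsilon> by (auto intro: vge_add)
 qed simp
 have "S - of_nat n = (\<Sum>l<n. (1 + \<epsilon>) ^ l - 1)" by (simp add: S_def sum_subtractf)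
 hence vS: "vge (S - of_nat n) 1" by (simp only:) (rule vge_sum[OF one])
 have nn: "(of_nat n :: 'k fls) \<noteq> 0" using n0 by (simp add: fls_of_nat)
 have S: "S \<noteq> 0" "val S = 0"
  using subdegree_add_vge[OF nn vS] by simp_all
 have "\<epsilon> * S = (1 + \<epsilon>) ^ n - 1" unfolding S_def by (simp add: power_diff_1_eq)
 moreover have "\<sigma> Z - Z = Z * ((1 + \<epsilon>) ^ n - 1)"
  unfolding Z_def fhom_power[OF h] \<sigma>X power_mult_distrib by (simp only: right_diff_distrib mult_1_right)
 ultimately have "\<sigma> Z - Z = Z * (\<epsilon> * S)" by (simp only:)
 hence Zd: "\<sigma> Z - Z \<noteq> 0" "val (\<sigma> Z - Z) = int n + i" using Z \<epsilon> S by simp_all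
 define u where "u = f / Z"
 have u: "u \<noteq> 0" "val u = 0" using f(1) Z n fls_divide_subdegree[OF f(1) Z(1)] by (simp_all add: u_def)
 have fu: "f = Z * u" using Z by (simp add: u_def)
 have \<sigma>u: "\<sigma> u \<noteq> 0" "val (\<sigma> u) = 0" using u fhom_eq_0[OF h] by (simp_all add: good_subdegree_1[OF g])
 have "\<sigma> f - f = (\<sigma> Z - Z) * \<sigma> u + Z * (\<sigma> u - u)" by (simp add: fu fhom_mult[OF h] algebra_simps)
 moreover have "vge (Z * (\<sigma> u - u)) (real n + real (nat (i + 1)))"
 proof (rule vge_mult)
  show "vge Z (real n)" using Z by (simp add: vge_iff)
  show "vge (\<sigma> u - u) (real (nat (i + 1)))"
   by (rule ram_vge_unit[OF g]) (use d i u in \<open>simp_all add: vge_iff\<close>)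
 qed
 moreover have nz: "(\<sigma> Z - Z) * \<sigma> u \<noteq> 0" using Zd \<sigma>u by simp
 moreover have "val ((\<sigma> Z - Z) * \<sigma> u) = int n + i" using Zd \<sigma>u by simp
 moreover from this have "real_of_int (val ((\<sigma> Z - Z) * \<sigma> u)) < real n + real (nat (i + 1))" using i by simp
 ultimately show ?thesis using subdegree_add_vge[OF nz, of "Z * (\<sigma> u - u)" "real n + real (nat (i + 1))"] n by simp
qed

lemma ram_wild:
 fixes \<sigma> :: "'k::field fls \<Rightarrow> 'k fls"
 assumes p: "CHAR('k) = p" and g: "good \<sigma> 1" and r: "ram \<sigma> i" and i: "i \<ge> 1"
  and f: "f \<noteq> 0" "\<not> int p dvd val f"
 shows "\<sigma> f - f \<noteq> 0 \<and> val (\<sigma> f - f) = val f + i"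
proof (cases "val f > 0")
 case True
 thus ?thesis using ram_wild_pos[OF p g r i] f by blast
next
 case False
 note h = good_fhom[OF g]
 have "val f \<noteq> 0" using f(2) by auto
 hence neg: "val (inverse f) > 0" using False by simp
 have nd: "\<not> int p dvd val (inverse f)" using f(2) by simp
 from ram_wild_pos[OF p g r i _ neg nd] f(1)
 have d: "\<sigma> (inverse f) - inverse f \<noteq> 0" "val (\<sigma> (inverse f) - inverse f) = - val f + i" by simp_all
 have \<sigma>f: "\<sigma> f \<noteq> 0" using f(1) fhom_eq_0[OF h] by simp
 have "\<sigma> f - f = - ((\<sigma> (inverse f) - inverse f) * f * \<sigma> f)"
  using f(1) \<sigma>f unfolding fhom_inverse[OF h] by (simp add: field_simps)
 thus ?thesis using d f(1) \<sigma>f by (simp add: good_subdegree_1[OF g])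
qed

lemma good_leading:
 fixes \<sigma> :: "'k::field fls \<Rightarrow> 'k fls"
 assumes g: "good \<sigma> d" and f: "vge f (real n)"
 shows "vge (\<sigma> f - fls_const (f $$ int n) * \<sigma> fls_X ^ n) (real d * (real n + 1))"
proof -
 note h = good_fhom[OF g]
 have "vge (f - fls_const (f $$ int n) * fls_X ^ n) (of_int (int n) + 1)"
 proof (rule vge_Suc)
  show "vge (f - fls_const (f $$ int n) * fls_X ^ n) (of_int (int n))"
  proof (rule vge_diff)
   have "vge (fls_const (f $$ int n) * fls_X ^ n) (0 + real n)"
    by (intro vge_mult vge_const) (simp_all add: vge_iff)
   thus "vge (fls_const (f $$ int n) * fls_X ^ n) (of_int (int n))" by simp
  qed (use f in simp)
  show "(f - fls_const (f $$ int n) * fls_X ^ n) $$ int n = 0" by (simp add: fls_X_power_nth)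
 qed
 from good_vge[OF g this] show ?thesis
  by (simp add: fhom_diff[OF h] fhom_mult[OF h] fhom_power[OF h] good_const[OF g])
qed

text \<open>The leading coefficients of \<open>\<sigma>(t)/t\<close> and \<open>\<sigma>'(X)/X\<close> are related by a \<open>p\<close>-th power.\<close>

lemma tame_character_step:
 fixes K \<sigma> \<sigma>' :: "'k::field fls \<Rightarrow> 'k fls"
 assumes p: "prime p" "CHAR('k) = p"
  and g: "good K p" and s: "good \<sigma> 1" and s': "good \<sigma>' 1"
  and comm: "\<sigma>' (K fls_X) = K (\<sigma> fls_X)"
 shows "(\<sigma>' fls_X $$ 1) ^ p = \<sigma> fls_X $$ 1"
proof -
 have p0: "p > 0" using p(1) prime_gt_0_nat by blast
 note h = good_fhom[OF g] and h' = good_fhom[OF s']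
 define a where "a = K fls_X $$ int p"
 define \<zeta> \<zeta>' where "\<zeta> = \<sigma> fls_X $$ 1" and "\<zeta>' = \<sigma>' fls_X $$ 1"
 have sX: "val (K fls_X) = int p" using good_subdegree[OF g, of fls_X] by simp
 have nzX: "K fls_X \<noteq> 0" using fhom_eq_0[OF h] by simp
 have a0: "a \<noteq> 0" unfolding a_def using nzX sX by (metis nth_fls_subdegree_nonzero)
 have vX: "vge (K fls_X) (real p)" using sX by (simp add: vge_iff)
 have "vge (\<sigma> fls_X) (real 1)" using good_vge_1[OF s, of fls_X 1] by (simp add: vge_iff)
 from good_leading[OF g this] have "vge (K (\<sigma> fls_X) - fls_const \<zeta> * K fls_X) (real p * 2)" by (simp add: \<zeta>_def)
 hence "(K (\<sigma> fls_X) - fls_const \<zeta> * K fls_X) $$ int p = 0" using p0 by (simp add: vge_def)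
 hence 1: "K (\<sigma> fls_X) $$ int p = \<zeta> * a" by (simp add: a_def)
 from good_leading[OF s' vX] have "vge (\<sigma>' (K fls_X) - fls_const a * \<sigma>' fls_X ^ p) (real p + 1)" by (simp add: a_def)
 hence "(\<sigma>' (K fls_X) - fls_const a * \<sigma>' fls_X ^ p) $$ int p = 0" by (simp add: vge_def)
 hence 2: "\<sigma>' (K fls_X) $$ int p = a * (\<sigma>' fls_X ^ p) $$ int p" by simp
 have s1: "val (\<sigma>' fls_X) = 1" by (simp add: good_subdegree_1[OF s'])
 have "(\<sigma>' fls_X ^ p) $$ int p = \<zeta>' ^ p"
  using fls_pow_base[of "\<sigma>' fls_X" p] s1 by (simp add: \<zeta>'_def fls_subdegree_pow)
 with 1 2 comm have "a * \<zeta>' ^ p = \<zeta> * a" by metis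
 thus ?thesis using a0 by (auto simp: \<zeta>_def \<zeta>'_def)
qed

lemma wild_iff:
 assumes "good \<sigma> 1"
 shows "vge (\<sigma> fls_X - fls_X) 2 \<longleftrightarrow> \<sigma> fls_X $$ 1 = (1::'k::field)"
proof
 assume "vge (\<sigma> fls_X - fls_X) 2"
 hence "(\<sigma> fls_X - fls_X) $$ 1 = 0" by (simp add: vge_def)
 thus "\<sigma> fls_X $$ 1 = 1" by simp
next
 assume a: "\<sigma> fls_X $$ 1 = 1"
 have "vge (\<sigma> fls_X - fls_X) (of_int 1 + 1)"
 proof (rule vge_Suc)
  show "vge (\<sigma> fls_X - fls_X) (of_int 1)"
   by (intro vge_diff good_vge_1[OF assms]) (simp_all add: vge_iff)
 qed (simp add: a)
 thus "vge (\<sigma> fls_X - fls_X) 2" by simp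
qed

lemma power_char_eq_1:
 fixes x :: "'k::field"
 assumes p: "prime p" "CHAR('k) = p" and "x ^ p = 1"
 shows "x = 1"
proof -
 have "(x - 1) ^ p = 0" using char_power_diff[OF p, of x 1] assms(3) by simp
 thus ?thesis by simp
qed

text \<open>The leading coefficient upstairs has p-th power the one downstairs, and in
  characteristic p only 1 has p-th power 1.\<close>

lemma wild_step:
 fixes K \<sigma> \<sigma>' :: "'k::field fls \<Rightarrow> 'k fls"
 assumes p: "prime p" "CHAR('k) = p"
  and g: "good K p" and s: "good \<sigma> 1" and s': "good \<sigma>' 1"
  and comm: "\<sigma>' (K fls_X) = K (\<sigma> fls_X)"
 shows "vge (\<sigma>' fls_X - fls_X) 2 \<longleftrightarrow> vge (\<sigma> fls_X - fls_X) 2"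
 unfolding wild_iff[OF s] wild_iff[OF s']
 using tame_character_step[OF assms] power_char_eq_1[OF p, of "\<sigma>' fls_X $$ 1"] by auto

lemma ram_0_iff:
 assumes "good \<sigma> 1"
 shows "ram \<sigma> 0 \<longleftrightarrow> \<not> vge (\<sigma> fls_X - fls_X) 2"
proof -
 have "vge (\<sigma> fls_X - fls_X) 1" by (intro vge_diff good_vge_1[OF assms]) (simp_all add: vge_iff)
 thus ?thesis by (auto simp: ram_def vge_iff)
qed

lemma ram_exists:
 assumes "vge (\<sigma> fls_X - fls_X) 2" "\<sigma> fls_X \<noteq> fls_X"
 shows "\<exists>i\<ge>1. ram \<sigma> i"
 using assms by (intro exI[of _ "val (\<sigma> fls_X - fls_X) - 1"]) (auto simp: ram_def vge_iff)

lemma ram_step_tame: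
 fixes K \<sigma> \<sigma>' :: "'k::field fls \<Rightarrow> 'k fls"
 assumes p: "prime p" "CHAR('k) = p"
  and g: "good K p" and s: "good \<sigma> 1" and s': "good \<sigma>' 1"
  and comm: "\<sigma>' (K fls_X) = K (\<sigma> fls_X)" and r: "ram \<sigma> 0"
 shows "ram \<sigma>' 0"
 using wild_step[OF p g s s' comm] r by (simp add: ram_0_iff[OF s] ram_0_iff[OF s'])

text \<open>The pole order j of z is prime to p, so \<open>val (\<sigma>' z - z)\<close> = - j + i;
  as the difference is a nonzero constant, i = j.\<close>

lemma ram_step_top:
 fixes \<sigma>' :: "'k::field fls \<Rightarrow> 'k fls"
 assumes p: "prime p" "CHAR('k) = p"
  and AS: "artin_schreier p x j K z" and s': "good \<sigma>' 1"
  and comm: "\<sigma>' (K fls_X) = K fls_X" and z: "\<sigma>' z - z = fls_const c" "c \<noteq> 0"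
 shows "ram \<sigma>' j"
proof -
 have g: "good K p" "z \<noteq> 0" "val z = - j" "\<not> int p dvd j" using AS by (simp_all add: artin_schreier_def)
 have "vge (\<sigma>' fls_X - fls_X) 2"
  using wild_step[OF p g(1) good_id s' comm] by simp
 moreover have "\<sigma>' fls_X \<noteq> fls_X"
 proof
  assume "\<sigma>' fls_X = fls_X"
  hence "\<sigma>' z = z" by (rule good_eq_id[OF s'])
  thus False using z by simp
 qed
 ultimately obtain i where i: "i \<ge> 1" "ram \<sigma>' i" using ram_exists by blast
 have "val (\<sigma>' z - z) = - j + i"
  using ram_wild[OF p(2) s' i(2,1) g(2)] g(3,4) by simp
 hence "i = j" by (simp add: z)
 thus ?thesis using i by simp
qed

text \<open>From wp(w) = \<sigma> x - x of order - j + i < 0 one gets p val(w) = - j + i, which is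
  the order of K w = \<sigma>' z - z. The same order is - j + i', so the number i' upstairs is
  i.\<close>

lemma ram_step_wild:
 fixes \<sigma> \<sigma>' :: "'k::field fls \<Rightarrow> 'k fls"
 assumes p: "prime p" "CHAR('k) = p"
  and x: "x \<noteq> 0" "val x = - j"
  and AS: "artin_schreier p x j K z" and s: "good \<sigma> 1" and s': "good \<sigma>' 1"
  and comm: "\<And>f. \<sigma>' (K f) = K (\<sigma> f)" and z: "\<sigma>' z = z + K w"
  and r: "ram \<sigma> i" "1 \<le> i" "i < j"
 shows "ram \<sigma>' i"
proof -
 have p1: "p > 1" using p(1) prime_gt_1_nat by blast
 have g: "good K p" "wp p z = K x" "z \<noteq> 0" "val z = - j" "\<not> int p dvd j"
  using AS by (simp_all add: artin_schreier_def)
 note h = good_fhom[OF g(1)] and h' = good_fhom[OF s']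
 have "K (\<sigma> x - x) = \<sigma>' (wp p z) - wp p z" by (simp add: fhom_diff[OF h] comm g(2))
 also have "\<sigma>' (wp p z) = wp p (z + K w)" by (simp add: wp_fhom[OF h'] z)
 also have "\<dots> = wp p z + wp p (K w)" by (rule wp_add) (use p in simp_all)
 finally have "K (\<sigma> x - x) = K (wp p w)" by (simp add: wp_fhom[OF h])
 hence w: "\<sigma> x - x = wp p w" by (simp add: fhom_eq_iff[OF h])
 have dx: "\<sigma> x - x \<noteq> 0" "val (\<sigma> x - x) = - j + i"
  using ram_wild[OF p(2) s r(1,2) x(1)] x(2) g(5) by simp_all
 have w0: "w \<noteq> 0" using dx(1) w p1 by (auto simp: wp_def zero_power)
 have neg: "val w < 0"
 proof (rule ccontr)
  assume "\<not> val w < 0"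
  hence "vge w 0" by (simp add: vge_iff)
  hence "vge (wp p w) 0" unfolding wp_def using vge_power[of w 0 p] by (intro vge_diff) auto
  thus False using dx w r(3) by (simp add: vge_iff)
 qed
 have "int p * val w < 1 * val w" using neg p1 by (intro mult_strict_right_mono_neg) auto
 hence lt: "real_of_int (val (w ^ p)) < real_of_int (val w)"
  unfolding of_int_less_iff by (simp add: fls_subdegree_pow)
 have "w ^ p \<noteq> 0" using w0 by simp
 from subdegree_add_vge[OF this _ lt, of "- w"] have "val (wp p w) = int p * val w"
  by (simp add: wp_def vge_iff fls_subdegree_pow)
 hence vw: "val (K w) = - j + i" using dx(2) w by (simp add: good_subdegree[OF g(1)])
 have cX: "\<sigma>' (K fls_X) = K (\<sigma> fls_X)" by (rule comm)
 have "vge (\<sigma> fls_X - fls_X) 2" using r by (simp add: ram_def vge_iff)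
 hence v2: "vge (\<sigma>' fls_X - fls_X) 2" using wild_step[OF p g(1) s s' cX] by simp
 have "\<sigma>' fls_X \<noteq> fls_X"
 proof
  assume "\<sigma>' fls_X = fls_X"
  hence "\<sigma>' z = z" by (rule good_eq_id[OF s'])
  hence "K w = 0" using z by simp
  thus False using w0 fhom_eq_0[OF h] by simp
 qed
 with v2 obtain i' where i': "i' \<ge> 1" "ram \<sigma>' i'" using ram_exists by blast
 have "val (\<sigma>' z - z) = - j + i'"
  using ram_wild[OF p(2) s' i'(2,1) g(3)] g(4,5) by simp
 hence "i' = i" using vw by (simp add: z)
 thus ?thesis using i' by simp
qed

lemma good_automorphism:
 fixes \<sigma> :: "'k::field fls \<Rightarrow> 'k fls"
 assumes p: "prime p" "CHAR('k) = p"
  and h: "fhom \<sigma>" and b: "bij \<sigma>" and c: "\<And>c. \<sigma> (fls_const c) = fls_const c"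
 shows "good \<sigma> 1"
 using fhom_bij_subdegree[OF p h b] h c by (simp add: good_def)

subsection \<open>Independence of characters and roots of unity\<close>

text \<open>The homomorphisms live on the whole field but are told apart, and related, on a
  multiplicative set M only. Their extensions beyond M may thus be arbitrary.\<close>

lemma dedekind:
 fixes \<sigma> :: "'i \<Rightarrow> 'w::field \<Rightarrow> 'w"
 assumes "finite I" and h: "\<And>i. i \<in> I \<Longrightarrow> fhom (\<sigma> i)"
  and M: "1 \<in> M" "\<And>x y. x \<in> M \<Longrightarrow> y \<in> M \<Longrightarrow> x * y \<in> M"
  and d: "\<And>i j. i \<in> I \<Longrightarrow> j \<in> I \<Longrightarrow> (\<And>x. x \<in> M \<Longrightarrow> \<sigma> i x = \<sigma> j x) \<Longrightarrow> i = j"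
  and z: "\<And>x. x \<in> M \<Longrightarrow> (\<Sum>i\<in>I. a i * \<sigma> i x) = 0"
  and i: "i \<in> I"
 shows "a i = 0"
 using assms
proof (induction I arbitrary: a i rule: finite_induct)
 case (insert j I)
 have IH: "a' i = 0" if "\<And>x. x \<in> M \<Longrightarrow> (\<Sum>i\<in>I. a' i * \<sigma> i x) = 0" "i \<in> I" for a' i
 proof (rule insert.IH[of a' i])
  show "\<And>i. i \<in> I \<Longrightarrow> fhom (\<sigma> i)" using insert.prems(1) by simp
  show "\<And>i j. i \<in> I \<Longrightarrow> j \<in> I \<Longrightarrow> (\<And>x. x \<in> M \<Longrightarrow> \<sigma> i x = \<sigma> j x) \<Longrightarrow> i = j"
   using insert.prems(4) by blast
 qed (use insert.prems that in auto)
 have z: "a j * \<sigma> j x + (\<Sum>i\<in>I. a i * \<sigma> i x) = 0" if "x \<in> M" for x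
  using insert.prems(5)[OF that] insert.hyps by simp
 have aI: "a i = 0" if "i \<in> I" for i
 proof -
  have "i \<noteq> j" using that insert.hyps by blast
  have "\<exists>y\<in>M. \<sigma> i y \<noteq> \<sigma> j y"
  proof (rule ccontr)
   assume "\<not> (\<exists>y\<in>M. \<sigma> i y \<noteq> \<sigma> j y)"
   hence "i = j" using that by (intro insert.prems(4)) auto
   thus False using \<open>i \<noteq> j\<close> by simp
  qed
  then obtain y where y: "y \<in> M" "\<sigma> i y \<noteq> \<sigma> j y" by blast
  have "a i * (\<sigma> i y - \<sigma> j y) = 0"
  proof (rule IH[of "\<lambda>i. a i * (\<sigma> i y - \<sigma> j y)", OF _ that])
   fix x assume x: "x \<in> M"
   have xy: "x * y \<in> M" using x y insert.prems(3) by blast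
   have "(\<Sum>i\<in>I. a i * (\<sigma> i y - \<sigma> j y) * \<sigma> i x) =
     (\<Sum>i\<in>I. a i * \<sigma> i (x * y)) - \<sigma> j y * (\<Sum>i\<in>I. a i * \<sigma> i x)"
    unfolding sum_distrib_left sum_subtractf[symmetric]
    by (intro sum.cong refl) (use insert.prems(1) in \<open>simp add: fhom_mult algebra_simps\<close>)
   moreover have "(\<Sum>i\<in>I. a i * \<sigma> i (x * y)) = - (a j * \<sigma> j (x * y))"
    using z[OF xy] by (simp add: eq_neg_iff_add_eq_0 add.commute)
   moreover have "(\<Sum>i\<in>I. a i * \<sigma> i x) = - (a j * \<sigma> j x)"
    using z[OF x] by (simp add: eq_neg_iff_add_eq_0 add.commute)
   ultimately show "(\<Sum>i\<in>I. a i * (\<sigma> i y - \<sigma> j y) * \<sigma> i x) = 0"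
    using insert.prems(1)[of j] by (simp add: fhom_mult mult_ac)
  qed
  thus ?thesis using y(2) by simp
 qed
 have "a j * \<sigma> j 1 = 0" using z[OF M(1)] aI by simp
 hence "a j = 0" using insert.prems(1)[of j] by (simp add: fhom_1)
 thus ?case using aI insert.prems(6) by blast
qed simp

lemma roots_exhausted:
 fixes P :: "'w::idom poly"
 assumes "P \<noteq> 0" "finite S" "Polynomial.degree P \<le> card S" "\<And>x. x \<in> S \<Longrightarrow> poly P x = 0" "poly P w = 0"
 shows "w \<in> S"
proof (rule ccontr)
 assume "w \<notin> S"
 hence "card (insert w S) = Suc (card S)" using assms(2) by simp
 moreover have "card (insert w S) \<le> card {x. poly P x = 0}"
  using assms poly_roots_finite[OF assms(1)] by (intro card_mono) auto
 moreover have "card {x. poly P x = 0} \<le> Polynomial.degree P" by (rule card_poly_roots_bound[OF assms(1)])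
 ultimately show False using assms(3) by simp
qed

definition primitive_root :: "nat \<Rightarrow> 'a::monoid_mult \<Rightarrow> bool" where
 "primitive_root m z \<longleftrightarrow> (\<forall>i. z ^ i = 1 \<longleftrightarrow> m dvd i)"

lemma power_eq_1_coprime:
 fixes x :: "'a::field"
 assumes "x ^ a = 1" "x ^ b = 1" "coprime a b" "a > 0"
 shows "x = 1"
proof -
 obtain u v where uv: "a * u = b * v + 1" using bezout_nat[of a b] assms(3,4) by auto
 have "(x ^ a) ^ u = (x ^ b) ^ v * x" by (simp only: power_mult[symmetric] uv power_add power_one_right)
 thus ?thesis using assms(1,2) by simp
qed

text \<open>For m = l n with l prime, take an l-th root of a primitive n-th root of unity. Should
  its n-th power be 1, then l does not divide n, and multiplication by a primitive l-th root of
  unity repairs it.\<close>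

lemma alg_closed_primitive_root:
 assumes "m > 0" "of_nat m \<noteq> (0::'k::alg_closed_field)"
 shows "\<exists>z::'k. primitive_root m z"
 using assms
proof (induction m rule: less_induct)
 case (less m)
 show ?case
 proof (cases "m = 1")
  case True
  thus ?thesis by (intro exI[of _ 1]) (simp add: primitive_root_def)
 next
  case False
  then obtain l where l: "prime l" "l dvd m" using prime_factor_nat by blast
  then obtain n where m: "m = l * n" by blast
  have l1: "l > 1" using l(1) prime_gt_1_nat by blast
  have n: "n > 0" "n < m" using less.prems(1) m l1 by auto
  have nz: "of_nat l \<noteq> (0::'k)" "of_nat n \<noteq> (0::'k)" using less.prems(2) m by auto
  obtain y :: 'k where y: "primitive_root n y" using less.IH[OF n(2,1) nz(2)] by blast
  have yn: "y ^ n = 1" using y by (simp add: primitive_root_def)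
  obtain z0 where z0: "z0 ^ l = y" using alg_closed_power_root[of l y] l1 by auto
  have "\<exists>z. z ^ l = y \<and> z ^ n \<noteq> 1"
  proof (cases "z0 ^ n = 1")
   case True
   have nl: "\<not> l dvd n"
   proof
    assume "l dvd n"
    then obtain d where d: "n = l * d" by blast
    hence "y ^ d = 1" using True z0 by (simp add: power_mult)
    hence "n dvd d" using y by (simp add: primitive_root_def)
    thus False using d n(1) l1 by (auto dest: dvd_imp_le)
   qed
   define P where "P = (\<Sum>i<l. monom (1::'k) i)"
   have "Polynomial.coeff P (l - 1) = 1" using l1 by (simp add: P_def coeff_sum coeff_monom)
   hence "l - 1 \<le> Polynomial.degree P" by (intro le_degree) simp
   hence "Polynomial.degree P > 0" using l1 by simp
   then obtain x where x: "poly P x = 0" using alg_closed_imp_poly_has_root by blast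
   hence s: "(\<Sum>i<l. x ^ i) = 0" by (simp add: P_def poly_sum poly_monom)
   have x1: "x \<noteq> 1" using s nz(1) by auto
   have "x ^ l - 1 = (x - 1) * (\<Sum>i<l. x ^ i)" by (rule power_diff_1_eq)
   hence xl: "x ^ l = 1" using s by simp
   have "coprime l n" using l(1) nl by (simp add: prime_imp_coprime)
   hence "x ^ n \<noteq> 1" using power_eq_1_coprime[OF xl, of n] x1 l1 by auto
   thus ?thesis using z0 xl True by (intro exI[of _ "z0 * x"]) (simp add: power_mult_distrib)
  qed (use z0 in blast)
  then obtain z where z: "z ^ l = y" "z ^ n \<noteq> 1" by blast
  have "z ^ i = 1 \<longleftrightarrow> m dvd i" for i
  proof
   assume zi: "z ^ i = 1"
   have "y ^ i = (z ^ i) ^ l" by (simp add: z(1)[symmetric] power_mult[symmetric] mult.commute)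
   hence "y ^ i = 1" using zi by simp
   hence "n dvd i" using y by (simp add: primitive_root_def)
   then obtain t where t: "i = n * t" by blast
   have "l dvd t"
   proof (rule ccontr)
    assume "\<not> l dvd t"
    hence "coprime l t" using l(1) by (simp add: prime_imp_coprime)
    moreover have "(z ^ n) ^ l = 1" using z(1) yn by (metis mult.commute power_mult)
    moreover have "(z ^ n) ^ t = 1" using zi t by (simp add: power_mult)
    ultimately show False using power_eq_1_coprime[of "z ^ n" l t] z(2) l1 by simp
   qed
   thus "m dvd i" using t m by (simp add: mult.commute)
  next
   assume "m dvd i"
   then obtain t where "i = m * t" by blast
   thus "z ^ i = 1" using z(1) yn by (simp add: m power_mult)
  qed
  thus ?thesis unfolding primitive_root_def by blast
 qed
qed

lemma primitive_root_sum:
 fixes z :: "'w::field"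
 assumes "primitive_root m z" "\<not> m dvd i"
 shows "(\<Sum>l<m. (z ^ i) ^ l) = 0"
proof -
 have "z ^ i \<noteq> 1" using assms by (simp add: primitive_root_def)
 moreover have "(z ^ i) ^ m = 1" using assms(1) by (simp add: primitive_root_def power_mult[symmetric])
 hence "(z ^ i - 1) * (\<Sum>l<m. (z ^ i) ^ l) = 0" by (simp add: power_diff_1_eq[symmetric])
 ultimately show ?thesis by simp
qed

lemma sum_shift_periodic:
 fixes f :: "nat \<Rightarrow> 'a::ab_group_add"
 assumes "f m = f 0"
 shows "(\<Sum>i<m. f (Suc i)) = (\<Sum>i<m. f i)"
proof -
 have "(\<Sum>i<Suc m. f i) = f 0 + (\<Sum>i<m. f (Suc i))" by (rule sum.lessThan_Suc_shift)
 thus ?thesis using assms by (simp add: add.commute)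
qed

text \<open>Lagrange interpolation at the conjugates \<open>y + i\<close> of an Artin--Schreier generator.\<close>

lemma artin_schreier_interpolation:
 fixes h :: "'w::field \<Rightarrow> 'w"
 assumes p: "prime p" "CHAR('w) = p" and h: "fhom h" and y: "h y = y + 1"
 defines "T \<equiv> \<lambda>w. \<Sum>i<p. (h ^^ i) w"
 shows "x = T x - (\<Sum>k\<le>p - 1. of_nat ((p - 1) choose k) * y ^ k * T (x * (- y) ^ (p - 1 - k)))"
proof -
 have p1: "p > 1" using p(1) prime_gt_1_nat by blast
 have yi: "(h ^^ i) y = y + of_nat i" for i
  by (induction i) (simp_all add: fhom_add[OF h] fhom_of_nat[OF h] y add_ac)
 \<comment> \<open>Fermat: (y - h^i y)^(p-1) = (- i)^(p-1), which is 1 for 0 < i < p and 0 for i =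
   0. Expanding this indicator binomially removes every conjugate of x except x itself from T
   x.\<close>
 have one: "(y + - (h ^^ i) y) ^ (p - 1) = 1" if "0 < i" "i < p" for i
 proof -
  have "(of_nat i :: 'w) \<noteq> 0" using that p(2) by (simp add: of_nat_eq_0_iff_char_dvd nat_dvd_not_less)
  moreover have "(- of_nat i :: 'w) ^ p = - of_nat i"
   using char_power_uminus[OF p] of_nat_power_char[OF p] by simp
  hence "(- of_nat i :: 'w) ^ (p - 1) * (- of_nat i) = 1 * (- of_nat i)"
   using power_minus_mult[of p "- of_nat i :: 'w"] p1 by simp
  ultimately have "(- of_nat i :: 'w) ^ (p - 1) = 1" by simp
  thus ?thesis by (simp add: yi)
 qed
 have "(\<Sum>k\<le>p - 1. of_nat ((p - 1) choose k) * y ^ k * T (x * (- y) ^ (p - 1 - k))) =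
   (\<Sum>k\<le>p - 1. \<Sum>i<p. (h ^^ i) x * (of_nat ((p - 1) choose k) * y ^ k * (- (h ^^ i) y) ^ (p - 1 - k)))"
 proof (intro sum.cong refl)
  fix k
  have "(h ^^ i) (x * (- y) ^ (p - 1 - k)) = (h ^^ i) x * (- (h ^^ i) y) ^ (p - 1 - k)" for i
   by (simp only: fhom_mult[OF fhom_funpow[OF h]] fhom_power[OF fhom_funpow[OF h]] fhom_uminus[OF fhom_funpow[OF h]])
  thus "of_nat ((p - 1) choose k) * y ^ k * T (x * (- y) ^ (p - 1 - k)) =
   (\<Sum>i<p. (h ^^ i) x * (of_nat ((p - 1) choose k) * y ^ k * (- (h ^^ i) y) ^ (p - 1 - k)))"
   by (simp only: T_def sum_distrib_left mult_ac)
 qed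
 also have "\<dots> = (\<Sum>i<p. (h ^^ i) x * (y + - (h ^^ i) y) ^ (p - 1))"
  by (subst sum.swap) (simp only: binomial_ring sum_distrib_left)
 also have "\<dots> = (\<Sum>i<p. if i = 0 then 0 else (h ^^ i) x)"
  by (intro sum.cong refl) (use one p1 in auto)
 finally have "T x - (\<Sum>k\<le>p - 1. of_nat ((p - 1) choose k) * y ^ k * T (x * (- y) ^ (p - 1 - k))) =
  (\<Sum>i<p. (h ^^ i) x - (if i = 0 then 0 else (h ^^ i) x))"
  by (simp add: T_def sum_subtractf)
 also have "\<dots> = (\<Sum>i<p. if i = 0 then x else 0)" by (intro sum.cong) auto
 also have "\<dots> = x" using p1 by simp
 finally show ?thesis by simp
qed

subsection \<open>The tower of a cyclic-by-tame extension\<close>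

text \<open>A unit is a constant times a series with constant term 1. The constant has an m-th root
  in k, and the series has one because m is nonzero in k.\<close>

lemma fls_power_decompose:
 fixes f :: "'k::alg_closed_field fls"
 assumes "m > 0" "of_nat m \<noteq> (0::'k)" "f \<noteq> 0"
 shows "\<exists>v. v \<noteq> 0 \<and> f = fls_X powi (val f) * v ^ m"
proof -
 define Z where "Z = (fls_X :: 'k fls) powi (val f)"
 have Z: "Z \<noteq> 0" "val Z = val f" by (simp_all add: Z_def)
 define u where "u = f / Z"
 have u: "u \<noteq> 0" "val u = 0"
  using assms(3) Z fls_divide_subdegree[OF assms(3) Z(1)] by (simp_all add: u_def)
 define a where "a = u $$ 0"
 have a: "a \<noteq> 0" using u nth_fls_subdegree_nonzero[of u] by (simp add: a_def)
 obtain a0 where a0: "a0 ^ m = a" using alg_closed_power_root assms(1) by blast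
 define w where "w = fls_const (inverse a) * u - 1"
 have "vge w (of_int 0 + 1)"
 proof (rule vge_Suc)
  have "vge (fls_const (inverse a) * u) (0 + 0)" by (intro vge_mult vge_const) (use u in \<open>simp_all add: vge_iff\<close>)
  thus "vge w (of_int 0)" unfolding w_def by (intro vge_diff) (simp_all add: vge_1)
  show "w $$ 0 = 0" using a by (simp add: w_def a_def)
 qed
 then obtain y where y: "y ^ m = 1 + w" using fls_root_exists[OF assms(2)] by auto
 have "(fls_const a0 * y) ^ m = u"
  using a by (simp add: power_mult_distrib y w_def a0 flip: fls_const_power mult.assoc)
 moreover from this have "fls_const a0 * y \<noteq> 0" using u(1) assms(1) by (metis power_eq_0_iff)
 moreover have "f = Z * u" using Z by (simp add: u_def)
 ultimately show ?thesis unfolding Z_def by blast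
qed

lemma funpow_comm: "(f ^^ a) ((f ^^ b) x) = (f ^^ b) ((f ^^ a) x)"
 by (metis add.commute comp_apply funpow_add)

text \<open>\<open>M\<close> stands for the image of the given extension of \<open>k((t))\<close> in an algebraic closure; \<open>g\<close> and \<open>c\<close>
 extend generators of its Galois group \<open>\<int>/p^R \<rtimes> \<int>/m\<close>.\<close>

locale ctower =
 fixes p m R \<alpha> :: nat and eK :: "'k::alg_closed_field fls \<Rightarrow> 'w::field" and M :: "'w set"
  and g c :: "'w \<Rightarrow> 'w"
 assumes prime: "prime p" and char: "CHAR('k) = p" and m0: "m > 0" and pm: "\<not> p dvd m"
  and eK: "fhom eK" and M1: "1 \<in> M"
  and Mdiff: "x \<in> M \<Longrightarrow> y \<in> M \<Longrightarrow> x - y \<in> M" and Mmult: "x \<in> M \<Longrightarrow> y \<in> M \<Longrightarrow> x * y \<in> M"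
  and Minv: "x \<in> M \<Longrightarrow> inverse x \<in> M" and MK: "eK a \<in> M"
  and g: "fhom g" and c: "fhom c" and gM: "x \<in> M \<Longrightarrow> g x \<in> M" and cM: "x \<in> M \<Longrightarrow> c x \<in> M"
  and gK: "g (eK a) = eK a" and cK: "c (eK a) = eK a"
  and gq: "x \<in> M \<Longrightarrow> (g ^^ (p ^ R)) x = x" and cm: "x \<in> M \<Longrightarrow> (c ^^ m) x = x"
  and cg: "x \<in> M \<Longrightarrow> c (g x) = (g ^^ \<alpha>) (c x)"
  and fix_K: "x \<in> M \<Longrightarrow> g x = x \<Longrightarrow> c x = x \<Longrightarrow> x \<in> range eK"
  and faithful: "i < p ^ R \<Longrightarrow> l < m \<Longrightarrow> (\<And>x. x \<in> M \<Longrightarrow> (g ^^ i) ((c ^^ l) x) = x) \<Longrightarrow> i = 0 \<and> l = 0"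
  and \<alpha>m: "\<alpha> ^ m mod p ^ Suc R = 1 mod p ^ Suc R"
begin

abbreviation q where "q \<equiv> p ^ R"

lemma p1: "p > 1" using prime prime_gt_1_nat by blast

lemma q0: "q > 0" using p1 by simp

lemma charw: "CHAR('w) = p"
proof (rule CHAR_eqI)
 have "eK (of_nat p) = 0"
  by (metis char fhom_0[OF eK] of_nat_CHAR semiring_char_fls)
 thus "of_nat p = (0::'w)" by (simp add: fhom_of_nat[OF eK])
 fix n assume "of_nat n = (0::'w)"
 hence "eK (of_nat n) = 0" by (simp add: fhom_of_nat[OF eK])
 hence "of_nat n = (0 :: 'k fls)" by (simp add: fhom_eq_0[OF eK])
 thus "p dvd n" by (simp add: of_nat_eq_0_iff_char_dvd char)
qed

lemma m_nz: "of_nat m \<noteq> (0::'k)" "of_nat m \<noteq> (0::'w)"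
 using pm by (simp_all add: of_nat_eq_0_iff_char_dvd char charw)

lemma M0: "0 \<in> M" using Mdiff[OF M1 M1] by simp
lemma Muminus: "x \<in> M \<Longrightarrow> - x \<in> M" using Mdiff[OF M0] by simp
lemma Madd: "x \<in> M \<Longrightarrow> y \<in> M \<Longrightarrow> x + y \<in> M" using Mdiff[of x "- y"] Muminus[of y] by simp
lemma Mpower: "x \<in> M \<Longrightarrow> x ^ n \<in> M" by (induction n) (simp_all add: M1 Mmult)
lemma Msum: "(\<And>i. i \<in> A \<Longrightarrow> f i \<in> M) \<Longrightarrow> sum f A \<in> M"
 by (induction A rule: infinite_finite_induct) (simp_all add: M0 Madd)

lemma gp: "fhom (g ^^ i)" and cp: "fhom (c ^^ i)"
 by (rule fhom_funpow[OF g], rule fhom_funpow[OF c])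

lemma gpM: "x \<in> M \<Longrightarrow> (g ^^ i) x \<in> M" by (induction i) (simp_all add: gM)
lemma cpM: "x \<in> M \<Longrightarrow> (c ^^ i) x \<in> M" by (induction i) (simp_all add: cM)
lemma gpK: "(g ^^ i) (eK a) = eK a" by (induction i) (simp_all add: gK)
lemma cpK: "(c ^^ i) (eK a) = eK a" by (induction i) (simp_all add: cK)

lemma funpow_periodic:
 assumes "\<And>x. x \<in> M \<Longrightarrow> f x \<in> M" "\<And>x. x \<in> M \<Longrightarrow> (f ^^ n) x = (x::'w)" "x \<in> M"
 shows "(f ^^ (n * k)) x = x"
 using assms(3) by (induction k) (simp_all add: funpow_add assms(2))

lemma gmod: assumes "x \<in> M" "i mod q = j mod q" shows "(g ^^ i) x = (g ^^ j) x"
proof -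
 have "(g ^^ i) x = (g ^^ (i mod q)) x" for i
 proof -
  have "(g ^^ (i mod q + q * (i div q))) x = (g ^^ (i mod q)) x"
   by (simp only: funpow_add comp_apply funpow_periodic[of g q, OF gM gq assms(1)])
  thus ?thesis by simp
 qed
 thus ?thesis using assms(2) by metis
qed

lemma cmod: assumes "x \<in> M" shows "(c ^^ l) x = (c ^^ (l mod m)) x"
proof -
 have "(c ^^ (l mod m + m * (l div m))) x = (c ^^ (l mod m)) x"
  by (simp only: funpow_add comp_apply funpow_periodic[of c m, OF cM cm assms])
 thus ?thesis by simp
qed

lemma cgp: "x \<in> M \<Longrightarrow> c ((g ^^ i) x) = (g ^^ (\<alpha> * i)) (c x)"
proof (induction i)
 case (Suc i)
 have "c ((g ^^ Suc i) x) = (g ^^ \<alpha>) (c ((g ^^ i) x))" using cg[OF gpM[OF Suc.prems]] by simp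
 also have "\<dots> = (g ^^ (\<alpha> + \<alpha> * i)) (c x)" using Suc by (simp add: funpow_add)
 finally show ?case by simp
qed simp

lemma cpgp: "x \<in> M \<Longrightarrow> (c ^^ l) ((g ^^ i) x) = (g ^^ (\<alpha> ^ l * i)) ((c ^^ l) x)"
proof (induction l)
 case (Suc l)
 thus ?case using cgp[OF cpM[OF Suc.prems], of "\<alpha> ^ l * i" l] by (simp add: mult.assoc)
qed simp

text \<open>\<alpha> describes conjugation in the group of the extension still to be built, whose
  cyclic part has order p^(R+1). Hence it is known modulo one more power of p than the tower of
  height R displays.\<close>

lemma \<alpha>m_mod: "r \<le> Suc R \<Longrightarrow> \<alpha> ^ m mod p ^ r = 1 mod p ^ r"
 using \<alpha>m by (metis le_imp_power_dvd mod_mod_cancel)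

text \<open>The steps of the tower: F 0 is the tame field, fixed by g, and F R is all of M.\<close>

definition F where "F r = {x \<in> M. (g ^^ (p ^ r)) x = x}"

lemma F_M: "x \<in> F r \<Longrightarrow> x \<in> M" by (simp add: F_def)

lemma F_closed:
 "1 \<in> F r" "0 \<in> F r" "eK a \<in> F r"
 "x \<in> F r \<Longrightarrow> y \<in> F r \<Longrightarrow> x - y \<in> F r" "x \<in> F r \<Longrightarrow> y \<in> F r \<Longrightarrow> x + y \<in> F r"
 "x \<in> F r \<Longrightarrow> y \<in> F r \<Longrightarrow> x * y \<in> F r" "x \<in> F r \<Longrightarrow> inverse x \<in> F r"
 "x \<in> F r \<Longrightarrow> x ^ n \<in> F r"
 by (simp_all add: F_def M1 M0 MK Mdiff Madd Mmult Minv Mpower gpK fhom_simps[OF gp] fhom_inverse[OF gp])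

lemma F_sum: "(\<And>i. i \<in> A \<Longrightarrow> f i \<in> F r) \<Longrightarrow> sum f A \<in> F r"
 by (induction A rule: infinite_finite_induct) (simp_all add: F_closed)

lemma F_top: "F R = M" using gq by (auto simp: F_def)

lemma F_mult: assumes "x \<in> F r" shows "(g ^^ (p ^ r * k)) x = x"
 by (induction k) (use assms in \<open>simp_all add: funpow_add F_def\<close>)

lemma F_mono: assumes "r \<le> s" "x \<in> F r" shows "x \<in> F s"
proof -
 have "p ^ s = p ^ r * p ^ (s - r)" using assms(1) by (simp flip: power_add)
 thus ?thesis using F_mult[OF assms(2), of "p ^ (s - r)"] assms(2) by (simp add: F_def)
qed

lemma F_g: assumes "x \<in> F r" shows "(g ^^ i) x \<in> F r"
proof -
 have "(g ^^ (p ^ r)) ((g ^^ i) x) = (g ^^ i) ((g ^^ (p ^ r)) x)"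
  by (rule funpow_comm)
 thus ?thesis using assms by (simp add: F_def gpM)
qed

text \<open>\<alpha> is invertible modulo p^R with inverse \<alpha>^(m-1), so conjugation by c maps
  the group generated by g^(p^r) onto itself.\<close>

lemma F_c1: assumes "x \<in> F r" shows "c x \<in> F r"
proof -
 have x: "x \<in> M" "(g ^^ (p ^ r)) x = x" using assms by (simp_all add: F_def)
 have 1: "(g ^^ (\<alpha> * p ^ r)) (c x) = c x" using cgp[OF x(1), of "p ^ r"] x(2) by simp
 have 2: "(g ^^ (\<alpha> * p ^ r * k)) (c x) = c x" for k
  by (induction k) (simp_all add: funpow_add 1)
 have "\<alpha> ^ m * p ^ r mod q = p ^ r mod q" using \<alpha>m_mod[of R] by (metis le_SucI le_refl mod_mult_left_eq mult_1)
 moreover have "\<alpha> ^ m * p ^ r = \<alpha> * p ^ r * \<alpha> ^ (m - 1)"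
  using m0 by (cases m) (simp_all add: mult_ac)
 ultimately have "p ^ r mod q = \<alpha> * p ^ r * \<alpha> ^ (m - 1) mod q" by metis
 from gmod[OF cM[OF x(1)] this]
 have "(g ^^ (p ^ r)) (c x) = (g ^^ (\<alpha> * p ^ r * \<alpha> ^ (m - 1))) (c x)" .
 thus ?thesis using 2 cM[OF x(1)] by (simp add: F_def)
qed

lemma F_c: "x \<in> F r \<Longrightarrow> (c ^^ l) x \<in> F r"
 by (induction l) (simp_all add: F_c1)

definition trace where "trace x = (\<Sum>i<q. (g ^^ i) x)"

lemma trace_g: assumes "x \<in> M" shows "g (trace x) = trace x"
proof -
 have "g (trace x) = (\<Sum>i<q. (g ^^ Suc i) x)" by (simp add: trace_def fhom_sum[OF g])
 also have "\<dots> = trace x" unfolding trace_def by (rule sum_shift_periodic) (simp add: gq assms)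
 finally show ?thesis .
qed

lemma trace_M: "x \<in> M \<Longrightarrow> trace x \<in> M" unfolding trace_def by (intro Msum gpM)

lemma g_distinct:
 assumes "i < q" "j < q" "\<And>x. x \<in> M \<Longrightarrow> (g ^^ i) x = (g ^^ j) x"
 shows "i = j"
proof -
 have *: "i = j" if le: "i \<le> j" and lt: "j < q" and eq: "\<And>x. x \<in> M \<Longrightarrow> (g ^^ i) x = (g ^^ j) x" for i j
 proof -
  have "(g ^^ (j - i)) x = x" if "x \<in> M" for x
  proof -
   have "(g ^^ i) ((g ^^ (j - i)) x) = (g ^^ (i + (j - i))) x" by (simp only: funpow_add comp_apply)
   hence "(g ^^ i) ((g ^^ (j - i)) x) = (g ^^ i) x" using eq[OF that] le by simp
   thus ?thesis by (simp add: fhom_eq_iff[OF gp])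
  qed
  hence "j - i = 0 \<and> (0::nat) = 0" using lt m0 by (intro faithful) auto
  thus ?thesis using le by simp
 qed
 show ?thesis using *[of i j] *[of j i] assms by (metis linear)
qed

lemma trace_nonzero: "\<exists>x\<in>M. trace x \<noteq> 0"
proof (rule ccontr)
 assume a: "\<not> (\<exists>x\<in>M. trace x \<noteq> 0)"
 have "(1::'w) = 0"
 proof (rule dedekind[where I = "{..<q}" and \<sigma> = "\<lambda>i. g ^^ i" and a = "\<lambda>_. 1" and M = M])
  show "\<And>x. x \<in> M \<Longrightarrow> (\<Sum>i<q. 1 * (g ^^ i) x) = 0" using a by (simp add: trace_def)
 qed (use gp M1 Mmult g_distinct q0 in auto)
 thus False by simp
qed

lemma trace_one: "\<exists>x\<in>M. trace x = 1"
proof -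
 obtain x where x: "x \<in> M" "trace x \<noteq> 0" using trace_nonzero by blast
 have "g (inverse (trace x)) = inverse (trace x)"
  by (simp add: fhom_inverse[OF g] trace_g[OF x(1)])
 hence i: "(g ^^ i) (inverse (trace x)) = inverse (trace x)" for i by (induction i) simp_all
 have "trace (inverse (trace x) * x) = inverse (trace x) * trace x"
  unfolding trace_def[of "inverse (trace x) * x"] fhom_mult[OF gp] i
  by (simp add: trace_def sum_distrib_left)
 thus ?thesis using x by (intro bexI[of _ "inverse (trace x) * x"]) (simp_all add: Mmult Minv trace_M)
qed

text \<open>Applied to the traces of \<open>M\<close>, independence of characters shows that \<open>c\<close> keeps its order on the
 fixed field of \<open>g\<close>.\<close>

lemma c_faithful:
 assumes l: "l < m" and fx: "\<And>x. x \<in> F 0 \<Longrightarrow> (c ^^ l) x = x"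
 shows "l = 0"
proof (rule ccontr)
 assume l0: "l \<noteq> 0"
 \<comment> \<open>The pair (0, i) stands for g^i and (1, i) for c^l g^i. If c^l fixed all traces,
   the coefficients - 1 and 1 would give a linear relation among these distinct
   homomorphisms.\<close>
 define \<sigma> where "\<sigma> ei = (if fst ei = (0::nat) then g ^^ snd ei else (\<lambda>x. (c ^^ l) ((g ^^ snd ei) x)))" for ei
 define a where "a ei = (if fst ei = (0::nat) then - 1 else (1::'w))" for ei :: "nat \<times> nat"
 have "a (0, 0) = 0"
 proof (rule dedekind[where I = "{0, 1} \<times> {..<q}" and \<sigma> = \<sigma> and M = M])
  show "fhom (\<sigma> ei)" for ei by (simp add: \<sigma>_def gp fhom_comp[OF cp gp])
  have mixed: False if mi: "i < q" "j < q" "\<And>x. x \<in> M \<Longrightarrow> (c ^^ l) ((g ^^ i) x) = (g ^^ j) x" for i j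
  proof -
   have "(g ^^ (((q - 1) * j + \<alpha> ^ l * i) mod q)) ((c ^^ l) x) = x" if x: "x \<in> M" for x
   proof -
    have "(g ^^ (((q - 1) * j + \<alpha> ^ l * i) mod q)) ((c ^^ l) x) = (g ^^ ((q - 1) * j + \<alpha> ^ l * i)) ((c ^^ l) x)"
     by (rule gmod[OF cpM[OF x]]) simp
    also have "\<dots> = (g ^^ ((q - 1) * j)) ((c ^^ l) ((g ^^ i) x))" by (simp add: funpow_add cpgp[OF x])
    also have "\<dots> = (g ^^ ((q - 1) * j + j)) x" by (simp add: mi(3)[OF x] funpow_add)
    also have "(q - 1) * j + j = q * j" using q0 by (cases q) simp_all
    also have "(g ^^ (q * j)) x = x" by (rule funpow_periodic[OF gM gq x])
    finally show ?thesis .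
   qed
   hence "((q - 1) * j + \<alpha> ^ l * i) mod q = 0 \<and> l = 0" using l q0 by (intro faithful) auto
   thus False using l0 by simp
  qed
  show "ei = ej" if ij: "ei \<in> {0, 1} \<times> {..<q}" "ej \<in> {0, 1} \<times> {..<q}"
   and eq: "\<And>x. x \<in> M \<Longrightarrow> \<sigma> ei x = \<sigma> ej x" for ei ej
  proof -
   obtain e i e' j where e: "ei = (e, i)" "ej = (e', j)" by (metis surj_pair)
   consider "e = 0" "e' = 0" | "e = 1" "e' = 1" | "e = 0" "e' = 1" | "e = 1" "e' = 0" using ij e by auto
   thus ?thesis
   proof cases
    case 1
    thus ?thesis using g_distinct[of i j] ij eq e by (simp add: \<sigma>_def)
   next
    case 2
    thus ?thesis using g_distinct[of i j] ij eq e by (simp add: \<sigma>_def fhom_eq_iff[OF cp])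
   next
    case 3
    thus ?thesis using mixed[of j i] ij eq e by (simp add: \<sigma>_def)
   next
    case 4
    thus ?thesis using mixed[of i j] ij eq e by (simp add: \<sigma>_def)
   qed
  qed
  show "(\<Sum>ei\<in>{0, 1} \<times> {..<q}. a ei * \<sigma> ei x) = 0" if x: "x \<in> M" for x
  proof -
   have "(\<Sum>ei\<in>{0, 1} \<times> {..<q}. a ei * \<sigma> ei x) = (\<Sum>e\<in>{0,1}. \<Sum>i<q. a (e, i) * \<sigma> (e, i) x)"
    by (simp add: sum.cartesian_product)
   also have "\<dots> = - trace x + (c ^^ l) (trace x)"
    by (simp add: a_def \<sigma>_def trace_def sum_negf fhom_sum[OF cp])
   also have "trace x \<in> F 0" using trace_g[OF x] trace_M[OF x] by (simp add: F_def)
   hence "(c ^^ l) (trace x) = trace x" by (rule fx)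
   finally show ?thesis by simp
  qed
 qed (use M1 Mmult q0 in auto)
 thus False by (simp add: a_def)
qed

lemma F0_K: "x \<in> F 0 \<Longrightarrow> c x = x \<Longrightarrow> x \<in> range eK"
 by (rule fix_K) (simp_all add: F_def)

end

context ctower
begin

text \<open>The Lagrange resolvent of \<open>c\<close>, corrected by an element of \<open>k((t))\<close>, is an \<open>m\<close>-th root of \<open>t\<close>.\<close>

lemma resolvent:
 assumes \<zeta>: "primitive_root m (\<zeta>::'k)"
 defines "Z \<equiv> eK (fls_const \<zeta>)"
 shows "\<exists>z\<in>F 0. z \<noteq> 0 \<and> c z = Z * z"
proof -
 have Zp: "Z ^ i = eK (fls_const (\<zeta> ^ i))" for i by (simp add: Z_def fhom_power[OF eK] fls_const_power)
 have "\<zeta> ^ m = 1" using \<zeta> by (simp add: primitive_root_def)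
 hence Zm: "Z ^ m = 1" by (simp add: Zp fhom_1[OF eK])
 have Z0: "Z \<noteq> 0" using Zm m0 by (auto simp: zero_power)
 define V where "V = inverse Z"
 have V: "V ^ m = 1" "Z * V = 1" using Zm Z0 by (simp_all add: V_def power_inverse)
 have cV: "c V = V" by (simp add: V_def Z_def fhom_inverse[OF c] cK)
 have VF: "V \<in> F 0" unfolding V_def Z_def by (intro F_closed)
 define \<rho> where "\<rho> x = (\<Sum>i<m. V ^ i * (c ^^ i) x)" for x
 have "\<exists>x\<in>F 0. \<rho> x \<noteq> 0"
 proof (rule ccontr)
  assume a: "\<not> (\<exists>x\<in>F 0. \<rho> x \<noteq> 0)"
  have "V ^ 0 = 0"
  proof (rule dedekind[where I = "{..<m}" and \<sigma> = "\<lambda>i. c ^^ i" and a = "\<lambda>i. V ^ i" and M = "F 0"])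
   have *: "i = j" if le: "i \<le> j" and lt: "j < m" and eq: "\<And>x. x \<in> F 0 \<Longrightarrow> (c ^^ i) x = (c ^^ j) x" for i j
   proof -
    have "(c ^^ (j - i)) x = x" if "x \<in> F 0" for x
    proof -
     have "(c ^^ i) ((c ^^ (j - i)) x) = (c ^^ (i + (j - i))) x" by (simp only: funpow_add comp_apply)
     hence "(c ^^ i) ((c ^^ (j - i)) x) = (c ^^ i) x" using eq[OF that] le by simp
     thus ?thesis by (simp add: fhom_eq_iff[OF cp])
    qed
    hence "j - i = 0" using lt by (intro c_faithful) auto
    thus ?thesis using le by simp
   qed
   show "i = j" if "i \<in> {..<m}" "j \<in> {..<m}" "\<And>x. x \<in> F 0 \<Longrightarrow> (c ^^ i) x = (c ^^ j) x" for i j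
    using *[of i j] *[of j i] that by (metis lessThan_iff linear)
   show "\<And>x. x \<in> F 0 \<Longrightarrow> (\<Sum>i<m. V ^ i * (c ^^ i) x) = 0" using a by (simp add: \<rho>_def)
  qed (use cp F_closed m0 in auto)
  thus False by simp
 qed
 then obtain x where x: "x \<in> F 0" "\<rho> x \<noteq> 0" by blast
 have "V * c (\<rho> x) = (\<Sum>i<m. V ^ Suc i * (c ^^ Suc i) x)"
  by (simp add: \<rho>_def fhom_sum[OF c] fhom_mult[OF c] fhom_power[OF c] cV sum_distrib_left mult_ac)
 also have "\<dots> = \<rho> x" unfolding \<rho>_def
  by (rule sum_shift_periodic) (simp add: V cm[OF F_M[OF x(1)]])
 finally have "Z * (V * c (\<rho> x)) = Z * \<rho> x" by simp
 hence "c (\<rho> x) = Z * \<rho> x" using V(2) by (simp flip: mult.assoc)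
 moreover have "\<rho> x \<in> F 0" unfolding \<rho>_def by (intro F_sum F_closed VF F_c x)
 ultimately show ?thesis using x by blast
qed

text \<open>The resolvent is an m-th root of some f in k((t)), which up to an m-th power is t^a.
  Since c multiplies it by a root of unity of exact order m, a is prime to m. A Bezout combination
  then gives a root of t, at the cost of replacing \<zeta> by a power that is again
  primitive.\<close>

lemma tame_uniformizer:
 "\<exists>\<zeta> \<tau>. primitive_root m (\<zeta>::'k) \<and> \<tau> \<in> F 0 \<and> \<tau> ^ m = eK fls_X \<and> c \<tau> = eK (fls_const \<zeta>) * \<tau>"
proof -
 obtain \<zeta> :: 'k where \<zeta>: "primitive_root m \<zeta>" using alg_closed_primitive_root[OF m0 m_nz(1)] by blast
 define Z where "Z = eK (fls_const \<zeta>)"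
 have Zp: "Z ^ i = eK (fls_const (\<zeta> ^ i))" for i by (simp add: Z_def fhom_power[OF eK] fls_const_power)
 have Z1: "Z ^ i = 1 \<longleftrightarrow> m dvd i" for i
  using \<zeta> by (metis Zp fhom_1[OF eK] fhom_eq_iff[OF eK] fls_const_1 fls_const_eq_1_iff primitive_root_def)
 have Z0: "Z \<noteq> 0" using Z1[of m] m0 by (auto simp: zero_power)
 have cZ: "c (Z ^ i) = Z ^ i" for i by (simp add: Zp cK)
 obtain z0 where z0: "z0 \<in> F 0" "z0 \<noteq> 0" "c z0 = Z * z0" using resolvent[OF \<zeta>] unfolding Z_def by blast
 have "c (z0 ^ m) = z0 ^ m" using Z1[of m] by (simp add: fhom_power[OF c] z0(3) power_mult_distrib)
 moreover have "z0 ^ m \<in> F 0" by (intro F_closed z0(1))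
 ultimately have "z0 ^ m \<in> range eK" by (intro F0_K)
 then obtain f where f: "z0 ^ m = eK f" by blast
 have f0: "f \<noteq> 0" using f z0(2) fhom_0[OF eK] by auto
 obtain v where v: "v \<noteq> 0" "f = fls_X powi (val f) * v ^ m"
  using fls_power_decompose[OF m0 m_nz(1) f0] by blast
 define a where "a = val f"
 have ev0: "eK v \<noteq> 0" using v(1) fhom_eq_0[OF eK] by simp
 define z1 where "z1 = z0 / eK v"
 have z1F: "z1 \<in> F 0" unfolding z1_def divide_inverse by (intro F_closed z0)
 have cz1: "c z1 = Z * z1" by (simp add: z1_def fhom_divide[OF c] cK z0(3))
 have "eK f = eK (fls_X powi a) * eK v ^ m" by (subst v(2)) (simp only: a_def fhom_mult[OF eK] fhom_power[OF eK])
 hence z1m: "z1 ^ m = eK (fls_X powi a)" using ev0 by (simp add: z1_def power_divide f)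
 have XK: "eK (fls_X powi i) = eK fls_X powi i" for i by (rule fhom_powi[OF eK])
 have X0: "eK fls_X \<noteq> 0" using fhom_eq_0[OF eK] by simp
 define d where "d = nat (gcd a (int m))"
 have d: "d > 0" "int d = gcd a (int m)" using m0 by (simp_all add: d_def)
 obtain a' where a': "a = int d * a'" using d(2) by (metis dvdE gcd_dvd1)
 have "int d dvd int m" using d(2) by simp
 then obtain m' where m': "m = d * m'" by auto
 \<comment> \<open>By construction w^d = 1 for d = gcd(a, m), so w is a constant and fixed by c. But
   c multiplies w by Z^m', which forces m to divide m' and d = 1.\<close>
 define w where "w = z1 ^ m' / eK (fls_X powi a')"
 have wd: "w ^ d = 1"
 proof -
  have "w ^ d = z1 ^ m / (eK fls_X powi a') ^ d"
   by (simp only: w_def power_divide XK power_mult[symmetric] m' mult.commute)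
  also have "(eK fls_X powi a') ^ d = eK (fls_X powi a)"
   by (simp only: XK a' power_int_power' mult.commute)
  finally show ?thesis using X0 by (simp only: z1m XK) simp
 qed
 have "w \<in> (\<lambda>i. (Z ^ m') ^ i) ` {..<d}"
 proof (rule roots_exhausted)
  let ?P = "monom 1 d + [:- 1:] :: 'w poly"
  have deg: "Polynomial.degree ?P = Polynomial.degree (monom (1::'w) d)"
   by (rule degree_add_eq_left) (use d in \<open>simp add: degree_monom_eq\<close>)
  show "?P \<noteq> 0" using deg d by (metis degree_0 degree_monom_eq less_numeral_extra(3) zero_neq_one)
  have inj: "inj_on (\<lambda>i. (Z ^ m') ^ i) {..<d}"
  proof -
   have *: "i = j" if "i \<le> j" "j < d" "(Z ^ m') ^ i = (Z ^ m') ^ j" for i j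
   proof -
    have "(Z ^ m') ^ j = (Z ^ m') ^ i * (Z ^ m') ^ (j - i)" using that(1) by (simp flip: power_add)
    hence "(Z ^ m') ^ (j - i) = 1" using that(3) Z0 by simp
    hence "m dvd m' * (j - i)" by (simp add: Z1 flip: power_mult)
    hence "d dvd j - i" using m' m0 by (cases "m' = 0") (simp_all add: mult.commute)
    thus ?thesis using that by (auto dest: dvd_imp_le)
   qed
   show ?thesis by (rule inj_onI) (metis * lessThan_iff linear)
  qed
  show "Polynomial.degree ?P \<le> card ((\<lambda>i. (Z ^ m') ^ i) ` {..<d})"
   unfolding deg card_image[OF inj] by (simp add: degree_monom_eq)
  show "poly ?P w = 0" using wd by (simp add: poly_monom)
  fix x assume "x \<in> (\<lambda>i. (Z ^ m') ^ i) ` {..<d}"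
  then obtain i where "x = (Z ^ m') ^ i" by auto
  hence "x ^ d = (Z ^ m) ^ i" by (simp only: m' power_mult[symmetric] mult_ac)
  thus "poly ?P x = 0" using Z1[of m] by (simp add: poly_monom)
 qed simp
 then obtain i where "w = (Z ^ m') ^ i" by blast
 hence "c w = w" by (metis cZ power_mult)
 moreover have "c w = Z ^ m' * w"
  by (simp add: w_def fhom_divide[OF c] fhom_power[OF c] cz1 power_mult_distrib cK)
 moreover have "w \<noteq> 0" using wd d(1) by (auto simp: zero_power)
 ultimately have "m dvd m'" using Z1 by simp
 hence "d = 1" using m' m0 by (auto dest!: dvd_imp_le)
 hence "gcd a (int m) = 1" using d(2) by simp
 then obtain s t where st: "s * a + t * int m = 1" using bezout_int[of a "int m"] by auto
 \<comment> \<open>A nonnegative Bezout coefficient: b a = 1 + m e, so z1^b t^(- e) has m-th power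
   t.\<close>
 define b where "b = nat (s mod int m)"
 have b: "int b = s mod int m" using m0 by (simp add: b_def)
 have "(int b * a) mod int m = (s * a + t * int m) mod int m" unfolding b by (simp add: mod_mult_left_eq)
 hence "(int b * a) mod int m = 1 mod int m" using st by simp
 hence "int m dvd int b * a - 1" by (simp add: mod_eq_dvd_iff)
 then obtain e where e: "int b * a - 1 = int m * e" by blast
 define \<tau> where "\<tau> = z1 ^ b * eK (fls_X powi (- e))"
 have "\<tau> \<in> F 0" unfolding \<tau>_def by (intro F_closed z1F)
 moreover have "\<tau> ^ m = eK fls_X"
 proof -
  have "\<tau> ^ m = (z1 ^ m) ^ b * (eK fls_X powi (- e)) ^ m"
   by (simp only: \<tau>_def XK power_mult_distrib power_mult[symmetric] mult.commute)
  also have "\<dots> = eK fls_X powi (a * int b) * eK fls_X powi (- e * int m)"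
   by (simp only: z1m XK power_int_power')
  also have "\<dots> = eK fls_X powi (a * int b + - e * int m)"
   by (rule power_int_add[symmetric]) (use X0 in simp)
  also have "a * int b + - e * int m = 1" using e by (simp add: algebra_simps)
  finally show ?thesis by simp
 qed
 moreover have "c \<tau> = eK (fls_const (\<zeta> ^ b)) * \<tau>"
  by (simp only: \<tau>_def fhom_mult[OF c] fhom_power[OF c] cz1 cK power_mult_distrib Zp mult_ac)
 moreover have "primitive_root m (\<zeta> ^ b)"
  unfolding primitive_root_def
 proof
  fix i
  have "(\<zeta> ^ b) ^ i = 1 \<longleftrightarrow> m dvd b * i" using \<zeta> by (simp add: primitive_root_def flip: power_mult)
  also have "\<dots> \<longleftrightarrow> m dvd i"
  proof
   assume "m dvd b * i"
   hence "int m dvd a * (int b * int i)" by (metis dvd_mult int_dvd_int_iff of_nat_mult)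
   hence "int m dvd int i * (int b * a)" by (simp only: mult_ac)
   also have "int i * (int b * a) = int i * (int m * e) + int i" using e by (simp add: algebra_simps)
   finally have "int m dvd int i * (int m * e) + int i" .
   moreover have "int m dvd int i * (int m * e)" by simp
   ultimately have "int m dvd int i" by (metis dvd_add_right_iff)
   thus "m dvd i" by simp
  qed simp
  finally show "(\<zeta> ^ b) ^ i = 1 \<longleftrightarrow> m dvd i" .
 qed
 ultimately show ?thesis by blast
qed

text \<open>y i is the projection of x to the eigenspace of c for \<zeta>^i. The quotient y i /
  \<tau>^i is fixed by c, hence lies in k((t)), and orthogonality of characters makes the
  projections add up to x.\<close>

lemma tame_decomposition:
 assumes \<zeta>: "primitive_root m (\<zeta>::'k)" and \<tau>: "\<tau> \<in> F 0" "\<tau> \<noteq> 0" "c \<tau> = eK (fls_const \<zeta>) * \<tau>"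
  and x: "x \<in> F 0"
 shows "\<exists>a. x = (\<Sum>i<m. eK (a i) * \<tau> ^ i)"
proof -
 define Z where "Z = eK (fls_const \<zeta>)"
 have Zp: "Z ^ i = eK (fls_const (\<zeta> ^ i))" for i by (simp add: Z_def fhom_power[OF eK] fls_const_power)
 have Z1: "Z ^ i = 1 \<longleftrightarrow> m dvd i" for i
  using \<zeta> by (metis Zp fhom_1[OF eK] fhom_eq_iff[OF eK] fls_const_1 fls_const_eq_1_iff primitive_root_def)
 have Z0: "Z \<noteq> 0" using Z1[of m] m0 by (auto simp: zero_power)
 define V where "V = inverse Z"
 have V1: "V ^ i = 1 \<longleftrightarrow> m dvd i" for i by (simp add: V_def power_inverse Z1)
 have prV: "primitive_root m V" by (simp add: primitive_root_def V1)
 have cV: "c V = V" by (simp add: V_def Z_def fhom_inverse[OF c] cK)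
 have VF: "V \<in> F 0" unfolding V_def Z_def by (intro F_closed)
 define n where "n = inverse (of_nat m :: 'w)"
 have n: "n * of_nat m = 1" using m_nz(2) by (simp add: n_def)
 have cn: "c n = n" by (simp add: n_def fhom_inverse[OF c] fhom_of_nat[OF c])
 have "n = eK (inverse (of_nat m))" by (simp add: n_def fhom_inverse[OF eK] fhom_of_nat[OF eK])
 hence nF: "n \<in> F 0" using F_closed(3) by simp
 define y where "y i = n * (\<Sum>l<m. V ^ (i * l) * (c ^^ l) x)" for i
 have yF: "y i \<in> F 0" for i unfolding y_def by (intro F_closed F_sum nF VF F_c x)
 have cy: "c (y i) = Z ^ i * y i" for i
 proof -
  have "V ^ i * c (y i) = n * (\<Sum>l<m. V ^ (i * Suc l) * (c ^^ Suc l) x)"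
   by (simp add: y_def fhom_sum[OF c] fhom_mult[OF c] fhom_power[OF c] cV cn sum_distrib_left power_add mult_ac)
  also have "(\<Sum>l<m. V ^ (i * Suc l) * (c ^^ Suc l) x) = (\<Sum>l<m. V ^ (i * l) * (c ^^ l) x)"
   by (rule sum_shift_periodic) (simp add: V1 cm[OF F_M[OF x]])
  finally have "V ^ i * c (y i) = y i" by (simp only: y_def)
  hence "Z ^ i * y i = (Z * V) ^ i * c (y i)" by (simp add: power_mult_distrib mult.assoc)
  thus ?thesis using Z0 by (simp add: V_def)
 qed
 have "\<exists>a. y i = eK a * \<tau> ^ i" for i
 proof -
  have "c (y i / \<tau> ^ i) = y i / \<tau> ^ i"
   using Z0 by (simp add: fhom_divide[OF c] fhom_power[OF c] cy \<tau>(3) Z_def[symmetric] power_mult_distrib)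
  moreover have "y i / \<tau> ^ i \<in> F 0" unfolding divide_inverse by (intro F_closed yF \<tau>)
  ultimately have "y i / \<tau> ^ i \<in> range eK" by (intro F0_K)
  then obtain a where "y i / \<tau> ^ i = eK a" by blast
  thus ?thesis using \<tau>(2) by (intro exI[of _ a]) (simp add: field_simps)
 qed
 then obtain a where a: "\<And>i. y i = eK (a i) * \<tau> ^ i" by metis
 have "(\<Sum>i<m. y i) = n * (\<Sum>l<m. (c ^^ l) x * (\<Sum>i<m. (V ^ l) ^ i))"
  unfolding y_def sum_distrib_left
  by (subst sum.swap) (simp add: power_mult[symmetric] mult_ac)
 also have "(\<Sum>l<m. (c ^^ l) x * (\<Sum>i<m. (V ^ l) ^ i)) = (\<Sum>l<m. if l = 0 then of_nat m * x else 0)"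
 proof (intro sum.cong refl)
  fix l assume l: "l \<in> {..<m}"
  show "(c ^^ l) x * (\<Sum>i<m. (V ^ l) ^ i) = (if l = 0 then of_nat m * x else 0)"
  proof (cases "l = 0")
   case False
   hence "\<not> m dvd l" using l by (auto dest: dvd_imp_le)
   thus ?thesis using primitive_root_sum[OF prV] False by simp
  qed (simp add: mult.commute)
 qed
 also have "\<dots> = of_nat m * x" using m0 by simp
 finally have "x = (\<Sum>i<m. y i)" using n by (simp flip: mult.assoc)
 thus ?thesis using a by auto
qed

lemma tame_embedding:
 "\<exists>\<zeta> K eF. primitive_root m (\<zeta>::'k) \<and> good K m \<and> fhom eF \<and> range eF = F 0 \<and> (\<forall>a. eF (K a) = eK a) \<and>
  c (eF fls_X) = eF (fls_const \<zeta>) * eF fls_X"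
proof -
 obtain \<zeta> \<tau> where \<zeta>: "primitive_root m (\<zeta>::'k)" and \<tau>: "\<tau> \<in> F 0" "\<tau> ^ m = eK fls_X" "c \<tau> = eK (fls_const \<zeta>) * \<tau>"
  using tame_uniformizer by blast
 have \<tau>0: "\<tau> \<noteq> 0" using \<tau>(2) m0 fhom_eq_0[OF eK, of fls_X] by (auto simp: zero_power)
 define T where "T = (fps_X ^ m :: 'k fps)"
 have T: "T \<noteq> 0" "T $ 0 = 0" "subdegree T = m" using m0 by (simp_all add: T_def)
 define K where "K f = fls_compose_fps f T" for f
 have gk: "good K m" using good_compose[OF T(1,2)] T(3) unfolding K_def by simp
 note hk = good_fhom[OF gk]
 have kX: "K fls_X = fls_X ^ m" by (simp add: K_def T_def fps_to_fls_power)
 have inj: "inj_on (\<lambda>i. val ((fls_X :: 'k fls) ^ i) mod int m) {..<m}"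
  by (rule inj_onI) simp
 let ?P = "monom 1 m + [:- fls_X:] :: 'k fls poly"
 have deg: "Polynomial.degree ?P = Polynomial.degree (monom (1::'k fls) m)"
  by (rule degree_add_eq_left) (use m0 in \<open>simp add: degree_monom_eq\<close>)
 have ev: "poly (map_poly f ?P) y = y ^ m - f fls_X" if "fhom f" for f :: "'k fls \<Rightarrow> 'c::field" and y
  by (simp add: fhom_map_poly_add[OF that] map_poly_pCons fhom_simps[OF that] map_poly_monom poly_monom)
 have ex: "\<exists>\<psi>'. fhom \<psi>' \<and> (\<forall>a. \<psi>' (K a) = eK a) \<and> \<psi>' fls_X = \<tau>"
 proof (rule simple_extension_hom[OF gk _ inj _ _ _ eK])
  show "Polynomial.degree ?P = m" using deg by (simp add: degree_monom_eq)
  show "poly (map_poly K ?P) fls_X = 0" by (simp only: ev[OF hk] kX diff_self)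
  show "poly (map_poly eK ?P) \<tau> = 0" by (simp only: ev[OF eK] \<tau>(2) diff_self)
 qed simp
 then obtain eF where eF: "fhom eF" "\<And>a. eF (K a) = eK a" "eF fls_X = \<tau>" by blast
 have "range eF = F 0"
 proof
  show "range eF \<subseteq> F 0"
  proof
   fix x assume "x \<in> range eF"
   then obtain f where f: "x = eF f" by blast
   obtain a where a: "f = (\<Sum>i<m. K (a i) * fls_X ^ i)" using good_basis[OF gk _ inj, of f] by auto
   have "x = (\<Sum>i<m. eK (a i) * \<tau> ^ i)"
    unfolding f a by (simp add: fhom_sum[OF eF(1)] fhom_mult[OF eF(1)] fhom_power[OF eF(1)] eF)
   thus "x \<in> F 0" by (auto intro!: F_sum F_closed \<tau>)
  qed
  show "F 0 \<subseteq> range eF"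
  proof
   fix x assume "x \<in> F 0"
   then obtain a where "x = (\<Sum>i<m. eK (a i) * \<tau> ^ i)" using tame_decomposition[OF \<zeta> \<tau>(1) \<tau>0 \<tau>(3)] by blast
   hence "x = eF (\<Sum>i<m. K (a i) * fls_X ^ i)"
    by (simp add: fhom_sum[OF eF(1)] fhom_mult[OF eF(1)] fhom_power[OF eF(1)] eF)
   thus "x \<in> range eF" by blast
  qed
 qed
 moreover have "eF (fls_const \<zeta>) = eK (fls_const \<zeta>)" using eF(2)[of "fls_const \<zeta>"] by (simp add: good_const[OF gk])
 ultimately show ?thesis using \<zeta> gk eF \<tau>(3) by (intro exI[of _ \<zeta>] exI[of _ K] exI[of _ eF]) simp
qed

end

section \<open>The cyclic part as a power series in normal form\<close>

lemma fps_mult_nth_cong: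
 assumes "\<And>k. k \<le> n \<Longrightarrow> A $ k = B $ k" "\<And>k. k \<le> n \<Longrightarrow> C $ k = D $ k"
 shows "(A * C) $ n = (B * D) $ n"
 unfolding fps_mult_nth by (rule sum.cong) (use assms in auto)

text \<open>This identity lets 1 + X represent a generator of a cyclic group of order p^r modulo
  X^(p^r), and it computes the action of g^(p^r).\<close>

lemma one_plus_X_power:
 assumes "prime p" "CHAR('a::comm_ring_1) = p"
 shows "(1 + fps_X :: 'a fps) ^ (p ^ r) = 1 + fps_X ^ (p ^ r)"
proof (induction r)
 case (Suc r)
 have "(1 + fps_X :: 'a fps) ^ (p ^ Suc r) = ((1 + fps_X) ^ (p ^ r)) ^ p" by (simp add: power_mult[symmetric] mult.commute)
 also have "\<dots> = 1 ^ p + (fps_X ^ (p ^ r)) ^ p" unfolding Suc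
  by (rule char_power_add) (use assms in simp_all)
 finally show ?case by (simp add: power_mult[symmetric] mult.commute)
qed simp

lemma one_plus_X_mult_nth:
 "((1 + fps_X) * A) $ n = A $ n + (if n = 0 then 0 else (A::'a::comm_ring_1 fps) $ (n - 1))"
 by (simp add: distrib_right)

lemma one_plus_X_power_mult_nth:
 assumes "d > 0"
 shows "((1 + fps_X ^ d) * A) $ n = A $ n + (if n < d then 0 else (A::'a::comm_ring_1 fps) $ (n - d))"
 by (simp add: distrib_right fps_X_power_mult_nth)

locale ntower = ctower p m R \<alpha> eK M g c
 for p m R \<alpha> :: nat and eK :: "'k::alg_closed_field fls \<Rightarrow> 'w::field" and M :: "'w set"
  and g c :: "'w \<Rightarrow> 'w" +
 fixes \<zeta> :: 'k and K0 :: "'k fls \<Rightarrow> 'k fls" and eF :: "'k fls \<Rightarrow> 'w"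
 assumes \<zeta>: "primitive_root m \<zeta>" and K0: "good K0 m" and eF: "fhom eF" and eF_range: "range eF = F 0"
  and eF_K0: "eF (K0 a) = eK a" and eF_c: "c (eF fls_X) = eF (fls_const \<zeta>) * eF fls_X"
begin

abbreviation U :: "'w fps" where "U \<equiv> 1 + fps_X"

lemma eF_M: "eF a \<in> M" using eF_range F_M by blast

lemma eF_g: "g (eF a) = eF a" using eF_range unfolding F_def by auto

lemma frobw: "fhom (\<lambda>x::'w. x ^ p)" by (rule fhom_frob[OF prime charw])

lemma fmap_U: "fhom h \<Longrightarrow> fmap h U = U"
 by (rule fps_ext) (simp add: fhom_simps)

lemma fmap_Frob_U: "fmap (\<lambda>x::'w. x ^ p) U = U"
 by (rule fmap_U[OF frobw])

lemma coeffs_M_mult: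
 assumes "\<And>n. A $ n \<in> M" "\<And>n. B $ n \<in> M"
 shows "(A * B) $ n \<in> M"
 unfolding fps_mult_nth by (intro Msum Mmult assms)

text \<open>The cocycle \<open>g \<mapsto> 1 + X\<close> is split by the series \<open>\<Sum>\<^sub>i g^i(\<theta>) (1 + X)^(- i)\<close>, where \<open>\<theta>\<close> has
 trace 1.\<close>

lemma hilbert_90:
 "\<exists>Y. Y $ 0 = 1 \<and> (\<forall>n. Y $ n \<in> M) \<and> (\<forall>n<q. g (Y $ n) = (U * Y) $ n)"
proof -
 obtain \<theta> where \<theta>: "\<theta> \<in> M" "trace \<theta> = 1" using trace_one by blast
 define V where "V = inverse U"
 have U0: "U $ 0 \<noteq> 0" by simp
 have UV: "U * V = 1" unfolding V_def by (rule inverse_mult_eq_1'[OF U0])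
 have Vn: "V $ n = (- 1) ^ n" for n
  unfolding V_def using fps_inverse_fps_X_plus1 by (metis fps_nth_Abs_fps add.commute)
 have gV: "fmap g V = V" by (rule fps_ext) (simp add: Vn fhom_simps[OF g])
 have VM: "(V ^ i) $ n \<in> M" for i n
 proof (induction i arbitrary: n)
  case (Suc i)
  have "V $ n \<in> M" for n unfolding Vn by (intro Mpower Muminus M1)
  thus ?case unfolding power_Suc by (intro coeffs_M_mult Suc)
 qed (simp add: M0 M1)
 define t where "t i = fps_const ((g ^^ i) \<theta>) * V ^ i" for i
 define Y where "Y = (\<Sum>i<q. t i)"
 have YM: "Y $ n \<in> M" for n
  unfolding Y_def t_def fps_sum_nth by (simp add: Msum Mmult gpM \<theta> VM)
 have "Y $ 0 = 1" using \<theta>(2) by (simp add: Y_def t_def fps_sum_nth trace_def Vn fps_power_zeroth)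
 moreover have "g (Y $ n) = (U * Y) $ n" if n: "n < q" for n
 proof -
  have Ut: "U * t (Suc i) = fmap g (t i)" for i
  proof -
   have "U * t (Suc i) = fps_const (g ((g ^^ i) \<theta>)) * V ^ i * (U * V)" by (simp add: t_def mult_ac)
   also have "\<dots> = fmap g (t i)" by (simp add: UV t_def fmap_mult[OF g] fmap_const[OF g] fmap_power[OF g] gV)
   finally show ?thesis .
  qed
  have "fmap g Y = (\<Sum>i<q. fmap g (t i))"
   by (rule fps_ext) (simp add: Y_def fps_sum_nth fhom_sum[OF g])
  also have "\<dots> = U * (\<Sum>i<q. t (Suc i))" by (simp only: Ut[symmetric] sum_distrib_left)
  also have "(\<Sum>i<q. t (Suc i)) = Y + (t q - t 0)"
  proof -
   have "(\<Sum>i<q. t i) + t q = t 0 + (\<Sum>i<q. t (Suc i))"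
    using sum.lessThan_Suc_shift[of t q] sum.lessThan_Suc[of t q] by (simp only: add.commute)
   thus ?thesis by (simp add: Y_def algebra_simps)
  qed
  finally have gY: "fmap g Y = U * Y + U * (t q - t 0)" by (simp add: distrib_left)
  have "(1 + fps_X ^ q) * V ^ q = (U * V) ^ q"
   unfolding power_mult_distrib one_plus_X_power[OF prime charw] ..
  also have "\<dots> = 1" by (simp only: UV power_one)
  finally have Vq: "V ^ q = 1 - fps_X ^ q * V ^ q" by (simp add: algebra_simps)
  \<comment> \<open>The sum over the cyclic group closes up only to this term, which is divisible by
    X^q; the cocycle relation therefore holds below q.\<close>
  have "t q - t 0 = fps_const \<theta> * (V ^ q - 1)" using gq[OF \<theta>(1)] by (simp add: t_def algebra_simps)
  also have "\<dots> = - (fps_X ^ q * (fps_const \<theta> * V ^ q))" by (subst Vq) (simp add: algebra_simps)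
  finally have "U * (t q - t 0) = - (fps_X ^ q * (U * (fps_const \<theta> * V ^ q)))"
   by (simp only: mult_minus_right mult.left_commute)
  hence "(U * (t q - t 0)) $ n = 0" using n by (simp add: fps_X_power_mult_nth)
  hence "fmap g Y $ n = (U * Y) $ n" by (simp only: gY fps_add_nth add_0_right)
  thus ?thesis by simp
 qed
 ultimately show ?thesis using YM by blast
qed

text \<open>The defect at index n of the Lang equation is fixed by g, hence lies in the tame field.
  Multiplying Y by 1 + h X^n changes it by wp(h), and the reduced remainder is absorbed by the new
  factor of index n.\<close>

lemma normal_form_exists_aux:
 assumes "1 \<le> n" "n \<le> q"
 shows "\<exists>Y f. Y $ 0 = 1 \<and> (\<forall>k. Y $ k \<in> M) \<and> (\<forall>k<q. g (Y $ k) = (U * Y) $ k) \<and> (\<forall>i. reduced p (f i)) \<and>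
  (\<forall>k<n. (Y * fmap eF (normal_form f n)) $ k = (Y $ k) ^ p)"
 using assms
proof (induction n rule: dec_induct)
 case base
 obtain Y where Y: "Y $ 0 = 1" "\<forall>n. Y $ n \<in> M" "\<forall>n<q. g (Y $ n) = (U * Y) $ n" using hilbert_90 by blast
 have "\<forall>i::nat. reduced p (0 :: 'k fls)" by (simp add: reduced_def)
 moreover have "\<forall>k<1. (Y * fmap eF (normal_form (\<lambda>_. 0) 1)) $ k = (Y $ k) ^ p"
  using Y(1) by (simp add: normal_form_def fhom_1[OF eF])
 ultimately show ?case using Y by (intro exI[of _ Y] exI[of _ "\<lambda>_. 0"]) simp
next
 case (step n)
 hence n: "n < q" "n > 0" by auto
 obtain Y f where Y: "Y $ 0 = 1" "\<And>k. Y $ k \<in> M" "\<And>k. k < q \<Longrightarrow> g (Y $ k) = (U * Y) $ k"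
  and f: "\<And>i. reduced p (f i)" and rel: "\<And>k. k < n \<Longrightarrow> (Y * fmap eF (normal_form f n)) $ k = (Y $ k) ^ p"
  using step.IH n by auto
 define W where "W = fmap eF (normal_form f n)"
 have W0: "W $ 0 = 1" by (simp add: W_def normal_form_nth_0 fhom_1[OF eF])
 have WM: "W $ k \<in> M" and gW: "g (W $ k) = W $ k" for k by (simp_all add: W_def eF_M eF_g)
 define Q where "Q = Y * W - fmap (\<lambda>x. x ^ p) Y"
 have Q: "Q $ k = 0" if "k < n" for k using rel[OF that] by (simp add: Q_def W_def)
 have QM: "Q $ n \<in> M" unfolding Q_def by (simp add: Mdiff coeffs_M_mult Y WM Mpower)
 \<comment> \<open>Frobenius fixes 1 + X, so g acts on Y W - F(Y) as multiplication by 1 + X; below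
   n this series vanishes, so its n-th coefficient is invariant.\<close>
 have "g (Q $ n) = (fmap g Y * W) $ n - (g (Y $ n)) ^ p"
 proof -
  have "fmap g W = W" by (rule fps_ext) (simp add: gW)
  hence "g ((Y * W) $ n) = (fmap g Y * W) $ n" by (metis fmap_mult[OF g] fmap_nth)
  thus ?thesis by (simp add: Q_def fhom_simps[OF g])
 qed
 also have "(fmap g Y * W) $ n = (U * Y * W) $ n"
  by (rule fps_mult_nth_cong) (use Y(3) n in simp_all)
 also have "(g (Y $ n)) ^ p = fmap (\<lambda>x. x ^ p) (U * Y) $ n" using Y(3)[OF n(1)] by simp
 also have "\<dots> = (U * fmap (\<lambda>x. x ^ p) Y) $ n" by (simp only: fmap_mult[OF frobw] fmap_Frob_U)
 also have "(U * Y * W) $ n - (U * fmap (\<lambda>x. x ^ p) Y) $ n = (U * Q) $ n"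
  by (simp add: Q_def algebra_simps)
 also have "\<dots> = Q $ n" using n Q by (simp add: one_plus_X_mult_nth)
 finally have "Q $ n \<in> F 0" using QM by (simp add: F_def)
 then obtain a where a: "Q $ n = eF a" using eF_range by blast
 obtain h f' where hf: "a = wp p h + f'" "f' = 0 \<or> val f' < 0 \<and> \<not> int p dvd val f'"
  using wp_reduce[OF prime char] by blast
 define b where "b = eF h"
 define Z where "Z = 1 + fps_const b * fps_X ^ n"
 define Y' where "Y' = Y * Z"
 define f'' where "f'' = f(n := f')"
 have Zk: "Z $ k = (if k = 0 then 1 else if k = n then b else 0)" for k
  using n by (simp add: Z_def fps_X_power_nth)
 have Y'k: "Y' $ k = Y $ k" if "k < n" for k
 proof -
  have "(Y * Z) $ k = (Y * 1) $ k" by (rule fps_mult_nth_cong) (use that in \<open>simp_all add: Zk\<close>)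
  thus ?thesis by (simp add: Y'_def)
 qed
 have Y'n: "Y' $ n = Y $ n + b"
  by (simp add: Y'_def Z_def distrib_left mult.left_commute[of Y] fps_mult_right_const_nth Y fps_X_power_mult_right_nth flip: mult.assoc)
 have nf: "fmap eF (normal_form f'' (Suc n)) = W * elem_factor n (eF f')"
 proof -
  have "normal_form f'' (Suc n) = normal_form f'' n * elem_factor n f'"
   using n by (simp add: normal_form_def prod.atLeastLessThan_Suc f''_def)
  also have "normal_form f'' n = normal_form f n" unfolding normal_form_def f''_def by (intro prod.cong) auto
  finally show ?thesis by (simp add: W_def fmap_mult[OF eF] fmap_elem_factor[OF eF])
 qed
 have YW: "(Y' * (W * elem_factor n (eF f'))) $ k = (Y' $ k) ^ p" if "k < Suc n" for k
 proof (cases "k = n")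
  case True
  have "Y' * (W * elem_factor n (eF f')) = (Y * W) * (Z * elem_factor n (eF f'))"
   by (simp add: Y'_def mult_ac)
  moreover have "Z * elem_factor n (eF f') = 1 + fps_X ^ n * (fps_const (b - eF f') - fps_const (b * eF f') * fps_X ^ n)"
   by (simp add: Z_def elem_factor_def algebra_simps flip: fps_const_sub fps_const_mult)
  ultimately have "Y' * (W * elem_factor n (eF f')) = Y * W + fps_X ^ n * ((fps_const (b - eF f') - fps_const (b * eF f') * fps_X ^ n) * (Y * W))"
   by (simp add: algebra_simps)
  hence "(Y' * (W * elem_factor n (eF f'))) $ n = (Y * W) $ n + ((fps_const (b - eF f') - fps_const (b * eF f') * fps_X ^ n) * (Y * W)) $ 0"
   by (simp add: fps_X_power_mult_nth)
  also have "\<dots> = (Y * W) $ n + (b - eF f')" using n Y(1) W0 by (simp add: fps_X_power_nth)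
  also have "(Y * W) $ n = eF a + (Y $ n) ^ p" using a by (simp add: Q_def diff_eq_eq)
  also have "eF a = b ^ p - b + eF f'" by (simp add: hf(1) fhom_add[OF eF] b_def wp_def fhom_diff[OF eF] fhom_power[OF eF])
  finally show ?thesis by (simp add: True Y'n char_power_add[OF prime charw])
 next
  case False
  hence k: "k < n" using that by simp
  have "(Y' * (W * elem_factor n (eF f'))) $ k = (Y * (W * 1)) $ k"
  proof (rule fps_mult_nth_cong)
   fix l assume l: "l \<le> k"
   thus "Y' $ l = Y $ l" using Y'k k by simp
   show "(W * elem_factor n (eF f')) $ l = (W * 1) $ l"
    by (rule fps_mult_nth_cong) (use l k in \<open>simp_all add: elem_factor_nth\<close>)
  qed
  thus ?thesis using rel[OF k] Y'k[OF k] by (simp add: W_def)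
 qed
 show ?case
 proof (intro exI[of _ Y'] exI[of _ f''] conjI allI impI)
  show "Y' $ 0 = 1" using Y'k[of 0] n Y(1) by simp
  fix k
  show "Y' $ k \<in> M" unfolding Y'_def
   by (rule coeffs_M_mult) (simp_all add: Y Zk M0 M1 b_def eF_M)
  show "g (Y' $ k) = (U * Y') $ k" if "k < q"
  proof -
   have "fmap g Z = Z" by (rule fps_ext) (simp add: Zk fhom_simps[OF g] b_def eF_g)
   hence "g (Y' $ k) = (fmap g Y * Z) $ k" unfolding Y'_def by (metis fmap_mult[OF g] fmap_nth)
   also have "\<dots> = (U * Y * Z) $ k" by (rule fps_mult_nth_cong) (use Y(3) that in simp_all)
   finally show ?thesis by (simp add: Y'_def mult.assoc)
  qed
  show "reduced p (f'' k)" using f hf(2) by (simp add: f''_def reduced_def)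
  show "(Y' * fmap eF (normal_form f'' (Suc n))) $ k = (Y' $ k) ^ p" if "k < Suc n"
   using YW[OF that] by (simp only: nf)
 qed
qed

lemma normal_form_exists:
 "\<exists>Y f. Y $ 0 = 1 \<and> (\<forall>k. Y $ k \<in> M) \<and> (\<forall>k<q. g (Y $ k) = (U * Y) $ k) \<and> (\<forall>i. reduced p (f i)) \<and>
  (\<forall>k<q. (Y * fmap eF (normal_form f q)) $ k = (Y $ k) ^ p)"
 by (rule normal_form_exists_aux) (use q0 in auto)

end

locale ltower = ntower p m R \<alpha> eK M g c \<zeta> K0 eF
 for p m R \<alpha> :: nat and eK :: "'k::alg_closed_field fls \<Rightarrow> 'w::field" and M :: "'w set"
  and g c :: "'w \<Rightarrow> 'w" and \<zeta> :: 'k and K0 :: "'k fls \<Rightarrow> 'k fls" and eF :: "'k fls \<Rightarrow> 'w" +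
 fixes Y :: "'w fps" and f :: "nat \<Rightarrow> 'k fls"
 assumes Y0: "Y $ 0 = 1" and YM: "Y $ k \<in> M" and Yg: "k < q \<Longrightarrow> g (Y $ k) = ((1 + fps_X) * Y) $ k"
  and f_red: "reduced p (f i)"
  and Y_rel: "k < q \<Longrightarrow> (Y * fmap eF (normal_form f q)) $ k = (Y $ k) ^ p"
begin

lemma Y_gp: "k < q \<Longrightarrow> (g ^^ i) (Y $ k) = (U ^ i * Y) $ k"
proof (induction i arbitrary: k)
 case (Suc i)
 have "(g ^^ Suc i) (Y $ k) = (g ^^ i) (g (Y $ k))" by (simp add: funpow_swap1)
 also have "\<dots> = (g ^^ i) (Y $ k) + (if k = 0 then 0 else (g ^^ i) (Y $ (k - 1)))"
  using Yg[OF Suc.prems] by (simp add: one_plus_X_mult_nth fhom_add[OF gp] fhom_0[OF gp])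
 also have "\<dots> = (U ^ i * Y) $ k + (if k = 0 then 0 else (U ^ i * Y) $ (k - 1))"
  using Suc by auto
 also have "\<dots> = (U * (U ^ i * Y)) $ k" by (simp only: one_plus_X_mult_nth)
 finally show ?case by (simp only: power_Suc mult.assoc)
qed simp

text \<open>g^(p^r) acts as multiplication by 1 + X^(p^r). It fixes the coefficients below p^r and
  adds 1 to the one at p^r, which is thereby an Artin-Schreier generator of \<open>F (Suc r)\<close>
  over \<open>F r\<close>.\<close>

lemma Y_gpp: "k < q \<Longrightarrow> (g ^^ (p ^ r)) (Y $ k) = Y $ k + (if k < p ^ r then 0 else Y $ (k - p ^ r))"
 using Y_gp[of k "p ^ r"] p1
 by (simp only: one_plus_X_power[OF prime charw]) (simp add: one_plus_X_power_mult_nth)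

lemma Y_F: "k < p ^ r \<Longrightarrow> k < q \<Longrightarrow> Y $ k \<in> F r"
 using Y_gpp[of k r] YM by (simp add: F_def)

lemma Y_shift: "r < R \<Longrightarrow> (g ^^ (p ^ r)) (Y $ (p ^ r)) = Y $ (p ^ r) + 1"
 using Y_gpp[of "p ^ r" r] p1 Y0 by simp

end

lemma normal_form_split:
 assumes "N > 0" "N < M"
 shows "\<exists>A. normal_form f M = normal_form f N * elem_factor N (f N) * A \<and> A $ 0 = 1 \<and> (\<forall>i\<le>N. i > 0 \<longrightarrow> A $ i = 0)"
proof -
 define P where "P K = (\<Prod>i\<in>{Suc N..<K}. elem_factor i (f i))" for K
 have "normal_form f M = (\<Prod>i\<in>{1..<Suc N}. elem_factor i (f i)) * P M"
  unfolding normal_form_def P_def by (rule prod.atLeastLessThan_concat[symmetric]) (use assms in auto)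
 also have "(\<Prod>i\<in>{1..<Suc N}. elem_factor i (f i)) = normal_form f N * elem_factor N (f N)"
  unfolding normal_form_def using assms(1) by (simp add: prod.atLeastLessThan_Suc)
 finally have 1: "normal_form f M = normal_form f N * elem_factor N (f N) * P M" .
 have "P M $ k = (1::'a fps) $ k" if "k \<le> N" for k
  using that
 proof (induction "M - Suc N" arbitrary: M k)
  case 0
  thus ?case by (simp add: P_def)
 next
  case (Suc d)
  then obtain M' where M: "M = Suc M'" by (cases M) auto
  have "P M $ k = (P M' * elem_factor M' (f M')) $ k"
   using Suc.hyps(2) by (simp add: M P_def prod.atLeastLessThan_Suc)
  also have "\<dots> = ((1::'a fps) * 1) $ k"
  proof (rule fps_mult_nth_cong)
   fix l assume l: "l \<le> k"
   show "P M' $ l = (1::'a fps) $ l" by (rule Suc.hyps(1)) (use Suc M l in auto)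
   show "elem_factor M' (f M') $ l = (1::'a fps) $ l"
    using Suc.prems Suc.hyps(2) M l by (simp add: elem_factor_nth)
  qed
  finally show ?case by simp
 qed
 thus ?thesis using 1 by (intro exI[of _ "P M"]) simp
qed

lemma normal_form_nth_eq:
 assumes "N > 0" "N < M" "k \<le> N"
 shows "normal_form f M $ k = normal_form f N $ k - (if k = N then f N else 0)"
proof -
 obtain A where A: "normal_form f M = normal_form f N * elem_factor N (f N) * A" "A $ 0 = 1"
  "\<And>i. i \<le> N \<Longrightarrow> i > 0 \<Longrightarrow> A $ i = 0"
  using normal_form_split[OF assms(1,2)] by blast
 have "normal_form f M $ k = (normal_form f N * elem_factor N (f N) * 1) $ k"
  unfolding A(1) by (rule fps_mult_nth_cong) (use A(2,3) assms(3) in auto)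
 also have "\<dots> = normal_form f N $ k - f N * (fps_X ^ N * normal_form f N) $ k"
  by (simp add: elem_factor_def algebra_simps)
 also have "(fps_X ^ N * normal_form f N) $ k = (if k = N then 1 else 0)"
  using assms(3) by (simp add: fps_X_power_mult_nth normal_form_nth_0)
 finally show ?thesis by simp
qed

lemma fhom_range:
 assumes h: "fhom h"
 shows "u \<in> range h \<Longrightarrow> v \<in> range h \<Longrightarrow> u - v \<in> range h"
  and "u \<in> range h \<Longrightarrow> v \<in> range h \<Longrightarrow> u * v \<in> range h"
  and "u \<in> range h \<Longrightarrow> u ^ n \<in> range h" and "of_nat n \<in> range h"
  and "(\<And>i. i \<in> A \<Longrightarrow> w i \<in> range h) \<Longrightarrow> (\<Sum>i\<in>A. w i) \<in> range h"
proof -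
 show "u - v \<in> range h" if "u \<in> range h" "v \<in> range h"
  using that by (auto simp: image_iff) (metis fhom_diff[OF h])
 show "u * v \<in> range h" if "u \<in> range h" "v \<in> range h"
  using that by (auto simp: image_iff) (metis fhom_mult[OF h])
 show "u ^ n \<in> range h" if "u \<in> range h"
  using that by (auto simp: image_iff) (metis fhom_power[OF h])
 show "of_nat n \<in> range h" using fhom_of_nat[OF h, of n] by (metis rangeI)
 show "(\<Sum>i\<in>A. w i) \<in> range h" if a: "\<And>i. i \<in> A \<Longrightarrow> w i \<in> range h"
 proof -
  have "w i = h (inv_into UNIV h (w i))" if "i \<in> A" for i using f_inv_into_f[OF a[OF that]] by simp
  hence "(\<Sum>i\<in>A. w i) = h (\<Sum>i\<in>A. inv_into UNIV h (w i))" by (simp add: fhom_sum[OF h])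
  thus ?thesis by blast
 qed
qed

lemma char_fixed_of_nat:
 fixes y :: "'w::field"
 assumes p: "prime p" "CHAR('w) = p" and y: "y ^ p = y"
 shows "\<exists>i. y = of_nat i"
proof -
 have p1: "p > 1" using p(1) prime_gt_1_nat by blast
 let ?P = "monom 1 p + [:0, - 1:] :: 'w poly"
 have deg: "Polynomial.degree ?P = Polynomial.degree (monom (1::'w) p)"
  by (rule degree_add_eq_left) (use p1 in \<open>simp add: degree_monom_eq\<close>)
 have "y \<in> (of_nat :: nat \<Rightarrow> 'w) ` {..<p}"
 proof (rule roots_exhausted)
  show "?P \<noteq> 0" using deg p1 by (metis degree_0 degree_monom_eq less_numeral_extra(3) zero_neq_one less_trans zero_less_one)
  have "inj_on (of_nat :: nat \<Rightarrow> 'w) {..<p}"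
  proof (rule inj_onI)
   have *: "i = j" if "i \<le> j" "j < p" "of_nat i = (of_nat j :: 'w)" for i j
   proof -
    have "of_nat (j - i) = (0 :: 'w)" using that by (simp add: of_nat_diff)
    hence "p dvd j - i" using p(2) by (simp add: of_nat_eq_0_iff_char_dvd)
    thus ?thesis using that by (auto dest: dvd_imp_le)
   qed
   fix i j assume "i \<in> {..<p}" "j \<in> {..<p}" "of_nat i = (of_nat j :: 'w)"
   thus "i = j" using *[of i j] *[of j i] by (metis lessThan_iff linear)
  qed
  thus "Polynomial.degree ?P \<le> card ((of_nat :: nat \<Rightarrow> 'w) ` {..<p})"
   unfolding deg by (simp add: card_image degree_monom_eq)
  show "poly ?P y = 0" using y by (simp add: poly_monom)
  fix x assume "x \<in> (of_nat :: nat \<Rightarrow> 'w) ` {..<p}"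
  thus "poly ?P x = 0" by (auto simp: poly_monom of_nat_power_char[OF p])
 qed simp
 thus ?thesis by auto
qed

section \<open>Laurent coordinates for the levels of the tower\<close>

context ltower
begin

text \<open>\<open>e\<close> identifies \<open>k((X))\<close> with the fixed field of \<open>g^(p^r)\<close>, and \<open>K\<close> is the embedding of the fixed field
 of \<open>g\<close> in these coordinates.\<close>

definition level :: "nat \<Rightarrow> ('k fls \<Rightarrow> 'w) \<Rightarrow> ('k fls \<Rightarrow> 'k fls) \<Rightarrow> bool" where
 "level r e K \<longleftrightarrow> fhom e \<and> range e = F r \<and> good K (p ^ r) \<and> (\<forall>a. e (K a) = eF a) \<and>
   fls_deriv (K fls_X) \<noteq> 0 \<and>
   val (fls_deriv (K fls_X)) = int (diff_exp p f r) + int (p ^ r) - 1 \<and>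
   (\<forall>i l \<sigma>. (\<forall>a. e (\<sigma> a) = (g ^^ i) ((c ^^ l) (e a))) \<longrightarrow>
    (\<not> m dvd l \<longrightarrow> ram \<sigma> 0) \<and>
    (m dvd l \<longrightarrow> \<not> p ^ r dvd i \<longrightarrow> ram \<sigma> (jump p f (multiplicity p i))))"

lemma levelD:
 assumes "level r e K"
 shows "fhom e" "range e = F r" "good K (p ^ r)" "\<And>a. e (K a) = eF a" "fls_deriv (K fls_X) \<noteq> 0"
  "val (fls_deriv (K fls_X)) = int (diff_exp p f r) + int (p ^ r) - 1"
 using assms by (simp_all add: level_def)

lemma level_ram:
 assumes "level r e K" "\<And>a. e (\<sigma> a) = (g ^^ i) ((c ^^ l) (e a))"
 shows "\<not> m dvd l \<Longrightarrow> ram \<sigma> 0" "m dvd l \<Longrightarrow> \<not> p ^ r dvd i \<Longrightarrow> ram \<sigma> (jump p f (multiplicity p i))"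
 using assms(1)[unfolded level_def, THEN conjunct2, THEN conjunct2, THEN conjunct2, THEN conjunct2, THEN conjunct2, THEN conjunct2] assms(2)
 by blast+

lemma eF_const: "eF (fls_const a) = eK (fls_const a)"
 using eF_K0[of "fls_const a"] good_const[OF K0] by simp

lemma gpc: "(g ^^ i) (eF (fls_const a)) = eF (fls_const a)" and cpc: "(c ^^ i) (eF (fls_const a)) = eF (fls_const a)"
 by (simp_all add: eF_const gpK cpK)

lemma cp_eF_X: "(c ^^ l) (eF fls_X) = eF (fls_const (\<zeta> ^ l) * fls_X)"
proof (induction l)
 case (Suc l)
 have "(c ^^ Suc l) (eF fls_X) = c (eF (fls_const (\<zeta> ^ l))) * c (eF fls_X)"
  by (simp add: Suc fhom_mult[OF c] fhom_mult[OF eF])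
 also have "c (eF (fls_const (\<zeta> ^ l))) = eF (fls_const (\<zeta> ^ l))" using cpc[of 1] by simp
 finally show ?case by (simp only: eF_c fhom_mult[OF eF, symmetric] mult.assoc[symmetric] fls_const_mult_const power_Suc2)
qed simp

text \<open>Exponents complementary to multiples of q and m provide an inverse of g^i c^l on
  \<open>F r\<close>. In coordinates this is a bijective field homomorphism fixing k, and such maps
  preserve the valuation.\<close>

lemma restrict_automorphism:
 assumes e: "fhom e" "range e = F r" and ec: "\<And>a. e (fls_const a) = eF (fls_const a)"
 shows "\<exists>\<sigma>. good \<sigma> 1 \<and> (\<forall>a. e (\<sigma> a) = (g ^^ i) ((c ^^ l) (e a)))"
proof -
 define s where "s x = (g ^^ i) ((c ^^ l) x)" for x
 have hs: "fhom s" unfolding s_def by (rule fhom_comp[OF gp cp])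
 have sF: "s x \<in> F r" if "x \<in> F r" for x unfolding s_def by (intro F_g F_c that)
 have onto: "\<exists>x\<in>F r. s x = y" if y: "y \<in> F r" for y
 proof (intro bexI)
  let ?y = "(g ^^ (i * (q - 1))) y"
  have yM: "y \<in> M" using y by (rule F_M)
  have l: "l + l * (m - 1) = m * l" using m0 by (cases m) simp_all
  have i: "i + i * (q - 1) = q * i" using q0 by (cases q) simp_all
  have "(c ^^ l) ((c ^^ (l * (m - 1))) ?y) = (c ^^ (m * l)) ?y" by (simp only: funpow_add[symmetric] comp_apply l flip: comp_apply[of "c ^^ l"])
  also have "\<dots> = ?y" by (rule funpow_periodic[OF cM cm gpM[OF yM]])
  finally have "s ((c ^^ (l * (m - 1))) ?y) = (g ^^ i) ?y" by (simp only: s_def)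
  also have "\<dots> = (g ^^ (q * i)) y" by (simp only: funpow_add[symmetric] comp_apply i flip: comp_apply[of "g ^^ i"])
  also have "\<dots> = y" by (rule funpow_periodic[OF gM gq yM])
  finally show "s ((c ^^ (l * (m - 1))) ?y) = y" .
  show "(c ^^ (l * (m - 1))) ?y \<in> F r" by (intro F_g F_c y)
 qed
 define \<sigma> where "\<sigma> a = inv_into UNIV e (s (e a))" for a
 have es: "e (\<sigma> a) = s (e a)" for a
  unfolding \<sigma>_def by (rule f_inv_into_f) (use sF[of "e a"] e(2) in blast)
 note ei = fhom_eq_iff[OF e(1)]
 have h: "fhom \<sigma>"
  unfolding fhom_def
  by (intro conjI allI; subst ei[symmetric]) (simp_all add: es fhom_simps[OF e(1)] fhom_simps[OF hs])
 have "bij \<sigma>"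
 proof (rule bijI)
  show "inj \<sigma>" by (rule fhom_inj[OF h])
  show "surj \<sigma>"
  unfolding surj_def
  proof
   fix b
   have "e b \<in> F r" using e(2) by blast
   then obtain x where x: "x \<in> F r" "s x = e b" using onto by blast
   then obtain a where "x = e a" using e(2) by blast
   hence "\<sigma> a = b" using x by (simp add: es ei flip: ei)
   thus "\<exists>a. b = \<sigma> a" by blast
  qed
 qed
 moreover have "\<sigma> (fls_const a) = fls_const a" for a
  by (subst ei[symmetric]) (simp add: es ec s_def cpc gpc)
 ultimately have "good \<sigma> 1" by (intro good_automorphism[OF prime char h])
 thus ?thesis using es by (auto simp: s_def)
qed

lemma level_const: "level r e K \<Longrightarrow> e (fls_const a) = eF (fls_const a)"
 using levelD(4)[of r e K "fls_const a"] good_const[OF levelD(3), of r e K a] by simp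

lemma level_automorphism:
 assumes "level r e K"
 shows "\<exists>\<sigma>. good \<sigma> 1 \<and> (\<forall>a. e (\<sigma> a) = (g ^^ i) ((c ^^ l) (e a)))"
 by (rule restrict_automorphism[OF levelD(1,2)[OF assms] level_const[OF assms]])

lemma Y_rel_level:
 assumes "r < R"
 shows "(Y * fmap eF (normal_form f (p ^ r))) $ (p ^ r) - eF (f (p ^ r)) = (Y $ (p ^ r)) ^ p"
  and "n < p ^ r \<Longrightarrow> (Y * fmap eF (normal_form f (p ^ r))) $ n = (Y $ n) ^ p"
proof -
 let ?N = "p ^ r"
 have N: "?N > 0" "?N < q" using p1 assms by simp_all
 note nf = normal_form_nth_eq[OF N, of _ f]
 have "(Y * fmap eF (normal_form f q)) $ n = (Y * fmap eF (normal_form f ?N)) $ n - (if n = ?N then eF (f ?N) else 0)"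
  if n: "n \<le> ?N" for n
 proof -
  have "(Y * fmap eF (normal_form f q)) $ n =
   (Y * (fmap eF (normal_form f ?N) - fps_const (eF (f ?N)) * fps_X ^ ?N)) $ n"
   by (rule fps_mult_nth_cong) (use n in \<open>auto simp: nf fhom_diff[OF eF] fhom_0[OF eF] fps_X_power_nth\<close>)
  also have "\<dots> = (Y * fmap eF (normal_form f ?N)) $ n - (fps_const (eF (f ?N)) * (fps_X ^ ?N * Y)) $ n"
   by (simp add: algebra_simps)
  also have "(fps_const (eF (f ?N)) * (fps_X ^ ?N * Y)) $ n = (if n = ?N then eF (f ?N) else 0)"
   using n by (simp add: fps_X_power_mult_nth Y0)
  finally show ?thesis .
 qed
 from this[of ?N] this[of n] show
  "(Y * fmap eF (normal_form f (p ^ r))) $ (p ^ r) - eF (f (p ^ r)) = (Y $ (p ^ r)) ^ p"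
  "n < p ^ r \<Longrightarrow> (Y * fmap eF (normal_form f (p ^ r))) $ n = (Y $ n) ^ p"
  using Y_rel[of ?N] Y_rel[of n] N by auto
qed

lemma Y_rel_top: "n < q \<Longrightarrow> (Y * fmap eF (normal_form f q)) $ n = (Y $ n) ^ p"
 by (rule Y_rel)

text \<open>If f_1 were 0, the first coefficient of Y would satisfy y^p = y, hence lie in the prime
  field and be fixed by g, whereas g adds 1 to it.\<close>

lemma f1_pole:
 assumes "R > 0"
 shows "pole (f 1) > 0"
proof -
 have "f 1 \<noteq> 0"
 proof
  assume "f 1 = 0"
  hence "(Y $ 1) ^ p = Y $ 1"
   using Y_rel_level(1)[OF assms] by (simp add: normal_form_def fhom_0[OF eF] fps_mult_nth fhom_1[OF eF])
  then obtain i where "Y $ 1 = of_nat i" using char_fixed_of_nat[OF prime charw] by blast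
  hence "g (Y $ 1) = Y $ 1" by (simp add: fhom_of_nat[OF g])
  thus False using Y_shift[OF assms] by simp
 qed
 thus ?thesis using reduced_pole(2)[OF f_red] by blast
qed

lemma level_0: "level 0 eF (\<lambda>x. x)"
proof -
 have "ram \<sigma> 0" if a: "\<And>a. eF (\<sigma> a) = (g ^^ i) ((c ^^ l) (eF a))" and l: "\<not> m dvd l" for i l \<sigma>
 proof -
  have "eF (\<sigma> fls_X) = eF (fls_const (\<zeta> ^ l) * fls_X)"
   unfolding a cp_eF_X by (induction i) (simp_all add: eF_g)
  hence "\<sigma> fls_X = fls_const (\<zeta> ^ l) * fls_X" by (simp only: fhom_eq_iff[OF eF])
  hence s: "\<sigma> fls_X - fls_X = fls_const (\<zeta> ^ l - 1) * fls_X" by (simp add: algebra_simps flip: fls_minus_const)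
  have "\<zeta> ^ l - 1 \<noteq> 0" using \<zeta> l by (simp add: primitive_root_def)
  thus ?thesis unfolding ram_def s by simp
 qed
 thus ?thesis using eF eF_range good_id by (simp add: level_def diff_exp_def)
qed

text \<open>Z is Y cut off at p^r and rewritten in the coordinates of level r, which contains
  exactly the coefficients needed; the Lang relation below p^r is not affected by the cut.\<close>

lemma level_series:
 assumes L: "level r e K" and r: "r \<le> R"
 shows "\<exists>Z. Z $ 0 = 1 \<and> (\<forall>n\<ge>p ^ r. Z $ n = 0) \<and> (\<forall>n<p ^ r. e (Z $ n) = Y $ n) \<and>
  (\<forall>n<p ^ r. (Z * fmap K (normal_form f (p ^ r))) $ n = (Z $ n) ^ p)"
proof -
 note e = levelD(1)[OF L]
 let ?N = "p ^ r"
 have N: "?N > 0" "?N \<le> q" using p1 r by (simp_all add: power_increasing)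
 have "\<exists>z. e z = Y $ n" if "n < ?N" for n
  using Y_F[OF that] that N levelD(2)[OF L] by (metis less_le_trans rangeE)
 then obtain y where y: "\<And>n. n < ?N \<Longrightarrow> e (y n) = Y $ n" by metis
 define Z where "Z = Abs_fps (\<lambda>n. if n < ?N then y n else 0)"
 have eZ: "e (Z $ n) = Y $ n" if "n < ?N" for n using that y by (simp add: Z_def)
 have "e (Z $ 0) = e 1" using eZ[OF N(1)] by (simp add: Y0 fhom_1[OF e])
 hence Z0: "Z $ 0 = 1" by (simp only: fhom_eq_iff[OF e])
 have rel: "(Z * fmap K (normal_form f ?N)) $ n = (Z $ n) ^ p" if n: "n < ?N" for n
 proof -
  have "e ((Z * fmap K (normal_form f ?N)) $ n) = (fmap e Z * fmap eF (normal_form f ?N)) $ n"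
   by (simp add: fps_mult_nth fhom_sum[OF e] fhom_mult[OF e] levelD(4)[OF L])
  also have "\<dots> = (Y * fmap eF (normal_form f ?N)) $ n"
   by (rule fps_mult_nth_cong) (use n eZ in auto)
  also have "\<dots> = (Y $ n) ^ p"
   using Y_rel_level(2)[of r n] Y_rel_top[of n] n r by (cases "r = R") auto
  also have "\<dots> = e ((Z $ n) ^ p)" by (simp add: eZ[OF n] fhom_power[OF e])
  finally show ?thesis by (simp only: fhom_eq_iff[OF e])
 qed
 show ?thesis by (intro exI[of _ Z] conjI allI impI Z0 eZ rel) (simp add: Z_def)
qed

text \<open>The Lang relation at index p^r, solved for the new coefficient y, reads wp(y) = (Z
  V)_(p^r) - K(f_(p^r)): the cut removes the summand y from the product.\<close>

lemma level_next_equation: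
 assumes L: "level r e K" and r: "r < R"
 shows "\<exists>x \<omega> \<eta> B. e x = wp p (Y $ (p ^ r)) \<and>
  fls_deriv x = K \<omega> * fls_deriv (K fls_X) + \<eta> \<and> \<omega> \<noteq> 0 \<and>
  val \<omega> = - int (rho p f r) - 1 \<and> vge \<eta> (of_int (- jump p f r)) \<and>
  vge x (- B) \<and> B < real p * of_int (jump p f r) \<and> jump p f r > 0"
proof -
 let ?N = "p ^ r"
 note e = levelD(1)[OF L]
 obtain Z where Z: "Z $ 0 = 1" "\<And>n. n \<ge> ?N \<Longrightarrow> Z $ n = 0" "\<And>n. n < ?N \<Longrightarrow> e (Z $ n) = Y $ n"
  "\<And>n. n < ?N \<Longrightarrow> (Z * fmap K (normal_form f ?N)) $ n = (Z $ n) ^ p"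
  using level_series[OF L] r by auto
 define x where "x = (Z * fmap K (normal_form f ?N)) $ ?N - K (f ?N)"
 have rho: "rho p f r > 0" by (rule rho_pos) (use p1 f1_pole r in auto)
 have "e ((Z * fmap K (normal_form f ?N)) $ ?N) = (fmap e Z * fmap eF (normal_form f ?N)) $ ?N"
  by (simp add: fps_mult_nth fhom_sum[OF e] fhom_mult[OF e] levelD(4)[OF L])
 also have "\<dots> = ((Y - fps_const (Y $ ?N) * fps_X ^ ?N) * fmap eF (normal_form f ?N)) $ ?N"
  by (rule fps_mult_nth_cong) (use Z(2,3) in \<open>auto simp: fps_X_power_nth fhom_0[OF e] le_less\<close>)
 also have "\<dots> = (Y * fmap eF (normal_form f ?N)) $ ?N - (fps_const (Y $ ?N) * (fps_X ^ ?N * fmap eF (normal_form f ?N))) $ ?N"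
  by (simp add: algebra_simps)
 also have "(fps_const (Y $ ?N) * (fps_X ^ ?N * fmap eF (normal_form f ?N))) $ ?N = Y $ ?N"
  by (simp add: fps_X_power_mult_nth normal_form_nth_0 fhom_1[OF eF])
 finally have ex: "e x = wp p (Y $ ?N)"
  using Y_rel_level(1)[OF r] by (simp add: x_def fhom_diff[OF e] levelD(4)[OF L] wp_def algebra_simps)
 show ?thesis
  using level_estimate[OF prime char levelD(3,5)[OF L] f_red Z(1,2,4) levelD(6)[OF L] rho] ex
  unfolding x_def[symmetric] by blast
qed

text \<open>The order of K \<omega> D is p^r (- rho - 1) + \<open>diff_exp\<close> + p^r - 1, which
  is - jump - 1 by definition of \<open>jump\<close>.\<close>

lemma sum_deriv_subdegree:
 assumes g: "good K (p ^ r)" and D: "fls_deriv (K fls_X) \<noteq> (0 :: 'k fls)"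
  "val (fls_deriv (K fls_X)) = int (diff_exp p h r) + int (p ^ r) - 1"
  and \<omega>: "\<omega> \<noteq> 0" "val \<omega> = - int (rho p h r) - 1"
  and \<eta>: "vge \<eta> (of_int (- jump p h r))"
 shows "K \<omega> * fls_deriv (K fls_X) + \<eta> \<noteq> 0 \<and>
  val (K \<omega> * fls_deriv (K fls_X) + \<eta>) = - jump p h r - 1"
proof -
 have nz: "K \<omega> * fls_deriv (K fls_X) \<noteq> 0" using D \<omega>(1) fhom_eq_0[OF good_fhom[OF g]] by simp
 have "val (K \<omega> * fls_deriv (K fls_X)) = int (p ^ r) * (- int (rho p h r) - 1) + (int (diff_exp p h r) + int (p ^ r) - 1)"
  using nz D(2) \<omega>(2) good_subdegree[OF g, of \<omega>] by (simp add: fls_subdegree_mult)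
 also have "\<dots> = - jump p h r - 1" by (simp add: jump_def algebra_simps)
 finally have s: "val (K \<omega> * fls_deriv (K fls_X)) = - jump p h r - 1" .
 show ?thesis using subdegree_add_vge[OF nz \<eta>] s by simp
qed

text \<open>The next coefficient of Y satisfies an Artin-Schreier equation whose jump is read off
  its derivative. The explicit Artin-Schreier extension of k((X)) with this equation is mapped into
  M, and the ramification data are carried over by the step lemmas.\<close>

lemma level_Suc:
 assumes L: "level r e K" and r: "r < R"
 shows "\<exists>e' K'. level (Suc r) e' K'"
proof -
 define N where "N = p ^ r"
 define j where "j = jump p f r"
 have N: "N > 0" "N < q" "N < p ^ Suc r" using p1 r by (simp_all add: N_def)
 have R0: "R > 0" using r by simp
 note e = levelD(1)[OF L] and K = levelD(3)[OF L]
 obtain x \<omega> \<eta> B where ex: "e x = wp p (Y $ N)"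
  and dx: "fls_deriv x = K \<omega> * fls_deriv (K fls_X) + \<eta>" and \<omega>: "\<omega> \<noteq> 0"
  "val \<omega> = - int (rho p f r) - 1" and \<eta>: "vge \<eta> (of_int (- j))"
  and B: "vge x (- B)" "B < real p * real_of_int j" and j: "j > 0"
  using level_next_equation[OF L r] unfolding N_def j_def by blast
 have dx': "fls_deriv x \<noteq> 0" "val (fls_deriv x) = - j - 1"
  using sum_deriv_subdegree[OF K levelD(5,6)[OF L] \<omega> \<eta>[unfolded j_def]] by (simp_all add: dx j_def)
 obtain b where b: "x - wp p b \<noteq> 0" "val (x - wp p b) = - j" "\<not> int p dvd j"
  using wp_reduce_deriv[OF prime char B(1) dx' j B(2)] by blast
 obtain K1 z where AS: "artin_schreier p (x - wp p b) j K1 z"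
  using artin_schreier_exists[OF prime char b(1,2) j b(3)] by blast
 hence K1: "good K1 p" and z: "wp p z = K1 (x - wp p b)" by (simp_all add: artin_schreier_def)
 \<comment> \<open>b moves the generator within its class, so that the right side has pole order j
   prime to p, as the explicit extension requires.\<close>
 define y where "y = Y $ N - e b"
 have "wp p y = wp p (Y $ N) - wp p (e b)" unfolding y_def by (rule wp_diff[OF prime charw])
 also have "\<dots> = e (x - wp p b)" by (simp add: ex fhom_diff[OF e] wp_fhom[OF e])
 finally obtain e' where e': "fhom e'" "\<And>a. e' (K1 a) = e a" "e' z = y"
  using artin_schreier_hom[OF prime AS e] by blast
 note h1 = good_fhom[OF K1]
 define K' where "K' a = K1 (K a)" for a
 have g': "good K' (p ^ Suc r)" unfolding K'_def using good_comp[OF K1 K] by simp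
 have eb: "e a \<in> F (Suc r)" for a using F_mono[of r "Suc r"] levelD(2)[OF L] by auto
 have YN: "Y $ N \<in> F (Suc r)" by (rule Y_F) (use N in auto)
 have range': "range e' = F (Suc r)"
 proof
  show "range e' \<subseteq> F (Suc r)"
  proof
   fix w assume "w \<in> range e'"
   then obtain v where v: "w = e' v" by blast
   obtain a where a: "v = (\<Sum>i<p. K1 (a i) * z ^ i)" using artin_schreier_basis[OF prime AS] by blast
   have "w = (\<Sum>i<p. e (a i) * y ^ i)"
    unfolding v a by (simp add: fhom_sum[OF e'(1)] fhom_mult[OF e'(1)] fhom_power[OF e'(1)] e')
   also have "\<dots> \<in> F (Suc r)" unfolding y_def by (intro F_sum F_closed eb YN)
   finally show "w \<in> F (Suc r)" .
  qed
  show "F (Suc r) \<subseteq> range e'"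
  proof
   fix w assume w: "w \<in> F (Suc r)"
   define h where "h = g ^^ N"
   define T where "T v = (\<Sum>i<p. (h ^^ i) v)" for v
   have hh: "fhom h" unfolding h_def by (rule gp)
   have hi: "h ^^ i = g ^^ (N * i)" for i by (simp add: h_def funpow_mult mult.commute)
   have T: "T v \<in> range e'" if v: "v \<in> F (Suc r)" for v
   proof -
    have "(h ^^ p) v = v" using v by (simp add: hi F_def N_def mult.commute)
    hence "h (T v) = T v" using sum_shift_periodic[of "\<lambda>i. (h ^^ i) v" p]
     by (simp add: T_def fhom_sum[OF hh])
    moreover have "T v \<in> M" unfolding T_def hi by (intro Msum gpM F_M[OF v])
    ultimately have "T v \<in> F r" by (simp add: F_def h_def N_def)
    then obtain a where "T v = e a" using levelD(2)[OF L] by blast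
    thus ?thesis using e'(2) by (metis rangeI)
   qed
   note cl = fhom_range[OF e'(1)]
   have "Y $ N = e' (z + K1 b)" by (simp add: fhom_add[OF e'(1)] e' y_def)
   hence Yr: "Y $ N \<in> range e'" by blast
   have hY: "h (Y $ N) = Y $ N + 1" using Y_shift[OF r] by (simp add: h_def N_def)
   \<comment> \<open>Interpolation at the conjugates of the generator expresses w by traces, which
     lie in \<open>F r\<close>, and powers of the generator; this gives surjectivity without a
     degree count.\<close>
   have "w = T w - (\<Sum>k\<le>p - 1. of_nat ((p - 1) choose k) * (Y $ N) ^ k * T (w * (- (Y $ N)) ^ (p - 1 - k)))"
    unfolding T_def using artin_schreier_interpolation[OF prime charw hh hY, of w] .
   moreover have "- (Y $ N) \<in> F (Suc r)" using F_closed(4)[OF F_closed(2) YN] by simp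
   ultimately show "w \<in> range e'"
    by (elim ssubst) (intro cl T Yr F_closed w)
  qed
 qed
 have ec': "e' (fls_const a) = eF (fls_const a)" for a
  using e'(2)[of "fls_const a"] good_const[OF K1] level_const[OF L] by simp
 \<comment> \<open>The chain rule plays the part of transitivity of the different.\<close>
 have D': "fls_deriv (K' fls_X) = K1 (fls_deriv (K fls_X)) * fls_deriv (K1 fls_X)"
  unfolding K'_def by (rule good_deriv[OF K1])
 have p1': "int (p - 1) = int p - 1" using p1 by simp
 have pd: "\<not> int p dvd val (x - wp p b)" using b(2,3) by simp
 have D1: "fls_deriv (K1 fls_X) \<noteq> 0" "val (fls_deriv (K1 fls_X)) = (int p - 1) * (j + 1)"
  using artin_schreier_different[OF prime char AS] subdegree_deriv[OF char b(1) pd] b(2) by auto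
 have nzD: "K1 (fls_deriv (K fls_X)) \<noteq> 0" using levelD(5)[OF L] fhom_eq_0[OF h1] by simp
 have D'0: "fls_deriv (K' fls_X) \<noteq> 0" using nzD D1(1) by (simp add: D')
 have "val (fls_deriv (K' fls_X)) = int p * (int (diff_exp p f r) + int (p ^ r) - 1) + (int p - 1) * (j + 1)"
  using nzD D1 by (simp add: D' fls_subdegree_mult good_subdegree[OF K1] levelD(6)[OF L])
 also have "\<dots> = int (diff_exp p f (Suc r)) + int (p ^ Suc r) - 1"
  unfolding diff_exp_Suc of_nat_add of_nat_mult p1' j_def jump_def by (simp add: algebra_simps)
 finally have E': "val (fls_deriv (K' fls_X)) = int (diff_exp p f (Suc r)) + int (p ^ Suc r) - 1" .
 have ram': "(\<not> m dvd l \<longrightarrow> ram \<sigma>' 0) \<and> (m dvd l \<longrightarrow> \<not> p ^ Suc r dvd i \<longrightarrow> ram \<sigma>' (jump p f (multiplicity p i)))"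
  if s': "\<forall>a. e' (\<sigma>' a) = (g ^^ i) ((c ^^ l) (e' a))" for i l \<sigma>'
 proof -
  obtain \<sigma>'' where "good \<sigma>'' 1" "\<forall>a. e' (\<sigma>'' a) = (g ^^ i) ((c ^^ l) (e' a))"
   using restrict_automorphism[OF e'(1) range' ec'] by blast
  hence gs': "good \<sigma>' 1" using s' by (metis ext fhom_eq_iff[OF e'(1)])
  obtain \<sigma> where \<sigma>: "good \<sigma> 1" "\<And>a. e (\<sigma> a) = (g ^^ i) ((c ^^ l) (e a))"
   using level_automorphism[OF L] by blast
  have "e' (\<sigma>' (K1 a)) = e' (K1 (\<sigma> a))" for a by (simp add: s' e'(2) \<sigma>(2))
  hence comm: "\<sigma>' (K1 a) = K1 (\<sigma> a)" for a by (simp only: fhom_eq_iff[OF e'(1)])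
  show ?thesis
  proof (intro conjI impI)
   assume "\<not> m dvd l"
   hence "ram \<sigma> 0" by (rule level_ram(1)[OF L \<sigma>(2)])
   thus "ram \<sigma>' 0" by (rule ram_step_tame[OF prime char K1 \<sigma>(1) gs' comm])
  next
   assume ml: "m dvd l" and i: "\<not> p ^ Suc r dvd i"
   have cl: "(c ^^ l) v = v" if "v \<in> M" for v using cmod[OF that, of l] ml by (simp add: dvd_eq_mod_eq_0)
   have eM: "e a \<in> M" for a using F_M levelD(2)[OF L] by blast
   show "ram \<sigma>' (jump p f (multiplicity p i))"
   proof (cases "p ^ r dvd i")
    case False
    have lt: "multiplicity p i < r" by (rule wild_multiplicity_less[OF False])
    have rs: "ram \<sigma> (jump p f (multiplicity p i))" by (rule level_ram(2)[OF L \<sigma>(2) ml False])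
    \<comment> \<open>g^(p^r) adds 1 to y and commutes with g^i, so it fixes the difference, which
      therefore comes from level r.\<close>
    have "\<exists>w. (g ^^ i) y - y = e w"
    proof -
     have "(g ^^ N) ((g ^^ i) (Y $ N)) = (g ^^ i) ((g ^^ N) (Y $ N))" by (rule funpow_comm)
     also have "\<dots> = (g ^^ i) (Y $ N) + 1" using Y_shift[OF r] by (simp add: N_def fhom_simps[OF gp])
     finally have "(g ^^ N) ((g ^^ i) (Y $ N) - Y $ N) = (g ^^ i) (Y $ N) - Y $ N"
      using Y_shift[OF r] by (simp add: fhom_diff[OF gp] N_def)
     hence "(g ^^ i) (Y $ N) - Y $ N \<in> F r" by (simp add: F_def N_def Mdiff gpM YM)
     moreover have "e b \<in> F r" using levelD(2)[OF L] by blast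
     ultimately have "((g ^^ i) (Y $ N) - Y $ N) - ((g ^^ i) (e b) - e b) \<in> F r" by (intro F_closed(4)[of "_ - _" r "_ - _"] F_closed(4)[of "(g ^^ i) (e b)"] F_g)
     hence "(g ^^ i) y - y \<in> F r" by (simp add: y_def fhom_diff[OF gp] algebra_simps)
     thus ?thesis using levelD(2)[OF L] by blast
    qed
    then obtain w where w: "(g ^^ i) y - y = e w" by blast
    have "e' (\<sigma>' z) = e' (z + K1 w)"
     using w cl[of y] YM eM[of b] by (simp add: s' e' fhom_add[OF e'(1)] y_def Mdiff diff_eq_eq add.commute)
    hence "\<sigma>' z = z + K1 w" by (simp only: fhom_eq_iff[OF e'(1)])
    from ram_step_wild[OF prime char b(1,2) AS \<sigma>(1) gs' comm this rs]
    show ?thesis using jump_gt_0[of p f "multiplicity p i", OF p1 f1_pole[OF R0]] jump_less[of p f, OF p1 f1_pole[OF R0] lt] by (simp add: j_def)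
   next
    case True
    then obtain k where k: "i = N * k" by (auto simp: N_def)
    have pk: "\<not> p dvd k" using i by (auto simp: k N_def)
    have mu: "multiplicity p i = r" by (rule wild_multiplicity[OF True i])
    have "(g ^^ i) (Y $ N) = Y $ N + of_nat k"
     unfolding k
    proof (induction k)
     case (Suc k)
     have "(g ^^ (N * Suc k)) (Y $ N) = (g ^^ N) ((g ^^ (N * k)) (Y $ N))" by (simp add: funpow_add)
     thus ?case using Suc Y_shift[OF r] by (simp add: N_def fhom_simps[OF gp] add_ac)
    qed simp
    moreover have "(g ^^ i) (e b) = e b"
    proof -
     have "e b \<in> F r" using levelD(2)[OF L] by blast
     from F_mult[OF this] show ?thesis by (simp add: k N_def)
    qed
    ultimately have "e' (\<sigma>' z) = e' (z + of_nat k)"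
     using cl[of y] YM eM[of b] by (simp add: s' e' fhom_simps[OF e'(1)] y_def Mdiff fhom_diff[OF gp])
    hence "\<sigma>' z - z = fls_const (of_nat k)" by (simp add: fhom_eq_iff[OF e'(1)] fls_of_nat)
    moreover have "(of_nat k :: 'k) \<noteq> 0" using pk by (simp add: of_nat_eq_0_iff_char_dvd char)
    moreover have "\<sigma>' (K1 fls_X) = K1 fls_X"
    proof -
     have "e fls_X \<in> F r" using levelD(2)[OF L] by blast
     from F_mult[OF this] have "e (\<sigma> fls_X) = e fls_X" by (simp add: \<sigma>(2) cl eM k N_def)
     thus ?thesis by (simp add: comm fhom_eq_iff[OF e])
    qed
    ultimately have "ram \<sigma>' j" by (intro ram_step_top[OF prime char AS gs'])
    thus ?thesis by (simp add: mu j_def)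
   qed
  qed
 qed
 have "level (Suc r) e' K'"
  unfolding level_def
 proof (intro conjI)
  show "\<forall>a. e' (K' a) = eF a" by (simp add: K'_def e' levelD(4)[OF L])
  show "\<forall>i l \<sigma>. (\<forall>a. e' (\<sigma> a) = (g ^^ i) ((c ^^ l) (e' a))) \<longrightarrow>
    (\<not> m dvd l \<longrightarrow> ram \<sigma> 0) \<and>
    (m dvd l \<longrightarrow> \<not> p ^ Suc r dvd i \<longrightarrow> ram \<sigma> (jump p f (multiplicity p i)))"
   using ram' by blast
 qed (fact e'(1) range' g' D'0 E')+
 thus ?thesis by blast
qed

lemma level_exists: "r \<le> R \<Longrightarrow> \<exists>e K. level r e K"
proof (induction r)
 case 0
 thus ?case using level_0 by blast
next
 case (Suc r)
 then obtain e K where "level r e K" by auto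
 from level_Suc[OF this] Suc.prems show ?case by auto
qed

end

section \<open>The tame generator and the class of the last step\<close>

lemma mod_mult_one_left: assumes "x mod n = 1 mod n" shows "x * i mod n = i mod (n::nat)"
proof -
 have "x * i mod n = (x mod n) * i mod n" by (simp only: mod_mult_left_eq)
 also have "\<dots> = i mod n" by (simp only: assms mod_mult_left_eq mult_1)
 finally show ?thesis .
qed

text \<open>After multiplication by X^n only the constant term matters, and \<sigma> fixes it;
  undoing the multiplication produces the factor z^n.\<close>

lemma scaling_leading:
 fixes f :: "'k::field fls"
 assumes s: "good \<sigma> 1" "\<sigma> fls_X = fls_const z * fls_X" and f: "f \<noteq> 0" "val f = - int n"
 shows "vge (fls_const (z ^ n) * \<sigma> f - f) (- real n + 1)"
proof -
 note h = good_fhom[OF s(1)]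
 define u where "u = fls_X ^ n * f"
 have u: "vge u 0" using f by (simp add: u_def vge_iff)
 have su: "\<sigma> u = fls_const (z ^ n) * fls_X ^ n * \<sigma> f"
  by (simp add: u_def fhom_mult[OF h] fhom_power[OF h] s(2) power_mult_distrib fls_const_power)
 have "vge (\<sigma> u - fls_const (u $$ 0)) 1" using good_leading[OF s(1), of u 0] u by simp
 hence "(\<sigma> u - fls_const (u $$ 0)) $$ 0 = 0" by (simp add: vge_def)
 hence "(\<sigma> u - u) $$ 0 = 0" by simp
 moreover have "vge (\<sigma> u - u) (of_int 0)" using u good_vge_1[OF s(1) u] by (intro vge_diff) auto
 ultimately have "vge (\<sigma> u - u) (of_int 0 + 1)" by (intro vge_Suc)
 moreover have "vge (fls_X powi (- int n) :: 'k fls) (- real n)" by (simp add: vge_iff)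
 ultimately have "vge (fls_X powi (- int n) * (\<sigma> u - u)) (- real n + 1)" using vge_mult by fastforce
 moreover have "fls_X powi (- int n) * (\<sigma> u - u) = fls_const (z ^ n) * \<sigma> f - f"
 proof -
  have "\<sigma> u - u = fls_X ^ n * (fls_const (z ^ n) * \<sigma> f - f)" by (simp only: su) (simp add: u_def algebra_simps)
  moreover have "(fls_X :: 'k fls) powi (- int n) * fls_X ^ n = 1" by (simp only: power_int_minus power_int_of_nat) simp
  ultimately show ?thesis by (simp only: mult.assoc[symmetric] mult_1)
 qed
 ultimately show ?thesis by simp
qed

context ltower
begin

lemma p0: "p > 0" using p1 by simp

text \<open>The inverse of \<alpha> modulo p^(R+1), taken as a power so that it is a natural
  number.\<close>

definition \<beta> where "\<beta> = \<alpha> ^ (m - 1)"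

lemma \<alpha>\<beta>: "\<alpha> * \<beta> = \<alpha> ^ m" unfolding \<beta>_def using m0 by (cases m) simp_all

lemma \<alpha>\<beta>_mod: "r \<le> Suc R \<Longrightarrow> (\<alpha> * \<beta>) mod p ^ r = 1 mod p ^ r"
 unfolding \<alpha>\<beta> by (rule \<alpha>m_mod)

lemma \<alpha>\<beta>_power_mod: assumes "r \<le> Suc R" shows "(\<alpha> ^ l * \<beta> ^ l) mod p ^ r = 1 mod p ^ r"
proof -
 have "(\<alpha> * \<beta>) ^ l mod p ^ r = (1 mod p ^ r) ^ l mod p ^ r" by (simp only: power_mod flip: \<alpha>\<beta>_mod[OF assms])
 thus ?thesis by (simp only: power_mod power_one power_mult_distrib)
qed

lemma of_nat_mod_p: "CHAR('x::comm_semiring_1_cancel) = p \<Longrightarrow> a mod p = b mod p \<Longrightarrow> (of_nat a :: 'x) = of_nat b"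
 by (metis of_nat_CHAR mod_div_mult_eq mult.commute mult_zero_left of_nat_add of_nat_mult add_0_right mult_zero_right)

lemma \<alpha>\<beta>_field: "of_nat \<alpha> * of_nat \<beta> = (1::'k)" "of_nat \<alpha> * of_nat \<beta> = (1::'w)"
 using \<alpha>\<beta>_mod[of 1] of_nat_mod_p[of "\<alpha> * \<beta>" 1, where ?'x = 'k] of_nat_mod_p[of "\<alpha> * \<beta>" 1, where ?'x = 'w] char charw
 by auto

lemma of_nat_M: "of_nat i \<in> M"
 by (induction i) (simp_all add: M0 Madd M1)

lemma gcp: assumes "v \<in> M" shows "(g ^^ i) ((c ^^ l) v) = (c ^^ l) ((g ^^ (\<beta> ^ l * i)) v)"
proof -
 have "(c ^^ l) ((g ^^ (\<beta> ^ l * i)) v) = (g ^^ (\<alpha> ^ l * (\<beta> ^ l * i))) ((c ^^ l) v)" by (rule cpgp[OF assms])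
 also have "\<dots> = (g ^^ i) ((c ^^ l) v)"
  by (rule gmod[OF cpM[OF assms]])
   (use mod_mult_one_left[OF \<alpha>\<beta>_power_mod[of R l], of i] in \<open>simp add: mult.assoc\<close>)
 finally show ?thesis ..
qed

lemma Y_shift_mult: "r < R \<Longrightarrow> (g ^^ (p ^ r * k)) (Y $ (p ^ r)) = Y $ (p ^ r) + of_nat k"
proof (induction k)
 case (Suc k)
 have "(g ^^ (p ^ r * Suc k)) (Y $ (p ^ r)) = (g ^^ p ^ r) ((g ^^ (p ^ r * k)) (Y $ (p ^ r)))" by (simp add: funpow_add)
 thus ?case using Suc Y_shift[of r] by (simp add: fhom_simps[OF gp] add_ac)
qed simp

text \<open>The first Artin--Schreier class is an eigenvector of \<open>c\<close>, which determines the action of \<open>c\<close> on its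
 leading term.\<close>

lemma first_eigenvalue:
 assumes R: "R > 0"
 shows "of_nat \<beta> * \<zeta> ^ rho p f 0 = 1"
proof (rule ccontr)
 assume ne: "of_nat \<beta> * \<zeta> ^ rho p f 0 \<noteq> 1"
 define n where "n = rho p f 0"
 have n: "n = pole (f 1)" "n > 0" using f1_pole[OF R] by (simp_all add: n_def)
 have f1: "f 1 \<noteq> 0" using n by auto
 have sf: "val (f 1) = - int n" "\<not> p dvd n" using reduced_pole[OF f_red f1] by (simp_all add: n(1))
 obtain \<sigma> where \<sigma>: "good \<sigma> 1" "\<And>a. eF (\<sigma> a) = (g ^^ 0) ((c ^^ 1) (eF a))" using level_automorphism[OF level_0] by blast
 have "eF (\<sigma> fls_X) = eF (fls_const \<zeta> * fls_X)" using cp_eF_X[of 1] by (simp add: \<sigma>(2))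
 hence \<sigma>X: "\<sigma> fls_X = fls_const \<zeta> * fls_X" by (simp only: fhom_eq_iff[OF eF])
 define y where "y = Y $ 1"
 have y: "y \<in> M" "wp p y = eF (- f 1)" "g y = y + 1"
  using Y_rel_level(1)[OF R] Y_shift[OF R]
  by (simp_all add: y_def YM normal_form_def fhom_simps[OF eF] fps_mult_nth wp_def algebra_simps)
 have gy: "(g ^^ \<beta>) y = y + of_nat \<beta>" using Y_shift_mult[OF R, of \<beta>] by (simp add: y_def)
 have "g (c y) = c y + of_nat \<beta>"
  using gcp[OF y(1), of 1 1] gy by (simp add: fhom_simps[OF c])
 \<comment> \<open>g sends c y to c y + \<beta> and y to y + 1, so the combination is fixed by
   g.\<close>
 hence "c y - of_nat \<beta> * y \<in> F 0"
  using y(1,3) by (simp add: F_def fhom_simps[OF g] Mdiff cM Mmult algebra_simps of_nat_M)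
 then obtain \<mu> where \<mu>: "c y - of_nat \<beta> * y = eF \<mu>" using eF_range by blast
 have "eF (wp p \<mu>) = wp p (c y) - wp p (of_nat \<beta> * y)"
  by (simp only: wp_fhom[OF eF] flip: \<mu> wp_diff[OF prime charw])
 also have "wp p (of_nat \<beta> * y) = of_nat \<beta> * wp p y"
  by (simp add: wp_def power_mult_distrib of_nat_power_char[OF prime charw] algebra_simps)
 also have "wp p (c y) = c (wp p y)" by (rule wp_fhom[OF c, symmetric])
 also have "c (wp p y) - of_nat \<beta> * wp p y = eF (\<sigma> (- f 1) - of_nat \<beta> * (- f 1))"
  by (simp only: y(2) fhom_diff[OF eF] fhom_mult[OF eF] fhom_of_nat[OF eF] \<sigma>(2)) simp
 finally have \<mu>2: "wp p \<mu> = of_nat \<beta> * f 1 - \<sigma> (f 1)"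
  by (simp add: fhom_eq_iff[OF eF] fhom_simps[OF good_fhom[OF \<sigma>(1)]])
 have \<zeta>0: "\<zeta> \<noteq> 0" using \<zeta> m0 by (auto simp: primitive_root_def zero_power dest: spec[of _ m])
 define d where "d = of_nat \<beta> * \<zeta> ^ n - 1"
 have d: "d \<noteq> 0" using ne by (simp add: d_def n_def)
 define A where "A = fls_const (\<zeta> ^ n) * \<sigma> (f 1) - f 1"
 \<comment> \<open>If d were nonzero, the leading term would survive, and wp(\<mu>) would have pole
   order n prime to p.\<close>
 have "fls_const (\<zeta> ^ n) * wp p \<mu> = fls_const d * f 1 + (- A)"
  by (simp add: \<mu>2 A_def d_def algebra_simps fls_of_nat flip: fls_minus_const fls_const_mult_const)
 moreover have "fls_const d * f 1 + (- A) \<noteq> 0 \<and> val (fls_const d * f 1 + (- A)) = val (fls_const d * f 1)"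
 proof (rule subdegree_add_vge)
  show "fls_const d * f 1 \<noteq> 0" using d f1 by simp
  show "vge (- A) (- real n + 1)" unfolding A_def by (intro vge_uminus scaling_leading[OF \<sigma>(1) \<sigma>X f1 sf(1)])
  show "real_of_int (val (fls_const d * f 1)) < - real n + 1" using sf(1) d f1 by simp
 qed
 moreover have "val (fls_const d * f 1) = - int n" using sf(1) d f1 by simp
 ultimately have w': "fls_const (\<zeta> ^ n) * wp p \<mu> \<noteq> 0" "val (fls_const (\<zeta> ^ n) * wp p \<mu>) = - int n" by simp_all
 hence w: "wp p \<mu> \<noteq> 0" "val (wp p \<mu>) = - int n" using \<zeta>0 by auto
 have pd: "\<not> int p dvd val (wp p \<mu>)" using w(2) sf(2) by simp
 have dd: "val (fls_deriv (wp p \<mu>)) = - int n - 1" using subdegree_deriv(2)[OF char w(1) pd] w(2) by simp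
 show False
 proof (rule not_wp_deriv[OF prime char _ dd])
  show "vge (wp p \<mu>) (- real n)" using w by (simp add: vge_iff)
  show "int n > 0" using n by simp
  show "real n < real p * real_of_int (int n)" using n p1 by simp
 qed
qed

text \<open>The additive cocycle with value v at g: if a lift of g sends y to y + v, its i-th power
  sends y to y + \<open>S i v\<close>.\<close>

definition S where "S i v = (\<Sum>k<i. (g ^^ k) v)"

lemma S_M: "v \<in> M \<Longrightarrow> S i v \<in> M" unfolding S_def by (intro Msum gpM)

lemma S_add: "S (i + j) v = S i v + (g ^^ i) (S j v)"
proof (induction j)
 case (Suc j)
 thus ?case by (simp add: S_def fhom_add[OF gp] funpow_add)
qed (simp add: S_def fhom_0[OF gp])

lemma S_q: "S q v = trace v" by (simp add: S_def trace_def)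

definition w0 where "w0 = Y $ (q - 1)"

lemma w0_M: "w0 \<in> M" by (simp add: w0_def YM)

definition Yt where "Yt = Abs_fps (\<lambda>n. if n < q then Y $ n else 0)"

lemma Yt_nth: "n < q \<Longrightarrow> Yt $ n = Y $ n" "n \<ge> q \<Longrightarrow> Yt $ n = 0" by (simp_all add: Yt_def)

lemma Yt_nth': "k \<le> q - 1 \<Longrightarrow> Yt $ k = Y $ k"
 by (rule Yt_nth(1)) (use q0 in linarith)

text \<open>w0 is what g would add to a coefficient of Y at index q, so its cocycle is the
  coefficient at q of multiplication by (1 + X)^i.\<close>

lemma S_w0: "S i w0 = (U ^ i * Yt) $ q"
proof (induction i)
 case (Suc i)
 have "(U ^ Suc i * Yt) $ q = (U ^ i * Yt) $ q + (U ^ i * Yt) $ (q - 1)"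
  using p0 by (simp add: mult.assoc one_plus_X_mult_nth)
 also have "(U ^ i * Yt) $ (q - 1) = (U ^ i * Y) $ (q - 1)"
  by (rule fps_mult_nth_cong) (simp_all only: Yt_nth')
 also have "\<dots> = (g ^^ i) w0" unfolding w0_def by (rule Y_gp[symmetric]) (use q0 in simp)
 finally show ?case using Suc by (simp add: S_def)
qed (simp add: S_def Yt_nth)

text \<open>(1 + X)^q = 1 + X^q has coefficient 1 at q. This nonzero value gives the lift of g the
  order p^(R+1) instead of p^R.\<close>

lemma trace_w0: "trace w0 = 1"
 using S_w0[of q] q0 by (simp add: S_q one_plus_X_power[OF prime charw] one_plus_X_power_mult_nth Yt_nth Y0)

lemma S_mult_q: assumes "v \<in> M" "trace v = 1" shows "S (q * t) v = of_nat t"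
proof (induction t)
 case (Suc t)
 have "S (q * Suc t) v = S q v + (g ^^ q) (S (q * t) v)" by (simp add: S_add)
 thus ?case using Suc by (simp add: S_q assms(2) fhom_of_nat[OF gp])
qed (simp add: S_def)

text \<open>By trace 1, q t steps of the cocycle add up to t, which vanishes for t = p; this is
  where the modulus p^(R+1) comes from.\<close>

lemma S_cong:
 assumes v: "v \<in> M" "trace v = 1" and ij: "i mod p ^ Suc R = j mod p ^ Suc R"
 shows "S i v = S j v"
proof -
 have "S i v = S (i mod p ^ Suc R) v" for i
 proof -
  have "S (i div p ^ Suc R * p ^ Suc R + i mod p ^ Suc R) v = S (q * (p * (i div p ^ Suc R))) v + (g ^^ (q * (p * (i div p ^ Suc R)))) (S (i mod p ^ Suc R) v)"
   unfolding S_add by (simp add: mult_ac)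
  also have "S (q * (p * (i div p ^ Suc R))) v = 0" unfolding S_mult_q[OF v] using charw by (metis mult_zero_left of_nat_CHAR of_nat_mult)
  also have "(g ^^ (q * (p * (i div p ^ Suc R)))) (S (i mod p ^ Suc R) v) = S (i mod p ^ Suc R) v"
   by (rule funpow_periodic[OF gM gq S_M[OF v(1)]])
  finally show ?thesis by (simp only: div_mult_mod_eq add_0_left)
 qed
 thus ?thesis using ij by metis
qed

text \<open>The right side of the Artin-Schreier equation that a coefficient of Y at index q would
  satisfy if the Lang equation continued with datum f_q = \<phi>.\<close>

definition X0 where "X0 \<phi> = (Yt * fmap eF (normal_form f q)) $ q - eF \<phi>"

text \<open>g multiplies Y by 1 + X. Below q this is the known relation; at q the missing
  coefficient leaves w0 behind, and the Lang relation at q - 1 supplies w0^p.\<close>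

lemma X0_g: "g (X0 \<phi>) - X0 \<phi> = wp p w0"
proof -
 define W where "W = fmap eF (normal_form f q)"
 have W0: "W $ 0 = 1" by (simp add: W_def normal_form_nth_0 fhom_1[OF eF])
 have gW: "fmap g W = W" by (rule fps_ext) (simp add: W_def eF_g)
 have "g ((Yt * W) $ q) = (fmap g Yt * W) $ q" by (metis fmap_mult[OF g] fmap_nth gW)
 also have "\<dots> = ((U * Yt - fps_const w0 * fps_X ^ q) * W) $ q"
 proof (rule fps_mult_nth_cong)
  fix k assume k: "k \<le> q"
  show "fmap g Yt $ k = (U * Yt - fps_const w0 * fps_X ^ q) $ k"
  proof (cases "k = q")
   case True
   thus ?thesis using S_w0[of 1] by (simp add: Yt_nth fhom_0[OF g] fps_X_power_nth S_def)
  next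
   case False
   thus ?thesis using Yg[of k] k by (simp add: Yt_nth one_plus_X_mult_nth fps_X_power_nth del: distrib_right)
  qed
 qed simp
 also have "\<dots> = (U * (Yt * W)) $ q - (fps_const w0 * (fps_X ^ q * W)) $ q" by (simp add: algebra_simps)
 also have "(fps_const w0 * (fps_X ^ q * W)) $ q = w0" by (simp add: fps_X_power_mult_nth W0)
 also have "(U * (Yt * W)) $ q = (Yt * W) $ q + (Yt * W) $ (q - 1)"
  using p0 by (simp add: one_plus_X_mult_nth)
 also have "(Yt * W) $ (q - 1) = (Y * W) $ (q - 1)"
  by (rule fps_mult_nth_cong) (simp_all only: Yt_nth')
 also have "\<dots> = w0 ^ p" unfolding w0_def W_def by (rule Y_rel) (use q0 in simp)
 finally show ?thesis by (simp add: X0_def W_def fhom_diff[OF g] eF_g wp_def algebra_simps)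
qed

lemma X0_M: "X0 \<phi> \<in> M"
 unfolding X0_def by (intro Mdiff coeffs_M_mult eF_M) (simp_all add: Yt_def YM M0 eF_M)

lemma X0_gp: "(g ^^ i) (X0 \<phi>) - X0 \<phi> = wp p (S i w0)"
proof (induction i)
 case (Suc i)
 have "(g ^^ Suc i) (X0 \<phi>) - X0 \<phi> = (g ^^ i) (g (X0 \<phi>) - X0 \<phi>) + ((g ^^ i) (X0 \<phi>) - X0 \<phi>)"
  by (simp add: funpow_swap1 fhom_diff[OF gp])
 also have "\<dots> = wp p ((g ^^ i) w0) + wp p (S i w0)" by (simp only: X0_g Suc wp_fhom[OF gp])
 also have "\<dots> = wp p (S (Suc i) w0)" by (simp add: S_def add.commute flip: wp_add[OF prime charw])
 finally show ?case .
qed (simp add: S_def wp_def p0 zero_power)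

text \<open>The projector onto the eigenspace where c acts as \<beta>. It takes a family because g
  c^l = c^l g^(\<beta>^l) replaces w0 by \<open>S (\<beta> ^ l) w0\<close> under the sum.\<close>

definition average where "average v = inverse (of_nat m) * (\<Sum>l<m. of_nat \<alpha> ^ l * (c ^^ l) (v l))"

lemma \<alpha>m_field: "of_nat \<alpha> ^ m = (1::'w)"
 using \<alpha>\<beta>_field(2) unfolding of_nat_mult[symmetric] \<alpha>\<beta> by (simp add: of_nat_power)

lemma X_eq_c: "c (average (\<lambda>_. X0 \<phi>)) = of_nat \<beta> * average (\<lambda>_. X0 \<phi>)"
proof -
 have "of_nat \<alpha> * c (average (\<lambda>_. X0 \<phi>)) = inverse (of_nat m) * (\<Sum>l<m. of_nat \<alpha> ^ Suc l * (c ^^ Suc l) (X0 \<phi>))"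
  by (simp add: average_def fhom_simps[OF c] fhom_inverse[OF c] fhom_sum[OF c] sum_distrib_left mult_ac)
 also have "(\<Sum>l<m. of_nat \<alpha> ^ Suc l * (c ^^ Suc l) (X0 \<phi>)) = (\<Sum>l<m. of_nat \<alpha> ^ l * (c ^^ l) (X0 \<phi>))"
  by (rule sum_shift_periodic) (simp add: \<alpha>m_field cm X0_M)
 finally have "of_nat \<alpha> * c (average (\<lambda>_. X0 \<phi>)) = average (\<lambda>_. X0 \<phi>)" by (simp add: average_def)
 hence "of_nat \<beta> * average (\<lambda>_. X0 \<phi>) = of_nat \<alpha> * of_nat \<beta> * c (average (\<lambda>_. X0 \<phi>))" by (simp add: mult_ac)
 thus ?thesis by (simp add: \<alpha>\<beta>_field)
qed

lemma wp_scale: "a ^ p = a \<Longrightarrow> wp p (a * v) = a * wp p v" for a v :: 'w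
 by (simp add: wp_def power_mult_distrib algebra_simps)

lemma wp_sum: "wp p (\<Sum>l<(n::nat). v l) = (\<Sum>l<n. wp p (v l :: 'w))"
 by (induction n) (simp_all add: wp_add[OF prime charw], simp add: wp_def p0 zero_power)

text \<open>Moving g past c^l turns it into the power \<beta>^l of g, where \<open>X0_gp\<close>
  applies; the weights lie in the prime field and therefore commute with \<open>wp\<close>.\<close>

lemma X_eq_g: "g (average (\<lambda>_. X0 \<phi>)) - average (\<lambda>_. X0 \<phi>) = wp p (average (\<lambda>l. S (\<beta> ^ l) w0))"
proof -
 have im: "inverse (of_nat m :: 'w) ^ p = inverse (of_nat m)"
  by (simp add: power_inverse of_nat_power_char[OF prime charw])
 have al: "(of_nat \<alpha> ^ l :: 'w) ^ p = of_nat \<alpha> ^ l" for l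
  using of_nat_power_char[OF prime charw, of "\<alpha> ^ l"] by simp
 have "g ((c ^^ l) (X0 \<phi>)) - (c ^^ l) (X0 \<phi>) = wp p ((c ^^ l) (S (\<beta> ^ l) w0))" for l
 proof -
  have "g ((c ^^ l) (X0 \<phi>)) - (c ^^ l) (X0 \<phi>) = (c ^^ l) ((g ^^ (\<beta> ^ l)) (X0 \<phi>) - X0 \<phi>)"
   using gcp[OF X0_M, of 1 l] by (simp add: fhom_diff[OF cp])
  thus ?thesis by (simp only: X0_gp wp_fhom[OF cp])
 qed
 hence "of_nat \<alpha> ^ l * g ((c ^^ l) (X0 \<phi>)) - of_nat \<alpha> ^ l * (c ^^ l) (X0 \<phi>) = wp p (of_nat \<alpha> ^ l * (c ^^ l) (S (\<beta> ^ l) w0))" for l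
  by (simp add: wp_scale[OF al] flip: right_diff_distrib)
 thus ?thesis
  by (simp add: average_def wp_scale[OF im] wp_sum fhom_simps[OF g] fhom_inverse[OF g] fhom_sum[OF g] flip: right_diff_distrib sum_subtractf)
qed

lemma trace_c: assumes v: "v \<in> M" shows "trace ((c ^^ l) v) = (c ^^ l) (trace v)"
proof -
 have "trace ((c ^^ l) v) = (c ^^ l) (\<Sum>i<q. (g ^^ (\<beta> ^ l * i)) v)"
  by (simp only: trace_def gcp[OF v] fhom_sum[OF cp])
 also have "(\<Sum>i<q. (g ^^ (\<beta> ^ l * i)) v) = (\<Sum>i<q. (g ^^ (\<beta> ^ l * i mod q)) v)"
  by (intro sum.cong refl gmod[OF v]) simp
 also have "\<dots> = (\<Sum>i<q. (g ^^ i) v)"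
 proof (rule sum.reindex_bij_witness[where i = "\<lambda>i. \<alpha> ^ l * i mod q" and j = "\<lambda>i. \<beta> ^ l * i mod q"])
  have 1: "\<alpha> ^ l * (\<beta> ^ l * i mod q) mod q = i" "\<beta> ^ l * (\<alpha> ^ l * i mod q) mod q = i" if "i < q" for i
  proof -
   have "\<alpha> ^ l * (\<beta> ^ l * i) mod q = i" "\<beta> ^ l * (\<alpha> ^ l * i) mod q = i"
    using mod_mult_one_left[OF \<alpha>\<beta>_power_mod[of R l], of i] that by (simp_all add: mult_ac)
   thus "\<alpha> ^ l * (\<beta> ^ l * i mod q) mod q = i" "\<beta> ^ l * (\<alpha> ^ l * i mod q) mod q = i"
    by (simp_all add: mod_mult_right_eq)
  qed
  show "\<And>i. i \<in> {..<q} \<Longrightarrow> \<alpha> ^ l * (\<beta> ^ l * i mod q) mod q = i"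
   "\<And>i. i \<in> {..<q} \<Longrightarrow> \<beta> ^ l * (\<alpha> ^ l * i mod q) mod q = i" using 1 by simp_all
 qed (use p0 in auto)
 finally show ?thesis by (simp add: trace_def)
qed

lemma trace_S: assumes v: "v \<in> M" shows "trace (S i v) = of_nat i * trace v"
proof -
 have "trace ((g ^^ k) v) = trace v" for k
 proof (induction k)
  case (Suc k)
  have "trace (g ((g ^^ k) v)) = g (trace ((g ^^ k) v))"
   by (simp add: trace_def fhom_sum[OF g] funpow_swap1)
  also have "\<dots> = trace ((g ^^ k) v)" by (rule trace_g[OF gpM[OF v]])
  finally show ?case using Suc by simp
 qed simp
 moreover have "trace (S i v) = (\<Sum>k<i. trace ((g ^^ k) v))"
  by (simp add: trace_def S_def fhom_sum[OF gp]) (rule sum.swap)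
 ultimately show ?thesis by simp
qed

definition w_eq where "w_eq = average (\<lambda>l. S (\<beta> ^ l) w0)"

lemma average_M: "(\<And>l. v l \<in> M) \<Longrightarrow> average v \<in> M"
 unfolding average_def by (intro Mmult Minv Msum Mpower of_nat_M cpM)

text \<open>The trace of \<open>S (\<beta> ^ l) w0\<close> is \<beta>^l, which cancels the weight
  \<alpha>^l. So averaging preserves the value that produces the order p^(R+1).\<close>

lemma trace_w_eq: "trace w_eq = 1"
proof -
 have a: "(g ^^ i) (of_nat k) = of_nat k" "(c ^^ i) (of_nat k) = of_nat k" for i k
  by (rule fhom_of_nat[OF gp], rule fhom_of_nat[OF cp])
 have "trace w_eq = inverse (of_nat m) * (\<Sum>l<m. of_nat \<alpha> ^ l * trace ((c ^^ l) (S (\<beta> ^ l) w0)))"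
  unfolding w_eq_def average_def trace_def
  by (simp add: fhom_mult[OF gp] fhom_inverse[OF gp] fhom_sum[OF gp] fhom_power[OF gp] a sum_distrib_left)
   (rule sum.swap)
 also have "\<dots> = inverse (of_nat m) * (\<Sum>l<m. of_nat \<alpha> ^ l * of_nat \<beta> ^ l)"
  by (simp add: trace_c S_M w0_M trace_S trace_w0 fhom_power[OF cp] a)
 also have "(\<Sum>l<m. of_nat \<alpha> ^ l * of_nat \<beta> ^ l) = (of_nat m :: 'w)"
  by (simp add: \<alpha>\<beta>_field flip: power_mult_distrib)
 finally show ?thesis using m_nz by simp
qed

lemma S_mult: "(\<Sum>k<a. (g ^^ (b * k)) (S b v)) = S (a * b) v"
proof (induction a)
 case (Suc a)
 have "S (Suc a * b) v = S (a * b + b) v" by (simp add: add.commute)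
 thus ?case using Suc by (simp add: S_add mult.commute)
qed (simp add: S_def)

text \<open>The compatibility behind C A = A^\<alpha> C: with A y = y + w and C y = \<beta> y, the
  two sides at y are \<beta> y + c w and \<beta> y + \<beta> \<open>S \<alpha> w\<close>.\<close>

lemma c_w_eq: "c w_eq = of_nat \<beta> * S \<alpha> w_eq"
proof -
 have a: "(g ^^ i) (of_nat k) = of_nat k" for i k by (rule fhom_of_nat[OF gp])
 let ?f = "\<lambda>l. of_nat \<alpha> ^ l * (c ^^ l) (S (\<alpha> * \<beta> ^ l) w0)"
 have "S \<alpha> w_eq = (\<Sum>k<\<alpha>. (g ^^ k) w_eq)" by (simp add: S_def)
 also have "\<dots> = inverse (of_nat m) * (\<Sum>l<m. of_nat \<alpha> ^ l * (\<Sum>k<\<alpha>. (g ^^ k) ((c ^^ l) (S (\<beta> ^ l) w0))))"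
  unfolding w_eq_def average_def
  by (simp add: fhom_mult[OF gp] fhom_inverse[OF gp] fhom_sum[OF gp] fhom_power[OF gp] a sum_distrib_left)
   (rule sum.swap)
 also have "(\<Sum>l<m. of_nat \<alpha> ^ l * (\<Sum>k<\<alpha>. (g ^^ k) ((c ^^ l) (S (\<beta> ^ l) w0)))) = (\<Sum>l<m. ?f l)"
  by (simp add: gcp[OF S_M[OF w0_M]] S_mult flip: fhom_sum[OF cp])
 \<comment> \<open>The summation index can be shifted cyclically because \<beta>^m is 1 modulo
   p^(R+1), the modulus on which the cocycle depends.\<close>
 also have "(\<Sum>l<m. ?f l) = (\<Sum>l<m. ?f (Suc l))"
 proof (rule sum_shift_periodic[symmetric])
  have "\<beta> ^ m = (\<alpha> ^ m) ^ (m - 1)" by (simp add: \<beta>_def flip: power_mult) (simp add: mult.commute)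
  hence "\<beta> ^ m mod p ^ Suc R = (\<alpha> ^ m mod p ^ Suc R) ^ (m - 1) mod p ^ Suc R" by (simp only: power_mod)
  hence "\<beta> ^ m mod p ^ Suc R = 1 mod p ^ Suc R" by (simp only: \<alpha>m power_mod power_one)
  from mod_mult_one_left[OF this, of \<alpha>] have "S (\<alpha> * \<beta> ^ m) w0 = S \<alpha> w0"
   by (intro S_cong[OF w0_M trace_w0]) (simp add: mult.commute)
  thus "?f m = ?f 0" by (simp add: \<alpha>m_field cm S_M w0_M)
 qed
 also have "\<dots> = (\<Sum>l<m. of_nat \<alpha> * (of_nat \<alpha> ^ l * (c ^^ Suc l) (S (\<beta> ^ l) w0)))"
 proof (intro sum.cong refl)
  fix l
  have "S (\<alpha> * \<beta> ^ Suc l) w0 = S (\<beta> ^ l) w0"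
  proof (rule S_cong[OF w0_M trace_w0])
   have "(\<alpha> * \<beta>) * \<beta> ^ l mod p ^ Suc R = \<beta> ^ l mod p ^ Suc R"
    by (rule mod_mult_one_left[OF \<alpha>\<beta>_mod]) simp
   thus "\<alpha> * \<beta> ^ Suc l mod p ^ Suc R = \<beta> ^ l mod p ^ Suc R" by (simp add: mult_ac)
  qed
  thus "?f (Suc l) = of_nat \<alpha> * (of_nat \<alpha> ^ l * (c ^^ Suc l) (S (\<beta> ^ l) w0))" by simp
 qed
 finally have "of_nat \<beta> * S \<alpha> w_eq = (of_nat \<alpha> * of_nat \<beta>) * (inverse (of_nat m) * (\<Sum>l<m. of_nat \<alpha> ^ l * (c ^^ Suc l) (S (\<beta> ^ l) w0)))"
  by (simp add: sum_distrib_left mult_ac)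
 also have "\<dots> = c w_eq"
  unfolding \<alpha>\<beta>_field by (simp add: w_eq_def average_def fhom_mult[OF c] fhom_inverse[OF c] fhom_sum[OF c] fhom_power[OF c] fhom_of_nat[OF c])
 finally show ?thesis ..
qed

end

section \<open>Lifting the group to the last Artin-Schreier extension\<close>

lemma fls_deriv_const_mult: "fls_deriv (fls_const a * f) = fls_const a * fls_deriv (f :: 'k::field fls)"
 by simp

lemma vge_const_mult: "vge f r \<Longrightarrow> vge (fls_const a * f) r" for f :: "'k::field fls"
 using vge_mult[of "fls_const a" 0 f r] vge_const[of 0 a] by simp

lemma good_funpow: assumes "good s 1" shows "good (s ^^ i) 1"
proof (induction i)
 case (Suc i)
 show ?case using good_comp[OF assms Suc] by (simp add: comp_def)
qed (use good_id in \<open>simp add: id_def\<close>)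

lemma artin_schreier_determined:
 assumes p: "prime p" and AS: "artin_schreier p x j K z"
  and P: "fhom P" and Q: "fhom Q" and e: "\<And>a. P (K a) = Q (K a)" "P z = Q z"
 shows "P f = Q f"
proof -
 obtain a where f: "f = (\<Sum>i<p. K (a i) * z ^ i)" using artin_schreier_basis[OF p AS] by blast
 show ?thesis unfolding f
  by (simp add: fhom_sum[OF P] fhom_sum[OF Q] fhom_mult[OF P] fhom_mult[OF Q] fhom_power[OF P] fhom_power[OF Q] e)
qed

lemma bij_periodic:
 assumes "n > 0" "\<And>x. (s ^^ n) x = x"
 shows "bij s"
proof -
 obtain k where k: "n = Suc k" using assms(1) by (cases n) auto
 show ?thesis
 proof (rule o_bij)
  show "(s ^^ k) \<circ> s = id" using assms(2) by (auto simp: k funpow_swap1)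
  show "s \<circ> (s ^^ k) = id" using assms(2) by (auto simp: k)
 qed
qed

text \<open>The maps y -> y + w and y -> \<beta> y respect the equation of y by the relations for x.
  All group relations need checking only on the base and at y: trace 1 makes the q-th power of A add
  1 to y, and \<beta>^m = 1 gives the order of C.\<close>

lemma artin_schreier_lift:
 fixes K \<sigma> \<tau> :: "'k::field fls \<Rightarrow> 'k fls"
 assumes p: "prime p" "CHAR('k) = p" and qm: "q > 0" "m > 0"
  and AS: "artin_schreier p (x - wp p b) j K z" and \<sigma>: "good \<sigma> 1" and \<tau>: "good \<tau> 1"
  and \<sigma>x: "\<sigma> x = x + wp p w" and \<tau>x: "\<tau> x = of_nat \<beta> * x"
  and \<tau>w: "\<tau> w = of_nat \<beta> * (\<Sum>k<\<alpha>. (\<sigma> ^^ k) w)" and trw: "(\<Sum>k<q. (\<sigma> ^^ k) w) = 1"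
  and \<sigma>q: "\<And>a. (\<sigma> ^^ q) a = a" and \<tau>m: "\<And>a. (\<tau> ^^ m) a = a" and \<tau>\<sigma>: "\<And>a. \<tau> (\<sigma> a) = (\<sigma> ^^ \<alpha>) (\<tau> a)"
  and \<beta>m: "of_nat \<beta> ^ m = (1::'k)"
 shows "\<exists>A C. good A 1 \<and> good C 1 \<and> (\<forall>a. A (K a) = K (\<sigma> a)) \<and> (\<forall>a. C (K a) = K (\<tau> a)) \<and>
  (\<forall>i. (A ^^ i) (z + K b) = z + K b + K (\<Sum>k<i. (\<sigma> ^^ k) w)) \<and>
  (\<forall>a. (A ^^ (q * p)) a = a) \<and> (\<forall>a. (C ^^ m) a = a) \<and> (\<forall>a. C (A a) = (A ^^ \<alpha>) (C a))"
proof -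
 \<comment> \<open>The explicit extension belongs to the reduced class x - wp(b), while the
   relations hold for x; adding K b returns to it.\<close>
 define y where "y = z + K b"
 have K: "good K p" and z: "wp p z = K (x - wp p b)" using AS by (simp_all add: artin_schreier_def)
 note h = good_fhom[OF K] and hs = good_fhom[OF \<sigma>] and ht = good_fhom[OF \<tau>]
 have pf: "CHAR('k fls) = p" using p(2) by simp
 note wadd = wp_add[OF p(1) pf] and wdiff = wp_diff[OF p(1) pf]
 have y: "wp p y = K x" by (simp add: y_def wadd z fhom_diff[OF h] wp_fhom[OF h])
 have beta_p: "(of_nat \<beta> :: 'k fls) ^ p = of_nat \<beta>" by (rule of_nat_power_char[OF p(1) pf])
 have "wp p (y + K w - K (\<sigma> b)) = K (\<sigma> (x - wp p b))"
  by (simp add: wadd wdiff y fhom_simps[OF hs] fhom_simps[OF h] wp_fhom[OF h] wp_fhom[OF hs] \<sigma>x)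
 then obtain A where A: "fhom A" "\<And>a. A (K a) = K (\<sigma> a)" "A z = y + K w - K (\<sigma> b)"
  using artin_schreier_hom[OF p(1) AS fhom_comp[OF h hs]] by blast
 have "wp p (of_nat \<beta> * y - K (\<tau> b)) = wp p (of_nat \<beta> * y) - wp p (K (\<tau> b))" by (rule wdiff)
 also have "wp p (of_nat \<beta> * y) = of_nat \<beta> * wp p y" by (simp add: wp_def power_mult_distrib beta_p algebra_simps)
 finally have "wp p (of_nat \<beta> * y - K (\<tau> b)) = K (\<tau> (x - wp p b))"
  by (simp add: y fhom_simps[OF ht] fhom_simps[OF h] wp_fhom[OF h] wp_fhom[OF ht] \<tau>x)
 then obtain C where C: "fhom C" "\<And>a. C (K a) = K (\<tau> a)" "C z = of_nat \<beta> * y - K (\<tau> b)"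
  using artin_schreier_hom[OF p(1) AS fhom_comp[OF h ht]] by blast
 have Ay: "A y = y + K w" and Cy: "C y = of_nat \<beta> * y"
  by (simp_all add: y_def fhom_add[OF A(1)] fhom_add[OF C(1)] A C)
 have det: "P f = Q f" if P: "fhom P" and Q: "fhom Q" and "\<And>a. P (K a) = Q (K a)" "P y = Q y" for P Q :: "'k fls \<Rightarrow> 'k fls" and f
 proof (rule artin_schreier_determined[OF p(1) AS P Q that(3)])
  have "P z = P y - P (K b)" "Q z = Q y - Q (K b)" by (simp_all add: y_def fhom_add[OF P] fhom_add[OF Q])
  thus "P z = Q z" using that by simp
 qed
 have Ai: "fhom (A ^^ i)" and Ci: "fhom (C ^^ i)" for i by (rule fhom_funpow[OF A(1)], rule fhom_funpow[OF C(1)])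
 have AK: "(A ^^ i) (K a) = K ((\<sigma> ^^ i) a)" and CK: "(C ^^ i) (K a) = K ((\<tau> ^^ i) a)" for i a
  by (induction i) (simp_all add: A C)
 have Aiy: "(A ^^ i) y = y + K (\<Sum>k<i. (\<sigma> ^^ k) w)" for i
 proof (induction i)
  case (Suc i)
  have "(A ^^ Suc i) y = (A ^^ i) (A y)" by (simp add: funpow_swap1)
  also have "\<dots> = y + K (\<Sum>k<i. (\<sigma> ^^ k) w) + K ((\<sigma> ^^ i) w)" by (simp only: Ay fhom_add[OF Ai] Suc AK)
  finally show ?case by (simp add: fhom_add[OF h])
 qed (simp add: fhom_0[OF h])
 have Aq: "((A ^^ q) ^^ k) y = y + of_nat k" for k
  by (induction k) (simp_all add: Aiy trw fhom_1[OF h] fhom_add[OF Ai] fhom_of_nat[OF Ai])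
 have ord_A: "(A ^^ (q * p)) a = a" for a
 proof (rule det[OF Ai fhom_id])
  fix a show "(A ^^ (q * p)) (K a) = K a" unfolding funpow_mult[symmetric]
   by (induction p) (simp_all add: AK \<sigma>q)
  have "(of_nat p :: 'k fls) = 0" using pf by (metis of_nat_CHAR)
  thus "(A ^^ (q * p)) y = y" using Aq[of p] by (simp add: funpow_mult)
 qed
 have ord_C: "(C ^^ m) a = a" for a
 proof (rule det[OF Ci fhom_id])
  fix a show "(C ^^ m) (K a) = K a" by (simp add: CK \<tau>m)
  have "(C ^^ i) y = of_nat (\<beta> ^ i) * y" for i
   by (induction i) (simp_all add: Cy fhom_mult[OF C(1)] fhom_power[OF C(1)] fhom_of_nat[OF C(1)])
  moreover have "(of_nat (\<beta> ^ m) :: 'k fls) = 1" using \<beta>m by (simp add: fls_of_nat flip: fls_const_power)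
  ultimately show "(C ^^ m) y = y" by simp
 qed
 have comm: "C (A a) = (A ^^ \<alpha>) (C a)" for a
 proof (rule det[OF fhom_comp[OF C(1) A(1)] fhom_comp[OF Ai C(1)]])
  fix a show "C (A (K a)) = (A ^^ \<alpha>) (C (K a))" by (simp add: A C AK \<tau>\<sigma>)
  have "C (A y) = of_nat \<beta> * y + K (\<tau> w)" by (simp add: Ay fhom_add[OF C(1)] Cy C)
  also have "\<dots> = of_nat \<beta> * (A ^^ \<alpha>) y"
   by (simp add: \<tau>w Aiy fhom_mult[OF h] fhom_of_nat[OF h] distrib_left)
  finally show "C (A y) = (A ^^ \<alpha>) (C y)" by (simp add: Cy fhom_mult[OF Ai] fhom_of_nat[OF Ai])
 qed
 have const: "A (fls_const a) = fls_const a" "C (fls_const a) = fls_const a" for a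
  using A(2)[of "fls_const a"] C(2)[of "fls_const a"]
  by (simp_all add: good_const[OF K] good_const[OF \<sigma>] good_const[OF \<tau>])
 have "q * p > 0" using qm p(1) prime_gt_0_nat by simp
 hence "bij A" "bij C" using bij_periodic[OF _ ord_A] bij_periodic[OF qm(2) ord_C] by auto
 hence "good A 1" "good C 1" using good_automorphism[OF p] A(1) C(1) const by blast+
 thus ?thesis using A(2) C(2) Aiy ord_A ord_C comm unfolding y_def by blast
qed

text \<open>Expand f in powers of z. The polynomial with these coefficients minus f has degree less
  than p but the p roots z + i, so it vanishes and f is its constant coordinate.\<close>

lemma artin_schreier_fixed:
 fixes K :: "'k::field fls \<Rightarrow> 'k fls"
 assumes p: "prime p" "CHAR('k) = p" and AS: "artin_schreier p x j K z"
  and P: "fhom P" "\<And>a. P (K a) = K a" "P z = z + 1" and f: "P f = f"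
 shows "f \<in> range K"
proof -
 have p1: "p > 1" using p(1) prime_gt_1_nat by blast
 obtain a where fa: "f = (\<Sum>i<p. K (a i) * z ^ i)" using artin_schreier_basis[OF p(1) AS] by blast
 define Q where "Q = (\<Sum>i<p. monom (K (a i)) i) - [:f:]"
 have Pi: "fhom (P ^^ i)" for i by (rule fhom_funpow[OF P(1)])
 have Pz: "(P ^^ i) z = z + of_nat i" for i
  by (induction i) (simp_all add: P fhom_add[OF P(1)] fhom_of_nat[OF P(1)] add_ac)
 have PK: "(P ^^ i) (K b) = K b" for i b by (induction i) (simp_all add: P)
 have Pf: "(P ^^ i) f = f" for i by (induction i) (simp_all add: f)
 have root: "poly Q (z + of_nat i) = 0" for i
 proof -
  have "(P ^^ i) f = (\<Sum>k<p. K (a k) * (z + of_nat i) ^ k)"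
   by (subst fa) (simp add: fhom_sum[OF Pi] fhom_mult[OF Pi] fhom_power[OF Pi] PK Pz)
  thus ?thesis by (simp add: Q_def poly_sum poly_monom Pf)
 qed
 have "Polynomial.degree Q \<le> p - 1" unfolding Q_def
 proof (rule degree_diff_le)
  show "Polynomial.degree (\<Sum>i<p. monom (K (a i)) i) \<le> p - 1"
   by (rule degree_sum_le) (auto intro: order_trans[OF degree_monom_le])
 qed simp
 have inj: "inj_on (\<lambda>i. z + of_nat i) {..<p}"
 proof (rule inj_onI)
  have *: "i = k" if "i \<le> k" "k < p" "of_nat i = (of_nat k :: 'k fls)" for i k
  proof -
   have "of_nat (k - i) = (0 :: 'k fls)" using that by (simp add: of_nat_diff)
   hence "p dvd k - i" using p(2) by (simp add: of_nat_eq_0_iff_char_dvd)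
   thus ?thesis using that by (auto dest: dvd_imp_le)
  qed
  fix i k assume "i \<in> {..<p}" "k \<in> {..<p}" "z + of_nat i = z + of_nat k"
  thus "i = k" using *[of i k] *[of k i] by (metis add_left_imp_eq lessThan_iff linear)
 qed
 have "Q = 0"
 proof (rule ccontr)
  assume Q: "Q \<noteq> 0"
  have "p = card ((\<lambda>i. z + of_nat i) ` {..<p})" using inj by (simp add: card_image)
  also have "\<dots> \<le> card {x. poly Q x = 0}"
   using poly_roots_finite[OF Q] root by (intro card_mono) auto
  also have "\<dots> \<le> Polynomial.degree Q" by (rule card_poly_roots_bound[OF Q])
  finally show False using \<open>Polynomial.degree Q \<le> p - 1\<close> p1 by simp
 qed
 hence "poly Q 0 = 0" by simp
 also have "poly Q 0 = (\<Sum>i<p. if i = 0 then K (a 0) else 0) - f"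
  unfolding Q_def poly_diff poly_sum poly_monom by (simp add: zero_power power_0_left if_distrib cong: if_cong sum.cong)
 finally have "f = K (a 0)" using p1 by simp
 thus ?thesis by blast
qed

section \<open>The jump of the last step\<close>

context ltower
begin

text \<open>The leading part of the derivative of X0 is the differential K \<omega> D. Under c^l,
  \<omega> contributes \<zeta>^(- l (a + 1)) and D contributes \<zeta>^l. The weight \<alpha>^l =
  \<zeta>^(l a), available by the eigenvalue condition, cancels the product, so all summands of the
  average share one leading term.\<close>

lemma top_equation:
 assumes R: "R > 0" and \<phi>: "reduced p \<phi>" and L: "level R e K"
 defines "f' \<equiv> f(q := \<phi>)"
 assumes eig: "of_nat \<beta> * \<zeta> ^ rho p f' R = 1"
 shows "\<exists>x B. e x = average (\<lambda>_. X0 \<phi>) \<and> fls_deriv x \<noteq> 0 \<and> val (fls_deriv x) = - jump p f' R - 1 \<and>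
  vge x (- B) \<and> B < real p * of_int (jump p f' R) \<and> jump p f' R > 0"
proof -
 define a where "a = rho p f' R"
 define j where "j = jump p f' R"
 note e = levelD(1)[OF L] and K = levelD(3)[OF L]
 note h = good_fhom[OF K]
 have \<zeta>\<alpha>: "of_nat \<alpha> = \<zeta> ^ a"
  using eig \<alpha>\<beta>_field(1) unfolding a_def by (metis mult.assoc mult.commute mult.left_neutral)
 obtain Z where Z: "Z $ 0 = 1" "\<And>n. n \<ge> q \<Longrightarrow> Z $ n = 0" "\<And>n. n < q \<Longrightarrow> e (Z $ n) = Y $ n"
  "\<And>n. n < q \<Longrightarrow> (Z * fmap K (normal_form f q)) $ n = (Z $ n) ^ p"
  using level_series[OF L] by auto
 have nf: "normal_form f' q = normal_form f q" unfolding normal_form_def f'_def by (intro prod.cong) auto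
 have de: "diff_exp p f' R = diff_exp p f R" by (rule diff_exp_cong) (use p1 in \<open>auto simp: f'_def\<close>)
 have "q > 1" by (rule one_less_power[OF p1 R])
 hence f'1: "f' 1 = f 1" by (simp add: f'_def)
 have f': "reduced p (f' i)" for i using f_red \<phi> by (simp add: f'_def)
 have rho0: "rho p f' R > 0" by (rule rho_pos) (use f'1 f1_pole[OF R] p0 in simp_all)
 define x0 where "x0 = (Z * fmap K (normal_form f' q)) $ q - K (f' q)"
 have ex0: "e x0 = X0 \<phi>"
 proof -
  have "e ((Z * fmap K (normal_form f q)) $ q) = (fmap e Z * fmap eF (normal_form f q)) $ q"
   by (simp add: fps_mult_nth fhom_sum[OF e] fhom_mult[OF e] levelD(4)[OF L])
  also have "fmap e Z = Yt" by (rule fps_ext) (simp add: Yt_def Z fhom_0[OF e])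
  moreover have "f' q = \<phi>" by (simp add: f'_def)
  ultimately show ?thesis by (simp only: x0_def nf X0_def fhom_diff[OF e] levelD(4)[OF L])
 qed
 obtain \<omega> \<eta> B where dx: "fls_deriv x0 = K \<omega> * fls_deriv (K fls_X) + \<eta>" and \<omega>: "\<omega> \<noteq> 0"
  "val \<omega> = - int a - 1" and \<eta>: "vge \<eta> (of_int (- j))"
  and B: "vge x0 (- B)" "B < real p * real_of_int j" and j: "j > 0"
  using level_estimate[OF prime char K levelD(5)[OF L] f' Z(1,2) Z(4)[folded nf] levelD(6)[OF L, folded de] rho0]
  unfolding x0_def[symmetric] a_def j_def by blast
 have dx0: "fls_deriv x0 \<noteq> 0" "val (fls_deriv x0) = - j - 1"
  using sum_deriv_subdegree[OF K levelD(5)[OF L] levelD(6)[OF L, folded de] \<omega>[unfolded a_def] \<eta>[unfolded j_def]]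
  by (simp_all add: dx j_def)
 define D where "D = fls_deriv (K fls_X)"
 have vD: "vge D (real (diff_exp p f' R) + real q - 1)"
  using levelD(5,6)[OF L] by (simp add: vge_iff D_def de)
 have "\<exists>\<tau>. good \<tau> 1 \<and> (\<forall>a. e (\<tau> a) = (c ^^ l) (e a)) \<and>
  vge (fls_deriv (of_nat \<alpha> ^ l * \<tau> x0 - x0)) (of_int (- j))" for l
 proof -
  obtain \<tau> where "good \<tau> 1 \<and> (\<forall>a. e (\<tau> a) = (g ^^ 0) ((c ^^ l) (e a)))"
   using level_automorphism[OF L] by blast
  hence \<tau>: "good \<tau> 1" "\<And>a. e (\<tau> a) = (c ^^ l) (e a)" by simp_all
  obtain \<sigma> where "good \<sigma> 1 \<and> (\<forall>a. eF (\<sigma> a) = (g ^^ 0) ((c ^^ l) (eF a)))"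
   using level_automorphism[OF level_0] by blast
  hence \<sigma>: "good \<sigma> 1" "\<And>a. eF (\<sigma> a) = (c ^^ l) (eF a)" by simp_all
  note ht = good_fhom[OF \<tau>(1)]
  have "eF (\<sigma> fls_X) = eF (fls_const (\<zeta> ^ l) * fls_X)" by (simp only: \<sigma>(2) cp_eF_X)
  hence \<sigma>X: "\<sigma> fls_X = fls_const (\<zeta> ^ l) * fls_X" by (simp only: fhom_eq_iff[OF eF])
  have "e (\<tau> (K b)) = e (K (\<sigma> b))" for b by (simp add: \<tau>(2) \<sigma>(2) levelD(4)[OF L])
  hence \<tau>K: "\<tau> (K b) = K (\<sigma> b)" for b by (simp only: fhom_eq_iff[OF e])
  \<comment> \<open>D transforms like the differential of the tame parameter, which \<sigma>
    multiplies by \<zeta>^l.\<close>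
  have \<tau>D: "\<tau> D * fls_deriv (\<tau> fls_X) = fls_const (\<zeta> ^ l) * D"
  proof -
   have "\<tau> D * fls_deriv (\<tau> fls_X) = fls_deriv (\<tau> (K fls_X))" unfolding D_def by (rule good_deriv[OF \<tau>(1), symmetric])
   also have "\<tau> (K fls_X) = fls_const (\<zeta> ^ l) * K fls_X"
    by (simp only: \<tau>K \<sigma>X fhom_mult[OF h] good_const[OF K])
   finally show ?thesis by (simp add: D_def)
  qed
  define z where "z = \<zeta> ^ l"
  have al: "(of_nat \<alpha> ^ l :: 'k fls) = fls_const (z ^ a)"
   by (simp add: fls_of_nat z_def \<zeta>\<alpha> fls_const_power mult.commute flip: power_mult)
  have "fls_deriv (\<tau> x0) = \<tau> (fls_deriv x0) * fls_deriv (\<tau> fls_X)" by (rule good_deriv[OF \<tau>(1)])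
  also have "\<tau> (fls_deriv x0) = K (\<sigma> \<omega>) * \<tau> D + \<tau> \<eta>" by (simp add: dx D_def fhom_add[OF ht] fhom_mult[OF ht] \<tau>K)
  finally have "fls_deriv (\<tau> x0) = K (\<sigma> \<omega>) * (\<tau> D * fls_deriv (\<tau> fls_X)) + \<tau> \<eta> * fls_deriv (\<tau> fls_X)"
   by (simp add: algebra_simps)
  hence d\<tau>: "fls_deriv (\<tau> x0) = fls_const z * K (\<sigma> \<omega>) * D + \<tau> \<eta> * fls_deriv (\<tau> fls_X)"
   unfolding \<tau>D z_def by (simp add: mult_ac)
  \<comment> \<open>The exponent is a + 1, not a, because \<omega> is a derivative and has pole
    order a + 1; the additional z is the factor coming from D.\<close>
  define E where "E = fls_const (z ^ Suc a) * \<sigma> \<omega> - \<omega>"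
  have \<omega>': "val \<omega> = - int (Suc a)" using \<omega>(2) by simp
  have "vge E (- real (Suc a) + 1)"
   unfolding E_def z_def by (rule scaling_leading[OF \<sigma>(1) \<sigma>X \<omega>(1) \<omega>'])
  hence "vge E (- real a)" by simp
  hence "vge (K E) (real q * (- real a))" by (rule good_vge[OF K])
  hence "vge (K E * D) (real q * (- real a) + (real (diff_exp p f' R) + real q - 1))" by (rule vge_mult[OF _ vD])
  moreover have "real_of_int (- j) \<le> real q * (- real a) + (real (diff_exp p f' R) + real q - 1)"
  proof -
   have "real_of_int (- j) = real (diff_exp p f' R) - real q * real a" by (simp add: j_def jump_def a_def)
   moreover have "real q \<ge> 1" using q0 by (metis One_nat_def Suc_leI of_nat_1 of_nat_le_iff)
   ultimately show ?thesis by simp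
  qed
  ultimately have vE: "vge (K E * D) (of_int (- j))" by (rule vge_mono)
  have "fls_deriv (of_nat \<alpha> ^ l * \<tau> x0 - x0) = K E * D + (fls_const (z ^ a) * (\<tau> \<eta> * fls_deriv (\<tau> fls_X)) - \<eta>)"
   unfolding al fls_deriv_sub fls_deriv_const_mult d\<tau> dx
   by (simp add: E_def D_def fhom_simps[OF h] good_const[OF K] algebra_simps flip: fls_const_mult_const)
  moreover have "vge (\<tau> \<eta> * fls_deriv (\<tau> fls_X)) (of_int (- j) + 0)"
  proof (rule vge_mult)
   show "vge (\<tau> \<eta>) (of_int (- j))" by (rule good_vge_1[OF \<tau>(1) \<eta>])
   have "vge (\<tau> fls_X) 1" by (rule good_vge_1[OF \<tau>(1)]) (simp add: vge_iff)
   from vge_deriv[OF this] show "vge (fls_deriv (\<tau> fls_X)) 0" by simp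
  qed
  ultimately have "vge (fls_deriv (of_nat \<alpha> ^ l * \<tau> x0 - x0)) (of_int (- j))"
   using vE \<eta> by (simp only: add_0_right) (intro vge_add vge_diff vge_const_mult)
  thus ?thesis using \<tau> by blast
 qed
 then obtain \<tau> where \<tau>: "\<And>l. good (\<tau> l) 1" "\<And>l a. e (\<tau> l a) = (c ^^ l) (e a)"
  "\<And>l. vge (fls_deriv (of_nat \<alpha> ^ l * \<tau> l x0 - x0)) (of_int (- j))"
  by metis
 define n where "n = inverse (of_nat m :: 'k)"
 have n: "n * of_nat m = 1" using m_nz by (simp add: n_def)
 define E where "E = (\<Sum>l<m. of_nat \<alpha> ^ l * \<tau> l x0 - x0)"
 define x where "x = x0 + fls_const n * E"
 have nm: "fls_const n * of_nat m = 1" using n by (simp add: fls_of_nat fls_const_mult_const)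
 have xs: "x = fls_const n * (\<Sum>l<m. of_nat \<alpha> ^ l * \<tau> l x0)"
 proof -
  have "E = (\<Sum>l<m. of_nat \<alpha> ^ l * \<tau> l x0) - of_nat m * x0" by (simp add: E_def sum_subtractf)
  hence "x = x0 - (fls_const n * of_nat m) * x0 + fls_const n * (\<Sum>l<m. of_nat \<alpha> ^ l * \<tau> l x0)"
   by (simp only: x_def right_diff_distrib mult.assoc) simp
  thus ?thesis by (simp add: nm)
 qed
 have en: "e (fls_const n) = inverse (of_nat m)"
  using nm m_nz by (metis fhom_1[OF e] fhom_mult[OF e] fhom_of_nat[OF e] inverse_unique mult.commute)
 have "e x = average (\<lambda>_. X0 \<phi>)"
  by (simp add: xs average_def en fhom_mult[OF e] fhom_sum[OF e] fhom_power[OF e] fhom_of_nat[OF e] \<tau>(2) ex0)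
 moreover have "fls_deriv x = fls_deriv x0 + fls_const n * fls_deriv E" by (simp add: x_def)
 moreover have "vge (fls_const n * fls_deriv E) (of_int (- j))"
  unfolding E_def fls_deriv_sum by (intro vge_const_mult vge_sum \<tau>(3))
 hence "fls_deriv x0 + fls_const n * fls_deriv E \<noteq> 0 \<and> val (fls_deriv x0 + fls_const n * fls_deriv E) = - j - 1"
  using subdegree_add_vge[OF dx0(1), of "fls_const n * fls_deriv E" "real_of_int (- j)"] dx0(2) by simp
 moreover have "vge x (- B)"
 proof -
  have "vge (of_nat \<alpha> ^ l * \<tau> l x0) (- B)" for l
   using vge_const_mult[OF good_vge_1[OF \<tau>(1) B(1)], of "of_nat \<alpha> ^ l"] by (simp add: fls_of_nat flip: fls_const_power)
  thus ?thesis unfolding xs by (intro vge_const_mult vge_sum)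
 qed
 ultimately show ?thesis using B(2) j unfolding j_def by metis
qed

end

subsection \<open>Extension of homomorphisms into an algebraically closed field\<close>

lemma ring_of_type_simps [simp]:
 "carrier (type_ring :: 'w::field ring) = UNIV"
 "\<one>\<^bsub>(type_ring :: 'w ring)\<^esub> = 1" "\<zero>\<^bsub>(type_ring :: 'w ring)\<^esub> = 0"
 "x \<otimes>\<^bsub>(type_ring :: 'w ring)\<^esub> y = x * y" "x \<oplus>\<^bsub>(type_ring :: 'w ring)\<^esub> y = x + y"
 by (simp_all add: ring_of_type_algebra_def)

lemma ring_of_type_pow [simp]: "x [^]\<^bsub>(type_ring :: 'w::field ring)\<^esub> (n::nat) = x ^ n"
proof (induction n)
 case (Suc n)
 thus ?case by (simp add: nat_pow_def mult.commute)
qed (simp add: nat_pow_def)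

lemma ring_of_type_ring: "ring (type_ring :: 'w::field ring)"
 and ring_of_type_cring: "cring (type_ring :: 'w::field ring)"
 and ring_of_type_field: "Ring.field (type_ring :: 'w::field ring)"
 by (rule ring_from_type_algebra, rule cring_from_type_algebra, rule field_from_type_algebra)

definition evalp :: "'w::field list \<Rightarrow> 'w \<Rightarrow> 'w" where
 "evalp = ring.eval type_ring"

lemma evalp_simps [simp]: "evalp [] y = 0" "evalp (a # p) y = a * y ^ length p + evalp p y"
 unfolding evalp_def ring.eval.simps[OF ring_of_type_ring] by simp_all

lemma evalp_poly: "evalp p y = poly (Poly (rev p)) y"
 by (induction p) (simp_all add: Poly_append poly_monom mult.commute)

lemma evalp_root:
 fixes p :: "'w::alg_closed_field list"
 assumes "length p > 1" "hd p \<noteq> 0"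
 shows "\<exists>y. evalp p y = 0"
proof -
 have "Polynomial.coeff (Poly (rev p)) (length p - 1) = hd p"
  using assms by (cases p) (auto simp: nth_default_def nth_append)
 hence "Polynomial.degree (Poly (rev p)) > 0"
  using assms le_degree[of "Poly (rev p)" "length p - 1"] by fastforce
 thus ?thesis using alg_closed_imp_poly_has_root unfolding evalp_poly by blast
qed

definition partial_hom :: "('a, 'z) ring_scheme \<Rightarrow> 'a set \<Rightarrow> ('a \<Rightarrow> 'w::field) \<Rightarrow> bool" where
 "partial_hom L E h \<longleftrightarrow> subfield E L \<and> h \<in> ring_hom (L\<lparr>carrier := E\<rparr>) type_ring"

lemma partial_homD:
 assumes "partial_hom L E h"
 shows "subfield E L" "x \<in> E \<Longrightarrow> y \<in> E \<Longrightarrow> h (x \<oplus>\<^bsub>L\<^esub> y) = h x + h y"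
  "x \<in> E \<Longrightarrow> y \<in> E \<Longrightarrow> h (x \<otimes>\<^bsub>L\<^esub> y) = h x * h y" "h \<one>\<^bsub>L\<^esub> = 1"
 using assms by (auto simp: partial_hom_def ring_hom_def)

lemma partial_homI:
 assumes "subfield E L" "\<And>x y. x \<in> E \<Longrightarrow> y \<in> E \<Longrightarrow> h (x \<oplus>\<^bsub>L\<^esub> y) = h x + h y"
  "\<And>x y. x \<in> E \<Longrightarrow> y \<in> E \<Longrightarrow> h (x \<otimes>\<^bsub>L\<^esub> y) = h x * h y" "h \<one>\<^bsub>L\<^esub> = 1"
 shows "partial_hom L E h"
 using assms by (auto simp: partial_hom_def ring_hom_def)

context field
begin

lemma partial_hom_ring_hom_ring:
 assumes "partial_hom R E (h :: 'a \<Rightarrow> 'w::field)"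
 shows "ring_hom_ring (R\<lparr>carrier := E\<rparr>) type_ring h"
proof -
 have "ring (R\<lparr>carrier := E\<rparr>)" using assms subfieldE(1) subring_is_ring by (auto simp: partial_hom_def)
 thus ?thesis using assms ring_of_type_ring by (intro ring_hom_ringI2) (auto simp: partial_hom_def)
qed

lemma partial_hom_0: assumes h: "partial_hom R E h" shows "h \<zero> = 0"
proof -
 interpret ring_hom_ring "R\<lparr>carrier := E\<rparr>" type_ring h by (rule partial_hom_ring_hom_ring[OF h])
 show ?thesis using hom_zero by simp
qed

text \<open>The minimal polynomial generates the kernel of evaluation at x, so evaluation at a root
  y of its image is well defined on the simple extension.\<close>

lemma simple_extension_partial_hom:
 assumes h: "partial_hom R E (h :: 'a \<Rightarrow> 'w::field)" and x: "x \<in> carrier R" "(algebraic over E) x"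
  and y: "evalp (map h (Irr E x)) y = 0"
 shows "\<exists>h'. partial_hom R (simple_extension E x) h' \<and> (\<forall>a\<in>E. h' a = h a) \<and> h' x = y"
proof -
 note E = partial_homD(1)[OF h]
 note Es = subfieldE(1)[OF E]
 let ?\<Omega> = "type_ring :: 'w ring"
 interpret \<Omega>: cring ?\<Omega> by (rule ring_of_type_cring)
 interpret Hom: ring_hom_ring "R\<lparr>carrier := E\<rparr>" ?\<Omega> h by (rule partial_hom_ring_hom_ring[OF h])
 interpret UP: domain "E[X]" by (rule univ_poly_is_domain[OF Es])
 have EX: "set p \<subseteq> E" if "p \<in> carrier (E[X])" for p using that by (simp add: polynomial_incl univ_poly_carrier)
 define \<theta> where "\<theta> p = evalp (map h p) y" for p
 have add: "\<theta> (p \<oplus>\<^bsub>E[X]\<^esub> r) = \<theta> p + \<theta> r" if "p \<in> carrier (E[X])" "r \<in> carrier (E[X])" for p r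
 proof -
  have "\<theta> (p \<oplus>\<^bsub>E[X]\<^esub> r) = \<Omega>.eval (\<Omega>.normalize (map h (poly_add p r))) y"
   unfolding \<theta>_def evalp_def univ_poly_add by (rule \<Omega>.eval_normalize[symmetric]) simp_all
  also have "\<Omega>.normalize (map h (poly_add p r)) = \<Omega>.poly_add (map h p) (map h r)"
   using Hom.poly_add_hom'[of p r] EX that poly_add_consistent[OF Es] by simp
  finally show ?thesis using \<Omega>.eval_poly_add[of "map h p" "map h r" y]
   by (simp add: \<theta>_def evalp_def del: \<Omega>.poly_add.simps poly_add.simps)
 qed
 have mult: "\<theta> (p \<otimes>\<^bsub>E[X]\<^esub> r) = \<theta> p * \<theta> r" if "p \<in> carrier (E[X])" "r \<in> carrier (E[X])" for p r
 proof -
  have "\<theta> (p \<otimes>\<^bsub>E[X]\<^esub> r) = \<Omega>.eval (\<Omega>.normalize (map h (poly_mult p r))) y"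
   unfolding \<theta>_def evalp_def univ_poly_mult by (rule \<Omega>.eval_normalize[symmetric]) simp_all
  also have "\<Omega>.normalize (map h (poly_mult p r)) = \<Omega>.poly_mult (map h p) (map h r)"
   using Hom.poly_mult_hom'[of p r] EX that poly_mult_consistent[OF Es] by simp
  finally show ?thesis using \<Omega>.eval_poly_mult[of "map h p" "map h r" y]
   by (simp add: \<theta>_def evalp_def del: \<Omega>.poly_mult.simps poly_mult.simps)
 qed
 have evh: "(\<lambda>p. eval p x) \<in> ring_hom (E[X]) R" by (rule eval_is_hom[OF Es x(1)])
 have well: "\<theta> p = \<theta> r" if pr: "p \<in> carrier (E[X])" "r \<in> carrier (E[X])" "eval p x = eval r x" for p r
 proof -
  define d where "d = p \<ominus>\<^bsub>E[X]\<^esub> r"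
  have d: "d \<in> carrier (E[X])" "d \<oplus>\<^bsub>E[X]\<^esub> r = p" using pr by (simp_all add: d_def UP.minus_eq UP.a_assoc UP.l_neg)
  have "eval d x \<oplus> eval r x = eval r x" using ring_hom_add[OF evh d(1) pr(2)] d(2) pr(3) by simp
  hence "eval d x = \<zero>"
   using add.r_cancel_one[of "eval r x" "eval d x"] ring_hom_closed[OF evh d(1)] ring_hom_closed[OF evh pr(2)] by simp
  hence "d \<in> PIdl\<^bsub>E[X]\<^esub> (Irr E x)"
   using d(1) Irr_generates_ker[OF E x] by (auto simp: a_kernel_def')
  then obtain s where s: "s \<in> carrier (E[X])" "d = s \<otimes>\<^bsub>E[X]\<^esub> Irr E x" by (auto simp: cgenideal_def)
  have "\<theta> d = \<theta> s * \<theta> (Irr E x)" unfolding s(2) by (rule mult[OF s(1) IrrE(1)[OF E x]])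
  also have "\<theta> (Irr E x) = 0" using y by (simp add: \<theta>_def)
  finally show ?thesis using add[OF d(1) pr(2)] d(2) by simp
 qed
 have img: "simple_extension E x = (\<lambda>p. eval p x) ` carrier (E[X])"
  by (rule simple_extension_as_eval_img[OF subfieldE(3)[OF E] x(1)])
 define h' where "h' a = \<theta> (SOME p. p \<in> carrier (E[X]) \<and> eval p x = a)" for a
 have h': "h' (eval p x) = \<theta> p" if p: "p \<in> carrier (E[X])" for p
 proof -
  have "(SOME r. r \<in> carrier (E[X]) \<and> eval r x = eval p x) \<in> carrier (E[X]) \<and>
   eval (SOME r. r \<in> carrier (E[X]) \<and> eval r x = eval p x) x = eval p x"
   by (rule someI[where P = "\<lambda>r. r \<in> carrier (E[X]) \<and> eval r x = eval p x"]) (use p in simp)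
  thus ?thesis unfolding h'_def by (intro well p) auto
 qed
 have hE: "h' a = h a" if a: "a \<in> E" for a
 proof (cases "a = \<zero>")
  case True
  thus ?thesis using h'[of "[]"] partial_hom_0[OF h] by (simp add: \<theta>_def univ_poly_def polynomial_def)
 next
  case False
  hence "[a] \<in> carrier (E[X])" using a by (simp add: univ_poly_def polynomial_def)
  moreover have "eval [a] x = a" using a subfieldE(3)[OF E] x(1) by auto
  ultimately show ?thesis using h'[of "[a]"] by (simp add: \<theta>_def)
 qed
 have "partial_hom R (simple_extension E x) h'"
 proof (rule partial_homI)
  show "subfield (simple_extension E x) R" using simple_extension_is_subfield[OF E x(1)] x(2) by simp
  show "h' (a \<oplus> b) = h' a + h' b" if ab: "a \<in> simple_extension E x" "b \<in> simple_extension E x" for a b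
  proof -
   obtain p r where pr: "p \<in> carrier (E[X])" "r \<in> carrier (E[X])" "a = eval p x" "b = eval r x" using ab img by auto
   thus ?thesis using ring_hom_add[OF evh pr(1,2)] add[OF pr(1,2)] h'[OF UP.a_closed[OF pr(1,2)]] h'[OF pr(1)] h'[OF pr(2)]
    by simp
  qed
  show "h' (a \<otimes> b) = h' a * h' b" if ab: "a \<in> simple_extension E x" "b \<in> simple_extension E x" for a b
  proof -
   obtain p r where pr: "p \<in> carrier (E[X])" "r \<in> carrier (E[X])" "a = eval p x" "b = eval r x" using ab img by auto
   thus ?thesis using ring_hom_mult[OF evh pr(1,2)] mult[OF pr(1,2)] h'[OF UP.m_closed[OF pr(1,2)]] h'[OF pr(1)] h'[OF pr(2)]
    by simp
  qed
  show "h' \<one> = 1" using hE subringE(3)[OF Es] partial_homD(4)[OF h] by simp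
 qed
 moreover have "h' x = y"
 proof -
  have "X \<in> carrier (E[X])" by (rule var_closed(1)[OF Es])
  moreover have "eval X x = x" using x(1) by (rule eval_var)
  ultimately show ?thesis using h'[of X] partial_homD(4)[OF h] partial_hom_0[OF h] by (simp add: \<theta>_def var_def)
 qed
 ultimately show ?thesis using hE by blast
qed

lemma partial_hom_root:
 assumes h: "partial_hom R E (h :: 'a \<Rightarrow> 'w::alg_closed_field)" and x: "x \<in> carrier R" "(algebraic over E) x"
 shows "\<exists>y. evalp (map h (Irr E x)) y = 0"
proof (rule evalp_root)
 note E = partial_homD(1)[OF h]
 have "degree (Irr E x) \<ge> 1" using IrrE(1,2)[OF E x] pirreducible_degree[OF E] by blast
 hence ne: "length (Irr E x) > 1" by simp
 thus "length (map h (Irr E x)) > 1" by simp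
 have "Irr E x \<noteq> []" using ne by auto
 hence "hd (map h (Irr E x)) = h (lead_coeff (Irr E x))" by (rule list.map_sel(1))
 thus "hd (map h (Irr E x)) \<noteq> 0"
  by (simp add: IrrE(3)[OF E x] partial_homD(4)[OF h])
qed

text \<open>Graphs turn extension of homomorphisms into inclusion of sets, with unions as bounds of
  chains; values outside the domain of definition are forgotten.\<close>

definition hom_graph :: "('a \<times> 'w::field) set \<Rightarrow> bool" where
 "hom_graph G \<longleftrightarrow> (\<exists>E h. partial_hom R E h \<and> G = (\<lambda>x. (x, h x)) ` E)"

lemma hom_graph_Union:
 fixes C :: "('a \<times> 'w::field) set set"
 assumes ne: "C \<noteq> {}" and hg: "\<And>G. G \<in> C \<Longrightarrow> hom_graph G"
  and two: "\<And>u v. u \<in> \<Union>C \<Longrightarrow> v \<in> \<Union>C \<Longrightarrow> \<exists>G\<in>C. u \<in> G \<and> v \<in> G"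
 shows "hom_graph (\<Union>C)"
proof -
 define E where "E = fst ` \<Union>C"
 define h where "h x = (THE a. (x, a) \<in> \<Union>C)" for x
 have h: "h x = a" if "(x, a) \<in> \<Union>C" for x a
  unfolding h_def
 proof (rule the_equality[where P = "\<lambda>a. (x, a) \<in> \<Union>C", OF that])
  fix b assume "(x, b) \<in> \<Union>C"
  from two[OF that this] show "b = a" using hg unfolding hom_graph_def by blast
 qed
 have loc: "\<exists>B k. partial_hom R B k \<and> x \<in> B \<and> y \<in> B \<and> B \<subseteq> E \<and> (\<forall>z\<in>B. h z = k z)"
  if xy: "x \<in> E" "y \<in> E" for x y
 proof -
  have "\<exists>a. (x, a) \<in> \<Union>C" "\<exists>b. (y, b) \<in> \<Union>C" using xy unfolding E_def by force+
  then obtain a b G where G: "G \<in> C" "(x, a) \<in> G" "(y, b) \<in> G" using two by meson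
  obtain B k where B: "partial_hom R B k" "G = (\<lambda>x. (x, k x)) ` B" using hg[OF G(1)] by (auto simp: hom_graph_def)
  have "(z, k z) \<in> \<Union>C" if "z \<in> B" for z using that B(2) G(1) by blast
  hence "\<forall>z\<in>B. h z = k z \<and> z \<in> E" using h unfolding E_def by force
  thus ?thesis using B G(2,3) by blast
 qed
 note sf = subfieldE(1)[OF partial_homD(1)]
 obtain G where G: "G \<in> C" using ne by blast
 then obtain B k where B: "partial_hom R B k" "G = (\<lambda>x. (x, k x)) ` B" using hg unfolding hom_graph_def by blast
 have one: "(\<one>, k \<one>) \<in> \<Union>C" using subringE(3)[OF sf[OF B(1)]] B(2) G by blast
 have "\<one> \<in> E" unfolding E_def by (rule image_eqI[OF _ one]) simp
 note x0 = this h[OF one, unfolded partial_homD(4)[OF B(1)]]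
 have cl: "x \<in> carrier R" "\<ominus> x \<in> E" "x \<noteq> \<zero> \<Longrightarrow> inv x \<in> E" "x \<oplus> y \<in> E" "x \<otimes> y \<in> E"
  "h (x \<oplus> y) = h x + h y" "h (x \<otimes> y) = h x * h y" if xy: "x \<in> E" "y \<in> E" for x y
 proof -
  obtain B k where B: "partial_hom R B k" "x \<in> B" "y \<in> B" "B \<subseteq> E" "\<forall>z\<in>B. h z = k z" using loc[OF xy] by blast
  note F = partial_homD(1)[OF B(1)] and S = sf[OF B(1)]
  have s: "x \<oplus> y \<in> B" "x \<otimes> y \<in> B" by (rule subringE(7)[OF S B(2,3)], rule subringE(6)[OF S B(2,3)])
  show "x \<in> carrier R" "\<ominus> x \<in> E" using B(2,4) subfieldE(3)[OF F] subringE(5)[OF S B(2)] by blast+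
  show "x \<noteq> \<zero> \<Longrightarrow> inv x \<in> E" using subfield_m_inv(1)[OF F, of x] B(2,4) by auto
  show "x \<oplus> y \<in> E" "x \<otimes> y \<in> E" using s B(4) by blast+
  show "h (x \<oplus> y) = h x + h y" "h (x \<otimes> y) = h x * h y" using B(2,3,5) s partial_homD(2,3)[OF B(1)] by simp_all
 qed
 have "subfield E R" by (rule subfieldI'[OF subringI]) (use cl x0(1) in auto)
 hence "partial_hom R E h" by (rule partial_homI) (use cl x0 in auto)
 moreover have "\<Union>C = (\<lambda>x. (x, h x)) ` E" using h unfolding E_def by force
 ultimately show ?thesis unfolding hom_graph_def by blast
qed

text \<open>A maximal extension is defined everywhere: otherwise a minimal polynomial over its
  domain has a root in the algebraically closed target, which allows a further simple
  extension.\<close>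

theorem partial_hom_extends:
 assumes h0: "partial_hom R E0 (h0 :: 'a \<Rightarrow> 'w::alg_closed_field)"
  and alg: "\<And>x. x \<in> carrier R \<Longrightarrow> (algebraic over E0) x"
 shows "\<exists>h. partial_hom R (carrier R) h \<and> (\<forall>x\<in>E0. h x = h0 x)"
proof -
 define G0 where "G0 = (\<lambda>x. (x, h0 x)) ` E0"
 define \<G> where "\<G> = {G. hom_graph G \<and> G0 \<subseteq> G}"
 have "\<exists>G\<in>\<G>. \<forall>B\<in>\<G>. G \<subseteq> B \<longrightarrow> B = G"
 proof (rule subset_Zorn_nonempty)
  show "\<G> \<noteq> {}" using h0 by (auto simp: \<G>_def G0_def hom_graph_def)
  fix C assume Cc: "C \<noteq> {}" "subset.chain \<G> C"
  have two: "\<exists>G\<in>C. u \<in> G \<and> v \<in> G" if uv: "u \<in> \<Union>C" "v \<in> \<Union>C" for u v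
  proof -
   obtain G1 G2 where "G1 \<in> C" "G2 \<in> C" "u \<in> G1" "v \<in> G2" using uv by auto
   thus ?thesis using Cc(2) unfolding subset_chain_def by (metis subsetD)
  qed
  have hg: "hom_graph G" "G0 \<subseteq> G" if "G \<in> C" for G
   using Cc(2) that by (auto simp: subset_chain_def \<G>_def)
  have "hom_graph (\<Union>C)" by (rule hom_graph_Union[OF Cc(1) hg(1) two])
  moreover have "G0 \<subseteq> \<Union>C" using Cc(1) hg(2) by blast
  ultimately show "\<Union>C \<in> \<G>" by (simp add: \<G>_def)
 qed
 then obtain G where G: "hom_graph G" "G0 \<subseteq> G" "\<And>B. hom_graph B \<Longrightarrow> G0 \<subseteq> B \<Longrightarrow> G \<subseteq> B \<Longrightarrow> B = G"
  by (auto simp: \<G>_def)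
 obtain E h where hE: "partial_hom R E h" and GE: "G = (\<lambda>x. (x, h x)) ` E"
  using G(1) by (auto simp: hom_graph_def)
 have E0: "E0 \<subseteq> E" "\<And>x. x \<in> E0 \<Longrightarrow> h x = h0 x"
  using G(2) unfolding G0_def GE by auto
 have "E = carrier R"
 proof (rule ccontr)
  assume ne: "E \<noteq> carrier R"
  have Es: "E \<subseteq> carrier R" by (rule subfieldE(3)[OF partial_homD(1)[OF hE]])
  then obtain x where x: "x \<in> carrier R" "x \<notin> E" using ne by blast
  have xa: "(algebraic over E) x" by (rule algebraic_mono[OF E0(1) alg[OF x(1)]])
  obtain y where "evalp (map h (Irr E x)) y = 0" using partial_hom_root[OF hE x(1) xa] by blast
  then obtain h' where h': "partial_hom R (simple_extension E x) h'" "\<forall>a\<in>E. h' a = h a"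
   using simple_extension_partial_hom[OF hE x(1) xa] by blast
  have sub: "E \<subseteq> simple_extension E x" by (rule simple_extension_incl[OF Es x(1)])
  have "(\<lambda>x. (x, h' x)) ` simple_extension E x = G"
  proof (rule G(3))
   show "hom_graph ((\<lambda>x. (x, h' x)) ` simple_extension E x)" using h'(1) by (auto simp: hom_graph_def)
   show "G \<subseteq> (\<lambda>x. (x, h' x)) ` simple_extension E x" unfolding GE using sub h'(2) by force
   thus "G0 \<subseteq> (\<lambda>x. (x, h' x)) ` simple_extension E x" using G(2) by blast
  qed
  hence "simple_extension E x = E" unfolding GE by (auto simp: image_iff)
  thus False using simple_extension_mem[OF subfieldE(1)[OF partial_homD(1)[OF hE]] x(1)] x(2) by simp
 qed
 thus ?thesis using hE E0 by auto
qed

end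

section \<open>Galois extensions inside an algebraic closure\<close>

lemma partial_hom_ring_hom: "partial_hom L (carrier L) h \<Longrightarrow> h \<in> ring_hom L type_ring"
 by (simp add: partial_hom_def)

lemma partial_hom_fhom:
 assumes "partial_hom type_ring (UNIV :: 'b::field set) (h :: 'b \<Rightarrow> 'w::field)"
 shows "fhom h"
 using partial_homD(2,3,4)[OF assms] by (simp add: fhom_def)

lemma galois_groupD:
 assumes "s \<in> carrier (galois_group L K)"
 shows "s \<in> ring_hom L L" "bij_betw s (carrier L) (carrier L)" "s \<in> extensional (carrier L)" "\<And>x. x \<in> K \<Longrightarrow> s x = x"
 using assms by (auto simp: galois_group_def Bij_def)

lemma galois_groupI:
 assumes "s \<in> ring_hom L L" "bij_betw s (carrier L) (carrier L)" "s \<in> extensional (carrier L)" "\<And>x. x \<in> K \<Longrightarrow> s x = x"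
 shows "s \<in> carrier (galois_group L K)"
 using assms by (auto simp: galois_group_def Bij_def)

context field
begin

lemma partial_hom_carrier_inj:
 assumes "partial_hom R (carrier R) (j :: 'a \<Rightarrow> 'w::field)"
 shows "inj_on j (carrier R)"
 by (rule non_trivial_field_hom_is_inj[OF partial_hom_ring_hom[OF assms] field_axioms ring_of_type_field])

lemma partial_hom_iso:
 assumes "partial_hom R (carrier R) (j :: 'a \<Rightarrow> 'w::field)"
 shows "j \<in> ring_iso R (type_ring\<lparr>carrier := j ` carrier R\<rparr>)"
 unfolding ring_iso_def using partial_hom_carrier_inj[OF assms] partial_homD(2-4)[OF assms]
 by (auto simp: bij_betw_def intro!: ring_hom_memI)

lemma partial_hom_eval:
 assumes j: "partial_hom R (carrier R) (j :: 'a \<Rightarrow> 'w::field)" and "set P \<subseteq> carrier R" "x \<in> carrier R"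
 shows "j (eval P x) = evalp (map j P) (j x)"
proof -
 interpret ring_hom_ring R "type_ring :: 'w ring" j
  using partial_hom_ring_hom_ring[OF j] by simp
 show ?thesis unfolding evalp_def by (rule eval_hom'[OF assms(3,2)])
qed

lemma galois_conjugates:
 assumes gal: "galois_extension R K" and z: "z \<in> carrier R"
 defines "P \<equiv> Irr K z" and "S \<equiv> {r \<in> carrier R. eval (Irr K z) r = \<zero>}"
 shows "P \<in> carrier (K[X])" "set P \<subseteq> K" "hd P = \<one>" "eval P z = \<zero>" "length P \<ge> 2" "finite S" "card S = degree P"
proof -
 have K: "subfield K R" and alg: "(algebraic over K) z" and sp: "splitted P" and sep: "\<And>a. count (roots P) a \<le> 1"
  using gal z by (auto simp: galois_extension_def P_def)
 note I = IrrE[OF K z alg, folded P_def]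
 show "P \<in> carrier (K[X])" "hd P = \<one>" "eval P z = \<zero>" by (fact I)+
 show "set P \<subseteq> K" using I(1) by (simp add: polynomial_incl univ_poly_carrier)
 have "degree P \<ge> 1" using I(1,2) pirreducible_degree[OF K] by blast
 thus len: "length P \<ge> 2" by simp
 have PR: "P \<in> carrier (poly_ring R)" by (rule carrier_polynomial_shell[OF subfieldE(1)[OF K] I(1)])
 have "set_mset (roots P) = S"
  using roots_mem_iff_is_root[OF PR] len unfolding S_def P_def[symmetric] is_root_def by auto
 moreover have "count (roots P) a = 1" if "a \<in># roots P" for a
 proof -
  have "count (roots P) a > 0" using that by simp
  thus ?thesis using sep[of a] by linarith
 qed
 hence "size (roots P) = card (set_mset (roots P))"
  by (simp add: size_multiset_overloaded_eq)
 ultimately show "finite S" "card S = degree P" using sp by (auto simp: splitted_def)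
qed

text \<open>h z is a root of the image of the minimal polynomial of z. The images under j of its
  roots in the normal, separable field already exhaust the degree.\<close>

lemma partial_hom_conjugate:
 assumes gal: "galois_extension R K" and j: "partial_hom R (carrier R) (j :: 'a \<Rightarrow> 'w::field)"
  and h: "partial_hom R (carrier R) h" and hj: "\<And>x. x \<in> K \<Longrightarrow> h x = j x" and z: "z \<in> carrier R"
 shows "h z \<in> j ` {r \<in> carrier R. eval (Irr K z) r = \<zero>}"
proof -
 define P where "P = Irr K z"
 define S where "S = {r \<in> carrier R. eval P r = \<zero>}"
 note C = galois_conjugates[OF gal z, folded P_def, folded S_def]
 have K: "K \<subseteq> carrier R" using gal subfieldE(3) by (auto simp: galois_extension_def)
 have PC: "set P \<subseteq> carrier R" using C(2) K by blast
 define Q where "Q = Poly (rev (map j P))"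
 have co: "Polynomial.coeff Q (length P - 1) = 1"
 proof -
  have "Polynomial.coeff Q (length P - 1) = j (hd P)"
   using C(5) by (cases P) (auto simp: Q_def nth_default_def nth_append)
  thus ?thesis using C(3) partial_homD(4)[OF j] by simp
 qed
 have "h z \<in> j ` S"
 proof (rule roots_exhausted)
  show "Q \<noteq> 0" using co by auto
  show "finite (j ` S)" using C(6) by simp
  have "inj_on j S" using partial_hom_carrier_inj[OF j] by (rule inj_on_subset) (auto simp: S_def)
  hence "card (j ` S) = length P - 1" using C(7) by (simp add: card_image)
  moreover have "Polynomial.degree Q \<le> length P - 1"
   using C(5) by (intro degree_le) (auto simp: Q_def nth_default_def)
  ultimately show "Polynomial.degree Q \<le> card (j ` S)" by simp
  show "poly Q x = 0" if "x \<in> j ` S" for x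
  proof -
   obtain r where r: "x = j r" "r \<in> carrier R" "eval P r = \<zero>" using \<open>x \<in> j ` S\<close> by (auto simp: S_def)
   show ?thesis using partial_hom_eval[OF j PC r(2)] partial_hom_0[OF j] by (simp add: r Q_def evalp_poly)
  qed
  have "map h P = map j P" using hj C(2) by auto
  hence "poly Q (h z) = evalp (map h P) (h z)" by (simp only: Q_def evalp_poly)
  thus "poly Q (h z) = 0"
   by (simp only: partial_hom_eval[OF h PC z, symmetric] C(4) partial_hom_0[OF h])
 qed
 thus ?thesis by (simp add: S_def P_def)
qed

text \<open>Both embeddings have the same image by normality. Surjectivity of their quotient is
  checked on the finite root set of each minimal polynomial, which an injective map
  permutes.\<close>

lemma partial_hom_automorphism:
 assumes gal: "galois_extension R K" and j: "partial_hom R (carrier R) (j :: 'a \<Rightarrow> 'w::field)"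
  and h: "partial_hom R (carrier R) h" and hj: "\<And>x. x \<in> K \<Longrightarrow> h x = j x"
 shows "\<exists>s\<in>carrier (galois_group R K). \<forall>x\<in>carrier R. j (s x) = h x"
proof -
 note ji = partial_hom_carrier_inj[OF j] and hi = partial_hom_carrier_inj[OF h]
 have K: "subfield K R" using gal by (simp add: galois_extension_def)
 have im: "h z \<in> j ` {r \<in> carrier R. eval (Irr K z) r = \<zero>}" if "z \<in> carrier R" for z
  by (rule partial_hom_conjugate[OF gal j h hj that])
 define s where "s = restrict (\<lambda>z. inv_into (carrier R) j (h z)) (carrier R)"
 have s: "s z \<in> carrier R" "j (s z) = h z" if "z \<in> carrier R" for z
 proof -
  have "h z \<in> j ` carrier R" using im[OF that] by auto
  thus "s z \<in> carrier R" "j (s z) = h z" using that by (simp_all add: s_def inv_into_into f_inv_into_f)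
 qed
 have eqI: "x = y" if "x \<in> carrier R" "y \<in> carrier R" "j x = j y" for x y using ji that by (auto dest: inj_onD)
 note jD = partial_homD(2-4)[OF j] and hD = partial_homD(2-4)[OF h]
 have hom: "s \<in> ring_hom R R"
  by (rule ring_hom_memI) (auto intro!: eqI simp: s jD hD)
 have inj: "inj_on s (carrier R)"
 proof (rule inj_onI)
  fix x y assume xy: "x \<in> carrier R" "y \<in> carrier R" "s x = s y"
  hence "h x = h y" using s by metis
  thus "x = y" using hi xy by (auto dest: inj_onD)
 qed
 have fix_K: "s x = x" if "x \<in> K" for x
  using that subfieldE(3)[OF K] s hj by (intro eqI) auto
 have surj: "carrier R \<subseteq> s ` carrier R"
 proof
  fix z assume z: "z \<in> carrier R"
  define S where "S = {r \<in> carrier R. eval (Irr K z) r = \<zero>}"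
  note C = galois_conjugates[OF gal z, folded S_def]
  have PC: "set (Irr K z) \<subseteq> carrier R" using C(2) subfieldE(3)[OF K] by blast
  have "s ` S \<subseteq> S"
  proof
   fix y assume "y \<in> s ` S"
   then obtain x where x: "x \<in> carrier R" "eval (Irr K z) x = \<zero>" "y = s x" by (auto simp: S_def)
   have "map j (Irr K z) = map h (Irr K z)" using hj C(2) by auto
   hence "j (eval (Irr K z) (s x)) = h (eval (Irr K z) x)"
    by (simp only: partial_hom_eval[OF j PC s(1)[OF x(1)]] partial_hom_eval[OF h PC x(1)] s(2)[OF x(1)])
   also have "\<dots> = j \<zero>" by (simp add: x(2) partial_hom_0[OF h] partial_hom_0[OF j])
   finally have "eval (Irr K z) (s x) = \<zero>"
    by (intro eqI) (simp_all add: eval_in_carrier[OF PC] s(1)[OF x(1)])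
   thus "y \<in> S" using x s by (simp add: S_def)
  qed
  hence "s ` S = S"
   by (intro card_subset_eq C(6)) (use inj_on_subset[OF inj, of S] in \<open>auto simp: S_def card_image\<close>)
  moreover have "z \<in> S" using z C(4) by (simp add: S_def)
  ultimately show "z \<in> s ` carrier R" by (auto simp: S_def)
 qed
 have "bij_betw s (carrier R) (carrier R)" using inj surj s(1) by (auto simp: bij_betw_def)
 moreover have "s \<in> extensional (carrier R)" unfolding s_def by (rule restrict_extensional)
 ultimately have "s \<in> carrier (galois_group R K)" by (intro galois_groupI[OF hom _ _ fix_K])
 thus ?thesis using s(2) by blast
qed

text \<open>An element outside K has a conjugate y different from it. The embedding that sends x to
  the image of y extends to the whole field and differs from j by an automorphism that moves
  x.\<close>

theorem galois_fixed_field: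
 assumes gal: "galois_extension R K" and h0: "partial_hom R K (h0 :: 'a \<Rightarrow> 'w::alg_closed_field)"
  and x: "x \<in> carrier R" "\<And>s. s \<in> carrier (galois_group R K) \<Longrightarrow> s x = x"
 shows "x \<in> K"
proof (rule ccontr)
 assume xK: "x \<notin> K"
 have K: "subfield K R" and alg: "\<And>z. z \<in> carrier R \<Longrightarrow> (algebraic over K) z"
  using gal by (auto simp: galois_extension_def)
 note sr = subringE[OF subfieldE(1)[OF K]]
 define P where "P = Irr K x"
 define S where "S = {r \<in> carrier R. eval P r = \<zero>}"
 note C = galois_conjugates[OF gal x(1), folded P_def, folded S_def]
 have PC: "set P \<subseteq> carrier R" using C(2) sr(1) by blast
 have "length P \<noteq> 2"
 proof
  assume "length P = 2"
  then obtain b where P: "P = [\<one>, b]" using C(3) by (cases P; cases "tl P") auto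
  have b: "b \<in> K" "b \<in> carrier R" using C(2) PC by (auto simp: P)
  have "x \<oplus> b = \<zero>" using C(4) x(1) b by (simp add: P)
  hence "x = \<ominus> b" using x(1) b(2) by (metis add.inv_equality a_comm)
  thus False using xK sr(5)[OF b(1)] by simp
 qed
 hence "card S \<ge> 2" using C(5,7) by simp
 hence "\<not> S \<subseteq> {x}" using card_mono[of "{x}" S] by auto
 then obtain y where y: "y \<in> carrier R" "eval P y = \<zero>" "y \<noteq> x" by (auto simp: S_def)
 obtain j where j: "partial_hom R (carrier R) j" "\<And>a. a \<in> K \<Longrightarrow> j a = h0 a"
  using partial_hom_extends[OF h0 alg] by auto
 have "map h0 P = map j P" using j(2) C(2) by auto
 hence "evalp (map h0 P) (j y) = j (eval P y)" by (simp only: partial_hom_eval[OF j(1) PC y(1)])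
 hence root: "evalp (map h0 (Irr K x)) (j y) = 0"
  unfolding y(2) partial_hom_0[OF j(1)] by (simp only: P_def)
 obtain h1 where h1: "partial_hom R (simple_extension K x) h1" "\<And>a. a \<in> K \<Longrightarrow> h1 a = h0 a" "h1 x = j y"
  using simple_extension_partial_hom[OF h0 x(1) alg[OF x(1)] root] by auto
 have sub: "K \<subseteq> simple_extension K x" by (rule simple_extension_incl[OF sr(1) x(1)])
 have xs: "x \<in> simple_extension K x" by (rule simple_extension_mem[OF subfieldE(1)[OF K] x(1)])
 obtain h where h: "partial_hom R (carrier R) h" "\<And>a. a \<in> simple_extension K x \<Longrightarrow> h a = h1 a"
  using partial_hom_extends[OF h1(1) algebraic_mono[OF sub alg]] by auto
 have "h a = j a" if "a \<in> K" for a using that sub h(2) h1(2) j(2) by auto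
 then obtain s where s: "s \<in> carrier (galois_group R K)" "\<And>a. a \<in> carrier R \<Longrightarrow> j (s a) = h a"
  using partial_hom_automorphism[OF gal j(1) h(1)] by blast
 have "j x = j y" using s(2)[OF x(1)] x(2)[OF s(1)] h(2)[OF xs] h1(3) by simp
 thus False using partial_hom_carrier_inj[OF j(1)] x(1) y by (auto dest: inj_onD)
qed

lemma galois_embedding:
 assumes gal: "galois_extension R (range \<iota>)" and \<iota>: "\<iota> \<in> ring_hom type_ring R"
 shows "\<exists>j :: 'a \<Rightarrow> 'k::field alg_closure. partial_hom R (carrier R) j \<and> (\<forall>a. j (\<iota> a) = to_ac a)"
  and "\<exists>h :: 'a \<Rightarrow> 'k::field alg_closure. partial_hom R (range \<iota>) h"
proof -
 have K: "subfield (range \<iota>) R" and alg: "\<And>z. z \<in> carrier R \<Longrightarrow> (algebraic over (range \<iota>)) z"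
  using gal by (auto simp: galois_extension_def)
 have "inj \<iota>" using non_trivial_field_hom_is_inj[OF \<iota> ring_of_type_field field_axioms] by simp
 define h where "h = to_ac \<circ> inv_into UNIV \<iota>"
 have h\<iota>: "h (\<iota> a) = to_ac a" for a using \<open>inj \<iota>\<close> by (simp add: h_def)
 have "\<iota> \<in> ring_iso type_ring (R\<lparr>carrier := range \<iota>\<rparr>)"
  using \<iota> \<open>inj \<iota>\<close> by (auto simp: ring_iso_def ring_hom_def bij_betw_def)
 from ring_iso_set_sym[OF ring_of_type_ring this]
 have "inv_into UNIV \<iota> \<in> ring_hom (R\<lparr>carrier := range \<iota>\<rparr>) type_ring" by (simp add: ring_iso_def)
 moreover have "to_ac \<in> ring_hom type_ring (type_ring :: 'k alg_closure ring)"
  by (rule ring_hom_memI) simp_all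
 ultimately have "h \<in> ring_hom (R\<lparr>carrier := range \<iota>\<rparr>) type_ring"
  unfolding h_def by (rule ring_hom_trans)
 hence h: "partial_hom R (range \<iota>) h" using K by (simp add: partial_hom_def)
 thus "\<exists>h :: 'a \<Rightarrow> 'k::field alg_closure. partial_hom R (range \<iota>) h" by blast
 obtain j where "partial_hom R (carrier R) j" "\<And>x. x \<in> range \<iota> \<Longrightarrow> j x = h x"
  using partial_hom_extends[OF h alg] by auto
 thus "\<exists>j :: 'a \<Rightarrow> 'k::field alg_closure. partial_hom R (carrier R) j \<and> (\<forall>a. j (\<iota> a) = to_ac a)"
  using h\<iota> by (intro exI[of _ j]) simp
qed

text \<open>Automorphisms are extended to the entire algebraic closure so that the tower can work
  with total functions that are homomorphisms everywhere.\<close>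

lemma galois_lift:
 assumes j: "partial_hom R (carrier R) (j :: 'a \<Rightarrow> 'k::field alg_closure)" and j\<iota>: "\<And>a. j (\<iota> a) = to_ac a" and \<iota>: "\<And>a. \<iota> a \<in> carrier R"
  and s: "s \<in> ring_hom R R"
 shows "\<exists>g :: 'k alg_closure \<Rightarrow> 'k alg_closure. fhom g \<and> (\<forall>x\<in>carrier R. g (j x) = j (s x))"
proof -
 let ?\<Omega> = "type_ring :: 'k alg_closure ring"
 interpret \<Omega>: field ?\<Omega> by (rule ring_of_type_field)
 interpret J: ring_hom_ring R ?\<Omega> j using partial_hom_ring_hom_ring[OF j] by simp
 have E: "subfield (j ` carrier R) ?\<Omega>" by (rule J.img_is_subfield(2)[OF carrier_is_subfield]) simp
 note ji = partial_hom_carrier_inj[OF j]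
 define h0 where "h0 = j \<circ> (s \<circ> inv_into (carrier R) j)"
 have h0: "h0 (j x) = j (s x)" if "x \<in> carrier R" for x using ji that by (simp add: h0_def)
 have "inv_into (carrier R) j \<in> ring_hom (?\<Omega>\<lparr>carrier := j ` carrier R\<rparr>) R"
  using ring_iso_set_sym[OF ring_axioms partial_hom_iso[OF j]] by (simp add: ring_iso_def)
 from ring_hom_trans[OF ring_hom_trans[OF this s] partial_hom_ring_hom[OF j]]
 have ph: "partial_hom ?\<Omega> (j ` carrier R) h0" using E by (simp add: partial_hom_def h0_def)
 have alg: "(\<Omega>.algebraic over (j ` carrier R)) y" for y
 proof -
  obtain P where P: "P \<noteq> 0" "poly (map_poly to_ac P) y = 0" by (rule alg_closure_algebraic)
  define l where "l = rev (map to_ac (coeffs P))"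
  have "Poly (rev l) = map_poly to_ac P" by (simp add: l_def map_poly_def)
  hence ev: "\<Omega>.eval l y = 0" using P(2) by (simp add: evalp_def[symmetric] evalp_poly)
  have "hd l \<noteq> 0" using P(1) by (simp add: l_def hd_rev last_map last_coeffs_eq_coeff_degree)
  moreover have "set l \<subseteq> j ` carrier R"
  proof
   fix v assume "v \<in> set l"
   then obtain a where "v = to_ac a" by (auto simp: l_def)
   thus "v \<in> j ` carrier R" using j\<iota>[of a] \<iota>[of a] by (metis image_eqI)
  qed
  ultimately have "l \<in> carrier ((j ` carrier R)[X]\<^bsub>?\<Omega>\<^esub>)"
   by (simp add: univ_poly_def polynomial_def)
  moreover have "l \<noteq> []" using P(1) by (simp add: l_def)
  ultimately show ?thesis using \<Omega>.algebraicI ev by simp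
 qed
 obtain g where g: "partial_hom ?\<Omega> (carrier ?\<Omega>) g" "\<And>y. y \<in> j ` carrier R \<Longrightarrow> g y = h0 y"
  using \<Omega>.partial_hom_extends[OF ph alg] by auto
 have "fhom g" using g(1) by (intro partial_hom_fhom) simp
 moreover have "g (j x) = j (s x)" if "x \<in> carrier R" for x using g(2) h0 that by simp
 ultimately show ?thesis by blast
qed

end

subsection \<open>Models of Galois extensions by Laurent series\<close>

lemma fhom_map_poly_prod:
 assumes h: "fhom h"
 shows "map_poly h (\<Prod>i\<in>I. P i) = (\<Prod>i\<in>I. map_poly h (P i))"
 by (induction I rule: infinite_finite_induct)
  (simp_all add: fhom_map_poly_mult[OF h] fhom_1[OF h] map_poly_1')

lemma dvd_shift_eq:
 fixes a b n :: nat
 assumes "a < n" "b < n" "n dvd b + (n - a)"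
 shows "a = b"
proof -
 obtain k where k: "b + (n - a) = n * k" using assms(3) by blast
 have "n * k < n * 2" "n * 0 < n * k" unfolding k[symmetric] using assms(1,2) by simp_all
 hence "k < 2" "0 < k" by simp_all
 hence "k = 1" by simp
 thus ?thesis using k assms by simp
qed

text \<open>A Galois extension in coordinates: k((X)) over the image of K, with generators A and C
  of the group and the ramification number of every element; f encodes the wild ones through
  \<open>jump\<close>.\<close>

locale galois_model =
 fixes p m r \<alpha> d :: nat and K A C :: "'k::alg_closed_field fls \<Rightarrow> 'k fls" and f :: "nat \<Rightarrow> 'k fls"
 assumes prime: "prime p" and char: "CHAR('k) = p" and m0: "m > 0"
  and K: "good K d" and gA: "good A 1" and gC: "good C 1"
  and AK: "A (K a) = K a" and CK: "C (K a) = K a"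
  and A_ord: "(A ^^ (p ^ r)) a = a" and C_ord: "(C ^^ m) a = a" and CA: "C (A a) = (A ^^ \<alpha>) (C a)"
  and fixed: "A a = a \<Longrightarrow> C a = a \<Longrightarrow> a \<in> range K"
  and ram_tame: "\<not> m dvd l \<Longrightarrow> ram (\<lambda>a. (A ^^ i) ((C ^^ l) a)) 0"
  and ram_wild: "m dvd l \<Longrightarrow> \<not> p ^ r dvd i \<Longrightarrow> ram (\<lambda>a. (A ^^ i) ((C ^^ l) a)) (jump p f (multiplicity p i))"
  and f1: "pole (f 1) > 0"
begin

abbreviation act :: "nat \<Rightarrow> nat \<Rightarrow> 'k fls \<Rightarrow> 'k fls" where "act i l a \<equiv> (A ^^ i) ((C ^^ l) a)"

lemma p0: "p > 0" using prime prime_gt_0_nat by blast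
lemma q0: "p ^ r > 0" using p0 by simp

lemma gAi: "good (A ^^ i) 1" and gCi: "good (C ^^ i) 1"
 by (rule good_funpow[OF gA], rule good_funpow[OF gC])

lemma act_good: "good (\<lambda>a. act i l a) 1" using good_comp[OF gAi gCi] by simp

lemma act_K: "act i l (K a) = K a"
proof -
 have "(C ^^ l) (K a) = K a" by (induction l) (simp_all add: CK)
 moreover have "(A ^^ i) (K a) = K a" by (induction i) (simp_all add: AK)
 ultimately show ?thesis by simp
qed

lemma A_mult: "(A ^^ (p ^ r * k)) a = a" unfolding funpow_mult[symmetric] by (induction k) (simp_all add: A_ord)
lemma C_mult: "(C ^^ (m * k)) a = a" unfolding funpow_mult[symmetric] by (induction k) (simp_all add: C_ord)

lemma act_mod: "act (i mod p ^ r) (l mod m) a = act i l a"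
proof -
 have "(C ^^ (l mod m + m * (l div m))) a = (C ^^ (l mod m)) a" by (simp only: funpow_add comp_apply C_mult)
 moreover have "(A ^^ (i mod p ^ r + p ^ r * (i div p ^ r))) b = (A ^^ (i mod p ^ r)) b" for b
  by (simp only: funpow_add comp_apply A_mult)
 ultimately show ?thesis by (simp only: mod_mult_div_eq)
qed

lemma CAi: "C ((A ^^ i) a) = (A ^^ (\<alpha> * i)) (C a)"
proof (induction i)
 case (Suc i)
 have "C ((A ^^ Suc i) a) = (A ^^ \<alpha>) (C ((A ^^ i) a))" by (simp add: CA)
 thus ?case using Suc by (simp add: funpow_add)
qed simp

lemma CiAi: "(C ^^ l) ((A ^^ i) a) = (A ^^ (\<alpha> ^ l * i)) ((C ^^ l) a)"
 by (induction l) (simp_all add: CAi mult.assoc)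

lemma act_act: "act i l (act i' l' a) = act (i + \<alpha> ^ l * i') (l + l') a"
 by (simp add: CiAi funpow_add)

definition inv_act :: "nat \<Rightarrow> nat \<Rightarrow> 'k fls \<Rightarrow> 'k fls" where
 "inv_act i l a = (C ^^ ((m - 1) * l)) ((A ^^ ((p ^ r - 1) * i)) a)"

lemma inv_act: "inv_act i l (act i l a) = a" "act i l (inv_act i l a) = a"
proof -
 have i: "(p ^ r - 1) * i + i = p ^ r * i" "i + (p ^ r - 1) * i = p ^ r * i" using q0 by (cases "p ^ r"; simp)+
 have l: "(m - 1) * l + l = m * l" "l + (m - 1) * l = m * l" using m0 by (cases m; simp)+
 have "(A ^^ ((p ^ r - 1) * i)) ((A ^^ i) b) = b" "(A ^^ i) ((A ^^ ((p ^ r - 1) * i)) b) = b" for b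
  using A_mult[of i b] by (simp only: i(1)[symmetric] funpow_add comp_apply, simp only: i(2)[symmetric] funpow_add comp_apply)
 moreover have "(C ^^ ((m - 1) * l)) ((C ^^ l) b) = b" "(C ^^ l) ((C ^^ ((m - 1) * l)) b) = b" for b
  using C_mult[of l b] by (simp only: l(1)[symmetric] funpow_add comp_apply, simp only: l(2)[symmetric] funpow_add comp_apply)
 ultimately show "inv_act i l (act i l a) = a" "act i l (inv_act i l a) = a" by (simp_all only: inv_act_def)
qed

lemma inv_act_good: "good (inv_act i l) 1"
 using good_comp[OF gCi[of "(m - 1) * l"] gAi[of "(p ^ r - 1) * i"]] by (simp add: inv_act_def[abs_def])

text \<open>Composition with the inverse fixes X, and a valuation-preserving map fixing X and k is
  the identity.\<close>

lemma act_determined: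
 assumes "good s 1" "s fls_X = act i l fls_X"
 shows "s a = act i l a"
proof -
 have "inv_act i l (s a) = a"
 proof (rule good_eq_id)
  show "good (\<lambda>a. inv_act i l (s a)) 1" using good_comp[OF inv_act_good assms(1)] by simp
  show "inv_act i l (s fls_X) = fls_X" by (simp add: assms(2) inv_act)
 qed
 thus ?thesis by (metis inv_act(2))
qed

lemma act_nontrivial:
 assumes "act i l fls_X = fls_X" shows "m dvd l \<and> p ^ r dvd i"
proof (rule ccontr)
 assume a: "\<not> (m dvd l \<and> p ^ r dvd i)"
 have "\<exists>k. ram (\<lambda>a. act i l a) k" using a ram_tame[of l i] ram_wild[of l i] by blast
 thus False using assms by (auto simp: ram_def)
qed

lemma act_eq_iff:
 assumes i: "i < p ^ r" "i' < p ^ r" "l < m" "l' < m" and eq: "act i l fls_X = act i' l' fls_X"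
 shows "i = i' \<and> l = l'"
proof -
 have f: "act i l a = act i' l' a" for a by (rule act_determined[OF act_good eq])
 define j where "j = (p ^ r - i) + i'"
 have "act j l' a = (C ^^ l) a" for a
 proof -
  have "act j l' a = (A ^^ (p ^ r - i)) (act i l a)" by (simp add: j_def funpow_add f)
  also have "\<dots> = (A ^^ (p ^ r - i + i)) ((C ^^ l) a)" by (simp only: funpow_add comp_apply)
  finally show ?thesis using i(1) A_ord by simp
 qed
 hence "act j (l' + (m - l)) a = (C ^^ (l + (m - l))) a" for a by (simp only: funpow_add comp_apply)
 hence *: "act j (l' + (m - l)) a = a" for a using C_ord[of a] i(3) by simp
 from act_nontrivial[OF *] have "m dvd l' + (m - l)" "p ^ r dvd p ^ r - i + i'" by (simp_all add: j_def)
 thus ?thesis using dvd_shift_eq[of l m l'] dvd_shift_eq[of i "p ^ r" i'] i by (simp add: add.commute)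
qed

definition orbit where "orbit a = (\<lambda>(i, l). act i l a) ` ({..<p ^ r} \<times> {..<m})"

lemma orbit_finite: "finite (orbit a)" by (simp add: orbit_def)

lemma act_orbit: "act i l a \<in> orbit a"
 unfolding orbit_def using act_mod[of i l a] q0 m0 by (intro image_eqI[of _ _ "(i mod p ^ r, l mod m)"]) auto

lemma orbit_self: "a \<in> orbit a" using act_orbit[of 0 0 a] by simp

lemma orbit_A: "A ` orbit a = orbit a" and orbit_C: "C ` orbit a = orbit a"
proof -
 have "A ` orbit a \<subseteq> orbit a"
 proof -
  have "A (act i l a) \<in> orbit a" for i l using act_orbit[of "Suc i" l a] by simp
  thus ?thesis by (auto simp: orbit_def[of a])
 qed
 thus "A ` orbit a = orbit a"
  using fhom_inj[OF good_fhom[OF gA]] by (intro card_subset_eq orbit_finite) (auto simp: card_image inj_on_subset)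
 have "C ` orbit a \<subseteq> orbit a"
 proof -
  have "C (act i l a) \<in> orbit a" for i l using act_orbit[of "\<alpha> * i" "Suc l" a] by (simp add: CAi)
  thus ?thesis by (auto simp: orbit_def[of a])
 qed
 thus "C ` orbit a = orbit a"
  using fhom_inj[OF good_fhom[OF gC]] by (intro card_subset_eq orbit_finite) (auto simp: card_image inj_on_subset)
qed

text \<open>The product runs over the orbit as a set, so that all roots are simple; its coefficients
  are fixed by A and C and therefore lie in the base.\<close>

definition orbit_poly where "orbit_poly a = (\<Prod>b\<in>orbit a. [:- b, 1:])"

lemma orbit_poly_root: "poly (orbit_poly a) x = 0 \<longleftrightarrow> x \<in> orbit a"
 unfolding orbit_poly_def poly_prod using orbit_finite by (auto simp: prod_zero_iff)

lemma orbit_poly_degree: "Polynomial.degree (orbit_poly a) = card (orbit a)"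
 unfolding orbit_poly_def by (subst degree_prod_eq_sum_degree) (auto simp: orbit_finite)

lemma orbit_poly_monic: "Polynomial.lead_coeff (orbit_poly a) = 1"
 unfolding orbit_poly_def by (simp add: lead_coeff_prod)

lemma orbit_poly_fixed:
 assumes h: "fhom h" and Ob: "h ` orbit a = orbit a"
 shows "map_poly h (orbit_poly a) = orbit_poly a"
proof -
 have "map_poly h (orbit_poly a) = (\<Prod>b\<in>orbit a. [:- h b, 1:])"
  by (simp add: orbit_poly_def fhom_map_poly_prod[OF h] map_poly_pCons fhom_simps[OF h])
 also have "\<dots> = (\<Prod>b\<in>h ` orbit a. [:- b, 1:])"
  by (subst prod.reindex) (auto intro: inj_on_subset[OF fhom_inj[OF h]])
 finally show ?thesis by (simp add: Ob orbit_poly_def)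
qed

lemma orbit_poly_coeff: "Polynomial.coeff (orbit_poly a) i \<in> range K"
proof (rule fixed)
 have "map_poly A (orbit_poly a) = orbit_poly a" "map_poly C (orbit_poly a) = orbit_poly a"
  using orbit_poly_fixed good_fhom gA gC orbit_A orbit_C by blast+
 thus "A (Polynomial.coeff (orbit_poly a) i) = Polynomial.coeff (orbit_poly a) i"
  "C (Polynomial.coeff (orbit_poly a) i) = Polynomial.coeff (orbit_poly a) i"
  using coeff_map_poly[of A "orbit_poly a" i] coeff_map_poly[of C "orbit_poly a" i]
  by (simp_all add: fhom_0[OF good_fhom[OF gA]] fhom_0[OF good_fhom[OF gC]])
qed

end

section \<open>Galois extensions isomorphic to a Laurent model\<close>

locale galois_record = galois_model p m r \<alpha> d K A C f
 for p m r \<alpha> d :: nat and K A C :: "'k::alg_closed_field fls \<Rightarrow> 'k fls" and f :: "nat \<Rightarrow> 'k fls" +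
 fixes L :: "('l, 'z) ring_scheme" and \<iota> E :: "'k fls \<Rightarrow> 'l"
 assumes L: "Ring.field L" and E: "E \<in> ring_iso type_ring L" and \<iota>: "\<iota> a = E (K a)"
begin

sublocale L: Ring.field L by (rule L)

lemma E_bij: "bij_betw E UNIV (carrier L)" using E by (simp add: ring_iso_def)

lemma E_hom: "E \<in> ring_hom type_ring L" using E by (simp add: ring_iso_def)

sublocale hom: ring_hom_ring "type_ring :: 'k fls ring" L E
 by (rule ring_hom_ringI2[OF ring_of_type_ring L.ring_axioms E_hom])

lemma E_eq_iff: "E a = E b \<longleftrightarrow> a = b" using E_bij by (auto simp: bij_betw_def inj_def)

lemma E_carrier: "E a \<in> carrier L" using E_bij by (auto simp: bij_betw_def)

lemma E_surj: "x \<in> carrier L \<Longrightarrow> \<exists>a. x = E a" using E_bij by (auto simp: bij_betw_def)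

lemma E_simps: "E (a + b) = E a \<oplus>\<^bsub>L\<^esub> E b" "E (a * b) = E a \<otimes>\<^bsub>L\<^esub> E b" "E 1 = \<one>\<^bsub>L\<^esub>" "E 0 = \<zero>\<^bsub>L\<^esub>"
 using hom.hom_add[of a b] hom.hom_mult[of a b] hom.hom_one hom.hom_zero by simp_all

lemma E_minus: "E (a - b) = E a \<ominus>\<^bsub>L\<^esub> E b"
proof -
 have "E (a - b) \<oplus>\<^bsub>L\<^esub> E b = E a" by (simp flip: E_simps)
 thus ?thesis
  using E_carrier by (metis L.add.inv_solve_right' L.minus_eq)
qed

lemma E_eval: "L.eval (map E P) (E x) = E (evalp P x)"
 using hom.eval_hom'[of x P] by (simp add: evalp_def)

lemma \<iota>_hom: "\<iota> \<in> ring_hom type_ring L"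
 by (rule ring_hom_memI) (simp_all add: \<iota> E_carrier E_simps fhom_simps[OF good_fhom[OF K]])

lemma subfield_K: "subfield (range \<iota>) L"
proof -
 interpret I: ring_hom_ring "type_ring :: 'k fls ring" L \<iota>
  by (rule ring_hom_ringI2[OF ring_of_type_ring L.ring_axioms \<iota>_hom])
 show ?thesis using I.img_is_subfield(2)[OF field.carrier_is_subfield[OF ring_of_type_field]] by simp
qed

definition orbit_list where "orbit_list a = map E (rev (coeffs (orbit_poly a)))"

lemma orbit_poly_nz: "orbit_poly a \<noteq> 0" using orbit_poly_monic[of a] by auto

lemma orbit_list_eval: "L.eval (orbit_list a) (E x) = E (poly (orbit_poly a) x)"
 unfolding orbit_list_def E_eval by (simp add: evalp_poly)

lemma orbit_list_hd: "orbit_list a \<noteq> []" "hd (orbit_list a) = \<one>\<^bsub>L\<^esub>"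
 using orbit_poly_nz[of a] orbit_poly_monic[of a]
 by (simp_all add: orbit_list_def list.map_sel(1) hd_rev last_coeffs_eq_coeff_degree E_simps)

lemma orbit_list_length: "length (orbit_list a) - 1 = card (orbit a)"
 using orbit_poly_nz[of a] by (simp add: orbit_list_def length_coeffs orbit_poly_degree)

lemma orbit_list_set: "set (orbit_list a) \<subseteq> range \<iota>"
proof
 fix x assume "x \<in> set (orbit_list a)"
 then obtain b where b: "x = E b" "b \<in> set (coeffs (orbit_poly a))" by (auto simp: orbit_list_def)
 then obtain i where "b = Polynomial.coeff (orbit_poly a) i" by (auto simp: coeffs_def split: if_splits)
 thus "x \<in> range \<iota>" using orbit_poly_coeff[of a i] b(1) by (auto simp: \<iota>[symmetric])
qed

lemma orbit_list_carrier: "orbit_list a \<in> carrier ((range \<iota>)[X]\<^bsub>L\<^esub>)"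
 using orbit_list_hd orbit_list_set by (simp add: univ_poly_def polynomial_def)

text \<open>The minimal polynomial of x divides the orbit polynomial, which splits into distinct
  linear factors; splitting and simplicity of roots pass to divisors.\<close>

theorem galois: "galois_extension L (range \<iota>)"
proof -
 have main: "(L.algebraic over (range \<iota>)) x \<and> L.splitted (L.Irr (range \<iota>) x) \<and>
  (\<forall>b. count (L.roots (L.Irr (range \<iota>) x)) b \<le> 1)" if x: "x \<in> carrier L" for x
 proof -
  obtain a where a: "x = E a" using E_surj[OF x] by blast
  define l where "l = orbit_list a"
  note lK = orbit_list_carrier[of a, folded l_def]
  have lL: "l \<in> carrier (poly_ring L)"
   by (rule L.carrier_polynomial_shell[OF subfieldE(1)[OF subfield_K] lK])
  have ln: "l \<noteq> []" using orbit_list_hd by (simp add: l_def)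
  have lx: "L.eval l x = \<zero>\<^bsub>L\<^esub>"
   using orbit_poly_root[of a a] orbit_self[of a] by (simp add: l_def a orbit_list_eval E_simps)
  have alg: "(L.algebraic over (range \<iota>)) x" by (rule L.algebraicI[OF lK ln lx])
  note I = L.IrrE[OF subfield_K x alg]
  have IL: "L.Irr (range \<iota>) x \<in> carrier (poly_ring L)"
   by (rule L.carrier_polynomial_shell[OF subfieldE(1)[OF subfield_K] I(1)])
  have div: "L.Irr (range \<iota>) x pdivides\<^bsub>L\<^esub> l" by (rule L.Irr_minimal[OF subfield_K x alg lK lx])
  define Ob where "Ob = E ` orbit a"
  have Ob: "finite Ob" "card Ob = length l - 1"
   using orbit_finite[of a] orbit_list_length[of a] by (simp_all add: Ob_def l_def card_image inj_on_def E_eq_iff)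
  have sub: "mset_set Ob \<subseteq># L.roots l"
  proof (rule mset_subset_eqI)
   fix b
   show "count (mset_set Ob) b \<le> count (L.roots l) b"
   proof (cases "b \<in> Ob")
    case True
    then obtain c where c: "b = E c" "c \<in> orbit a" by (auto simp: Ob_def)
    hence "L.is_root l b"
     using orbit_poly_root[of a c] ln by (simp add: L.is_root_def E_carrier l_def orbit_list_eval E_simps)
    hence "b \<in># L.roots l" using L.roots_mem_iff_is_root[OF lL] by simp
    thus ?thesis using True Ob(1) by (simp add: Suc_le_eq)
   qed (simp add: count_mset_set')
  qed
  have "size (L.roots l) \<le> size (mset_set Ob)" using L.size_roots_le_degree[OF lL] Ob by simp
  hence roots: "L.roots l = mset_set Ob"
   using sub by (metis mset_subset_size not_less subset_mset.less_le)
  hence "L.splitted l" using Ob by (simp add: L.splitted_def)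
  hence "L.splitted (L.Irr (range \<iota>) x)" using L.pdivides_imp_splitted[OF IL lL ln _ div] by blast
  moreover have "count (L.roots (L.Irr (range \<iota>) x)) b \<le> 1" for b
  proof -
   have "count (L.roots (L.Irr (range \<iota>) x)) b \<le> count (mset_set Ob) b"
    using L.pdivides_imp_roots_incl[OF IL lL ln div] unfolding roots by (rule mset_subset_eq_count)
   also have "\<dots> \<le> 1" by (simp add: count_mset_set')
   finally show ?thesis .
  qed
  ultimately show ?thesis using alg by blast
 qed
 thus ?thesis unfolding galois_extension_def using L subfield_K by blast
qed

abbreviation Gal where "Gal \<equiv> galois_group L (range \<iota>)"

definition gact where "gact i l = restrict (\<lambda>x. E (act i l (inv_into UNIV E x))) (carrier L)"

lemma gact: "gact i l (E a) = E (act i l a)"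
 using E_bij by (simp add: gact_def E_carrier bij_betw_def)

lemma gact_galois: "gact i l \<in> carrier (Gal)"
proof (rule galois_groupI)
 note h = good_fhom[OF act_good[of i l]]
 have 1: "gact i l (E a \<oplus>\<^bsub>L\<^esub> E b) = gact i l (E a) \<oplus>\<^bsub>L\<^esub> gact i l (E b)"
  "gact i l (E a \<otimes>\<^bsub>L\<^esub> E b) = gact i l (E a) \<otimes>\<^bsub>L\<^esub> gact i l (E b)" for a b
  using fhom_add[OF h, of a b] fhom_mult[OF h, of a b] by (simp_all add: gact E_simps(1,2)[symmetric])
 have 2: "gact i l \<one>\<^bsub>L\<^esub> = \<one>\<^bsub>L\<^esub>"
  using gact[of i l 1] fhom_1[OF h] by (simp add: E_simps)
 show "gact i l \<in> ring_hom L L"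
 proof (rule ring_hom_memI)
  fix x y assume "x \<in> carrier L" "y \<in> carrier L"
  then obtain a b where "x = E a" "y = E b" using E_surj by blast
  thus "gact i l x \<in> carrier L" "gact i l (x \<otimes>\<^bsub>L\<^esub> y) = gact i l x \<otimes>\<^bsub>L\<^esub> gact i l y"
   "gact i l (x \<oplus>\<^bsub>L\<^esub> y) = gact i l x \<oplus>\<^bsub>L\<^esub> gact i l y" using 1 by (simp_all add: gact E_carrier)
 qed (fact 2)
 show "gact i l \<in> extensional (carrier L)" unfolding gact_def by (rule restrict_extensional)
 show "bij_betw (gact i l) (carrier L) (carrier L)"
 proof (rule bij_betwI')
  fix x y assume "x \<in> carrier L" "y \<in> carrier L"
  then obtain a b where "x = E a" "y = E b" using E_surj by blast
  thus "(gact i l x = gact i l y) = (x = y)" by (simp add: gact E_eq_iff fhom_eq_iff[OF h])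
 next
  fix x assume "x \<in> carrier L"
  then obtain a where "x = E a" using E_surj by blast
  thus "gact i l x \<in> carrier L" by (simp add: gact E_carrier)
 next
  fix y assume "y \<in> carrier L"
  then obtain a where a: "y = E a" using E_surj by blast
  hence "y = gact i l (E (inv_act i l a))" by (simp add: gact inv_act)
  thus "\<exists>x\<in>carrier L. y = gact i l x" using E_carrier by blast
 qed
 fix x assume "x \<in> range \<iota>"
 thus "gact i l x = x" by (auto simp: \<iota> gact act_K)
qed

text \<open>An automorphism over the base permutes the roots of the orbit polynomial of X, so it
  sends X where some group element does, and X determines it.\<close>

lemma galois_group_eq:
 "carrier (Gal) = (\<lambda>(i, l). gact i l) ` ({..<p ^ r} \<times> {..<m})"
proof
 show "(\<lambda>(i, l). gact i l) ` ({..<p ^ r} \<times> {..<m}) \<subseteq> carrier (Gal)"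
  using gact_galois by auto
 show "carrier (Gal) \<subseteq> (\<lambda>(i, l). gact i l) ` ({..<p ^ r} \<times> {..<m})"
 proof
  fix s assume s: "s \<in> carrier (Gal)"
  note sD = galois_groupD[OF s]
  define t where "t a = inv_into UNIV E (s (E a))" for a
  have et: "E (t a) = s (E a)" for a
   unfolding t_def by (rule f_inv_into_f) (use E_bij sD(2) E_carrier[of a] in \<open>auto simp: bij_betw_def\<close>)
  have ht: "fhom t" unfolding fhom_def
   by (intro conjI allI; subst E_eq_iff[symmetric])
    (simp_all add: et E_simps ring_hom_one[OF sD(1)] ring_hom_add[OF sD(1)] ring_hom_mult[OF sD(1)] E_carrier)
  have tk: "t (K a) = K a" for a by (subst E_eq_iff[symmetric]) (simp add: et sD(4) flip: \<iota>)
  have "surj t"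
   unfolding surj_def
  proof
   fix b
   obtain x where x: "x \<in> carrier L" "s x = E b"
    using sD(2) E_carrier[of b] unfolding bij_betw_def by (metis imageE)
   then obtain a where "x = E a" using E_surj by blast
   hence "b = t a" using x(2) by (simp add: et flip: E_eq_iff)
   thus "\<exists>a. b = t a" by blast
  qed
  hence "bij t" using fhom_inj[OF ht] by (simp add: bij_def)
  moreover have "t (fls_const a) = fls_const a" for a using tk[of "fls_const a"] by (simp add: good_const[OF K])
  ultimately have gt: "good t 1" by (intro good_automorphism[OF prime char ht])
  have "map_poly t (orbit_poly fls_X) = orbit_poly fls_X"
  proof (rule poly_eqI)
   fix n
   obtain b where "Polynomial.coeff (orbit_poly fls_X) n = K b" using orbit_poly_coeff by blast
   thus "Polynomial.coeff (map_poly t (orbit_poly fls_X)) n = Polynomial.coeff (orbit_poly fls_X) n"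
    by (simp add: coeff_map_poly fhom_0[OF ht] tk)
  qed
  hence "poly (orbit_poly fls_X) (t fls_X) = t (poly (orbit_poly fls_X) fls_X)"
   by (simp add: fhom_poly[OF ht])
  also have "poly (orbit_poly fls_X) fls_X = 0" using orbit_poly_root orbit_self by blast
  finally have "t fls_X \<in> orbit fls_X" using orbit_poly_root by (simp add: fhom_0[OF ht])
  then obtain i l where il: "i < p ^ r" "l < m" "t fls_X = act i l fls_X" by (auto simp: orbit_def)
  have "s = gact i l"
  proof (rule extensionalityI[OF sD(3)])
   show "gact i l \<in> extensional (carrier L)" using galois_groupD(3)[OF gact_galois] .
   fix x assume "x \<in> carrier L"
   then obtain a where "x = E a" using E_surj by blast
   thus "s x = gact i l x" using act_determined[OF gt il(3), of a] by (simp add: gact flip: et)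
  qed
  thus "s \<in> (\<lambda>(i, l). gact i l) ` ({..<p ^ r} \<times> {..<m})" using il by auto
 qed
qed

lemma gact_inj: "inj_on (\<lambda>(i, l). gact i l) ({..<p ^ r} \<times> {..<m})"
proof (rule inj_onI, clarsimp)
 fix i l i' l' assume il: "i < p ^ r" "l < m" "i' < p ^ r" "l' < m" "gact i l = gact i' l'"
 hence "E (act i l fls_X) = E (act i' l' fls_X)" by (metis gact)
 thus "i = i' \<and> l = l'" using act_eq_iff il by (simp add: E_eq_iff)
qed

end

subsection \<open>The ramification filtration\<close>

lemma evalp_vge:
 fixes a :: "'k::field fls"
 assumes "\<And>c. c \<in> set g \<Longrightarrow> vge c 0" "val a \<le> 0" "a \<noteq> 0"
 shows "vge (evalp g a) ((real (length g) - 1) * val a)"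
 using assms(1)
proof (induction g)
 case (Cons c g)
 let ?v = "real_of_int (val a)"
 have "vge (a ^ length g) (real (length g) * ?v)" by (rule vge_power) (simp add: vge_iff)
 hence "vge (c * a ^ length g) (0 + real (length g) * ?v)" by (intro vge_mult) (simp add: Cons.prems)
 moreover have "vge (evalp g a) (real (length g) * ?v)"
 proof (rule vge_mono)
  show "vge (evalp g a) ((real (length g) - 1) * ?v)" using Cons by simp
  show "real (length g) * ?v \<le> (real (length g) - 1) * ?v"
   using assms(2) by (intro mult_right_mono_neg) auto
 qed
 ultimately show ?case by (simp add: vge_add)
qed simp

lemma integral_vge:
 fixes a :: "'k::field fls"
 assumes g: "\<And>c. c \<in> set g \<Longrightarrow> vge c 0" "g \<noteq> []" "hd g = 1" and root: "evalp g a = 0"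
 shows "vge a 0"
proof (rule ccontr)
 assume "\<not> vge a 0"
 hence a: "a \<noteq> 0" "val a < 0" by (auto simp: vge_iff)
 obtain g' where g': "g = 1 # g'" using g(2,3) by (cases g) auto
 let ?v = "real_of_int (val a)" and ?n = "real (length g')"
 have n: "a ^ length g' + evalp g' a = 0" using root by (simp add: g')
 have "a ^ length g' + evalp g' a \<noteq> 0 \<and> val (a ^ length g' + evalp g' a) = val (a ^ length g')"
 proof (rule subdegree_add_vge)
  show "a ^ length g' \<noteq> 0" using a by simp
  show "vge (evalp g' a) ((?n - 1) * ?v)" by (rule evalp_vge) (use g(1) a in \<open>auto simp: g'\<close>)
  have "?n * ?v < (?n - 1) * ?v" using a(2) by (intro mult_strict_right_mono_neg) auto
  thus "real_of_int (val (a ^ length g')) < (?n - 1) * ?v" by (simp add: fls_subdegree_pow)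
 qed
 thus False using n by simp
qed

lemma coeff_prod_vge:
 fixes P :: "'i \<Rightarrow> 'k::field fls poly"
 assumes "\<And>i n. i \<in> I \<Longrightarrow> vge (Polynomial.coeff (P i) n) 0"
 shows "vge (Polynomial.coeff (\<Prod>i\<in>I. P i) n) 0"
 using assms
proof (induction I arbitrary: n rule: infinite_finite_induct)
 case (insert i I)
 have "vge (\<Sum>k\<le>n. Polynomial.coeff (P i) k * Polynomial.coeff (\<Prod>i\<in>I. P i) (n - k)) 0"
 proof (rule vge_sum)
  fix k
  have "vge (Polynomial.coeff (P i) k * Polynomial.coeff (\<Prod>i\<in>I. P i) (n - k)) (0 + 0)"
   by (intro vge_mult insert.IH insert.prems) auto
  thus "vge (Polynomial.coeff (P i) k * Polynomial.coeff (\<Prod>i\<in>I. P i) (n - k)) 0" by simp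
 qed
 thus ?case using insert.hyps by (simp add: coeff_mult)
qed (simp_all add: vge_1)

lemma initial_segment_card:
 fixes J :: "nat \<Rightarrow> int"
 assumes "\<And>a b. a < b \<Longrightarrow> J a < J b" "s < r"
 shows "i \<le> J s \<longleftrightarrow> card {b. b < r \<and> J b < i} \<le> s"
proof
 assume a: "i \<le> J s"
 have "{b. b < r \<and> J b < i} \<subseteq> {..<s}"
 proof
  fix b assume b: "b \<in> {b. b < r \<and> J b < i}"
  show "b \<in> {..<s}"
  proof (rule ccontr)
   assume "b \<notin> {..<s}"
   hence "J s \<le> J b" using assms(1)[of s b] by (cases "s = b") auto
   thus False using a b by simp
  qed
 qed
 thus "card {b. b < r \<and> J b < i} \<le> s" using card_mono[of "{..<s}"] by simp
next
 assume a: "card {b. b < r \<and> J b < i} \<le> s"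
 show "i \<le> J s"
 proof (rule ccontr)
  assume "\<not> i \<le> J s"
  moreover have "J b \<le> J s" if "b \<le> s" for b using assms(1)[of b s] that by (cases "b = s") auto
  ultimately have "{..s} \<subseteq> {b. b < r \<and> J b < i}"
   using assms(2) by fastforce
  hence "Suc s \<le> card {b. b < r \<and> J b < i}" using card_mono[of "{b. b < r \<and> J b < i}" "{..s}"] by simp
  thus False using a by simp
 qed
qed

lemma multiples_below: "D > 0 \<Longrightarrow> {i. i < D * N \<and> D dvd i} = (\<lambda>k. D * k) ` {..<N::nat}"
 by (auto simp: dvd_def)

context galois_record
begin

abbreviation VR where "VR \<equiv> valuation_ring L \<iota>"

text \<open>A monic equation with integral coefficients excludes a pole, as the top power would
  dominate. Conversely the orbit polynomial of a series without pole has integral coefficients in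
  the base.\<close>

lemma valuation_ring_carrier: "carrier (VR) = E ` {a. vge a 0}"
proof
 show "carrier (VR) \<subseteq> E ` {a. vge a 0}"
 proof
  fix x assume "x \<in> carrier (VR)"
  then obtain g where x: "x \<in> carrier L" and g: "g \<in> carrier ((\<iota> ` range fps_to_fls)[X]\<^bsub>L\<^esub>)" "g \<noteq> []"
   "hd g = \<one>\<^bsub>L\<^esub>" "L.eval g x = \<zero>\<^bsub>L\<^esub>" by (auto simp: valuation_ring_def integral_closure_def)
  obtain a where a: "x = E a" using E_surj[OF x] by blast
  have gs: "set g \<subseteq> \<iota> ` range fps_to_fls" using g(1,2) by (simp add: univ_poly_def polynomial_def)
  define h where "h = map (inv_into UNIV E) g"
  have inv: "E (inv_into UNIV E b) = b" if "b \<in> set g" for b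
  proof (rule f_inv_into_f)
   show "b \<in> range E" using gs that by (auto simp: \<iota>)
  qed
  have gh: "g = map E h" by (simp add: h_def inv map_idI)
  have "vge a 0"
  proof (rule integral_vge)
   show "h \<noteq> []" using g(2) by (simp add: h_def)
   hence "E (hd h) = E 1" using g(3) by (simp add: gh list.map_sel(1) E_simps)
   thus "hd h = 1" by (simp only: E_eq_iff)
   have "E (evalp h a) = E 0" using g(4) by (simp add: gh a E_eval E_simps)
   thus "evalp h a = 0" by (simp only: E_eq_iff)
   fix b assume "b \<in> set h"
   hence "E b \<in> \<iota> ` range fps_to_fls" using gs by (auto simp: gh)
   then obtain c where "b = K (fps_to_fls c)" by (auto simp: \<iota> E_eq_iff)
   thus "vge b 0" using good_vge[OF K vge_fps_to_fls[of c]] by simp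
  qed
  thus "x \<in> E ` {a. vge a 0}" using a by blast
 qed
 show "E ` {a. vge a 0} \<subseteq> carrier (VR)"
 proof (rule image_subsetI, clarify)
  fix a assume a: "vge (a :: 'k fls) 0"
  have co: "vge (Polynomial.coeff (orbit_poly a) n) 0" for n
   unfolding orbit_poly_def
  proof (rule coeff_prod_vge)
   fix b n assume "b \<in> orbit a"
   then obtain i l where "b = act i l a" by (auto simp: orbit_def)
   hence "vge b 0" using good_vge_1[OF act_good a] by simp
   thus "vge (Polynomial.coeff [:- b, 1:] n) 0"
    by (cases n) (auto simp: coeff_pCons vge_uminus vge_1 split: nat.split)
  qed
  have "set (orbit_list a) \<subseteq> \<iota> ` range fps_to_fls"
  proof
   fix x assume "x \<in> set (orbit_list a)"
   then obtain b where b: "x = E b" "b \<in> set (coeffs (orbit_poly a))" by (auto simp: orbit_list_def)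
   then obtain i where i: "b = Polynomial.coeff (orbit_poly a) i" by (auto simp: coeffs_def split: if_splits)
   then obtain c where c: "b = K c" using orbit_poly_coeff by blast
   have "vge (K c) 0" using co[of i] by (simp add: i[symmetric] c)
   hence "vge c 0"
    using good_subdegree[OF K, of c] fhom_eq_0[OF good_fhom[OF K], of c] good_pos[OF K]
    by (auto simp: vge_iff zero_le_mult_iff)
   hence "c \<in> range fps_to_fls" by (simp only: vge_0_iff_range)
   thus "x \<in> \<iota> ` range fps_to_fls" using b(1) by (auto simp: c \<iota>)
  qed
  hence "orbit_list a \<in> carrier ((\<iota> ` range fps_to_fls)[X]\<^bsub>L\<^esub>)"
   using orbit_list_hd by (simp add: univ_poly_def polynomial_def)
  moreover have "L.eval (orbit_list a) (E a) = \<zero>\<^bsub>L\<^esub>"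
   using orbit_poly_root[of a a] orbit_self[of a] by (simp add: orbit_list_eval E_simps)
  ultimately show "E a \<in> carrier (VR)"
   using orbit_list_hd E_carrier by (auto simp: valuation_ring_def integral_closure_def)
 qed
qed

lemma valuation_ring_simps:
 "x \<otimes>\<^bsub>VR\<^esub> y = x \<otimes>\<^bsub>L\<^esub> y" "x \<oplus>\<^bsub>VR\<^esub> y = x \<oplus>\<^bsub>L\<^esub> y" "\<one>\<^bsub>VR\<^esub> = \<one>\<^bsub>L\<^esub>"
 by (simp_all add: valuation_ring_def)

lemma valuation_ideal_eq: "valuation_ideal L \<iota> = E ` {a. vge a 1}"
proof -
 have unit: "E a \<in> Units (VR) \<longleftrightarrow> \<not> vge a 1" if a: "vge a 0" for a
 proof
  assume "E a \<in> Units (VR)"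
  then obtain b where b: "vge b 0" "E a \<otimes>\<^bsub>L\<^esub> E b = \<one>\<^bsub>L\<^esub>"
   by (auto simp: Units_def valuation_ring_simps valuation_ring_carrier)
  hence "E (a * b) = E 1" by (simp add: E_simps)
  hence ab: "a * b = 1" by (simp only: E_eq_iff)
  show "\<not> vge a 1"
  proof
   assume "vge a 1"
   hence "vge (a * b) (1 + 0)" using b(1) by (rule vge_mult)
   thus False by (simp add: ab vge_iff)
  qed
 next
  assume n: "\<not> vge a 1"
  hence a0: "a \<noteq> 0" "val a = 0" using a by (auto simp: vge_iff)
  have "a * inverse a = 1" using a0 by simp
  hence "val (inverse a) = 0" using a0 fls_subdegree_mult[of a "inverse a"] by simp
  hence "vge (inverse a) 0" by (simp add: vge_iff)
  moreover have "E a \<otimes>\<^bsub>L\<^esub> E (inverse a) = \<one>\<^bsub>L\<^esub>" "E (inverse a) \<otimes>\<^bsub>L\<^esub> E a = \<one>\<^bsub>L\<^esub>"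
   using a0 by (simp_all flip: E_simps)
  ultimately show "E a \<in> Units (VR)"
   using a by (auto simp: Units_def valuation_ring_simps valuation_ring_carrier)
 qed
 have "vge a 0" if "vge a 1" for a :: "'k fls" using vge_mono[OF that] by simp
 thus ?thesis unfolding valuation_ideal_def valuation_ring_carrier using unit by (auto simp: E_eq_iff)
qed

lemma valuation_ideal_power:
 "valuation_ideal L \<iota> [^]\<^bsub>ideals_set (VR)\<^esub> (n::nat) = E ` {a. vge a (real n)}"
proof (induction n)
 case 0
 thus ?case by (simp add: nat_pow_def ideals_set_def valuation_ring_carrier)
next
 case (Suc n)
 have "valuation_ideal L \<iota> [^]\<^bsub>ideals_set (VR)\<^esub> Suc n =
  ideal_prod (VR) (E ` {a. vge a (real n)}) (E ` {a. vge a 1})" (is "_ = ?P")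
  using Suc by (simp add: nat_pow_def ideals_set_def valuation_ideal_eq)
 also have "?P = E ` {a. vge a (real (Suc n))}"
 proof
  show "?P \<subseteq> E ` {a. vge a (real (Suc n))}"
  proof
   fix x assume "x \<in> ?P"
   thus "x \<in> E ` {a. vge a (real (Suc n))}"
   proof (induction rule: ideal_prod.induct)
    case (prod i j)
    then obtain a b where ab: "i = E a" "j = E b" "vge a (real n)" "vge b 1" by blast
    hence "vge (a * b) (real (Suc n))" using vge_mult[OF ab(3,4)] by (simp add: add.commute)
    moreover have "i \<otimes>\<^bsub>VR\<^esub> j = E (a * b)" by (simp add: valuation_ring_simps ab E_simps)
    ultimately show ?case by blast
   next
    case (sum s1 s2)
    then obtain a b where ab: "s1 = E a" "s2 = E b" "vge a (real (Suc n))" "vge b (real (Suc n))" by blast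
    hence "vge (a + b) (real (Suc n))" by (intro vge_add)
    moreover have "s1 \<oplus>\<^bsub>VR\<^esub> s2 = E (a + b)" by (simp add: valuation_ring_simps ab E_simps)
    ultimately show ?case by blast
   qed
  qed
  show "E ` {a. vge a (real (Suc n))} \<subseteq> ?P"
  proof (rule image_subsetI, clarify)
   fix a assume a: "vge (a :: 'k fls) (real (Suc n))"
   define y where "y = inverse (fls_X :: 'k fls)"
   have yX: "y * fls_X = 1" unfolding y_def by (rule left_inverse) simp
   hence "y \<noteq> 0" by auto
   hence "val y = - 1" using fls_subdegree_mult[of y fls_X] yX by simp
   hence v: "vge y (- 1)" "vge (fls_X :: 'k fls) 1" by (simp_all add: vge_iff)
   have "vge (a * y) (real n)" using vge_mult[OF a v(1)] by simp
   hence "E (a * y) \<otimes>\<^bsub>VR\<^esub> E fls_X \<in> ?P"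
    using v(2) by (intro ideal_prod.prod) auto
   moreover have "E (a * y) \<otimes>\<^bsub>VR\<^esub> E fls_X = E a"
    by (simp only: valuation_ring_simps(1) E_simps(2)[symmetric] mult.assoc yX mult_1_right)
   ultimately show "E a \<in> ?P" by simp
  qed
 qed
 finally show ?case .
qed

text \<open>The uniformizer decides: what \<sigma> does to X modulo a power of X bounds its effect
  on every integral series.\<close>

lemma lower_group_eq:
 assumes "i \<ge> 0"
 shows "lower_ramification_group L \<iota> i =
  (\<lambda>(i, l). gact i l) ` {il \<in> {..<p ^ r} \<times> {..<m}. vge (act (fst il) (snd il) fls_X - fls_X) (of_int (i + 1))}"
proof -
 have n: "real (nat (i + 1)) = real_of_int (i + 1)" using assms by simp
 have iff: "(\<forall>b\<in>carrier (VR). gact s l b \<ominus>\<^bsub>L\<^esub> b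
   \<in> valuation_ideal L \<iota> [^]\<^bsub>ideals_set (VR)\<^esub> nat (i + 1)) \<longleftrightarrow>
  vge (act s l fls_X - fls_X) (of_int (i + 1))" for s l
 proof -
  have "gact s l (E a) \<ominus>\<^bsub>L\<^esub> E a \<in> E ` {a. vge a (real (nat (i + 1)))} \<longleftrightarrow> vge (act s l a - a) (real (nat (i + 1)))" for a
   by (auto simp: gact E_minus[symmetric] E_eq_iff)
  hence "(\<forall>b\<in>carrier (VR). gact s l b \<ominus>\<^bsub>L\<^esub> b
    \<in> valuation_ideal L \<iota> [^]\<^bsub>ideals_set (VR)\<^esub> nat (i + 1)) \<longleftrightarrow>
   (\<forall>a. vge a 0 \<longrightarrow> vge (act s l a - a) (real (nat (i + 1))))"
   unfolding valuation_ring_carrier valuation_ideal_power by blast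
  also have "\<dots> \<longleftrightarrow> vge (act s l fls_X - fls_X) (real (nat (i + 1)))"
   using ram_vge_unit[OF act_good] by (auto simp: vge_iff[of fls_X])
  finally show ?thesis unfolding n .
 qed
 show ?thesis
  unfolding lower_ramification_group_def galois_group_eq using iff by (auto simp: image_iff split: prod.splits) blast+
qed

lemma p1: "p > 1" using prime prime_gt_1_nat by blast

definition breaks_below where "breaks_below i = card {b. b < r \<and> jump p f b < i}"

definition wild_group where "wild_group b = (\<lambda>i. gact i 0) ` {i. i < p ^ r \<and> p ^ b dvd i}"

lemma lower_group_0: "card (lower_ramification_group L \<iota> 0) = p ^ r * m"
proof -
 have "vge (act i l fls_X - fls_X) 1" for i l
  by (intro vge_diff good_vge_1[OF act_good]) (simp_all add: vge_iff)
 hence "lower_ramification_group L \<iota> 0 = (\<lambda>(i, l). gact i l) ` ({..<p ^ r} \<times> {..<m})"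
  by (subst lower_group_eq) auto
 thus ?thesis using gact_inj by (simp add: card_image)
qed

text \<open>Tame elements drop out at index 1. The number of g^s depends only on the multiplicity of
  p in s and increases with it, so the groups are those generated by the powers g^(p^b), with b the
  number of jumps below i.\<close>

lemma lower_group_wild:
 assumes i: "i \<ge> 1"
 shows "lower_ramification_group L \<iota> i = wild_group (breaks_below i)"
proof -
 have iff: "vge (act s l fls_X - fls_X) (of_int (i + 1)) \<longleftrightarrow> l = 0 \<and> p ^ breaks_below i dvd s"
  if sl: "s < p ^ r" "l < m" for s l
 proof (cases "l = 0")
  case False
  hence "\<not> m dvd l" using sl(2) by (auto dest: dvd_imp_le)
  hence "ram (\<lambda>a. act s l a) 0" by (rule ram_tame)
  thus ?thesis using False i by (auto simp: ram_def vge_iff)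
 next
  case True
  show ?thesis
  proof (cases "s = 0")
   case False
   hence nd: "\<not> p ^ r dvd s" using sl(1) by (auto dest: dvd_imp_le)
   have "ram (\<lambda>a. act s l a) (jump p f (multiplicity p s))" using True nd by (intro ram_wild) auto
   hence "vge (act s l fls_X - fls_X) (of_int (i + 1)) \<longleftrightarrow> i \<le> jump p f (multiplicity p s)"
    by (auto simp: ram_def vge_iff)
   also have "\<dots> \<longleftrightarrow> breaks_below i \<le> multiplicity p s"
    unfolding breaks_below_def by (rule initial_segment_card[OF jump_less[of p f, OF p1 f1] wild_multiplicity_less[OF nd]])
   also have "\<dots> \<longleftrightarrow> p ^ breaks_below i dvd s"
    using False prime by (intro power_dvd_iff_le_multiplicity[symmetric]) (auto simp: prime_nat_iff)
   finally show ?thesis using True by simp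
  qed (use True in simp)
 qed
 have "{il \<in> {..<p ^ r} \<times> {..<m}. vge (act (fst il) (snd il) fls_X - fls_X) (of_int (i + 1))} =
  {il \<in> {..<p ^ r} \<times> {..<m}. snd il = 0 \<and> p ^ breaks_below i dvd fst il}"
 proof (rule Collect_cong)
  fix il
  show "(il \<in> {..<p ^ r} \<times> {..<m} \<and> vge (act (fst il) (snd il) fls_X - fls_X) (of_int (i + 1))) =
   (il \<in> {..<p ^ r} \<times> {..<m} \<and> snd il = 0 \<and> p ^ breaks_below i dvd fst il)"
   using iff[of "fst il" "snd il"] by (metis SigmaE fst_conv lessThan_iff snd_conv)
 qed
 also have "\<dots> = {s. s < p ^ r \<and> p ^ breaks_below i dvd s} \<times> {0}" using m0 by auto
 finally have eq: "{il \<in> {..<p ^ r} \<times> {..<m}. vge (act (fst il) (snd il) fls_X - fls_X) (of_int (i + 1))} =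
  {s. s < p ^ r \<and> p ^ breaks_below i dvd s} \<times> {0}" .
 have "0 \<le> i" using i by simp
 show ?thesis unfolding lower_group_eq[OF \<open>0 \<le> i\<close>] eq by (auto simp: wild_group_def image_iff)
qed

lemma wild_group_card:
 assumes "b \<le> r" shows "card (wild_group b) = p ^ (r - b)"
proof -
 have pr: "p ^ r = p ^ b * p ^ (r - b)" using assms by (simp flip: power_add)
 have pb: "p ^ b > 0" using p0 by simp
 have "{i. i < p ^ r \<and> p ^ b dvd i} = (\<lambda>k. p ^ b * k) ` {..<p ^ (r - b)}"
  unfolding pr by (rule multiples_below[OF pb])
 moreover have "inj_on (\<lambda>k. p ^ b * k) {..<p ^ (r - b)}" using pb by (auto simp: inj_on_def)
 moreover have "inj_on (\<lambda>i. gact i 0) {i. i < p ^ r \<and> p ^ b dvd i}"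
 proof (rule inj_onI)
  fix i i' assume "i \<in> {i. i < p ^ r \<and> p ^ b dvd i}" "i' \<in> {i. i < p ^ r \<and> p ^ b dvd i}" "gact i 0 = gact i' 0"
  thus "i = i'" using inj_onD[OF gact_inj, of "(i, 0)" "(i', 0)"] m0 by auto
 qed
 ultimately show ?thesis by (simp add: wild_group_def card_image)
qed

end

subsection \<open>The Herbrand function\<close>

lemma sum_telescope_tail:
 fixes h :: "nat \<Rightarrow> real"
 assumes "B \<le> r"
 shows "(\<Sum>b<r. if B \<le> b then h b - h (Suc b) else 0) = h B - h r"
proof -
 have "(\<Sum>b<r. if B \<le> b then h b - h (Suc b) else 0) = (\<Sum>b\<in>{B..<r}. h b - h (Suc b))"
  by (rule sum.mono_neutral_cong_right) auto
 also have "\<dots> = h B - h r"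
  using sum_Suc_diff'[OF assms, of "\<lambda>b. - h b"] by (simp add: sum_subtractf sum_negf)
 finally show ?thesis .
qed

lemma has_integral_step:
 fixes t J :: real
 assumes "0 \<le> t" "0 \<le> J"
 shows "((\<lambda>s. if s \<le> J then 1 else 0) has_integral (min t J)) {0..t}"
proof -
 have "((\<lambda>_. 1 :: real) has_integral (min t J - 0)) {0..min t J}"
  using has_integral_const_real[of "1::real" 0 "min t J"] assms by simp
 hence "((\<lambda>s. if s \<in> {0..min t J} then 1 else 0) has_integral (min t J)) {0..t}"
  using has_integral_restrict[of "{0..min t J}" "{0..t}" "\<lambda>_. 1 :: real" "min t J"] by simp
 thus ?thesis by (rule has_integral_eq[rotated]) auto
qed

text \<open>\<open>\<Gamma> b\<close> is the lower ramification group at indices with exactly b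
  jumps below them. The upper numbering depends on the lower one through these groups, their orders
  and the positions J.\<close>

locale herbrand =
 fixes L :: "('l, 'z) ring_scheme" and \<iota> :: "'k::field fls \<Rightarrow> 'l" and p m r :: nat and J :: "nat \<Rightarrow> int"
  and \<Gamma> :: "nat \<Rightarrow> ('l \<Rightarrow> 'l) set"
 assumes p1: "p > 1" and m0: "m > 0" and J0: "\<And>b. J b > 0" and J_mono: "\<And>a b. a < b \<Longrightarrow> J a < J b"
  and G0: "card (lower_ramification_group L \<iota> 0) = p ^ r * m"
  and G: "\<And>i. i \<ge> 1 \<Longrightarrow> lower_ramification_group L \<iota> i = \<Gamma> (card {b. b < r \<and> J b < i})"
  and \<Gamma>: "\<And>b. b \<le> r \<Longrightarrow> card (\<Gamma> b) = p ^ (r - b)"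
begin

abbreviation Jr :: "nat \<Rightarrow> real" where "Jr b \<equiv> real_of_int (J b)"

definition jumps_below :: "real \<Rightarrow> nat" where "jumps_below s = card {b. b < r \<and> Jr b < s}"

lemma jumps_below_le: "jumps_below s \<le> r"
proof -
 have "card {b. b < r \<and> Jr b < s} \<le> card {..<r}" by (rule card_mono) auto
 thus ?thesis by (simp add: jumps_below_def)
qed

lemma jumps_below_ceiling: "card {b. b < r \<and> J b < \<lceil>s\<rceil>} = jumps_below s"
 unfolding jumps_below_def less_ceiling_iff ..

lemma jumps_below_iff: "b < r \<Longrightarrow> s \<le> Jr b \<longleftrightarrow> jumps_below s \<le> b"
 using initial_segment_card[of J b r "\<lceil>s\<rceil>", OF J_mono] unfolding jumps_below_ceiling by (simp add: ceiling_le_iff)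

lemma lower_group: "s > 0 \<Longrightarrow> lower_ramification_group L \<iota> \<lceil>s\<rceil> = \<Gamma> (jumps_below s)"
 using G[of "\<lceil>s\<rceil>"] by (simp add: jumps_below_ceiling one_le_ceiling)

text \<open>m times the drop of the integrand at the b-th jump. Abel summation makes the integrand a
  combination of the indicators of s \<le> J b, hence its integral \<Phi> a combination of the
  functions \<open>min t (Jr b)\<close>.\<close>

definition wt :: "nat \<Rightarrow> real" where "wt b = 1 / real p ^ b - 1 / real p ^ Suc b"

lemma wt_pos: "wt b \<ge> 0"
proof -
 have "real p ^ b \<le> real p ^ Suc b" using p1 by (intro power_increasing) auto
 thus ?thesis using p1 by (simp add: wt_def frac_le)
qed

definition \<Phi> :: "real \<Rightarrow> real" where
 "\<Phi> t = 1 / real m * (t / real p ^ r + (\<Sum>b<r. wt b * min t (Jr b)))"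

lemma integrand:
 assumes "s > 0"
 shows "real (card (lower_ramification_group L \<iota> \<lceil>s\<rceil>)) / real (card (lower_ramification_group L \<iota> 0)) =
  1 / real m * (1 / real p ^ r + (\<Sum>b<r. wt b * (if s \<le> Jr b then 1 else 0)))"
proof -
 define B where "B = jumps_below s"
 have B: "B \<le> r" unfolding B_def by (rule jumps_below_le)
 have "(\<Sum>b<r. wt b * (if s \<le> Jr b then 1 else 0)) = (\<Sum>b<r. if B \<le> b then 1 / real p ^ b - 1 / real p ^ Suc b else 0)"
  by (intro sum.cong refl) (simp add: jumps_below_iff B_def wt_def)
 also have "\<dots> = 1 / real p ^ B - 1 / real p ^ r" by (rule sum_telescope_tail[OF B])
 finally have 1: "1 / real p ^ r + (\<Sum>b<r. wt b * (if s \<le> Jr b then 1 else 0)) = 1 / real p ^ B" by simp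
 have "real p ^ r = real p ^ B * real p ^ (r - B)" using B by (simp flip: power_add)
 thus ?thesis unfolding 1 lower_group[OF assms] G0 B_def[symmetric] \<Gamma>[OF B] using p1 by simp
qed

lemma phi_eq:
 assumes t: "t \<ge> 0"
 shows "herbrand_phi L \<iota> t = \<Phi> t"
proof -
 have "((\<lambda>s. 1 / real m * (1 / real p ^ r + (\<Sum>b<r. wt b * (if s \<le> Jr b then 1 else 0))))
  has_integral (1 / real m * (t / real p ^ r + (\<Sum>b<r. wt b * min t (Jr b))))) {0..t}"
 proof (intro has_integral_mult_right has_integral_add has_integral_sum)
  show "((\<lambda>s. 1 / real p ^ r) has_integral t / real p ^ r) {0..t}"
   using has_integral_const_real[of "1 / real p ^ r" 0 t] t by simp
  show "((\<lambda>s. if s \<le> Jr b then 1 else 0) has_integral min t (Jr b)) {0..t}" for b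
   using J0[of b] t by (intro has_integral_step) auto
 qed simp
 hence "((\<lambda>s. real (card (lower_ramification_group L \<iota> \<lceil>s\<rceil>)) / real (card (lower_ramification_group L \<iota> 0)))
  has_integral \<Phi> t) {0..t}"
  unfolding \<Phi>_def
  by (rule has_integral_spike_finite[of "{0}", rotated 2]) (use integrand in auto)
 from integral_unique[OF this] show ?thesis
  unfolding herbrand_phi_def if_not_P[OF leD[OF t]] .
qed

lemma \<Phi>_strict: assumes "t < t'" shows "\<Phi> t < \<Phi> t'"
proof -
 have "t / real p ^ r < t' / real p ^ r" using assms p1 by (intro divide_strict_right_mono) auto
 moreover have "(\<Sum>b<r. wt b * min t (Jr b)) \<le> (\<Sum>b<r. wt b * min t' (Jr b))"
  using assms wt_pos by (intro sum_mono mult_left_mono) auto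
 ultimately show ?thesis unfolding \<Phi>_def using m0 by (intro mult_strict_left_mono add_less_le_mono) auto
qed

lemma \<Phi>_0: "\<Phi> 0 = 0"
proof -
 have "min 0 (Jr b) = 0" for b using J0[of b] by (simp add: min_def)
 thus ?thesis by (simp add: \<Phi>_def)
qed

lemma \<Phi>_ge: assumes "t \<ge> 0" shows "\<Phi> t \<ge> t / (real m * real p ^ r)"
proof -
 have "min t (Jr b) \<ge> 0" for b using J0[of b] assms by simp
 hence "(\<Sum>b<r. wt b * min t (Jr b)) \<ge> 0" by (intro sum_nonneg mult_nonneg_nonneg wt_pos)
 hence "1 / real m * (t / real p ^ r + 0) \<le> \<Phi> t" unfolding \<Phi>_def by (intro mult_left_mono add_left_mono) auto
 thus ?thesis by simp
qed

lemma \<Phi>_surj: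
 assumes "v > 0" shows "\<exists>t>0. \<Phi> t = v"
proof -
 define T where "T = v * (real m * real p ^ r)"
 have T: "T \<ge> 0" using assms by (simp add: T_def)
 have "continuous_on {0..T} \<Phi>" unfolding \<Phi>_def[abs_def] by (intro continuous_intros) (use p1 in auto)
 moreover have "\<Phi> 0 \<le> v" using assms by (simp add: \<Phi>_0)
 moreover have "v \<le> \<Phi> T" using \<Phi>_ge[OF T] m0 p1 by (simp add: T_def)
 ultimately obtain t where t: "0 \<le> t" "\<Phi> t = v" using IVT'[of \<Phi> 0 v T] T by auto
 hence "t \<noteq> 0" using assms \<Phi>_0 by auto
 thus ?thesis using t by (intro exI[of _ t]) simp
qed

text \<open>The inverse is formed on all arguments from - 1 on, so injectivity must also cover the
  identity part on negative arguments, whose values stay negative.\<close>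

lemma psi:
 assumes "t > 0" shows "herbrand_psi L \<iota> (\<Phi> t) = t"
 unfolding herbrand_psi_def
proof (rule the_inv_into_f_eq)
 have neg: "herbrand_phi L \<iota> t = t" if "t < 0" for t using that by (simp add: herbrand_phi_def)
 have pos: "\<Phi> t \<ge> 0" if "t \<ge> 0" for t using \<Phi>_strict[of 0 t] that by (cases "t = 0") (auto simp: \<Phi>_0)
 show "inj_on (herbrand_phi L \<iota>) {-1..}"
 proof (rule inj_onI)
  fix x y assume "herbrand_phi L \<iota> x = herbrand_phi L \<iota> y"
  thus "x = y"
   using neg[of x] neg[of y] phi_eq[of x] phi_eq[of y] pos[of x] pos[of y] \<Phi>_strict[of x y] \<Phi>_strict[of y x]
   by (cases x y rule: linorder_cases; cases "x < 0"; cases "y < 0") auto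
 qed
 show "herbrand_phi L \<iota> t = \<Phi> t" using assms by (intro phi_eq) simp
 show "t \<in> {-1..}" using assms by simp
qed

lemma upper_group: "t > 0 \<Longrightarrow> upper_ramification_group L \<iota> (\<Phi> t) = \<Gamma> (jumps_below t)"
 by (simp add: upper_ramification_group_def psi lower_group)

lemma \<Gamma>_inj: assumes "b \<le> r" "b' \<le> r" "\<Gamma> b = \<Gamma> b'" shows "b = b'"
proof -
 have "p ^ (r - b) = p ^ (r - b')" using \<Gamma> assms by metis
 thus ?thesis using p1 assms(1,2) by simp
qed

lemma break_iff:
 assumes t: "t > 0"
 shows "(\<forall>\<epsilon>>0. upper_ramification_group L \<iota> (\<Phi> t + \<epsilon>) \<noteq> upper_ramification_group L \<iota> (\<Phi> t)) \<longleftrightarrow>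
  (\<exists>b<r. t = Jr b)"
proof
 assume "\<exists>b<r. t = Jr b"
 then obtain b where b: "b < r" "t = Jr b" by blast
 have "jumps_below t \<le> b" using jumps_below_iff[OF b(1), of t] b(2) by simp
 show "\<forall>\<epsilon>>0. upper_ramification_group L \<iota> (\<Phi> t + \<epsilon>) \<noteq> upper_ramification_group L \<iota> (\<Phi> t)"
 proof (intro allI impI notI)
  fix \<epsilon> :: real
  assume \<epsilon>: "\<epsilon> > 0" and eq: "upper_ramification_group L \<iota> (\<Phi> t + \<epsilon>) = upper_ramification_group L \<iota> (\<Phi> t)"
  have "\<Phi> t > 0" using \<Phi>_strict[OF t] by (simp add: \<Phi>_0)
  then obtain t' where t': "t' > 0" "\<Phi> t' = \<Phi> t + \<epsilon>" using \<Phi>_surj[of "\<Phi> t + \<epsilon>"] \<epsilon> by auto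
  have "\<Phi> t < \<Phi> t'" using t'(2) \<epsilon> by linarith
  hence "t' \<noteq> t" "\<not> t' < t" using \<Phi>_strict[of t' t] by (metis less_irrefl, metis less_asym)
  hence "t < t'" by linarith
  hence "\<not> t' \<le> Jr b" unfolding b(2) by linarith
  hence "jumps_below t' > b" using jumps_below_iff[OF b(1), of t'] by linarith
  moreover have "jumps_below t' = jumps_below t"
  proof (rule \<Gamma>_inj[OF jumps_below_le jumps_below_le])
   show "\<Gamma> (jumps_below t') = \<Gamma> (jumps_below t)"
    using eq by (simp only: upper_group[OF t] upper_group[OF t'(1)] t'(2)[symmetric])
  qed
  ultimately show False using \<open>jumps_below t \<le> b\<close> by simp
 qed
next
 assume a: "\<forall>\<epsilon>>0. upper_ramification_group L \<iota> (\<Phi> t + \<epsilon>) \<noteq> upper_ramification_group L \<iota> (\<Phi> t)"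
 show "\<exists>b<r. t = Jr b"
 proof (rule ccontr)
  assume n: "\<not> (\<exists>b<r. t = Jr b)"
  \<comment> \<open>The least element t' is the next jump after t, or t + 1 if none comes sooner;
    between t and t' the number of jumps below does not change.\<close>
  define T where "T = insert (t + 1) (real_of_int ` J ` {b. b < r \<and> Jr b > t})"
  have T: "finite T" "T \<noteq> {}" by (simp_all add: T_def)
  define t' where "t' = Min T"
  have "t < t'" using T by (auto simp: t'_def T_def)
  have "Jr b < t' \<longleftrightarrow> Jr b < t" if "b < r" for b
  proof
   assume b: "Jr b < t'"
   have "\<not> Jr b > t"
   proof
    assume "Jr b > t"
    hence "Jr b \<in> T" using that by (auto simp: T_def)
    hence "t' \<le> Jr b" using T by (simp add: t'_def)
    thus False using b by simp
   qed
   thus "Jr b < t" using n that by force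
  qed (use \<open>t < t'\<close> in simp)
  hence "jumps_below t' = jumps_below t" unfolding jumps_below_def by (intro arg_cong[of _ _ card] Collect_cong) auto
  hence "upper_ramification_group L \<iota> (\<Phi> t') = upper_ramification_group L \<iota> (\<Phi> t)"
   using t \<open>t < t'\<close> by (simp add: upper_group)
  moreover have "\<Phi> t' - \<Phi> t > 0" using \<Phi>_strict[OF \<open>t < t'\<close>] by simp
  ultimately show False using a[rule_format, of "\<Phi> t' - \<Phi> t"] by simp
 qed
qed

lemma upper_breaks_eq: "upper_breaks L \<iota> = (\<lambda>b. \<Phi> (Jr b)) ` {..<r}"
proof
 show "upper_breaks L \<iota> \<subseteq> (\<lambda>b. \<Phi> (Jr b)) ` {..<r}"
 proof
  fix v assume v: "v \<in> upper_breaks L \<iota>"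
  then obtain t where t: "t > 0" "\<Phi> t = v" using \<Phi>_surj by (auto simp: upper_breaks_def)
  thus "v \<in> (\<lambda>b. \<Phi> (Jr b)) ` {..<r}"
   using break_iff[OF t(1)] v by (auto simp: upper_breaks_def)
 qed
 show "(\<lambda>b. \<Phi> (Jr b)) ` {..<r} \<subseteq> upper_breaks L \<iota>"
 proof
  fix v assume "v \<in> (\<lambda>b. \<Phi> (Jr b)) ` {..<r}"
  then obtain b where b: "b < r" "v = \<Phi> (Jr b)" by auto
  have t: "Jr b > 0" using J0 by simp
  hence "v > 0" using \<Phi>_strict[OF t] by (simp add: \<Phi>_0 b)
  thus "v \<in> upper_breaks L \<iota>" using break_iff[OF t] b by (auto simp: upper_breaks_def)
 qed
qed

text \<open>At \<open>Jr b\<close> the minima are the earlier jumps for i < b and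
  \<open>Jr b\<close> itself from b on, where the weights telescope to 1/p^b.\<close>

lemma \<Phi>_jump:
 assumes "b < r"
 shows "real m * \<Phi> (Jr b) = (\<Sum>i<b. wt i * Jr i) + Jr b / real p ^ b"
proof -
 have "(\<Sum>i<r. wt i * min (Jr b) (Jr i)) =
  (\<Sum>i<r. (if i < b then wt i * Jr i else 0) + Jr b * (if b \<le> i then wt i else 0))"
 proof (intro sum.cong refl)
  fix i
  show "wt i * min (Jr b) (Jr i) =
   (if i < b then wt i * Jr i else 0) + Jr b * (if b \<le> i then wt i else 0)"
   using J_mono[of i b] J_mono[of b i] by (cases i b rule: linorder_cases) (auto simp: min_def)
 qed
 also have "\<dots> = (\<Sum>i<r. if i < b then wt i * Jr i else 0) + Jr b * (\<Sum>i<r. if b \<le> i then wt i else 0)"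
  by (simp add: sum.distrib sum_distrib_left)
 also have "(\<Sum>i<r. if b \<le> i then wt i else 0) = 1 / real p ^ b - 1 / real p ^ r"
  unfolding wt_def by (rule sum_telescope_tail) (use assms in simp)
 also have "(\<Sum>i<r. if i < b then wt i * Jr i else 0) = (\<Sum>i<b. wt i * Jr i)"
  by (rule sum.mono_neutral_cong_right) (use assms in auto)
 finally show ?thesis using m0 by (simp add: \<Phi>_def algebra_simps)
qed

end

theorem (in galois_record) upper_breaks: "upper_breaks L \<iota> = (\<lambda>b. real (rho p f b) / real m) ` {..<r}"
proof -
 interpret herbrand L \<iota> p m r "jump p f" wild_group
  by unfold_locales
   (use p1 m0 jump_gt_0[of p f, OF p1 f1] jump_less[of p f, OF p1 f1] lower_group_0 lower_group_wild wild_group_card in \<open>auto simp: breaks_below_def\<close>)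
 \<comment> \<open>The recursion for the lower jumps adds rho_(b+1) - rho_b after division by
   p^(b+1), and the weight accounts for the change of denominator.\<close>
 have "(\<Sum>i<b. wt i * real_of_int (jump p f i)) + real_of_int (jump p f b) / real p ^ b = real (rho p f b)" for b
 proof (induction b)
  case 0
  show ?case by (simp add: jump_def diff_exp_def)
 next
  case (Suc b)
  have "real_of_int (jump p f (Suc b)) = real_of_int (jump p f b) + real p ^ Suc b * (real (rho p f (Suc b)) - real (rho p f b))"
   unfolding jump_Suc[OF p0] by (simp del: rho.simps)
  moreover have nz: "real p ^ Suc b \<noteq> 0" using p1 by simp
  ultimately have "real_of_int (jump p f (Suc b)) / real p ^ Suc b = real_of_int (jump p f b) / real p ^ Suc b + (real (rho p f (Suc b)) - real (rho p f b))"
   by (simp only: add_divide_distrib nonzero_mult_div_cancel_left[OF nz])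
  thus ?case using Suc by (simp add: wt_def left_diff_distrib del: rho.simps power_Suc)
 qed
 hence "\<Phi> (real_of_int (jump p f b)) = real (rho p f b) / real m" if "b < r" for b
  using \<Phi>_jump[OF that] m0 by (simp add: field_simps)
 thus ?thesis unfolding upper_breaks_eq by (intro image_cong) auto
qed

subsection \<open>Semidirect products of cyclic groups\<close>

lemma (in group) cyclic_subgroup_generator:
 assumes iso: "G\<lparr>carrier := S\<rparr> \<cong> integer_mod_group a" and S: "subgroup S G" and a: "a > 0"
 shows "\<exists>g\<in>S. S = (\<lambda>i::nat. g [^] i) ` {..<a} \<and> (\<forall>i::nat. g [^] i = \<one> \<longleftrightarrow> a dvd i)"
proof -
 have S_sub: "S \<subseteq> carrier G" using S subgroup.subset by blast
 interpret Z: group "integer_mod_group a" by simp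
 interpret S: group "G\<lparr>carrier := S\<rparr>" using S subgroup_imp_group by blast
 obtain h where h: "h \<in> iso (integer_mod_group a) (G\<lparr>carrier := S\<rparr>)"
  using S.iso_sym[OF iso] by (auto simp: is_iso_def)
 have car: "carrier (integer_mod_group a) = {0..<int a}" using a by (simp add: carrier_integer_mod_group)
 have bij: "bij_betw h {0..<int a} S" using h car by (simp add: iso_def)
 have mult: "h ((x + y) mod int a) = h x \<otimes> h y" if "x \<in> {0..<int a}" "y \<in> {0..<int a}" for x y
  using h that car by (auto simp: iso_def hom_def)
 have hS: "h x \<in> S" if "x \<in> {0..<int a}" for x using bij that by (auto simp: bij_betw_def)
 have z: "0 \<in> {0..<int a}" using a by simp
 have h0: "h 0 = \<one>"
 proof -
  have "h 0 \<otimes> h 0 = h 0" using mult[OF z z] by simp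
  thus ?thesis using hS[OF z] S_sub by (metis l_cancel_one subsetD)
 qed
 define u where "u = 1 mod int a"
 have u: "u \<in> {0..<int a}" using a by (simp add: u_def)
 define g where "g = h u"
 have g: "g \<in> S" "g \<in> carrier G" using hS[OF u] S_sub by (auto simp: g_def)
 have pow: "g [^] i = h (int i mod int a)" for i :: nat
 proof (induction i)
  case 0
  thus ?case by (simp add: h0)
 next
  case (Suc i)
  have "g [^] Suc i = h (int i mod int a) \<otimes> h u" using Suc by (simp add: g_def)
  also have "\<dots> = h ((int i mod int a + u) mod int a)" using a u by (intro mult[symmetric]) auto
  also have "(int i mod int a + u) mod int a = int (Suc i) mod int a" by (simp add: u_def mod_add_eq add.commute)
  finally show ?case .
 qed
 have "S = h ` {0..<int a}" using bij by (simp add: bij_betw_def)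
 also have "\<dots> = (\<lambda>i::nat. g [^] i) ` {..<a}"
 proof -
  have "{0..<int a} = int ` {..<a}" by (auto simp: image_iff intro!: bexI[of _ "nat _"])
  thus ?thesis by (auto simp: pow image_iff)
 qed
 finally have "S = (\<lambda>i::nat. g [^] i) ` {..<a}" .
 moreover have "g [^] i = \<one> \<longleftrightarrow> a dvd i" for i :: nat
 proof -
  have "g [^] i = \<one> \<longleftrightarrow> h (int i mod int a) = h 0" by (simp add: pow h0)
  also have "\<dots> \<longleftrightarrow> int i mod int a = 0"
   using bij a z by (intro inj_on_eq_iff[of h "{0..<int a}"]) (auto simp: bij_betw_def)
  also have "\<dots> \<longleftrightarrow> a dvd i" by (simp add: dvd_eq_mod_eq_0 flip: zmod_int)
  finally show ?thesis .
 qed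
 ultimately show ?thesis using g(1) by blast
qed

locale cyclic_semidirect = group G for G (structure) +
 fixes \<nu> c and a b \<alpha> :: nat
 assumes \<nu>: "\<nu> \<in> carrier G" and c: "c \<in> carrier G" and a0: "a > 0" and b0: "b > 0"
  and \<nu>_ord: "\<nu> [^] a = \<one>" and c_ord: "c [^] b = \<one>" and c\<nu>: "c \<otimes> \<nu> = \<nu> [^] \<alpha> \<otimes> c"
  and gen: "x \<in> carrier G \<Longrightarrow> \<exists>i<a. \<exists>l<b. x = \<nu> [^] i \<otimes> c [^] l"
  and uniq: "\<nu> [^] (i::nat) \<otimes> c [^] (l::nat) = \<one> \<Longrightarrow> a dvd i \<and> b dvd l"
begin

definition el :: "nat \<Rightarrow> nat \<Rightarrow> 'a" where "el i l = \<nu> [^] i \<otimes> c [^] l"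

lemma el_closed: "el i l \<in> carrier G" by (simp add: el_def \<nu> c)

lemma gen_el: "x \<in> carrier G \<Longrightarrow> \<exists>i<a. \<exists>l<b. x = el i l" unfolding el_def by (rule gen)

lemma c_\<nu>_pow: "c \<otimes> \<nu> [^] (i::nat) = \<nu> [^] (\<alpha> * i) \<otimes> c"
proof (induction i)
 case (Suc i)
 have "c \<otimes> \<nu> [^] Suc i = (c \<otimes> \<nu> [^] i) \<otimes> \<nu>" by (simp add: \<nu> c m_assoc)
 also have "\<dots> = \<nu> [^] (\<alpha> * i) \<otimes> (c \<otimes> \<nu>)" by (simp add: Suc \<nu> c m_assoc)
 also have "\<dots> = (\<nu> [^] (\<alpha> * i) \<otimes> \<nu> [^] \<alpha>) \<otimes> c" by (simp add: c\<nu> \<nu> c m_assoc)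
 also have "\<nu> [^] (\<alpha> * i) \<otimes> \<nu> [^] \<alpha> = \<nu> [^] (\<alpha> * Suc i)" by (simp add: nat_pow_mult \<nu> add.commute)
 finally show ?case .
qed (simp add: \<nu> c)

lemma c_pow_\<nu>_pow: "c [^] (l::nat) \<otimes> \<nu> [^] (i::nat) = \<nu> [^] (\<alpha> ^ l * i) \<otimes> c [^] l"
proof (induction l arbitrary: i)
 case (Suc l)
 have "c [^] Suc l \<otimes> \<nu> [^] i = c [^] l \<otimes> (c \<otimes> \<nu> [^] i)" by (simp add: \<nu> c m_assoc)
 also have "\<dots> = (c [^] l \<otimes> \<nu> [^] (\<alpha> * i)) \<otimes> c" by (simp add: c_\<nu>_pow \<nu> c m_assoc)
 also have "\<dots> = \<nu> [^] (\<alpha> ^ l * (\<alpha> * i)) \<otimes> c [^] Suc l" by (simp add: Suc \<nu> c m_assoc)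
 finally show ?case by (simp add: mult_ac)
qed (simp add: \<nu>)

lemma el_mult: "el i l \<otimes> el i' l' = el (i + \<alpha> ^ l * i') (l + l')"
proof -
 have "el i l \<otimes> el i' l' = \<nu> [^] i \<otimes> (c [^] l \<otimes> \<nu> [^] i') \<otimes> c [^] l'" by (simp add: el_def \<nu> c m_assoc)
 also have "\<dots> = (\<nu> [^] i \<otimes> \<nu> [^] (\<alpha> ^ l * i')) \<otimes> (c [^] l \<otimes> c [^] l')"
  by (simp add: c_pow_\<nu>_pow \<nu> c m_assoc)
 finally show ?thesis by (simp add: el_def nat_pow_mult \<nu> c)
qed

lemma el_0: "el 0 0 = \<one>" by (simp add: el_def)

lemma el_one_iff: "el i l = \<one> \<longleftrightarrow> a dvd i \<and> b dvd l"
proof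
 assume "a dvd i \<and> b dvd l"
 then obtain s t where "i = a * s" "l = b * t" by blast
 thus "el i l = \<one>" by (simp add: el_def nat_pow_pow[symmetric] \<nu> c \<nu>_ord c_ord)
qed (use uniq in \<open>simp add: el_def\<close>)

lemma el_periodic: "a dvd s \<Longrightarrow> b dvd t \<Longrightarrow> el (i + s) (l + t) = el i l"
proof -
 assume "a dvd s" "b dvd t"
 hence "\<nu> [^] s = \<one>" "c [^] t = \<one>" using el_one_iff[of s 0] el_one_iff[of 0 t] by (simp_all add: el_def \<nu> c)
 thus ?thesis by (simp add: el_def nat_pow_mult[symmetric] \<nu> c)
qed

lemma el_eq_iff: "el i l = el i' l' \<longleftrightarrow> i mod a = i' mod a \<and> l mod b = l' mod b"
proof
 assume eq: "el i l = el i' l'"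
 have "el ((a - 1) * i) 0 \<otimes> el i l \<otimes> el 0 ((b - 1) * l) = el ((a - 1) * i + i) (l + (b - 1) * l)"
  by (simp add: el_mult)
 also have "(a - 1) * i + i = a * i" using a0 by (cases a) simp_all
 also have "l + (b - 1) * l = b * l" using b0 by (cases b) simp_all
 also have "el (a * i) (b * l) = \<one>" by (simp add: el_one_iff)
 finally have "el ((a - 1) * i) 0 \<otimes> el i' l' \<otimes> el 0 ((b - 1) * l) = \<one>" unfolding eq .
 hence "el ((a - 1) * i + i') (l' + (b - 1) * l) = \<one>" by (simp add: el_mult)
 hence d: "a dvd (a - 1) * i + i'" "b dvd l' + (b - 1) * l" by (simp_all add: el_one_iff)
 have aux: "x mod n = y mod n" if n: "n > 0" "n dvd (n - 1) * x + y" for n x y :: nat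
 proof -
  have "(n - 1) * x + x = n * x" using n(1) by (cases n) simp_all
  hence "(n - 1) * x + y + x = n * x + y" by linarith
  hence "((n - 1) * x + y + x) mod n = (n * x + y) mod n" by (simp only:)
  also have "\<dots> = y mod n" by (rule mod_mult_self4)
  also have "((n - 1) * x + y + x) mod n = x mod n" using n(2) by (metis add.left_neutral mod_add_left_eq mod_eq_0_iff_dvd)
  finally show ?thesis .
 qed
 show "i mod a = i' mod a \<and> l mod b = l' mod b" using aux[OF a0 d(1)] aux[OF b0, of l l'] d(2) by (simp add: add.commute)
next
 assume e: "i mod a = i' mod a \<and> l mod b = l' mod b"
 have "el i l = el (i mod a) (l mod b)" for i l
  using el_periodic[of "a * (i div a)" "b * (l div b)" "i mod a" "l mod b"] by simp
 thus "el i l = el i' l'" using e by metis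
qed

lemma \<alpha>_pow: "\<alpha> ^ b mod a = 1 mod a"
proof -
 have "el 0 b \<otimes> el 1 0 = el (\<alpha> ^ b) b" by (simp add: el_mult)
 moreover have "el 0 b \<otimes> el 1 0 = el 1 0" using el_one_iff[of 0 b] el_closed by simp
 ultimately show ?thesis using el_eq_iff by metis
qed

lemma el_pow: "\<exists>s. el i l [^] (k::nat) = el s (k * l)"
proof (induction k)
 case 0
 show ?case using el_0 by (intro exI[of _ 0]) simp
next
 case (Suc k)
 then obtain s where "el i l [^] k = el s (k * l)" by blast
 thus ?case by (auto simp: el_mult add.commute)
qed

lemma \<nu>_el: "el i 0 [^] (k::nat) = el (i * k) 0"
 by (simp add: el_def \<nu> nat_pow_pow)

context
 fixes p n :: nat and H
 assumes p: "prime p" and n: "n \<ge> 1" and a: "a = p ^ n" and pb: "\<not> p dvd b"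
  and H: "subgroup H G" and cardH: "card H = p"
begin

text \<open>The quotient of order b is prime to p, so the exponent of c vanishes; inside the cyclic
  group of order p^n the condition makes the other exponent divisible by p^(n-1).\<close>

lemma order_p_elements:
 assumes x: "x \<in> carrier G" "x [^] p = \<one>"
 shows "x \<in> (\<lambda>t. el (p ^ (n - 1) * t) 0) ` {..<p}"
proof -
 obtain i l where il: "i < a" "l < b" "x = el i l" using gen_el[OF x(1)] by blast
 obtain s where "el i l [^] p = el s (p * l)" using el_pow by blast
 hence "b dvd p * l" using x(2) il(3) el_one_iff by metis
 moreover have "coprime b p" using prime_imp_coprime[OF p pb] by (simp add: coprime_commute)
 ultimately have "b dvd l" by (simp add: coprime_dvd_mult_right_iff)
 hence l: "l = 0" using il(2) by (auto dest: dvd_imp_le)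
 hence "a dvd i * p" using x(2) il(3) by (simp add: \<nu>_el el_one_iff)
 moreover have ap: "a = p ^ (n - 1) * p" using n by (simp add: a flip: power_Suc2)
 moreover have p0: "p > 0" using p prime_gt_0_nat by blast
 ultimately have "p ^ (n - 1) dvd i" by (simp add: dvd_mult_cancel_right)
 then obtain t where t: "i = p ^ (n - 1) * t" by blast
 have "t < p" using il(1) p0 unfolding t ap by simp
 thus ?thesis using il(3) l t by blast
qed

lemma H_eq: "H = (\<lambda>t. el (p ^ (n - 1) * t) 0) ` {..<p}"
proof (rule card_seteq)
 show "finite ((\<lambda>t. el (p ^ (n - 1) * t) 0) ` {..<p})" by simp
 show "card ((\<lambda>t. el (p ^ (n - 1) * t) 0) ` {..<p}) \<le> card H"
  using card_image_le[of "{..<p}"] cardH by simp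
 interpret H: group "G\<lparr>carrier := H\<rparr>" using H subgroup_imp_group by blast
 show "H \<subseteq> (\<lambda>t. el (p ^ (n - 1) * t) 0) ` {..<p}"
 proof
  fix x assume x: "x \<in> H"
  hence "x [^]\<^bsub>G\<lparr>carrier := H\<rparr>\<^esub> order (G\<lparr>carrier := H\<rparr>) = \<one>\<^bsub>G\<lparr>carrier := H\<rparr>\<^esub>"
   by (intro H.pow_order_eq_1) simp
  hence "x [^] p = \<one>" using nat_pow_consistent by (simp add: order_def cardH)
  moreover have "x \<in> carrier G" using x H subgroup.subset by blast
  ultimately show "x \<in> (\<lambda>t. el (p ^ (n - 1) * t) 0) ` {..<p}" using order_p_elements by blast
 qed
qed

text \<open>H contains every solution of x^p = 1, and conjugation preserves this equation.\<close>

lemma H_normal: "H \<lhd> G"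
proof (rule normal_invI[OF H])
 fix x h assume x: "x \<in> carrier G" and h: "h \<in> H"
 obtain t where t: "h = el (p ^ (n - 1) * t) 0" using h H_eq by blast
 have hc: "h \<in> carrier G" by (simp add: t el_closed)
 have "(x \<otimes> h \<otimes> inv x) [^] k = x \<otimes> h [^] k \<otimes> inv x" for k :: nat
 proof (induction k)
  case (Suc k)
  have ix: "inv x \<otimes> (x \<otimes> y) = y" if "y \<in> carrier G" for y
   using x that by (simp add: m_assoc[symmetric])
  show ?case using x hc Suc by (simp add: m_assoc ix)
 qed (use x in simp)
 moreover have "h [^] p = \<one>"
 proof -
  have "a = p ^ (n - 1) * p" using n by (simp add: a flip: power_Suc2)
  thus ?thesis by (simp add: t \<nu>_el el_one_iff mult_ac)
 qed
 ultimately have "(x \<otimes> h \<otimes> inv x) [^] p = \<one>" using x by simp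
 thus "x \<otimes> h \<otimes> inv x \<in> H" using order_p_elements[of "x \<otimes> h \<otimes> inv x"] x hc H_eq by simp
qed

lemma el_H_iff: "el i l \<in> H \<longleftrightarrow> p ^ (n - 1) dvd i \<and> b dvd l"
proof
 assume "el i l \<in> H"
 then obtain t where "el i l = el (p ^ (n - 1) * t) 0" using H_eq by blast
 hence "i mod a = p ^ (n - 1) * t mod a" "l mod b = 0" using el_eq_iff[of i l "p ^ (n - 1) * t" 0] by simp_all
 moreover have "p ^ (n - 1) dvd a" by (simp add: a le_imp_power_dvd)
 ultimately show "p ^ (n - 1) dvd i \<and> b dvd l" by (metis dvd_mod_iff dvd_triv_left mod_0_imp_dvd)
next
 assume d: "p ^ (n - 1) dvd i \<and> b dvd l"
 then obtain t where t: "i = p ^ (n - 1) * t" by blast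
 have ap: "a = p ^ (n - 1) * p" using n by (simp add: a flip: power_Suc2)
 have e: "p ^ (n - 1) * (t mod p) = (p ^ (n - 1) * t) mod a" unfolding ap by (rule mult_mod_right)
 have "el i l = el (p ^ (n - 1) * (t mod p)) 0"
  unfolding el_eq_iff e t using d by (simp only: mod_mod_trivial mod_0 dvd_eq_mod_eq_0)
 moreover have "t mod p < p" using p prime_gt_0_nat by simp
 ultimately show "el i l \<in> H" unfolding H_eq by blast
qed

end

end

lemma semidirect_cyclic_coordinates:
 fixes G (structure)
 assumes G: "semidirect_cyclic G a b" and a: "a > 0" and b: "b > 0"
 shows "\<exists>\<nu> c \<alpha>. cyclic_semidirect G \<nu> c a b \<alpha>"
proof -
 interpret group G using G by (simp add: semidirect_cyclic_def)
 obtain N Q where N: "N \<lhd> G" and Q: "subgroup Q G" and NQ: "N \<inter> Q = {\<one>}" "N <#> Q = carrier G"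
  and isoN: "G\<lparr>carrier := N\<rparr> \<cong> integer_mod_group a" and isoQ: "G\<lparr>carrier := Q\<rparr> \<cong> integer_mod_group b"
  using G by (auto simp: semidirect_cyclic_def)
 have Ns: "subgroup N G" using N normal_imp_subgroup by blast
 obtain \<nu> where \<nu>: "\<nu> \<in> N" "N = (\<lambda>i::nat. \<nu> [^] i) ` {..<a}" "\<And>i::nat. \<nu> [^] i = \<one> \<longleftrightarrow> a dvd i"
  using cyclic_subgroup_generator[OF isoN Ns a] by blast
 obtain c where c: "c \<in> Q" "Q = (\<lambda>i::nat. c [^] i) ` {..<b}" "\<And>i::nat. c [^] i = \<one> \<longleftrightarrow> b dvd i"
  using cyclic_subgroup_generator[OF isoQ Q b] by blast
 have car: "\<nu> \<in> carrier G" "c \<in> carrier G" using \<nu>(1) c(1) subgroup.subset[OF Ns] subgroup.subset[OF Q] by auto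
 have pw: "\<nu> [^] (i::nat) \<in> N" "c [^] (i::nat) \<in> Q" for i
  using \<nu>(1) c(1) by (induction i) (simp_all add: subgroup.one_closed[OF Ns] subgroup.one_closed[OF Q] subgroup.m_closed[OF Ns] subgroup.m_closed[OF Q])
 have "c \<otimes> \<nu> \<otimes> inv c \<in> N" using normal_invE(2)[OF N car(2) \<nu>(1)] .
 then obtain \<alpha> where \<alpha>: "c \<otimes> \<nu> \<otimes> inv c = \<nu> [^] (\<alpha>::nat)" using \<nu>(2) by blast
 have "cyclic_semidirect G \<nu> c a b \<alpha>"
 proof
  show "\<nu> [^] a = \<one>" "c [^] b = \<one>" using \<nu>(3) c(3) by simp_all
  have "\<nu> [^] \<alpha> \<otimes> c = c \<otimes> \<nu> \<otimes> (inv c \<otimes> c)"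
   unfolding \<alpha>[symmetric] using car by (simp add: m_assoc)
  thus "c \<otimes> \<nu> = \<nu> [^] \<alpha> \<otimes> c" using car by simp
  show "\<exists>i<a. \<exists>l<b. x = \<nu> [^] i \<otimes> c [^] l" if x: "x \<in> carrier G" for x
  proof -
   obtain y z where "y \<in> N" "z \<in> Q" "x = y \<otimes> z" using x NQ(2)[symmetric] by (auto simp: set_mult_def)
   thus ?thesis using \<nu>(2) c(2) by blast
  qed
  show "a dvd i \<and> b dvd l" if one: "\<nu> [^] i \<otimes> c [^] l = \<one>" for i l :: nat
  proof -
   have "\<nu> [^] i = inv (c [^] l)" using inv_equality[OF one] car by simp
   hence "\<nu> [^] i \<in> Q" using subgroup.m_inv_closed[OF Q pw(2)] by simp
   hence 1: "\<nu> [^] i = \<one>" using NQ(1) pw(1) by blast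
   hence "c [^] l = \<one>" using one car by simp
   thus ?thesis using 1 \<nu>(3) c(3) by simp
  qed
 qed (use car a b in auto)
 thus ?thesis by blast
qed

subsection \<open>From Galois extensions to towers and back\<close>

lemma galois_group_mult:
 assumes "s \<in> carrier (galois_group L K)" "t \<in> carrier (galois_group L K)"
 shows "s \<otimes>\<^bsub>galois_group L K\<^esub> t = compose (carrier L) s t"
 using assms by (simp add: galois_group_def BijGroup_def)

lemma (in galois_record) gact_mod: "gact (i mod p ^ r) (l mod m) = gact i l"
 unfolding gact_def act_mod ..

lemma (in galois_record) gact_mult:
 "gact i l \<otimes>\<^bsub>Gal\<^esub> gact i' l' = gact (i + \<alpha> ^ l * i') (l + l')"
proof (rule extensionalityI)
 show "gact i l \<otimes>\<^bsub>Gal\<^esub> gact i' l' \<in> extensional (carrier L)"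
  by (simp add: galois_group_mult gact_galois compose_def)
 show "gact (i + \<alpha> ^ l * i') (l + l') \<in> extensional (carrier L)" using galois_groupD(3)[OF gact_galois] .
 fix x assume x: "x \<in> carrier L"
 then obtain a where "x = E a" using E_surj by blast
 thus "(gact i l \<otimes>\<^bsub>Gal\<^esub> gact i' l') x = gact (i + \<alpha> ^ l * i') (l + l') x"
  using x by (simp add: galois_group_mult gact_galois compose_def gact act_act)
qed

text \<open>Both groups have coordinates (i, l) with the same multiplication rule, so matching
  coordinates is an isomorphism.\<close>

lemma galois_record_iso:
 assumes rec: "galois_record p m r \<alpha> d K A C f L \<iota> E" and G: "cyclic_semidirect G \<nu> c (p ^ r) m \<alpha>"
 shows "\<exists>\<phi>\<in>iso G (galois_group L (range \<iota>)).
  \<forall>i l. \<phi> (cyclic_semidirect.el G \<nu> c i l) = galois_record.gact A C L E i l"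
proof -
 interpret galois_record p m r \<alpha> d K A C f L \<iota> E by (rule rec)
 interpret G: cyclic_semidirect G \<nu> c "p ^ r" m \<alpha> by (rule G)
 let ?\<Gamma> = "galois_group L (range \<iota>)"
 define ix where "ix x = (SOME il. fst il < p ^ r \<and> snd il < m \<and> x = G.el (fst il) (snd il))" for x
 have ix: "fst (ix x) < p ^ r \<and> snd (ix x) < m \<and> x = G.el (fst (ix x)) (snd (ix x))" if x: "x \<in> carrier G" for x
 proof -
  obtain i l where "i < p ^ r" "l < m" "x = G.el i l" using G.gen_el[OF x] by blast
  hence ex: "\<exists>il. fst il < p ^ r \<and> snd il < m \<and> x = G.el (fst il) (snd il)" by (intro exI[of _ "(i, l)"]) simp
  show ?thesis using someI_ex[OF ex] by (simp only: ix_def)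
 qed
 define \<phi> where "\<phi> x = gact (fst (ix x)) (snd (ix x))" for x
 have el: "\<phi> (G.el i l) = gact i l" for i l
 proof -
  have "G.el i l = G.el (fst (ix (G.el i l))) (snd (ix (G.el i l)))" using ix[OF G.el_closed] by blast
  hence "fst (ix (G.el i l)) mod p ^ r = i mod p ^ r" "snd (ix (G.el i l)) mod m = l mod m"
   using G.el_eq_iff by metis+
  thus ?thesis unfolding \<phi>_def by (metis gact_mod)
 qed
 have "\<phi> \<in> hom G ?\<Gamma>"
 proof (rule homI)
  fix x y assume "x \<in> carrier G" "y \<in> carrier G"
  then obtain i l i' l' where "x = G.el i l" "y = G.el i' l'" using G.gen_el by metis
  thus "\<phi> (x \<otimes>\<^bsub>G\<^esub> y) = \<phi> x \<otimes>\<^bsub>?\<Gamma>\<^esub> \<phi> y" by (simp add: G.el_mult el gact_mult)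
 qed (simp add: \<phi>_def gact_galois)
 moreover have "bij_betw \<phi> (carrier G) (carrier ?\<Gamma>)"
 proof (rule bij_betwI')
  fix x y assume xy: "x \<in> carrier G" "y \<in> carrier G"
  show "(\<phi> x = \<phi> y) = (x = y)"
  proof
   assume "\<phi> x = \<phi> y"
   hence "ix x = ix y"
    using inj_onD[OF gact_inj, of "ix x" "ix y"] ix[OF xy(1)] ix[OF xy(2)]
    by (simp add: \<phi>_def case_prod_beta mem_Times_iff)
   thus "x = y" using ix[OF xy(1)] ix[OF xy(2)] by metis
  qed simp
 next
  fix x assume "x \<in> carrier G"
  thus "\<phi> x \<in> carrier ?\<Gamma>" by (simp add: \<phi>_def gact_galois)
 next
  fix s assume "s \<in> carrier ?\<Gamma>"
  then obtain i l where "s = gact i l" unfolding galois_group_eq by auto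
  thus "\<exists>x\<in>carrier G. s = \<phi> x" using el G.el_closed by (intro bexI[of _ "G.el i l"]) auto
 qed
 ultimately show ?thesis using el by (auto simp: iso_def)
qed

lemma to_ac_fhom: "fhom (to_ac :: 'a::field \<Rightarrow> 'a alg_closure)"
 by (simp add: fhom_def)

lemma fhom_record:
 assumes f: "fhom (f :: 'a::field \<Rightarrow> 'b::field)"
 shows "Ring.field ((type_ring :: 'b ring)\<lparr>carrier := range f\<rparr>)"
  "f \<in> ring_iso type_ring ((type_ring :: 'b ring)\<lparr>carrier := range f\<rparr>)"
proof -
 let ?\<Omega> = "type_ring :: 'b ring"
 interpret \<Omega>: Ring.field ?\<Omega> by (rule ring_of_type_field)
 have hom: "f \<in> ring_hom type_ring ?\<Omega>"
  by (rule ring_hom_memI) (simp_all add: fhom_simps[OF f])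
 interpret I: ring_hom_ring type_ring ?\<Omega> f
  by (rule ring_hom_ringI2[OF ring_of_type_ring ring_of_type_ring hom])
 have "subfield (range f) ?\<Omega>"
  using I.img_is_subfield(2)[OF field.carrier_is_subfield[OF ring_of_type_field]] by simp
 thus "Ring.field (?\<Omega>\<lparr>carrier := range f\<rparr>)" by (rule \<Omega>.subfield_iff(2))
 show "f \<in> ring_iso type_ring (?\<Omega>\<lparr>carrier := range f\<rparr>)"
  unfolding ring_iso_def by (auto simp: bij_betw_def fhom_inj[OF f] fhom_simps[OF f] intro!: ring_hom_memI)
qed

lemma subfield_ring_of_type:
 assumes M: "subfield M (type_ring :: 'w::field ring)"
 shows "1 \<in> M" "x \<in> M \<Longrightarrow> y \<in> M \<Longrightarrow> x * y \<in> M" "x \<in> M \<Longrightarrow> y \<in> M \<Longrightarrow> x - y \<in> M"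
  "x \<in> M \<Longrightarrow> inverse x \<in> M"
proof -
 interpret \<Omega>: Ring.field "type_ring :: 'w ring" by (rule ring_of_type_field)
 note S = subringE[OF subfieldE(1)[OF M], simplified]
 show "1 \<in> M" "x \<in> M \<Longrightarrow> y \<in> M \<Longrightarrow> x * y \<in> M" using S(3,6) by simp_all
 have "\<ominus>\<^bsub>type_ring\<^esub> y = - y" using \<Omega>.r_neg[of y] by (simp add: eq_neg_iff_add_eq_0 add.commute)
 thus "x \<in> M \<Longrightarrow> y \<in> M \<Longrightarrow> x - y \<in> M" using S(7)[of x "- y"] S(5)[of y] by simp
 show "inverse x \<in> M" if x: "x \<in> M"
 proof (cases "x = 0")
  case False
  thus ?thesis using \<Omega>.subfield_m_inv[OF M, of x] x by (auto dest!: inverse_unique)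
 qed (use x in simp)
qed

context ltower
begin

lemma level_galois_model:
 assumes R: "R > 0" and L: "level R e K" and \<sigma>: "\<And>a. e (\<sigma> a) = g (e a)" and \<tau>: "\<And>a. e (\<tau> a) = c (e a)"
 shows "galois_model p m R \<alpha> (p ^ R * m) (\<lambda>a. K (K0 a)) \<sigma> \<tau> f"
proof
 note e = levelD(1)[OF L]
 note ei = fhom_eq_iff[OF e]
 have eM: "range e = M" using levelD(2)[OF L] F_top by simp
 have eaM: "e a \<in> M" for a using eM by blast
 have e_K: "e (K (K0 a)) = eK a" for a by (simp add: levelD(4)[OF L] eF_K0)
 have e\<sigma>: "e ((\<sigma> ^^ i) a) = (g ^^ i) (e a)" and e\<tau>: "e ((\<tau> ^^ i) a) = (c ^^ i) (e a)" for i a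
  by (induction i) (simp_all add: \<sigma> \<tau>)
 show "good (\<lambda>a. K (K0 a)) (p ^ R * m)" by (rule good_comp[OF levelD(3)[OF L] K0])
 obtain s where s: "good s 1" "\<And>a. e (s a) = (g ^^ 1) ((c ^^ 0) (e a))" using level_automorphism[OF L] by blast
 have "s = \<sigma>" by (rule ext) (use s(2) \<sigma> in \<open>simp flip: ei\<close>)
 thus "good \<sigma> 1" using s(1) by simp
 obtain t where t: "good t 1" "\<And>a. e (t a) = (g ^^ 0) ((c ^^ 1) (e a))" using level_automorphism[OF L] by blast
 have "t = \<tau>" by (rule ext) (use t(2) \<tau> in \<open>simp flip: ei\<close>)
 thus "good \<tau> 1" using t(1) by simp
 show "\<sigma> (K (K0 a)) = K (K0 a)" "\<tau> (K (K0 a)) = K (K0 a)" for a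
  by (simp_all add: \<sigma> \<tau> e_K gK cK flip: ei)
 show "(\<sigma> ^^ p ^ R) a = a" "(\<tau> ^^ m) a = a" "\<tau> (\<sigma> a) = (\<sigma> ^^ \<alpha>) (\<tau> a)" for a
  by (simp_all add: e\<sigma> e\<tau> \<sigma> \<tau> gq cm cg eaM flip: ei)
 show "a \<in> range (\<lambda>a. K (K0 a))" if "\<sigma> a = a" "\<tau> a = a" for a
 proof -
  have "g (e a) = e a" "c (e a) = e a" using that by (metis \<sigma>, metis \<tau>)
  then obtain b where "e a = eK b" using fix_K[OF eaM] by blast
  hence "a = K (K0 b)" by (simp add: e_K flip: ei)
  thus ?thesis by blast
 qed
 have act: "e ((\<sigma> ^^ i) ((\<tau> ^^ l) a)) = (g ^^ i) ((c ^^ l) (e a))" for i l a by (simp add: e\<sigma> e\<tau>)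
 show "\<not> m dvd l \<Longrightarrow> ram (\<lambda>a. (\<sigma> ^^ i) ((\<tau> ^^ l) a)) 0" for i l
  by (rule level_ram(1)[of R e K "\<lambda>a. (\<sigma> ^^ i) ((\<tau> ^^ l) a)" i l, OF L act])
 show "m dvd l \<Longrightarrow> \<not> p ^ R dvd i \<Longrightarrow> ram (\<lambda>a. (\<sigma> ^^ i) ((\<tau> ^^ l) a)) (jump p f (multiplicity p i))" for i l
  by (rule level_ram(2)[of R e K "\<lambda>a. (\<sigma> ^^ i) ((\<tau> ^^ l) a)" i l, OF L act])
qed (use prime char m0 f1_pole[OF R] in auto)

text \<open>The averaged class yields an extension to which both generators lift. The q-th power of
  A adds 1 to the generator z, so its fixed field is the image of K1. Ramification numbers below the
  last jump persist, and the new one is j.\<close>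

theorem top_galois_model:
 assumes R: "R > 0" and \<phi>: "reduced p \<phi>"
 defines "f' \<equiv> f(q := \<phi>)"
 assumes eig: "of_nat \<beta> * \<zeta> ^ rho p f' R = 1"
 shows "\<exists>e K K1 \<sigma> \<tau> A C. level R e K \<and> fhom K1 \<and>
  (\<forall>a. e (\<sigma> a) = g (e a)) \<and> (\<forall>a. e (\<tau> a) = c (e a)) \<and>
  (\<forall>a. A (K1 a) = K1 (\<sigma> a)) \<and> (\<forall>a. C (K1 a) = K1 (\<tau> a)) \<and>
  (\<forall>a. (A ^^ (p ^ R)) a = a \<longrightarrow> a \<in> range K1) \<and>
  galois_model p m (Suc R) \<alpha> (p * (p ^ R * m)) (\<lambda>a. K1 (K (K0 a))) A C f'"
proof -
 obtain e K where L: "level R e K" using level_exists by blast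
 note e = levelD(1)[OF L] and K = levelD(3)[OF L]
 define j where "j = jump p f' R"
 obtain x B where x: "e x = average (\<lambda>_. X0 \<phi>)" and dx: "fls_deriv x \<noteq> 0" "val (fls_deriv x) = - j - 1"
  and B: "vge x (- B)" "B < real p * real_of_int j" and j: "j > 0"
  using top_equation[OF R \<phi> L eig[unfolded f'_def]] unfolding j_def f'_def by blast
 obtain b where b: "x - wp p b \<noteq> 0" "val (x - wp p b) = - j" "\<not> int p dvd j"
  using wp_reduce_deriv[OF prime char B(1) dx j B(2)] by blast
 obtain K1 z where AS: "artin_schreier p (x - wp p b) j K1 z"
  using artin_schreier_exists[OF prime char b(1,2) j b(3)] by blast
 hence K1: "good K1 p" by (simp add: artin_schreier_def)
 note h1 = good_fhom[OF K1] and ei = fhom_eq_iff[OF e]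
 obtain \<sigma> where \<sigma>: "\<And>a. e (\<sigma> a) = g (e a)" using level_automorphism[OF L, of 1 0] by auto
 obtain \<tau> where \<tau>: "\<And>a. e (\<tau> a) = c (e a)" using level_automorphism[OF L, of 0 1] by auto
 interpret mod: galois_model p m R \<alpha> "q * m" "\<lambda>a. K (K0 a)" \<sigma> \<tau> f
  by (rule level_galois_model[OF R L \<sigma> \<tau>])
 have e\<sigma>: "e ((\<sigma> ^^ i) a) = (g ^^ i) (e a)" and e\<tau>: "e ((\<tau> ^^ i) a) = (c ^^ i) (e a)" for i a
  by (induction i) (simp_all add: \<sigma> \<tau>)
 have eM: "range e = M" using levelD(2)[OF L] F_top by simp
 have "w_eq \<in> M" unfolding w_eq_def by (intro average_M S_M w0_M)
 then obtain w where w: "e w = w_eq" using eM by (metis rangeE)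
 have \<sigma>x: "\<sigma> x = x + wp p w"
  by (subst ei[symmetric]) (use X_eq_g[of \<phi>] in \<open>simp add: \<sigma> x w w_eq_def fhom_add[OF e] wp_fhom[OF e] diff_eq_eq add.commute\<close>)
 have \<tau>x: "\<tau> x = of_nat \<beta> * x"
  by (subst ei[symmetric]) (simp add: \<tau> x fhom_mult[OF e] fhom_of_nat[OF e] X_eq_c)
 have \<tau>w: "\<tau> w = of_nat \<beta> * (\<Sum>k<\<alpha>. (\<sigma> ^^ k) w)"
  by (subst ei[symmetric]) (simp add: \<tau> w fhom_mult[OF e] fhom_of_nat[OF e] fhom_sum[OF e] e\<sigma> c_w_eq S_def)
 have trw: "(\<Sum>k<q. (\<sigma> ^^ k) w) = 1"
  by (subst ei[symmetric]) (use trace_w_eq in \<open>simp add: w fhom_1[OF e] fhom_sum[OF e] e\<sigma> trace_def\<close>)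
 have \<beta>m: "of_nat \<beta> ^ m = (1::'k)"
 proof -
  have "of_nat \<alpha> ^ m = (1::'k)" using \<alpha>\<beta>_field(1) unfolding of_nat_mult[symmetric] \<alpha>\<beta> by simp
  thus ?thesis by (simp add: \<beta>_def flip: power_mult) (simp add: mult.commute power_mult)
 qed
 obtain A C where AC: "good A 1" "good C 1" "\<And>a. A (K1 a) = K1 (\<sigma> a)" "\<And>a. C (K1 a) = K1 (\<tau> a)"
  "\<And>i. (A ^^ i) (z + K1 b) = z + K1 b + K1 (\<Sum>k<i. (\<sigma> ^^ k) w)"
  "\<And>a. (A ^^ (q * p)) a = a" "\<And>a. (C ^^ m) a = a" "\<And>a. C (A a) = (A ^^ \<alpha>) (C a)"
  using artin_schreier_lift[OF prime char q0 m0 AS mod.gA mod.gC \<sigma>x \<tau>x \<tau>w trw mod.A_ord mod.C_ord mod.CA \<beta>m] by blast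
 note gA = good_funpow[OF AC(1)] and gC = good_funpow[OF AC(2)]
 have AK: "(A ^^ i) (K1 a) = K1 ((\<sigma> ^^ i) a)" and CK: "(C ^^ i) (K1 a) = K1 ((\<tau> ^^ i) a)" for i a
  by (induction i) (simp_all add: AC)
 have Az: "(A ^^ i) z = z + K1 (\<Sum>k<i. (\<sigma> ^^ k) w) - K1 ((\<sigma> ^^ i) b - b)" for i
  using AC(5)[of i] by (simp add: fhom_add[OF good_fhom[OF gA]] AK fhom_diff[OF h1] algebra_simps)
 note \<sigma>qk = mod.A_mult
 have Aqz: "(A ^^ (q * k)) z = z + of_nat k" for k
 proof -
  have "e (\<Sum>k<q * k. (\<sigma> ^^ k) w) = e (of_nat k)"
   using S_mult_q[of w_eq k] \<open>w_eq \<in> M\<close> trace_w_eq by (simp add: fhom_sum[OF e] e\<sigma> w S_def fhom_of_nat[OF e])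
  hence "(\<Sum>k<q * k. (\<sigma> ^^ k) w) = of_nat k" by (simp only: ei)
  thus ?thesis unfolding Az \<sigma>qk by (simp add: fhom_of_nat[OF h1] fhom_0[OF h1])
 qed
 have fix1: "a \<in> range K1" if "(A ^^ q) a = a" for a
  by (rule artin_schreier_fixed[OF prime char AS good_fhom[OF gA[of q]] _ _ that])
   (use Aqz[of 1] \<sigma>qk[of 1] in \<open>simp_all add: AK\<close>)
 have "q > 1" by (rule one_less_power[OF p1 R])
 hence f'1: "pole (f' 1) > 0" using f1_pole[OF R] by (simp add: f'_def)
 have jump': "jump p f' i = jump p f i" if i: "i < R" for i
  by (rule jump_cong) (use i p1 in \<open>auto simp: f'_def\<close>)
 have "galois_model p m (Suc R) \<alpha> (p * (p ^ R * m)) (\<lambda>a. K1 (K (K0 a))) A C f'"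
 proof
  show "good (\<lambda>a. K1 (K (K0 a))) (p * (p ^ R * m))" by (rule good_comp[OF K1 mod.K])
  show "A (K1 (K (K0 a))) = K1 (K (K0 a))" "C (K1 (K (K0 a))) = K1 (K (K0 a))" for a
   by (simp_all add: AC mod.AK mod.CK)
  show "(A ^^ (p ^ Suc R)) a = a" for a using AC(6)[of a] by (simp add: mult.commute)
  show "a \<in> range (\<lambda>a. K1 (K (K0 a)))" if Aa: "A a = a" and Ca: "C a = a" for a
  proof -
   have "(A ^^ i) a = a" for i by (induction i) (simp_all add: Aa)
   then obtain b where b: "a = K1 b" using fix1 by blast
   have "K1 (\<sigma> b) = K1 b" "K1 (\<tau> b) = K1 b" using Aa Ca by (simp_all add: b AC)
   hence "\<sigma> b = b" "\<tau> b = b" by (simp_all add: fhom_eq_iff[OF h1])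
   thus ?thesis using b mod.fixed by blast
  qed
  have comm: "(A ^^ i) ((C ^^ l) (K1 a)) = K1 (mod.act i l a)" for i l a by (simp add: AK CK)
  have good: "good (\<lambda>a. (A ^^ i) ((C ^^ l) a)) 1" for i l using good_comp[OF gA[of i] gC[of l]] by simp
  show "ram (\<lambda>a. (A ^^ i) ((C ^^ l) a)) 0" if "\<not> m dvd l" for i l
   by (rule ram_step_tame[OF prime char K1 mod.act_good good comm mod.ram_tame[OF that]])
  show "ram (\<lambda>a. (A ^^ i) ((C ^^ l) a)) (jump p f' (multiplicity p i))"
   if ml: "m dvd l" and i: "\<not> p ^ Suc R dvd i" for i l
  proof -
   obtain k where k: "l = m * k" using ml by blast
   have Cl: "(C ^^ l) a = a" for a unfolding k by (induction k) (simp_all add: AC(7) funpow_add)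
   show ?thesis
   proof (cases "q dvd i")
    case False
    have lt: "multiplicity p i < R" by (rule wild_multiplicity_less[OF False])
    have r: "ram (\<lambda>a. mod.act i l a) (jump p f' (multiplicity p i))"
     using mod.ram_wild[OF ml False] jump'[OF lt] by simp
    have "(A ^^ i) ((C ^^ l) z) = z + K1 ((\<Sum>k<i. (\<sigma> ^^ k) w) - ((\<sigma> ^^ i) b - b))"
     by (simp add: Cl Az fhom_diff[OF h1])
    from ram_step_wild[OF prime char b(1,2) AS mod.act_good good comm this r] show ?thesis
     using jump_gt_0[of p f' "multiplicity p i", OF p1 f'1] jump_less[of p f', OF p1 f'1 lt] by (simp add: j_def)
   next
    case True
    then obtain s where s: "i = q * s" by blast
    have mu: "multiplicity p i = R" by (rule wild_multiplicity[OF True i])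
    have ps: "\<not> p dvd s" using i by (auto simp: s)
    have "(A ^^ i) ((C ^^ l) z) - z = fls_const (of_nat s)" by (simp add: Cl s Aqz fls_of_nat)
    moreover have "(of_nat s :: 'k) \<noteq> 0" using ps by (simp add: of_nat_eq_0_iff_char_dvd char)
    moreover have "(A ^^ i) ((C ^^ l) (K1 fls_X)) = K1 fls_X" by (simp add: Cl s AK \<sigma>qk)
    ultimately have "ram (\<lambda>a. (A ^^ i) ((C ^^ l) a)) j" by (intro ram_step_top[OF prime char AS good])
    thus ?thesis by (simp add: mu j_def)
   qed
  qed
 qed (fact prime char m0 AC f'1)+
 with L h1 \<sigma> \<tau> AC(3,4) fix1 show ?thesis by blast
qed

end

section \<open>The given quotient extension as a tower\<close>

locale quotient_galois = cyclic_semidirect G \<nu> c "p ^ Suc R" m \<alpha>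
 for G :: "'g monoid" (structure) and \<nu> c and p R m \<alpha> :: nat +
 fixes H :: "'g set" and L :: "'l ring" and \<iota> :: "'k::alg_closed_field fls \<Rightarrow> 'l" and \<phi> :: "'g set \<Rightarrow> 'l \<Rightarrow> 'l"
 assumes prime: "prime p" and char: "CHAR('k) = p" and pm: "\<not> p dvd m"
  and H: "subgroup H G" "card H = p" and gal: "galois_extension_with_group (G Mod H) L \<iota> \<phi>"
begin

lemma H_n: "H \<lhd> G" by (rule H_normal[OF prime _ refl pm H]) simp

lemma el_H: "el i l \<in> H \<longleftrightarrow> p ^ R dvd i \<and> m dvd l"
 using el_H_iff[OF prime _ refl pm H] by simp

abbreviation Gal where "Gal \<equiv> galois_group L (range \<iota>)"

definition \<psi> where "\<psi> x = \<phi> (H #> x)"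

lemma galL: "galois_extension L (range \<iota>)" and fieldL: "Ring.field L"
 and \<iota>_hom: "\<iota> \<in> ring_hom type_ring L" and \<phi>_iso: "\<phi> \<in> iso (G Mod H) (Gal)"
 using gal by (auto simp: galois_extension_with_group_def galois_extension_def)

lemma \<psi>_closed: "x \<in> carrier G \<Longrightarrow> \<psi> x \<in> carrier (Gal)"
proof -
 assume "x \<in> carrier G"
 hence "H #> x \<in> carrier (G Mod H)" by (auto simp: FactGroup_def RCOSETS_def)
 thus ?thesis using \<phi>_iso by (auto simp: \<psi>_def iso_def hom_def)
qed

lemma \<psi>_carrier: "x \<in> carrier G \<Longrightarrow> z \<in> carrier L \<Longrightarrow> \<psi> x z \<in> carrier L"
 by (rule ring_hom_closed[OF galois_groupD(1)[OF \<psi>_closed]])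

lemma \<psi>_mult:
 assumes "x \<in> carrier G" "y \<in> carrier G" "z \<in> carrier L"
 shows "\<psi> (x \<otimes> y) z = \<psi> x (\<psi> y z)"
proof -
 have xy: "H #> x \<in> carrier (G Mod H)" "H #> y \<in> carrier (G Mod H)" using assms by (auto simp: FactGroup_def RCOSETS_def)
 have hom: "\<phi> \<in> hom (G Mod H) (Gal)" using \<phi>_iso by (simp add: iso_def)
 have "(H #> x) \<otimes>\<^bsub>G Mod H\<^esub> (H #> y) = H #> (x \<otimes> y)"
  using normal.rcos_sum[OF H_n assms(1,2)] by (simp add: FactGroup_def)
 hence "\<psi> (x \<otimes> y) = \<psi> x \<otimes>\<^bsub>Gal\<^esub> \<psi> y"
  using hom_mult[OF hom xy] by (simp add: \<psi>_def)
 thus ?thesis using assms by (simp add: galois_group_mult \<psi>_closed compose_def)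
qed

lemma \<psi>_onto: "s \<in> carrier (Gal) \<Longrightarrow> \<exists>x\<in>carrier G. s = \<psi> x"
proof -
 assume "s \<in> carrier (Gal)"
 hence "s \<in> \<phi> ` carrier (G Mod H)" using \<phi>_iso by (simp add: iso_def bij_betw_def)
 thus ?thesis by (auto simp: FactGroup_def RCOSETS_def \<psi>_def)
qed

lemma \<psi>_one: assumes "z \<in> carrier L" shows "\<psi> \<one> z = z"
proof -
 have "\<psi> \<one> (\<psi> \<one> z) = \<psi> \<one> z" using \<psi>_mult[of \<one> \<one> z] assms by simp
 moreover have "inj_on (\<psi> \<one>) (carrier L)" using galois_groupD(2)[OF \<psi>_closed] by (simp add: bij_betw_def)
 ultimately show ?thesis using assms \<psi>_carrier by (auto dest: inj_onD)
qed

lemma \<psi>_id_iff: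
 assumes x: "x \<in> carrier G"
 shows "(\<forall>z\<in>carrier L. \<psi> x z = z) \<longleftrightarrow> x \<in> H"
proof
 assume "\<forall>z\<in>carrier L. \<psi> x z = z"
 hence "\<psi> x = \<psi> \<one>"
  using galois_groupD(3)[OF \<psi>_closed] x \<psi>_one by (intro extensionalityI[where A = "carrier L"]) auto
 moreover have "inj_on \<phi> (carrier (G Mod H))" using \<phi>_iso by (simp add: iso_def bij_betw_def)
 moreover have "H #> x \<in> carrier (G Mod H)" "H #> \<one> \<in> carrier (G Mod H)" using x by (auto simp: FactGroup_def RCOSETS_def)
 ultimately have "H #> x = H #> \<one>" unfolding \<psi>_def by (auto dest: inj_onD)
 moreover have "H #> \<one> = H" using H(1) subgroup.subset by (intro coset_mult_one) blast
 ultimately have "H #> x = H" by simp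
 thus "x \<in> H" using rcos_self[OF x H(1)] by simp
next
 assume "x \<in> H"
 hence "H #> x = H #> \<one>" using coset_join2[OF x H(1)] H(1) subgroup.subset coset_mult_one by metis
 thus "\<forall>z\<in>carrier L. \<psi> x z = z" using \<psi>_one by (simp add: \<psi>_def)
qed

lemma \<psi>_pow: "x \<in> carrier G \<Longrightarrow> z \<in> carrier L \<Longrightarrow> (\<psi> x ^^ i) z = \<psi> (x [^] i) z"
proof (induction i arbitrary: z)
 case (Suc i)
 have "(\<psi> x ^^ Suc i) z = (\<psi> x ^^ i) (\<psi> x z)" by (simp add: funpow_swap1)
 also have "\<dots> = \<psi> (x [^] i) (\<psi> x z)" using Suc \<psi>_carrier by simp
 also have "\<dots> = \<psi> (x [^] Suc i) z" using Suc.prems \<psi>_mult[of "x [^] i" x z] by simp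
 finally show ?case .
qed (simp add: \<psi>_one)

text \<open>\<nu> and c act on L through their cosets. Elements of H act trivially, which gives the
  orders p^R and m, and only they do, which gives faithfulness. The lifts g and h to the algebraic
  closure inherit the relations on the image of L.\<close>

lemma tower_embedding:
 "\<exists>(j :: 'l \<Rightarrow> 'k fls alg_closure) g h. partial_hom L (carrier L) j \<and> (\<forall>a. j (\<iota> a) = to_ac a) \<and>
  (\<forall>i l. \<forall>z\<in>carrier L. (g ^^ i) ((h ^^ l) (j z)) = j (\<psi> (el i l) z)) \<and>
  ctower p m R \<alpha> to_ac (j ` carrier L) g h"
proof -
 interpret L: Ring.field L by (rule fieldL)
 obtain j :: "'l \<Rightarrow> 'k fls alg_closure" where j: "partial_hom L (carrier L) j" "\<And>a. j (\<iota> a) = to_ac a"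
  using L.galois_embedding(1)[OF galL \<iota>_hom] by blast
 have \<iota>c: "\<iota> a \<in> carrier L" for a using ring_hom_closed[OF \<iota>_hom] by simp
 note ji = inj_onD[OF L.partial_hom_carrier_inj[OF j(1)]]
 obtain g where g: "fhom g" "\<And>x. x \<in> carrier L \<Longrightarrow> g (j x) = j (\<psi> \<nu> x)"
  using L.galois_lift[OF j \<iota>c galois_groupD(1)[OF \<psi>_closed[OF \<nu>]]] by blast
 obtain h where h: "fhom h" "\<And>x. x \<in> carrier L \<Longrightarrow> h (j x) = j (\<psi> c x)"
  using L.galois_lift[OF j \<iota>c galois_groupD(1)[OF \<psi>_closed[OF c]]] by blast
 have gi: "(g ^^ i) (j z) = j (\<psi> (\<nu> [^] i) z)" if "z \<in> carrier L" for i z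
 proof -
  have "(g ^^ i) (j z) = j ((\<psi> \<nu> ^^ i) z) \<and> (\<psi> \<nu> ^^ i) z \<in> carrier L"
   by (induction i) (use that \<nu> \<psi>_carrier g(2) in auto)
  thus ?thesis using \<psi>_pow[OF \<nu> that] by simp
 qed
 have hi: "(h ^^ i) (j z) = j (\<psi> (c [^] i) z)" if "z \<in> carrier L" for i z
 proof -
  have "(h ^^ i) (j z) = j ((\<psi> c ^^ i) z) \<and> (\<psi> c ^^ i) z \<in> carrier L"
   by (induction i) (use that c \<psi>_carrier h(2) in auto)
  thus ?thesis using \<psi>_pow[OF c that] by simp
 qed
 have act: "(g ^^ i) ((h ^^ l) (j z)) = j (\<psi> (el i l) z)" if "z \<in> carrier L" for i l z
  using that \<nu> c by (simp add: gi hi \<psi>_carrier el_def \<psi>_mult)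
 have K: "\<psi> x (\<iota> a) = \<iota> a" if "x \<in> carrier G" for x a using galois_groupD(4)[OF \<psi>_closed[OF that]] by blast
 interpret J: ring_hom_ring L "type_ring :: 'k fls alg_closure ring" j
  using L.partial_hom_ring_hom_ring[OF j(1)] by simp
 have "subfield (j ` carrier L) (type_ring :: 'k fls alg_closure ring)"
  by (rule J.img_is_subfield(2)[OF L.carrier_is_subfield]) simp
 note M = subfield_ring_of_type[OF this]
 have "ctower p m R \<alpha> to_ac (j ` carrier L) g h"
 proof
  show "m > 0" by (rule b0)
  show "fhom (to_ac :: 'k fls \<Rightarrow> _)" by (rule to_ac_fhom)
  show "to_ac a \<in> j ` carrier L" for a using j(2)[of a] \<iota>c[of a] by (metis image_eqI)
  show "g x \<in> j ` carrier L" "h x \<in> j ` carrier L" if "x \<in> j ` carrier L" for x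
   using that g(2) h(2) \<psi>_carrier \<nu> c by auto
  show "g (to_ac a) = to_ac a" "h (to_ac a) = to_ac a" for a
   using g(2)[OF \<iota>c] h(2)[OF \<iota>c] K[OF \<nu>] K[OF c] by (simp_all flip: j(2))
  have id: "j (\<psi> x z) = j z" if "x \<in> H" "z \<in> carrier L" for x z
   using that \<psi>_id_iff[of x] H(1) subgroup.subset by fastforce
  show "(g ^^ p ^ R) x = x" if xM: "x \<in> j ` carrier L" for x
  proof -
   obtain z where z: "x = j z" "z \<in> carrier L" using xM by blast
   have "el (p ^ R) 0 \<in> H" by (simp add: el_H)
   thus ?thesis using act[OF z(2), of "p ^ R" 0] id z by simp
  qed
  show "(h ^^ m) x = x" if xM: "x \<in> j ` carrier L" for x
  proof -
   obtain z where z: "x = j z" "z \<in> carrier L" using xM by blast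
   have "el 0 m \<in> H" by (simp add: el_H)
   thus ?thesis using act[OF z(2), of 0 m] id z by simp
  qed
  show "h (g x) = (g ^^ \<alpha>) (h x)" if xM: "x \<in> j ` carrier L" for x
  proof -
   obtain z where z: "x = j z" "z \<in> carrier L" using xM by blast
   have "h (g x) = j (\<psi> (c \<otimes> \<nu>) z)" using z \<nu> c \<psi>_carrier by (simp add: g(2) h(2) \<psi>_mult)
   also have "\<dots> = (g ^^ \<alpha>) (h x)" using z \<nu> c \<psi>_carrier by (simp add: c\<nu> gi h(2) \<psi>_mult)
   finally show ?thesis .
  qed
  show "x \<in> range to_ac" if xM: "x \<in> j ` carrier L" and gh: "g x = x" "h x = x" for x
  proof -
   obtain z where z: "x = j z" "z \<in> carrier L" using xM by blast
   have fg: "(g ^^ i) x = x" "(h ^^ i) x = x" for i by (induction i) (simp_all add: gh)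
   obtain h0 :: "'l \<Rightarrow> 'k fls alg_closure" where h0: "partial_hom L (range \<iota>) h0"
    using L.galois_embedding(2)[OF galL \<iota>_hom] by blast
   have "z \<in> range \<iota>"
   proof (rule L.galois_fixed_field[OF galL h0 z(2)])
    fix s assume "s \<in> carrier (Gal)"
    then obtain y where y: "y \<in> carrier G" "s = \<psi> y" using \<psi>_onto by blast
    obtain i l where il: "y = el i l" using gen_el[OF y(1)] by blast
    have "j (\<psi> y z) = j z" using act[OF z(2), of i l] fg by (simp add: z(1)[symmetric] il)
    thus "s z = z" using ji \<psi>_carrier[OF y(1) z(2)] z(2) y(2) by blast
   qed
   thus ?thesis using j(2) z(1) by auto
  qed
  show "i = 0 \<and> l = 0" if il: "i < p ^ R" "l < m" and fx: "\<And>x. x \<in> j ` carrier L \<Longrightarrow> (g ^^ i) ((h ^^ l) x) = x" for i l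
  proof -
   have "\<psi> (el i l) z = z" if z: "z \<in> carrier L" for z
    using fx[of "j z"] act[OF z, of i l] z ji[of "\<psi> (el i l) z" z] \<psi>_carrier[OF el_closed z] by simp
   hence "el i l \<in> H" using \<psi>_id_iff[OF el_closed] by blast
   thus ?thesis using il by (auto simp: el_H dest: dvd_imp_le)
  qed
  show "\<alpha> ^ m mod p ^ Suc R = 1 mod p ^ Suc R" by (rule \<alpha>_pow)
 qed (fact prime char pm g(1) h(1) M)+
 thus ?thesis using j act by blast
qed

end

section \<open>Choice of the last datum and domination\<close>

lemma rho_mono:
 assumes "p > 0" "b \<le> b'"
 shows "rho p f b \<le> rho p f b'"
 using assms(2)
proof (induction rule: dec_induct)
 case (step n)
 have "rho p f n \<le> p * rho p f n" using assms(1) by (cases p) auto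
 also have "\<dots> \<le> rho p f (Suc n)" by (simp only: rho.simps max.cobounded1)
 finally show ?case using step.IH by (rule order_trans[rotated])
qed simp

text \<open>Equality of the sets of jumps is turned into equality of the first and last ones: the
  first enters the congruence, the last the recursion for \<open>rho\<close>.\<close>

lemma mono_on_image_extrema:
 fixes u v :: "nat \<Rightarrow> real"
 assumes u: "mono_on {1..R} u" and v: "\<And>a b. a \<le> b \<Longrightarrow> v a \<le> v b" and R: "R > 0" and eq: "u ` {1..R} = v ` {..<R}"
 shows "u 1 = v 0" "u R = v (R - 1)"
proof -
 have mem: "u i \<in> v ` {..<R}" if "i \<in> {1..R}" for i using eq that by blast
 have mem': "v b \<in> u ` {1..R}" if "b \<in> {..<R}" for b using eq that by blast
 obtain b where b: "b < R" "u 1 = v b" using mem[of 1] R by auto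
 obtain i where i: "i \<in> {1..R}" "v 0 = u i" using mem'[of 0] R by auto
 have "v 0 \<le> u 1" using v[of 0 b] b by simp
 moreover have "u 1 \<le> v 0" using mono_onD[OF u, of 1 i] i R by simp
 ultimately show "u 1 = v 0" by simp
 obtain b where b: "b < R" "u R = v b" using mem[of R] R by auto
 obtain i where i: "i \<in> {1..R}" "v (R - 1) = u i" using mem'[of "R - 1"] R by auto
 have "u R \<le> v (R - 1)" using v[of b "R - 1"] b by simp
 moreover have "v (R - 1) \<le> u R" using mono_onD[OF u, of i R] i R by simp
 ultimately show "u R = v (R - 1)" by simp
qed

context quotient_galois
begin

text \<open>Level R has image j(L), so following its coordinates by the inverse of j presents L
  itself as a Laurent field, and the jumps of L become readable as \<open>rho\<close> / m.\<close>

lemma level_record: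
 assumes j: "partial_hom L (carrier L) j" "\<And>a. j (\<iota> a) = to_ac a"
  and T: "ltower p m R \<alpha> to_ac (j ` carrier L) g h \<zeta> K0 eF Y f" and R: "R > 0"
  and lev: "ltower.level p m (j ` carrier L) g h eF f R e K"
  and \<sigma>: "\<And>a. e (\<sigma> a) = g (e a)" and \<tau>: "\<And>a. e (\<tau> a) = h (e a)"
 shows "galois_record p m R \<alpha> (p ^ R * m) (\<lambda>a. K (K0 a)) \<sigma> \<tau> f L \<iota> (\<lambda>a. inv_into (carrier L) j (e a))"
  and "j (inv_into (carrier L) j (e a)) = e a" "inv_into (carrier L) j (e a) \<in> carrier L"
proof -
 interpret T: ltower p m R \<alpha> to_ac "j ` carrier L" g h \<zeta> K0 eF Y f by (rule T)
 interpret L: Ring.field L by (rule fieldL)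
 note inj = L.partial_hom_carrier_inj[OF j(1)]
 define E where "E a = inv_into (carrier L) j (e a)" for a
 have eM: "range e = j ` carrier L" using T.levelD(2)[OF lev] T.F_top by simp
 have E: "E a \<in> carrier L" "j (E a) = e a" for a
 proof -
  have "e a \<in> j ` carrier L" using eM by blast
  thus "E a \<in> carrier L" "j (E a) = e a" by (simp_all add: E_def inv_into_into f_inv_into_f)
 qed
 thus "j (inv_into (carrier L) j (e a)) = e a" "inv_into (carrier L) j (e a) \<in> carrier L" by (simp_all add: E_def)
 have "inv_into (carrier L) j \<circ> e \<in> ring_iso type_ring L"
  using fhom_record(2)[OF T.levelD(1)[OF lev]] unfolding eM
  by (intro ring_iso_set_trans[OF _ ring_iso_set_sym[OF L.ring_axioms L.partial_hom_iso[OF j(1)]]])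
 hence iso: "E \<in> ring_iso type_ring L" by (simp add: E_def[abs_def] comp_def)
 have "\<iota> a = E (K (K0 a))" for a
  using ring_hom_closed[OF \<iota>_hom, of a] by (intro inj_onD[OF inj]) (simp_all add: E j(2) T.levelD(4)[OF lev] T.eF_K0)
 hence "galois_record p m R \<alpha> (p ^ R * m) (\<lambda>a. K (K0 a)) \<sigma> \<tau> f L \<iota> E"
  using T.level_galois_model[OF R lev \<sigma> \<tau>] fieldL iso
  by (intro galois_record.intro galois_record_axioms.intro)
 thus "galois_record p m R \<alpha> (p ^ R * m) (\<lambda>a. K (K0 a)) \<sigma> \<tau> f L \<iota> (\<lambda>a. inv_into (carrier L) j (e a))"
  by (simp add: E_def[abs_def])
qed

text \<open>The top model is taken as the new extension. Its jumps below R are unchanged since the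
  normal form changes only at p^R, and its subfield fixed by H is the Laurent field of level R,
  which is L in coordinates.\<close>

theorem dominating_extension:
 assumes R: "R > 0" and jumps: "has_upper_jumps L \<iota> R u" and uR: "u (Suc R) = real a / real m"
  and alt: "u (Suc R) = real p * u R \<or> u (Suc R) > real p * u R \<and> \<not> p dvd a"
  and cong: "[real m * u (Suc R) = real m * u 1] (rmod real m)"
 shows "\<exists>(L' :: 'k fls alg_closure ring) \<iota>' \<phi>'. galois_extension_with_group G L' \<iota>' \<phi>' \<and>
  has_upper_jumps L' \<iota>' (Suc R) u \<and> dominates G H L' \<iota>' \<phi>' L \<iota> \<phi>"
proof -
 obtain j :: "'l \<Rightarrow> 'k fls alg_closure" and g h where j: "partial_hom L (carrier L) j" "\<forall>a. j (\<iota> a) = to_ac a"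
  and act': "\<forall>i l. \<forall>z\<in>carrier L. (g ^^ i) ((h ^^ l) (j z)) = j (\<psi> (el i l) z)"
  and T: "ctower p m R \<alpha> to_ac (j ` carrier L) g h"
  using tower_embedding by blast
 note j = j(1) spec[OF j(2)]
 have act: "(g ^^ i) ((h ^^ l) (j z)) = j (\<psi> (el i l) z)" if "z \<in> carrier L" for i l z
  using act' that by blast
 interpret T: ctower p m R \<alpha> to_ac "j ` carrier L" g h by (rule T)
 obtain \<zeta> K0 eF where tame: "primitive_root m \<zeta>" "good K0 m" "fhom eF" "range eF = T.F 0"
  "\<And>a. eF (K0 a) = to_ac a" "h (eF fls_X) = eF (fls_const \<zeta>) * eF fls_X"
  using T.tame_embedding by blast
 interpret N: ntower p m R \<alpha> to_ac "j ` carrier L" g h \<zeta> K0 eF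
  by unfold_locales (use tame in auto)
 obtain Y f where Y: "Y $ 0 = 1" "\<forall>k. Y $ k \<in> j ` carrier L" "\<forall>k<p ^ R. g (Y $ k) = ((1 + fps_X) * Y) $ k"
  "\<forall>i. reduced p (f i)" "\<forall>k<p ^ R. (Y * fmap eF (normal_form f (p ^ R))) $ k = (Y $ k) ^ p"
  using N.normal_form_exists by blast
 have lt: "ltower p m R \<alpha> to_ac (j ` carrier L) g h \<zeta> K0 eF Y f"
  by unfold_locales (use Y in auto)
 interpret B: ltower p m R \<alpha> to_ac "j ` carrier L" g h \<zeta> K0 eF Y f by (rule lt)
 have p0: "p > 0" using T.p1 by simp
 have m0: "m > 0" by (rule T.m0)
 interpret L: Ring.field L by (rule fieldL)

 have breaks: "upper_breaks L \<iota> = (\<lambda>b. real (rho p f b) / real m) ` {..<R}"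
 proof -
  obtain e K where lev: "B.level R e K" using B.level_exists by blast
  obtain \<sigma> where "\<forall>a. e (\<sigma> a) = (g ^^ 1) ((h ^^ 0) (e a))" using B.level_automorphism[OF lev] by blast
  hence \<sigma>: "e (\<sigma> a) = g (e a)" for a by simp
  obtain \<tau> where "\<forall>a. e (\<tau> a) = (g ^^ 0) ((h ^^ 1) (e a))" using B.level_automorphism[OF lev] by blast
  hence \<tau>: "e (\<tau> a) = h (e a)" for a by simp
  show ?thesis by (rule galois_record.upper_breaks[OF level_record(1)[OF j lt R lev \<sigma> \<tau>]])
 qed
 have u_mono: "mono_on {1..R} u" and u_img: "u ` {1..R} = (\<lambda>b. real (rho p f b) / real m) ` {..<R}"
  using jumps breaks by (simp_all add: has_upper_jumps_def)
 have v_mono: "real (rho p f b) / real m \<le> real (rho p f b') / real m" if "b \<le> b'" for b b'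
  using rho_mono[OF p0 that, of f] by (intro divide_right_mono of_nat_mono of_nat_0_le_iff)
 note ext = mono_on_image_extrema[OF u_mono v_mono R u_img]
 obtain R0 where R0: "R = Suc R0" using R by (cases R) auto
 have uR': "u R = real (rho p f R0) / real m" using ext(2) by (simp add: R0)

 \<comment> \<open>If a = p * \<open>rho p f R0\<close>, the maximum in the recursion is supplied by
   the previous step, and the datum 0 suffices; otherwise p does not divide a, so the monomial of
   pole order a is reduced.\<close>
 define \<omega> :: "'k fls" where "\<omega> = (if a = p * rho p f R0 then 0 else fls_X powi (- int a))"
 have a_cases: "a = p * rho p f R0 \<or> a > p * rho p f R0 \<and> \<not> p dvd a"
 proof -
  have "real a = real m * u (Suc R)" "real (p * rho p f R0) = real m * (real p * u R)"
   using m0 by (simp_all add: uR uR')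
  hence "u (Suc R) = real p * u R \<Longrightarrow> real a = real (p * rho p f R0)"
   "u (Suc R) > real p * u R \<Longrightarrow> real a > real (p * rho p f R0)"
   using m0 by (simp_all only: mult_less_cancel_left_pos of_nat_0_less_iff)
  thus ?thesis using alt by (simp only: of_nat_eq_iff of_nat_less_iff) blast
 qed
 have \<omega>: "reduced p \<omega>" using a_cases by (auto simp: reduced_def \<omega>_def)
 define f' where "f' = f(p ^ R := \<omega>)"
 have pow_lt: "p ^ b < p ^ R" if "b < R" for b using that T.p1 by simp
 have rho': "rho p f' b = rho p f b" if "b < R" for b
 proof (rule rho_cong)
  fix i assume "i \<le> b"
  hence "p ^ i \<noteq> p ^ R" using pow_lt[of i] that by simp
  thus "f' (p ^ i) = f (p ^ i)" by (simp add: f'_def)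
 qed
 have rhoR: "rho p f' R = a"
 proof -
  have "f' (p ^ Suc R0) = \<omega>" by (simp add: f'_def R0)
  hence "rho p f' R = max (p * rho p f R0) (pole \<omega>)" using rho'[of R0] by (simp add: R0)
  thus ?thesis using a_cases by (auto simp: \<omega>_def pole_def)
 qed
 \<comment> \<open>m u_1 is \<open>rho p f 0\<close> and m u_n is a. Being congruent modulo m they
   give the same power of \<zeta>, and the eigenvalue of the first step serves for the last.\<close>
 have eig: "of_nat B.\<beta> * \<zeta> ^ rho p f' R = 1"
 proof -
  have "real m * u 1 = real (rho p f 0)" "real m * u (Suc R) = real a" using ext(1) uR m0 by simp_all
  then obtain t :: int where "real (rho p f 0) = real a + of_int t * real m"
   using cong unfolding rcong_altdef by auto
  hence "real_of_int (int (rho p f 0)) = real_of_int (int a + t * int m)" by simp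
  hence "int (rho p f 0) = int a + t * int m" by (simp only: of_int_eq_iff)
  hence "int (rho p f 0) mod int m = int a mod int m" by simp
  hence mod: "rho p f 0 mod m = a mod m" by (simp flip: zmod_int)
  have \<zeta>m: "\<zeta> ^ i = \<zeta> ^ (i mod m)" for i
  proof -
   have "\<zeta> ^ m = 1" using tame(1) by (simp add: primitive_root_def)
   hence "\<zeta> ^ (m * (i div m) + i mod m) = \<zeta> ^ (i mod m)" by (simp only: power_add power_mult) simp
   thus ?thesis by simp
  qed
  have "\<zeta> ^ rho p f' R = \<zeta> ^ rho p f 0" unfolding rhoR using \<zeta>m mod by metis
  thus ?thesis using B.first_eigenvalue[OF R] by simp
 qed
 obtain e K K1 \<sigma> \<tau> A C where lev: "B.level R e K" and K1: "fhom K1"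
  and \<sigma>': "\<forall>a. e (\<sigma> a) = g (e a)" and \<tau>': "\<forall>a. e (\<tau> a) = h (e a)"
  and AK': "\<forall>a. A (K1 a) = K1 (\<sigma> a)" and CK': "\<forall>a. C (K1 a) = K1 (\<tau> a)"
  and fix1: "\<forall>a. (A ^^ (p ^ R)) a = a \<longrightarrow> a \<in> range K1"
  and model: "galois_model p m (Suc R) \<alpha> (p * (p ^ R * m)) (\<lambda>a. K1 (K (K0 a))) A C f'"
  using B.top_galois_model[OF R \<omega> eig[unfolded f'_def], folded f'_def]
  by (elim exE conjE) (rule that; assumption)
 note \<sigma> = spec[OF \<sigma>'] and \<tau> = spec[OF \<tau>'] and AK = spec[OF AK'] and CK = spec[OF CK']
 note i1 = fhom_eq_iff[OF K1]

 define E where "E a = inv_into (carrier L) j (e a)" for a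
 note rec = level_record(1)[OF j lt R lev \<sigma> \<tau>, folded E_def]
 have E: "j (E a) = e a" "E a \<in> carrier L" for a
  using level_record(2,3)[OF j lt R lev \<sigma> \<tau>, of a] by (simp_all add: E_def)
 interpret low: galois_record p m R \<alpha> "p ^ R * m" "\<lambda>a. K (K0 a)" \<sigma> \<tau> f L \<iota> E
  using rec by (simp add: E_def[abs_def])

 \<comment> \<open>As a field this is k((X)) of the top model, placed in the algebraic closure to
   obtain the required carrier type; the base enters through \<iota>', that is through all three
   embeddings, not through \<open>to_ac\<close> alone.\<close>
 define L' where "L' = (type_ring :: 'k fls alg_closure ring)\<lparr>carrier := range to_ac\<rparr>"
 define \<iota>' :: "'k fls \<Rightarrow> 'k fls alg_closure" where "\<iota>' a = to_ac (K1 (K (K0 a)))" for a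
 have L'c: "carrier L' = range to_ac" by (simp add: L'_def)
 have rec': "galois_record p m (Suc R) \<alpha> (p * (p ^ R * m)) (\<lambda>a. K1 (K (K0 a))) A C f' L' \<iota>' to_ac"
  by (intro galois_record.intro galois_record_axioms.intro model)
   (simp_all add: L'_def \<iota>'_def fhom_record[OF to_ac_fhom])
 interpret top: galois_record p m "Suc R" \<alpha> "p * (p ^ R * m)" "\<lambda>a. K1 (K (K0 a))" A C f' L' \<iota>' to_ac
  by (rule rec')
 obtain \<phi>' where \<phi>': "\<phi>' \<in> iso G (galois_group L' (range \<iota>'))" "\<And>i l. \<phi>' (el i l) = top.gact i l"
  using galois_record_iso[OF rec' cyclic_semidirect_axioms] by blast
 have \<phi>'_el: "\<phi>' (el i l) (to_ac b) = to_ac (top.act i l b)" for i l b by (simp add: \<phi>'(2) top.gact)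
 have "galois_extension_with_group G L' \<iota>' \<phi>'"
  using top.galois top.\<iota>_hom \<phi>'(1) by (simp add: galois_extension_with_group_def)
 moreover have "has_upper_jumps L' \<iota>' (Suc R) u"
  unfolding has_upper_jumps_def
 proof
  have uR_le: "u R \<le> u (Suc R)"
  proof -
   have "u R \<ge> 0" by (simp add: uR')
   hence "1 * u R \<le> real p * u R" using p0 by (intro mult_right_mono) auto
   thus ?thesis using alt by auto
  qed
  show "mono_on {1..Suc R} u"
  proof (rule mono_onI)
   fix x y assume xy: "x \<in> {1..Suc R}" "y \<in> {1..Suc R}" "x \<le> y"
   show "u x \<le> u y"
   proof (cases "y = Suc R")
    case True
    show ?thesis
    proof (cases "x = Suc R")
     case False
     hence "u x \<le> u R" using xy R by (intro mono_onD[OF u_mono]) auto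
     thus ?thesis using uR_le True by simp
    qed (use True in simp)
   next
    case False
    thus ?thesis using xy by (intro mono_onD[OF u_mono]) auto
   qed
  qed
  have "upper_breaks L' \<iota>' = (\<lambda>b. real (rho p f' b) / real m) ` {..<Suc R}" by (rule top.upper_breaks)
  also have "\<dots> = insert (u (Suc R)) ((\<lambda>b. real (rho p f' b) / real m) ` {..<R})"
   unfolding lessThan_Suc image_insert rhoR uR ..
  also have "(\<lambda>b. real (rho p f' b) / real m) ` {..<R} = u ` {1..R}"
   unfolding u_img by (intro image_cong refl) (simp add: rho')
  finally show "u ` {1..Suc R} = upper_breaks L' \<iota>'" by (simp add: atLeastAtMostSuc_conv)
 qed
 moreover have "dominates G H L' \<iota>' \<phi>' L \<iota> \<phi>"
 proof -
  have AK1: "top.act i l (K1 b) = K1 (low.act i l b)" for i l b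
  proof -
   have "(C ^^ l) (K1 b) = K1 ((\<tau> ^^ l) b)" by (induction l) (simp_all add: CK)
   moreover have "(A ^^ i) (K1 b) = K1 ((\<sigma> ^^ i) b)" for b by (induction i) (simp_all add: AK)
   ultimately show ?thesis by simp
  qed
  \<comment> \<open>The copy of L inside L'. It is the fixed field of H because H is generated by
    the p^R-th power of \<nu>, whose fixed elements are those in the range of K1.\<close>
  define t where "t b = to_ac (K1 b)" for b
  have t: "fhom t" unfolding t_def by (rule fhom_comp[OF to_ac_fhom K1])
  have ff: "fixed_field L' \<phi>' H = range t"
  proof
   show "fixed_field L' \<phi>' H \<subseteq> range t"
   proof
    fix x assume x: "x \<in> fixed_field L' \<phi>' H"
    then obtain b where b: "x = to_ac b" by (auto simp: fixed_field_def L'c)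
    have "el (p ^ R) 0 \<in> H" by (simp add: el_H)
    hence "\<phi>' (el (p ^ R) 0) x = x" using x by (simp add: fixed_field_def)
    hence "(A ^^ (p ^ R)) b = b" by (simp add: b \<phi>'_el)
    thus "x \<in> range t" using fix1 b by (auto simp: t_def)
   qed
   show "range t \<subseteq> fixed_field L' \<phi>' H"
   proof
    fix x assume "x \<in> range t"
    then obtain b where b: "x = t b" by blast
    have "\<phi>' s x = x" if s: "s \<in> H" for s
    proof -
     have "s \<in> carrier G" using s H(1) subgroup.subset by blast
     then obtain i l where il: "s = el i l" using gen_el by blast
     hence "p ^ R dvd i" "m dvd l" using s el_H by simp_all
     hence "low.act i l b = b" using low.act_mod[of i l b] by (simp add: dvd_eq_mod_eq_0)
     thus ?thesis by (simp add: il b t_def \<phi>'_el AK1)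
    qed
    thus "x \<in> fixed_field L' \<phi>' H" by (simp add: fixed_field_def L'c b t_def)
   qed
  qed
  define \<theta> where "\<theta> = E \<circ> inv_into UNIV t"
  have \<theta>: "\<theta> (t b) = E b" for b by (simp add: \<theta>_def fhom_inj[OF t])
  have "inv_into UNIV t \<in> ring_iso (L'\<lparr>carrier := fixed_field L' \<phi>' H\<rparr>) type_ring"
   unfolding ff using ring_iso_set_sym[OF ring_of_type_ring fhom_record(2)[OF t]] by (simp add: L'_def)
  hence iso: "\<theta> \<in> ring_iso (L'\<lparr>carrier := fixed_field L' \<phi>' H\<rparr>) L"
   unfolding \<theta>_def by (rule ring_iso_set_trans[OF _ low.E])
  have "\<theta> (\<iota>' b) = \<iota> b" for b by (simp add: \<iota>'_def \<theta>[unfolded t_def] low.\<iota>)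
  moreover have "\<theta> (\<phi>' s x) = \<phi> (H #> s) (\<theta> x)"
   if s: "s \<in> carrier G" and x: "x \<in> fixed_field L' \<phi>' H" for s x
  proof -
   obtain i l where il: "s = el i l" using gen_el[OF s] by blast
   obtain b where b: "x = t b" using x by (auto simp: ff)
   have e\<sigma>: "e ((\<sigma> ^^ i) b) = (g ^^ i) (e b)" and e\<tau>: "e ((\<tau> ^^ i) b) = (h ^^ i) (e b)" for i b
    by (induction i) (simp_all add: \<sigma> \<tau>)
   have "j (E (low.act i l b)) = (g ^^ i) ((h ^^ l) (j (E b)))" by (simp add: E e\<sigma> e\<tau>)
   also have "\<dots> = j (\<psi> (el i l) (E b))" by (rule act[OF E(2)])
   finally have "E (low.act i l b) = \<psi> (el i l) (E b)"
    by (rule inj_onD[OF L.partial_hom_carrier_inj[OF j(1)]]) (simp_all add: E \<psi>_carrier el_closed)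
   thus ?thesis using \<theta> by (simp add: il b t_def \<phi>'_el AK1 \<psi>_def)
  qed
  ultimately show ?thesis unfolding dominates_def using iso by blast
 qed
 ultimately show ?thesis by blast
qed

end

theorem proposition5p1:
 fixes p n m a :: nat
  and G :: "'g monoid" and H :: "'g set"
  and L :: "'l ring" and \<iota> :: "'k::alg_closed_field fls \<Rightarrow> 'l" and \<phi> :: "'g set \<Rightarrow> 'l \<Rightarrow> 'l"
  and u :: "nat \<Rightarrow> real"
 assumes "Factorial_Ring.prime p" and "CHAR('k) = p"
  and "n \<ge> 2" and "m \<ge> 1" and "\<not> p dvd m"
  and "semidirect_cyclic G (p ^ n) m"
  and "subgroup H G" and "card H = p"
  and "galois_extension_with_group (G Mod H) L \<iota> \<phi>"
  and "has_upper_jumps L \<iota> (n - 1) u"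
  and "u n = real a / real m"
  and "u n = real p * u (n - 1) \<or> (u n > real p * u (n - 1) \<and> \<not> p dvd a)"
  and "[real m * u n = real m * u 1] (rmod real m)"
 shows "\<exists>(L' :: 'k fls alg_closure ring) \<iota>' \<phi>'.
      galois_extension_with_group G L' \<iota>' \<phi>' \<and>
      has_upper_jumps L' \<iota>' n u \<and>
      dominates G H L' \<iota>' \<phi>' L \<iota> \<phi>"
proof -
 obtain R where n: "n = Suc R" "R > 0" using assms(3) by (cases n) auto
 have "p ^ n > 0" using prime_gt_0_nat[OF assms(1)] by simp
 then obtain \<nu> c \<alpha> where "cyclic_semidirect G \<nu> c (p ^ n) m \<alpha>"
  using semidirect_cyclic_coordinates[OF assms(6)] assms(4) by auto
 hence "quotient_galois G \<nu> c p R m \<alpha> H L \<iota> \<phi>"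
  using assms unfolding n(1) by (intro quotient_galois.intro quotient_galois_axioms.intro)
 from quotient_galois.dominating_extension[OF this n(2), of u a] show ?thesis
  using assms(10-13) by (simp only: n(1) diff_Suc_1)
qed

end
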